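(* Let $f:\mathbb{R}\to\mathbb{R}$ be a smooth function (no convexity is assumed) and let $(S_t)_{t\ge 0}$ be the Kruzhkov entropy-solution semigroup of $\partial_t u+\partial_x f(u)=0$ on $\mathbb{R}$. Let $u_-,u_+\in\mathbb{R}$ be given. Let $\mathcal{M}$ be the set of monotone functions $b:\mathbb{R}\to\mathbb{R}$ such that $b-u_-\in L^2((-\infty,0))$ and $b-u_+\in L^2((0,\infty))$ (in particular $b(\pm\infty)=u_\pm$). If $a:\mathbb{R}\to\mathbb{R}$ is a measurable function such that $a-u_-\in (L^1\cap L^\infty)((-\infty,0))$ and $a-u_+\in (L^1\cap L^\infty)((0,\infty))$, then the function $$t\mapsto d_2(S_ta;\mathcal{M}),\qquad t\ge 0,$$ is non-increasing.
   Context: For $a\in L^\infty(\mathbb{R})$, $S_ta=u(t,\cdot)$ denotes the unique bounded entropy solution (Kruzhkov) of $\partial_tu+\partial_xf(u)=0$ with $u(0,\cdot)=a$, taken as the representative continuous in time with values in $L^1_{\rm loc}(\mathbb{R})$. That is, $u\in L^\infty$ attains the initial data and for every convex $\eta:\mathbb{R}\to\mathbb{R}$, with $q'=\eta' f'$, one has $\partial_t\eta(u)+\partial_xq(u)\le 0$ in the sense of distributions. The $L^2$-distance is $d_2(v;\mathcal{M}):=\inf_{b\in\mathcal{M}}\|v-b\|_{L^2(\mathbb{R})}$. *)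

theory Defs
  imports "HOL-Analysis.Analysis"
begin

definition L1_on :: "'a::euclidean_space set \<Rightarrow> ('a \<Rightarrow> real) \<Rightarrow> bool" where
  "L1_on A g \<longleftrightarrow> integrable (lebesgue_on A) g"

definition L2_on :: "'a::euclidean_space set \<Rightarrow> ('a \<Rightarrow> real) \<Rightarrow> bool" where
  "L2_on A g \<longleftrightarrow> g \<in> borel_measurable (lebesgue_on A) \<and>
     integrable (lebesgue_on A) (\<lambda>x. (g x)\<^sup>2)"

definition Linf_on :: "'a::euclidean_space set \<Rightarrow> ('a \<Rightarrow> real) \<Rightarrow> bool" where
  "Linf_on A g \<longleftrightarrow> g \<in> borel_measurable (lebesgue_on A) \<and>
     (\<exists>C. AE x in lebesgue_on A. \<bar>g x\<bar> \<le> C)"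

definition smooth :: "(real \<Rightarrow> real) \<Rightarrow> bool" where
  "smooth f \<longleftrightarrow> (\<forall>n x. ((deriv ^^ n) f) field_differentiable (at x))"

text \<open>A function of \<open>(t, x)\<close> is \<open>C\<^sup>\<infinity>\<close> iff it generates a family \<open>D i j\<close>, the mixed partial
  derivative of order \<open>i\<close> in \<open>t\<close> and \<open>j\<close> in \<open>x\<close>, all of whose members are (Frechet) differentiable.\<close>

definition smooth2 :: "(real \<times> real \<Rightarrow> real) \<Rightarrow> bool" where
  "smooth2 \<phi> \<longleftrightarrow> (\<exists>D :: nat \<Rightarrow> nat \<Rightarrow> real \<times> real \<Rightarrow> real. D 0 0 = \<phi> \<and>
     (\<forall>i j p. (D i j has_derivative (\<lambda>(h, k). h * D (Suc i) j p + k * D i (Suc j) p)) (at p)))"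

definition test_function :: "(real \<times> real) set \<Rightarrow> (real \<times> real \<Rightarrow> real) \<Rightarrow> bool" where
  "test_function \<Omega> \<phi> \<longleftrightarrow> smooth2 \<phi> \<and> (\<exists>K. compact K \<and> K \<subseteq> \<Omega> \<and> (\<forall>p. p \<notin> K \<longrightarrow> \<phi> p = 0))"

text \<open>\<open>\<partial>\<^sub>t v + \<partial>\<^sub>x w \<le> 0\<close> in the sense of distributions on \<open>(0,\<infinity>) \<times> \<real>\<close>.\<close>

definition div_nonpos :: "(real \<Rightarrow> real \<Rightarrow> real) \<Rightarrow> (real \<Rightarrow> real \<Rightarrow> real) \<Rightarrow> bool" where
  "div_nonpos v w \<longleftrightarrow>
     (\<forall>\<phi>. test_function ({0<..} \<times> UNIV) \<phi> \<and> (\<forall>p. 0 \<le> \<phi> p) \<longrightarrow>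
        - (LINT (t, x) | lebesgue_on ({0<..} \<times> UNIV).
             v t x * deriv (\<lambda>s. \<phi> (s, x)) t + w t x * deriv (\<lambda>y. \<phi> (t, y)) x) \<le> 0)"

text \<open>A convex \<open>\<eta>\<close> need not be differentiable everywhere, but it is so off a countable set, and its
  derivative is continuous there. So a continuous \<open>q\<close> with \<open>q' = \<eta>' f'\<close> at the points of
  differentiability of \<open>\<eta>\<close> exists and is unique up to an additive constant.\<close>

definition entropy_flux_pair ::
    "(real \<Rightarrow> real) \<Rightarrow> (real \<Rightarrow> real) \<Rightarrow> (real \<Rightarrow> real) \<Rightarrow> bool" where
  "entropy_flux_pair f \<eta> q \<longleftrightarrow> convex_on UNIV \<eta> \<and> continuous_on UNIV q \<and>
     (\<forall>v. \<eta> field_differentiable (at v) \<longrightarrow>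
        (q has_field_derivative deriv \<eta> v * deriv f v) (at v))"

definition continuous_L1loc :: "(real \<Rightarrow> real \<Rightarrow> real) \<Rightarrow> bool" where
  "continuous_L1loc u \<longleftrightarrow>
     (\<forall>t\<ge>0. \<forall>R. L1_on {-R..R} (u t)) \<and>
     (\<forall>t0\<ge>0. \<forall>R. ((\<lambda>t. LINT x | lebesgue_on {-R..R}. \<bar>u t x - u t0 x\<bar>) \<longlongrightarrow> 0)
        (at t0 within {0..}))"

text \<open>\<open>u t\<close> is (a representative of) \<open>S\<^sub>t a\<close>; the slices \<open>u t\<close> are fixed up to null sets.\<close>

definition kruzhkov_solution ::
    "(real \<Rightarrow> real) \<Rightarrow> (real \<Rightarrow> real) \<Rightarrow> (real \<Rightarrow> real \<Rightarrow> real) \<Rightarrow> bool" where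
  "kruzhkov_solution f a u \<longleftrightarrow>
     Linf_on ({0<..} \<times> UNIV) (\<lambda>(t, x). u t x) \<and>
     continuous_L1loc u \<and>
     (AE x in lebesgue. u 0 x = a x) \<and>
     (\<forall>\<eta> q. entropy_flux_pair f \<eta> q \<longrightarrow>
        div_nonpos (\<lambda>t x. \<eta> (u t x)) (\<lambda>t x. q (u t x)))"

definition monotone_profiles :: "real \<Rightarrow> real \<Rightarrow> (real \<Rightarrow> real) set" where
  "monotone_profiles um up = {b. (mono b \<or> antimono b) \<and>
     L2_on {..<0} (\<lambda>x. b x - um) \<and> L2_on {0<..} (\<lambda>x. b x - up)}"

text \<open>Extended-valued, so that a function outside \<open>L\<^sup>2\<close> has norm \<open>\<infinity>\<close> instead of the default value
  \<open>0\<close> of a non-existing integral.\<close>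

definition L2_norm :: "(real \<Rightarrow> real) \<Rightarrow> ennreal" where
  "L2_norm g = (if L2_on UNIV g then ennreal (sqrt (LINT x | lebesgue. (g x)\<^sup>2)) else \<infinity>)"

definition d2 :: "(real \<Rightarrow> real) \<Rightarrow> (real \<Rightarrow> real) set \<Rightarrow> ennreal" where
  "d2 v M = (INF b\<in>M. L2_norm (\<lambda>x. v x - b x))"

end

theory Submission
  imports Defs "HOL-Computational_Algebra.Polynomial"
begin

text \<open>Reduce to \<open>um \<le> up\<close> by \<open>u \<mapsto> - u\<close>. For a nondecreasing \<open>b\<close> the layer cake formula writes
  \<open>(u - b)\<^sup>2 / 2\<close> as the integral over the levels \<open>c\<close> of \<open>(u - c)\<^sup>+\<close> where \<open>b \<le> c\<close> and of \<open>(c - u)\<^sup>+\<close>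
  where \<open>c < b\<close>, and \<open>{c < b}\<close> is a half-line. Minimising level by level, the squared distance is
  twice the integral over \<open>c\<close> of \<open>min\<^sub>y E\<^sub>c(t, y)\<close>, where
  \<open>E\<^sub>c(t, y) = \<integral>\<^bsub>x<y\<^esub> (u - c)\<^sup>+ + \<integral>\<^bsub>x>y\<^esub> (c - u)\<^sup>+\<close>, because minimisers are automatically monotone in \<open>c\<close>
  and so are the level positions of a single monotone profile. It remains to show that each
  \<open>min\<^sub>y E\<^sub>c(t, y)\<close> decreases in \<open>t\<close>.

  Let \<open>U\<close> be the potential with \<open>U\<^sub>x = u - c\<close> and \<open>U\<^sub>t = - (f(u) - f(c))\<close>. Up to a constant,
  \<open>E\<^sub>c(t, y) = U(t, y) + (1/2) \<integral> \<bar>u - c\<bar>\<close>. Put \<open>m = min U(t, -)\<close> and test Kruzhkov's inequality for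
  \<open>\<bar>u - c\<bar>\<close> with \<open>\<Phi>(U)\<close>, where \<open>\<Phi>\<close> is \<open>1\<close> above the level \<open>m\<close> and drops steeply to \<open>0\<close> below it. The interior
  term \<open>sgn(u - c) (f(u) - f(c)) U\<^sub>x + \<bar>u - c\<bar> U\<^sub>t\<close> vanishes identically, so \<open>\<integral> \<bar>u - c\<bar> \<Phi>(U)\<close> decreases.
  At time \<open>t\<close> it is the full integral. At an earlier time \<open>s\<close> it misses the part where \<open>U < m\<close>, and there
  \<open>\<integral> \<bar>u - c\<bar> = \<integral> \<bar>U\<^sub>x\<bar>\<close> is at least \<open>2 (m - U(s, y))\<close>, since \<open>U\<close> comes down from the level \<open>m\<close> to
  \<open>U(s, y)\<close> and goes up again. This is the claim \<open>E\<^sub>c(t, argmin) \<le> E\<^sub>c(s, y)\<close>. As \<open>u\<close> is only bounded and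
  measurable, the argument is run on mollifications, for which the cancellation holds up to an error
  that disappears with the mollification parameter.\<close>

text \<open>Three small parameters are removed in a fixed order. The cancellation is exact only for
  the solution itself, and a weight of steepness \<open>1 / \<delta>\<close> divides its mollified
  error by \<open>\<delta>\<close>; so mollification is removed first at fixed
  \<open>\<delta>\<close>, then \<open>\<delta>\<close> tends to 0, and last the radius
  \<open>R\<close> of a spatial cutoff tends to infinity. The cutoff is forced because
  \<open>\<integral> \<bar>u - c\<bar>\<close> is infinite for \<open>um < c < up\<close>. Its
  derivative costs only the flux of \<open>(u - c)\<^sup>+\<close> on the left and of
  \<open>(c - u)\<^sup>+\<close> on the right; these are integrable there, so the cost is of order
  \<open>1 / R\<close>. Strictly between the end states \<open>U\<close> grows linearly at both
  ends, so a minimiser exists. The same growth, with a margin for the motion of \<open>U\<close> in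
  time, keeps \<open>U\<close> above \<open>m\<close> near the ends during all of
  \<open>[s, t]\<close>, so that the weight is 1 wherever the cutoff varies. A weight built from
  \<open>U\<close> is not a smooth test function. Hence the inequality is tested with translates of
  a kernel only, which makes it a pointwise inequality for mollified functions; after that a
  \<open>C^1\<close> weight suffices.\<close>

section \<open>A smooth kernel\<close>

text \<open>Derivatives appear as existential witnesses, so that closure under products and affine
  substitutions is a plain induction on the order; iterates of \<open>deriv\<close>, as in
  \<open>smooth\<close>, would first need a formula for every derivative.\<close>

primrec times_diff :: "nat \<Rightarrow> (real \<Rightarrow> real) \<Rightarrow> bool" where
  "times_diff 0 f = True"
| "times_diff (Suc n) f = (\<exists>f'. (\<forall>x. (f has_real_derivative f' x) (at x)) \<and> times_diff n f')"

lemma times_diff_SucD: "times_diff (Suc n) f \<Longrightarrow> times_diff n f"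
  by (induction n arbitrary: f) auto

lemma times_diff_const: "times_diff n (\<lambda>x. c)"
proof (induction n arbitrary: c)
  case (Suc n)
  then show ?case by (auto intro!: exI[of _ "\<lambda>x. 0"])
qed simp

lemma times_diff_add:
  "times_diff n f \<Longrightarrow> times_diff n g \<Longrightarrow> times_diff n (\<lambda>x. f x + g x)"
proof (induction n arbitrary: f g)
  case (Suc n)
  from Suc.prems obtain f' g' where *: "\<And>x. (f has_real_derivative f' x) (at x)" "times_diff n f'"
     "\<And>x. (g has_real_derivative g' x) (at x)" "times_diff n g'" by auto
  show ?case
    using * Suc.IH[of f' g'] by (auto intro!: exI[of _ "\<lambda>x. f' x + g' x"] DERIV_add)
qed simp

lemma times_diff_mult:
  "times_diff n f \<Longrightarrow> times_diff n g \<Longrightarrow> times_diff n (\<lambda>x. f x * g x)"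
proof (induction n arbitrary: f g)
  case (Suc n)
  from Suc.prems obtain f' g' where *: "\<And>x. (f has_real_derivative f' x) (at x)" "times_diff n f'"
     "\<And>x. (g has_real_derivative g' x) (at x)" "times_diff n g'" by auto
  have "times_diff n f" "times_diff n g"
    using Suc.prems times_diff_SucD by blast+
  then have "times_diff n (\<lambda>x. f' x * g x + g' x * f x)"
    using * Suc.IH by (intro times_diff_add) auto
  then show ?case
    using * by (auto intro!: exI[of _ "\<lambda>x. f' x * g x + g' x * f x"] DERIV_mult)
qed simp

lemma times_diff_affine: "times_diff n f \<Longrightarrow> times_diff n (\<lambda>x. f (a * x + b))"
proof (induction n arbitrary: f)
  case (Suc n)
  from Suc.prems obtain f' where *: "\<And>x. (f has_real_derivative f' x) (at x)" "times_diff n f'"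
    by auto
  have "((\<lambda>x. f (a * x + b)) has_real_derivative f' (a * x + b) * a) (at x)" for x
    by (rule DERIV_chain2[OF *(1)]) (auto intro!: derivative_eq_intros)
  moreover have "times_diff n (\<lambda>x. f' (a * x + b) * a)"
    using Suc.IH[OF *(2)] times_diff_const by (intro times_diff_mult) auto
  ultimately show ?case by (auto intro!: exI[of _ "\<lambda>x. f' (a * x + b) * a"])
qed simp

text \<open>The induction carries all orders \<open>m\<close> at once, because one order is consumed
  each time \<open>deriv\<close> replaces the witness.\<close>

lemma smooth_if_times_diff:
  assumes "\<And>n. times_diff n f" shows "smooth f"
proof -
  have "\<forall>m. times_diff m ((deriv ^^ n) f)" for n
  proof (induction n)
    case (Suc n)
    show ?case
    proof
      fix m
      from Suc have "times_diff (Suc m) ((deriv ^^ n) f)" by blast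
      then obtain f' where f': "\<And>x. ((deriv ^^ n) f has_real_derivative f' x) (at x)" "times_diff m f'"
        by auto
      then have "deriv ((deriv ^^ n) f) = f'" by (auto intro!: ext DERIV_imp_deriv)
      with f' show "times_diff m ((deriv ^^ Suc n) f)" by simp
    qed
  qed (use assms in simp)
  then have "\<exists>f'. \<forall>x. ((deriv ^^ n) f has_real_derivative f' x) (at x)" for n
    using times_diff.simps(2)[of 0 "(deriv ^^ n) f"] by blast
  then show ?thesis unfolding smooth_def field_differentiable_def by blast
qed

text \<open>The polynomial is carried along because the functions \<open>p(1/x) exp(-1/x)\<close>
  are closed under differentiation: one derivative formula then gives all orders.
  \<open>flat 1\<close> is the classical smooth function that is flat at 0.\<close>

definition flat :: "real poly \<Rightarrow> real \<Rightarrow> real" where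
  "flat p x = (if x > 0 then poly p (1 / x) * exp (- (1 / x)) else 0)"

lemma tendsto_poly_times_exp_minus:
  "((\<lambda>y::real. poly p y * exp (- y)) \<longlongrightarrow> 0) at_top"
proof -
  have "((\<lambda>y::real. \<Sum>i\<le>degree p. coeff p i * (y ^ i / exp y)) \<longlongrightarrow> (\<Sum>i\<le>degree p. coeff p i * 0)) at_top"
    by (intro tendsto_intros tendsto_power_div_exp_0)
  then show ?thesis
    by (simp add: poly_altdef exp_minus sum_distrib_right divide_inverse mult.assoc)
qed

lemma flat_over_x_tendsto: "((\<lambda>x. flat p x / x) \<longlongrightarrow> 0) (at 0)"
proof -
  have "((\<lambda>x. flat p x / x) \<longlongrightarrow> 0) (at_right 0)"
  proof -
    \<comment> \<open>\<open>pCons 0 p\<close> is \<open>p\<close> multiplied by its argument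
      \<open>1 / x\<close>; it absorbs the division by \<open>x\<close>.\<close>
    have "((\<lambda>x. poly (pCons 0 p) (inverse x) * exp (- (inverse x))) \<longlongrightarrow> 0) (at_right (0::real))"
      by (rule filterlim_compose[OF tendsto_poly_times_exp_minus filterlim_inverse_at_top_right])
    moreover have "\<forall>\<^sub>F x in at_right (0::real). poly (pCons 0 p) (inverse x) * exp (- (inverse x)) = flat p x / x"
      unfolding eventually_at_right_field by (intro exI[of _ 1]) (auto simp: flat_def field_simps)
    ultimately show ?thesis by (rule Lim_transform_eventually)
  qed
  moreover have "((\<lambda>x. flat p x / x) \<longlongrightarrow> 0) (at_left 0)"
  proof (rule Lim_transform_eventually[OF tendsto_const])
    show "\<forall>\<^sub>F x in at_left 0. 0 = flat p x / x"
      unfolding eventually_at_left_field by (intro exI[of _ "-1"]) (auto simp: flat_def)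
  qed
  ultimately show ?thesis by (simp add: filterlim_split_at)
qed

text \<open>In the variable \<open>y = 1 / x\<close> the derivative of \<open>p(y) exp(-y)\<close>
  is \<open>(p' - p)(y) exp(-y)\<close>, and \<open>dy/dx = - y^2\<close> supplies the factor
  \<open>monom 1 2\<close> and the sign. At 0 the difference quotient is
  \<open>flat p x / x\<close>.\<close>

lemma flat_deriv:
  "(flat p has_real_derivative flat (monom 1 2 * (p - pderiv p)) x) (at x)"
proof -
  consider "x < 0" | "x = 0" | "x > 0" by linarith
  then show ?thesis
  proof cases
    case 1
    have "((\<lambda>x. 0) has_real_derivative 0) (at x)" by simp
    then have "(flat p has_real_derivative 0) (at x)"
      by (rule has_field_derivative_transform_within_open[where S = "{..<0}"]) (use 1 in \<open>auto simp: flat_def\<close>)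
    then show ?thesis using 1 by (simp add: flat_def)
  next
    case 2
    have "(flat p has_real_derivative 0) (at 0)"
      using flat_over_x_tendsto[of p] by (simp add: has_field_derivative_iff) (simp add: flat_def)
    then show ?thesis using 2 by (simp add: flat_def)
  next
    case 3
    have "((\<lambda>x. poly p (1 / x) * exp (- (1 / x))) has_real_derivative
        (poly (pderiv p) (1/x) * (- 1 / x\<^sup>2)) * exp (- (1 / x)) +
        (exp (- (1/x)) * (1 / x\<^sup>2)) * poly p (1 / x)) (at x)"
      using 3 by (auto intro!: derivative_eq_intros DERIV_chain2[OF poly_DERIV] simp: power2_eq_square)
    then have "(flat p has_real_derivative
        (poly (pderiv p) (1/x) * (- 1 / x\<^sup>2)) * exp (- (1 / x)) +
        (exp (- (1/x)) * (1 / x\<^sup>2)) * poly p (1 / x)) (at x)"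
      by (rule has_field_derivative_transform_within_open[where S = "{0<..}"]) (use 3 in \<open>auto simp: flat_def\<close>)
    moreover have "(poly (pderiv p) (1/x) * (- 1 / x\<^sup>2)) * exp (- (1 / x)) +
        (exp (- (1/x)) * (1 / x\<^sup>2)) * poly p (1 / x) = flat (monom 1 2 * (p - pderiv p)) x"
      using 3 by (simp add: flat_def poly_monom field_simps)
    ultimately show ?thesis by simp
  qed
qed

lemma times_diff_flat: "times_diff n (flat p)"
  by (induction n arbitrary: p) (use flat_deriv in auto)

text \<open>The support lies strictly to the right of \<open>0\<close>: averaging only over later times keeps the test
  functions inside the open half-plane for every \<open>t \<ge> 0\<close>, including \<open>t = 0\<close>.\<close>

definition kernel :: "real \<Rightarrow> (real \<Rightarrow> real) \<Rightarrow> bool" where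
  "kernel \<epsilon> k \<longleftrightarrow> smooth k \<and> (\<forall>x. 0 \<le> k x) \<and> (\<forall>x. x \<notin> {\<epsilon>..2*\<epsilon>} \<longrightarrow> k x = 0) \<and>
     has_bochner_integral lborel k 1"

lemma kernel_exists: assumes "\<epsilon> > 0" shows "\<exists>k. kernel \<epsilon> k"
proof -
  \<comment> \<open>The coefficients \<open>1\<close> and \<open>-1\<close> are written out so that
    \<open>times_diff_affine\<close> applies.\<close>
  define b where "b x = flat 1 (1 * x + (-\<epsilon>)) * flat 1 ((-1) * x + 2 * \<epsilon>)" for x
  have td: "times_diff n b" for n
    unfolding b_def by (intro times_diff_mult times_diff_affine times_diff_flat)
  have nonneg: "b x \<ge> 0" for x by (simp add: b_def flat_def)
  have zero: "b x = 0" if "x \<notin> {\<epsilon>..2*\<epsilon>}" for x using that by (auto simp: b_def flat_def)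
  have pos: "b x > 0" if "x \<in> {\<epsilon><..<2*\<epsilon>}" for x using that by (auto simp: b_def flat_def)
  have cont: "continuous_on UNIV b"
    using td[of 1] by (auto intro: DERIV_continuous_on)
  have int: "integrable lborel b"
  proof -
    have "set_integrable lborel {\<epsilon>..2*\<epsilon>} b"
      unfolding set_integrable_def using continuous_on_subset[OF cont]
      by (intro borel_integrable_compact) auto
    moreover have "(\<lambda>x. indicator {\<epsilon>..2*\<epsilon>} x *\<^sub>R b x) = b"
      using zero by (force simp: indicator_def)
    ultimately show ?thesis unfolding set_integrable_def by metis
  qed
  define I where "I = integral\<^sup>L lborel b"
  have "I > 0"
  proof -
    have "I \<noteq> 0"
    proof
      assume "I = 0"
      then have "AE x in lborel. b x = 0"
        using integral_nonneg_eq_0_iff_AE[OF int] nonneg I_def by auto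
      then have "AE x in lborel. x \<notin> {\<epsilon><..<2*\<epsilon>}"
        by (rule AE_mp) (use pos in \<open>fastforce intro!: AE_I2\<close>)
      then have "emeasure lborel {\<epsilon><..<2*\<epsilon>} = 0"
        by (subst (asm) AE_iff_measurable[where N="{\<epsilon><..<2*\<epsilon>}"]) auto
      then show False using assms by simp
    qed
    moreover have "I \<ge> 0" unfolding I_def by (simp add: nonneg)
    ultimately show ?thesis by simp
  qed
  have "kernel \<epsilon> (\<lambda>x. b x * (1 / I))"
    unfolding kernel_def
  proof (intro conjI allI impI)
    show "smooth (\<lambda>x. b x * (1 / I))"
      by (intro smooth_if_times_diff times_diff_mult td times_diff_const)
    show "has_bochner_integral lborel (\<lambda>x. b x * (1 / I)) 1"
      using has_bochner_integral_mult_left[OF has_bochner_integral_integrable[OF int], of "1/I"] \<open>I > 0\<close>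
      by (simp add: I_def)
  qed (use nonneg zero \<open>I > 0\<close> in auto)
  then show ?thesis by blast
qed

lemma smooth2_product:
  assumes "smooth \<alpha>" "smooth \<beta>"
  shows "smooth2 (\<lambda>(r, z). \<alpha> (r - \<tau>) * \<beta> (z - x))"
proof -
  have d: "((deriv ^^ n) \<gamma> has_real_derivative (deriv ^^ Suc n) \<gamma> y) (at y)" if "smooth \<gamma>" for n \<gamma> y
    using that unfolding smooth_def by (auto intro: field_differentiable_derivI)
  define D where "D i j = (\<lambda>(r, z). (deriv ^^ i) \<alpha> (r - \<tau>) * (deriv ^^ j) \<beta> (z - x))" for i j
  have "(D i j has_derivative (\<lambda>(h, k). h * D (Suc i) j p + k * D i (Suc j) p)) (at p)" for i j p
  proof -
    have 1: "((\<lambda>p. (deriv ^^ i) \<alpha> (fst p - \<tau>)) has_derivative (\<lambda>q. fst q * (deriv ^^ Suc i) \<alpha> (fst p - \<tau>))) (at p)"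
      by (rule DERIV_compose_FDERIV[OF d[OF assms(1)]]) (auto intro!: derivative_eq_intros)
    have 2: "((\<lambda>p. (deriv ^^ j) \<beta> (snd p - x)) has_derivative (\<lambda>q. snd q * (deriv ^^ Suc j) \<beta> (snd p - x))) (at p)"
      by (rule DERIV_compose_FDERIV[OF d[OF assms(2)]]) (auto intro!: derivative_eq_intros)
    have eq: "D i j = (\<lambda>p. (deriv ^^ i) \<alpha> (fst p - \<tau>) * (deriv ^^ j) \<beta> (snd p - x))"
      unfolding D_def by auto
    show ?thesis unfolding eq
      by (rule has_derivative_eq_rhs[OF has_derivative_mult[OF 1 2]])
         (auto simp: D_def fun_eq_iff algebra_simps split_beta)
  qed
  then show ?thesis unfolding smooth2_def
    by (intro exI[of _ D]) (auto simp: D_def)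
qed

section \<open>Averages against a kernel\<close>

text \<open>Bounded everywhere rather than almost everywhere: sections, translates and products stay
  in the class, and integrals over segments exist without side conditions.\<close>

definition bdd_borel :: "('a::topological_space \<Rightarrow> real) \<Rightarrow> bool" where
  "bdd_borel h \<longleftrightarrow> h \<in> borel_measurable borel \<and> (\<exists>H. \<forall>z. \<bar>h z\<bar> \<le> H)"

lemma bdd_borelI: "h \<in> borel_measurable borel \<Longrightarrow> (\<And>z. \<bar>h z\<bar> \<le> H) \<Longrightarrow> bdd_borel h"
  unfolding bdd_borel_def by blast

lemma bdd_borelD[measurable_dest]: "bdd_borel h \<Longrightarrow> h \<in> borel_measurable borel"
  unfolding bdd_borel_def by blast

lemma bdd_borelE: assumes "bdd_borel h" obtains H where "H \<ge> 0" "\<And>z. \<bar>h z\<bar> \<le> H"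
proof -
  obtain H where "\<And>z. \<bar>h z\<bar> \<le> H" using assms unfolding bdd_borel_def by blast
  moreover from this[of undefined] have "H \<ge> 0" by linarith
  ultimately show thesis using that by blast
qed

lemma bdd_borel_section1: "bdd_borel (case_prod h) \<Longrightarrow> bdd_borel (h (r::'a::second_countable_topology) :: 'b::second_countable_topology \<Rightarrow> real)"
proof -
  assume *: "bdd_borel (case_prod h)"
  then have "case_prod h \<in> borel_measurable (borel \<Otimes>\<^sub>M borel)"
    using bdd_borelD borel_prod by metis
  then have "(\<lambda>z. case_prod h (r, z)) \<in> borel_measurable borel" by measurable
  then show ?thesis using * unfolding bdd_borel_def by auto
qed

lemma bdd_borel_section2: "bdd_borel (case_prod h) \<Longrightarrow> bdd_borel (\<lambda>r. h (r::'a::second_countable_topology) (z :: 'b::second_countable_topology))"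
proof -
  assume *: "bdd_borel (case_prod h)"
  then have "case_prod h \<in> borel_measurable (borel \<Otimes>\<^sub>M borel)"
    using bdd_borelD borel_prod by metis
  then have "(\<lambda>r. case_prod h (r, z)) \<in> borel_measurable borel" by measurable
  then show ?thesis using * unfolding bdd_borel_def by auto
qed

lemma lipschitz_if_deriv_bounded:
  fixes g :: "real \<Rightarrow> real"
  assumes "\<And>x. (g has_real_derivative g' x) (at x)" "\<And>x. \<bar>g' x\<bar> \<le> K"
  shows "\<bar>g a - g b\<bar> \<le> K * \<bar>a - b\<bar>"
  using field_differentiable_bound[of UNIV g g' K a b] assms by simp

text \<open>Weaker than \<open>kernel\<close> because it has to be stable under
  \<open>deriv\<close>: neither sign nor mass survives differentiation.\<close>

definition bump_on :: "real \<Rightarrow> (real \<Rightarrow> real) \<Rightarrow> bool" where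
  "bump_on N \<alpha> \<longleftrightarrow> smooth \<alpha> \<and> (\<forall>x. x \<notin> {0..N} \<longrightarrow> \<alpha> x = 0)"

lemma smooth_has_deriv: "smooth \<alpha> \<Longrightarrow> (\<alpha> has_real_derivative deriv \<alpha> x) (at x)"
  unfolding smooth_def by (metis field_differentiable_derivI funpow_0)

lemma smooth_deriv: "smooth \<alpha> \<Longrightarrow> smooth (deriv \<alpha>)"
  unfolding smooth_def by (metis funpow_Suc_right comp_apply)

lemma smooth_continuous: "smooth \<alpha> \<Longrightarrow> continuous_on A \<alpha>"
  by (meson DERIV_continuous_on has_field_derivative_at_within smooth_has_deriv)

lemma bump_on_deriv: assumes "bump_on N \<alpha>" shows "bump_on N (deriv \<alpha>)"
proof -
  have "deriv \<alpha> x = 0" if "x \<notin> {0..N}" for x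
  proof -
    have "((\<lambda>x. 0) has_real_derivative 0) (at x)" by simp
    then have "(\<alpha> has_real_derivative 0) (at x)"
      by (rule has_field_derivative_transform_within_open[where S = "- {0..N}"])
         (use assms that in \<open>auto simp: bump_on_def\<close>)
    then show ?thesis by (rule DERIV_imp_deriv)
  qed
  then show ?thesis using assms smooth_deriv unfolding bump_on_def by auto
qed

lemma bump_on_bounded: assumes "bump_on N \<alpha>" obtains B where "B \<ge> 0" "\<And>x. \<bar>\<alpha> x\<bar> \<le> B"
proof -
  have "bounded (\<alpha> ` {0..N})"
    using assms by (intro compact_imp_bounded compact_continuous_image smooth_continuous) (auto simp: bump_on_def)
  then obtain B where B: "B > 0" "\<And>x. x \<in> {0..N} \<Longrightarrow> \<bar>\<alpha> x\<bar> \<le> B"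
    unfolding bounded_pos by auto
  have "\<bar>\<alpha> x\<bar> \<le> B" for x
    using B assms by (cases "x \<in> {0..N}") (auto simp: bump_on_def)
  with that[of B] B(1) show thesis by simp
qed

lemma bump_on_borel: "bump_on N \<alpha> \<Longrightarrow> \<alpha> \<in> borel_measurable borel"
  by (simp add: bump_on_def borel_measurable_continuous_onI smooth_continuous)

text \<open>A correlation rather than a convolution. With \<open>\<alpha>\<close> supported to the
  right of 0 it averages over points to the right of \<open>x\<close>, which for the time variable
  means later times; the price is a minus sign in the derivative.\<close>

definition avg :: "(real \<Rightarrow> real) \<Rightarrow> (real \<Rightarrow> real) \<Rightarrow> real \<Rightarrow> real" where
  "avg \<alpha> h x = (LINT z|lborel. \<alpha> (z - x) * h z)"

lemma integrable_on_segment: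
  assumes "g \<in> borel_measurable borel" "\<And>z. \<bar>g z\<bar> \<le> B" "\<And>z. z \<notin> {a..b} \<Longrightarrow> g z = 0"
  shows "integrable lborel (g :: real \<Rightarrow> real)" 
    and "a \<le> b \<Longrightarrow> \<bar>LINT z|lborel. g z\<bar> \<le> B * (b - a)"
proof -
  have i: "integrable lborel (\<lambda>z. indicator {a..b} z * B)"
    by (auto simp: emeasure_lborel_Icc_eq)
  have le: "\<bar>g z\<bar> \<le> indicator {a..b} z * B" for z
    using assms(2,3)[of z] by (auto simp: indicator_def)
  show "integrable lborel g"
    by (rule Bochner_Integration.integrable_bound[OF i]) (use assms(1) le in \<open>auto intro!: AE_I2 order_trans[OF le]\<close>)
  have "\<bar>LINT z|lborel. g z\<bar> \<le> (LINT z|lborel. indicator {a..b} z * B)"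
    by (rule integral_abs_bound_integral[OF \<open>integrable lborel g\<close> i le])
  also assume "a \<le> b" then have "(LINT z|lborel. indicator {a..b} z * B) = B * (b - a)" by simp
  finally show "\<bar>LINT z|lborel. g z\<bar> \<le> B * (b - a)" .
qed

lemma avg_integrable:
  assumes "bump_on N \<alpha>" "bdd_borel h"
  shows "integrable lborel (\<lambda>z. \<alpha> (z - x) * h z)"
proof -
  obtain B where B: "B \<ge> 0" "\<And>x. \<bar>\<alpha> x\<bar> \<le> B" using bump_on_bounded[OF assms(1)] by blast
  obtain H where H: "H \<ge> 0" "\<And>x. \<bar>h x\<bar> \<le> H" using bdd_borelE[OF assms(2)] by blast
  note [measurable] = bump_on_borel[OF assms(1)] bdd_borelD[OF assms(2)]
  show ?thesis
  proof (rule integrable_on_segment(1)[where a = x and b = "x + N" and B = "B * H"])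
    show "\<bar>\<alpha> (z - x) * h z\<bar> \<le> B * H" for z
      unfolding abs_mult by (intro mult_mono B H) auto
    show "\<alpha> (z - x) * h z = 0" if "z \<notin> {x..x + N}" for z
      using that assms(1) by (auto simp: bump_on_def)
  qed measurable
qed

lemma bump_on_integrable: assumes "bump_on N \<alpha>" shows "integrable lborel \<alpha>"
  using avg_integrable[OF assms, of "\<lambda>_. 1" 0] by (simp add: bdd_borelI[where H = 1])

lemma avg_bound:
  assumes "bump_on N \<alpha>" "bdd_borel h" "\<And>z. \<bar>h z\<bar> \<le> H" 
  shows "\<bar>avg \<alpha> h x\<bar> \<le> (LINT z|lborel. \<bar>\<alpha> z\<bar>) * H"
proof -
  have i: "integrable lborel (\<lambda>z. \<bar>\<alpha> z\<bar>)" using bump_on_integrable[OF assms(1)] by simp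
  then have i2: "integrable lborel (\<lambda>z. \<bar>\<alpha> (z - x)\<bar>)"
    using lborel_integrable_real_affine[OF i, of 1 "-x"] by simp
  have "\<bar>avg \<alpha> h x\<bar> \<le> (LINT z|lborel. \<bar>\<alpha> (z - x)\<bar> * H)"
    unfolding avg_def
    using i2 by (intro integral_abs_bound_integral avg_integrable[OF assms(1,2)])
      (auto simp: abs_mult intro!: mult_left_mono assms(3))
  also have "\<dots> = (LINT z|lborel. \<bar>\<alpha> (z - x)\<bar>) * H" using i2 by simp
  also have "(LINT z|lborel. \<bar>\<alpha> (z - x)\<bar>) = (LINT z|lborel. \<bar>\<alpha> z\<bar>)"
    using lborel_integral_real_affine[of 1 "\<lambda>z. \<bar>\<alpha> z\<bar>" "-x"] by simp
  finally show ?thesis .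
qed

text \<open>\<open>h\<close> is merely measurable, so the kernel has to be differentiated. The
  second-order Taylor remainder of \<open>\<alpha>\<close> is at most \<open>K * d\<^sup>2\<close>
  uniformly and lives on a fixed segment, so its integral against \<open>h\<close> is still
  quadratic in \<open>d\<close>.\<close>

lemma avg_deriv:
  assumes "bump_on N \<alpha>" "bdd_borel h"
  shows "(avg \<alpha> h has_real_derivative - avg (deriv \<alpha>) h x) (at x)"
proof -
  note d1 = bump_on_deriv[OF assms(1)] and d2 = bump_on_deriv[OF bump_on_deriv[OF assms(1)]]
  have sm: "smooth \<alpha>" "smooth (deriv \<alpha>)" using assms(1) smooth_deriv by (auto simp: bump_on_def)
  obtain K where K: "K \<ge> 0" "\<And>x. \<bar>deriv (deriv \<alpha>) x\<bar> \<le> K" using bump_on_bounded[OF d2] by blast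
  obtain H where H: "H \<ge> 0" "\<And>x. \<bar>h x\<bar> \<le> H" using bdd_borelE[OF assms(2)] by blast
  note [measurable] = bump_on_borel[OF assms(1)] bdd_borelD[OF assms(2)] bump_on_borel[OF d1]
  have lip: "\<bar>deriv \<alpha> a - deriv \<alpha> b\<bar> \<le> K * \<bar>a - b\<bar>" for a b
    by (rule lipschitz_if_deriv_bounded[OF smooth_has_deriv[OF sm(2)] K(2)])
  have taylor: "\<bar>\<alpha> (y - d) - \<alpha> y + d * deriv \<alpha> y\<bar> \<le> K * d\<^sup>2" for y d
  proof (cases "d = 0")
    case False
    define \<xi> where "\<xi> = (\<lambda>s. \<alpha> (y - s))"
    have "\<exists>s. \<bar>s\<bar> \<le> \<bar>d\<bar> \<and> \<alpha> (y - d) - \<alpha> y = - d * deriv \<alpha> (y - s)"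
    proof (cases "d > 0")
      case True
      obtain z where "y - d < z" "z < y" "\<alpha> y - \<alpha> (y - d) = (y - (y - d)) * deriv \<alpha> z"
        using MVT2[of "y - d" y \<alpha> "deriv \<alpha>"] smooth_has_deriv[OF sm(1)] True by auto
      then show ?thesis by (intro exI[of _ "y - z"]) auto
    next
      case False
      with \<open>d \<noteq> 0\<close> have "d < 0" by simp
      then obtain z where "y < z" "z < y - d" "\<alpha> (y - d) - \<alpha> y = (y - d - y) * deriv \<alpha> z"
        using MVT2[of y "y - d" \<alpha> "deriv \<alpha>"] smooth_has_deriv[OF sm(1)] by auto
      then show ?thesis by (intro exI[of _ "y - z"]) auto
    qed
    then obtain s where s: "\<bar>s\<bar> \<le> \<bar>d\<bar>" "\<alpha> (y - d) - \<alpha> y = - d * deriv \<alpha> (y - s)" by blast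
    have "\<bar>\<alpha> (y - d) - \<alpha> y + d * deriv \<alpha> y\<bar> = \<bar>d\<bar> * \<bar>deriv \<alpha> y - deriv \<alpha> (y - s)\<bar>"
      unfolding s(2) abs_mult[symmetric] by (simp add: algebra_simps)
    also have "\<dots> \<le> \<bar>d\<bar> * (K * \<bar>s\<bar>)" using lip[of y "y - s"] by (intro mult_left_mono) auto
    also have "\<dots> \<le> \<bar>d\<bar> * (K * \<bar>d\<bar>)" using s K by (intro mult_left_mono) auto
    finally show ?thesis by (simp add: power2_eq_square mult_ac)
  qed simp
  have rem: "\<bar>avg \<alpha> h (x + d) - avg \<alpha> h x + d * avg (deriv \<alpha>) h x\<bar> \<le> K * d\<^sup>2 * H * (\<bar>N\<bar> + 2)"
    if d: "\<bar>d\<bar> \<le> 1" for d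
  proof -
    have i: "integrable lborel (\<lambda>z. \<alpha> (z - (x + d)) * h z)" "integrable lborel (\<lambda>z. \<alpha> (z - x) * h z)"
      "integrable lborel (\<lambda>z. deriv \<alpha> (z - x) * h z)"
      by (rule avg_integrable[OF assms] avg_integrable[OF d1 assms(2)])+
    have "avg \<alpha> h (x + d) - avg \<alpha> h x + d * avg (deriv \<alpha>) h x =
       (LINT z|lborel. (\<alpha> (z - (x + d)) * h z - \<alpha> (z - x) * h z) + d * (deriv \<alpha> (z - x) * h z))"
      unfolding avg_def using i
      by (subst Bochner_Integration.integral_add) (auto simp: Bochner_Integration.integral_diff)
    also have "\<dots> = (LINT z|lborel. (\<alpha> (z - x - d) - \<alpha> (z - x) + d * deriv \<alpha> (z - x)) * h z)"
      by (simp add: algebra_simps)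
    \<comment> \<open>For \<open>\<bar>d\<bar> \<le> 1\<close> this single segment contains the
      supports of both translates of \<open>\<alpha>\<close>.\<close>
    also have "\<bar>\<dots>\<bar> \<le> K * d\<^sup>2 * H * ((x + \<bar>N\<bar> + 1) - (x - 1))"
    proof (rule integrable_on_segment(2))
      show "\<bar>(\<alpha> (z - x - d) - \<alpha> (z - x) + d * deriv \<alpha> (z - x)) * h z\<bar> \<le> K * d\<^sup>2 * H" for z
        unfolding abs_mult using K by (intro mult_mono taylor H) auto
      show "(\<alpha> (z - x - d) - \<alpha> (z - x) + d * deriv \<alpha> (z - x)) * h z = 0"
        if "z \<notin> {x - 1..x + \<bar>N\<bar> + 1}" for z
      proof -
        have "z - x - d \<notin> {0..N}" "z - x \<notin> {0..N}" using that d by auto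
        then show ?thesis using assms(1) d1 by (auto simp: bump_on_def)
      qed
      show "(\<lambda>z. (\<alpha> (z - x - d) - \<alpha> (z - x) + d * deriv \<alpha> (z - x)) * h z) \<in> borel_measurable borel"
        by measurable
    qed auto
    finally show ?thesis by (simp add: algebra_simps)
  qed
  define Q where "Q = K * H * (\<bar>N\<bar> + 2)"
  have "((\<lambda>d. (avg \<alpha> h (x + d) - avg \<alpha> h x) / d - (- avg (deriv \<alpha>) h x)) \<longlongrightarrow> 0) (at 0)"
  proof (rule Lim_null_comparison)
    show "((\<lambda>d. Q * \<bar>d\<bar>) \<longlongrightarrow> 0) (at 0)" by (auto intro!: tendsto_eq_intros)
    show "\<forall>\<^sub>F d in at 0. norm ((avg \<alpha> h (x + d) - avg \<alpha> h x) / d - (- avg (deriv \<alpha>) h x)) \<le> Q * \<bar>d\<bar>"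
      unfolding eventually_at
    proof (intro exI[of _ 1] conjI ballI impI)
      fix d :: real assume d: "d \<noteq> 0 \<and> dist d 0 < 1"
      have "norm ((avg \<alpha> h (x + d) - avg \<alpha> h x) / d - (- avg (deriv \<alpha>) h x)) =
        \<bar>avg \<alpha> h (x + d) - avg \<alpha> h x + d * avg (deriv \<alpha>) h x\<bar> / \<bar>d\<bar>"
      proof -
        have "X / d - (- Y) = (X + d * Y) / d" for X Y :: real using d by (simp add: field_simps)
        then show ?thesis by (simp only: real_norm_def abs_divide)
      qed
      also have "\<dots> \<le> (K * d\<^sup>2 * H * (\<bar>N\<bar> + 2)) / \<bar>d\<bar>"
        using rem[of d] d by (intro divide_right_mono) auto
      also have "\<dots> = Q * \<bar>d\<bar>" using d by (simp add: Q_def field_simps power2_eq_square)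
      finally show "norm ((avg \<alpha> h (x + d) - avg \<alpha> h x) / d - (- avg (deriv \<alpha>) h x)) \<le> Q * \<bar>d\<bar>" .
    qed auto
  qed
  then show ?thesis unfolding DERIV_def by (rule LIM_zero_cancel)
qed

lemma avg_lipschitz:
  assumes "bump_on N \<alpha>" "bdd_borel h" "\<And>z. \<bar>h z\<bar> \<le> H" 
  shows "\<bar>avg \<alpha> h x - avg \<alpha> h y\<bar> \<le> (LINT z|lborel. \<bar>deriv \<alpha> z\<bar>) * H * \<bar>x - y\<bar>"
  by (rule lipschitz_if_deriv_bounded[OF avg_deriv[OF assms(1,2)]])
     (use avg_bound[OF bump_on_deriv[OF assms(1)] assms(2,3)] in simp)

lemma avg_bdd_borel: assumes "bump_on N \<alpha>" "bdd_borel h" shows "bdd_borel (avg \<alpha> h)"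
proof -
  obtain H where H: "H \<ge> 0" "\<And>x. \<bar>h x\<bar> \<le> H" using bdd_borelE[OF assms(2)] by blast
  have "continuous_on UNIV (avg \<alpha> h)"
    using avg_deriv[OF assms] has_field_derivative_at_within
    by (intro DERIV_continuous_on[where D = "\<lambda>x. - avg (deriv \<alpha>) h x"]) blast
  then show ?thesis
    using avg_bound[OF assms H(2)] by (auto intro!: bdd_borelI borel_measurable_continuous_onI)
qed

lemma avg_param_bdd_borel:
  assumes "bump_on N \<alpha>" "bdd_borel (case_prod h)" shows "bdd_borel (\<lambda>r. avg \<alpha> (h (r::real)) x)"
proof -
  obtain H where H: "H \<ge> 0" "\<And>p. \<bar>case_prod h p\<bar> \<le> H" using bdd_borelE[OF assms(2)] by blast
  have [measurable]: "case_prod h \<in> borel_measurable (borel \<Otimes>\<^sub>M borel)"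
    using bdd_borelD[OF assms(2)] borel_prod by metis
  note [measurable] = bump_on_borel[OF assms(1)]
  have "(\<lambda>r. avg \<alpha> (h r) x) \<in> borel_measurable borel" unfolding avg_def by measurable
  then show ?thesis
    by (rule bdd_borelI[OF _ avg_bound[OF assms(1) bdd_borel_section1[OF assms(2)]]])
       (use H(2)[of "(_,_)"] in auto)
qed

lemma bdd_borel_swap:
  "bdd_borel (case_prod h) \<Longrightarrow> bdd_borel (case_prod (\<lambda>z r. h (r::real) (z::real)))"
proof -
  assume *: "bdd_borel (case_prod h)"
  then have [measurable]: "case_prod h \<in> borel_measurable (borel \<Otimes>\<^sub>M borel)"
    using bdd_borelD borel_prod by metis
  have "case_prod (\<lambda>z r. h r z) \<in> borel_measurable (borel \<Otimes>\<^sub>M borel)" by measurable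
  then show ?thesis using * by (auto simp: bdd_borel_def borel_prod)
qed

text \<open>Fubini. \<open>avg_deriv\<close> differentiates the outer average only; exchanging the
  averages makes it applicable in either variable.\<close>

lemma avg_swap:
  assumes a: "bump_on N \<alpha>" and b: "bump_on N' \<beta>" and h: "bdd_borel (case_prod h)"
  shows "avg \<alpha> (\<lambda>r. avg \<beta> (h r) x) \<tau> = avg \<beta> (\<lambda>z. avg \<alpha> (\<lambda>r. h r z) \<tau>) x"
    and "integrable (lborel \<Otimes>\<^sub>M lborel) (\<lambda>(r, z). \<alpha> (r - \<tau>) * \<beta> (z - x) * h r z)"
proof -
  obtain H where H: "H \<ge> 0" "\<And>p. \<bar>case_prod h p\<bar> \<le> H" using bdd_borelE[OF h] by blast
  have [measurable]: "case_prod h \<in> borel_measurable (borel \<Otimes>\<^sub>M borel)"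
    using bdd_borelD[OF h] borel_prod by metis
  note [measurable] = bump_on_borel[OF a] bump_on_borel[OF b]
  have "integrable (lborel \<Otimes>\<^sub>M lborel) (\<lambda>(r, z). \<alpha> (r - \<tau>) * \<beta> (z - x))"
  proof (rule lborel_pair.Fubini_integrable)
    show "integrable lborel (\<lambda>r. LINT z|lborel. norm (case (r, z) of (r, z) \<Rightarrow> \<alpha> (r - \<tau>) * \<beta> (z - x)))"
      using avg_integrable[OF a, of "\<lambda>_. 1" \<tau>]
      by (simp add: abs_mult bdd_borelI[where H = 1])
    show "AE r in lborel. integrable lborel (\<lambda>z. case (r, z) of (r, z) \<Rightarrow> \<alpha> (r - \<tau>) * \<beta> (z - x))"
      using avg_integrable[OF b, of "\<lambda>_. 1" x] by (simp add: bdd_borelI[where H = 1])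
  qed measurable
  then have "integrable (lborel \<Otimes>\<^sub>M lborel) (\<lambda>p. H * (case p of (r, z) \<Rightarrow> \<alpha> (r - \<tau>) * \<beta> (z - x)))"
    by (rule integrable_mult_right)
  then show i: "integrable (lborel \<Otimes>\<^sub>M lborel) (\<lambda>(r, z). \<alpha> (r - \<tau>) * \<beta> (z - x) * h r z)"
  proof (rule Bochner_Integration.integrable_bound)
    show "AE p in lborel \<Otimes>\<^sub>M lborel. norm (case p of (r, z) \<Rightarrow> \<alpha> (r - \<tau>) * \<beta> (z - x) * h r z)
        \<le> norm (H * (case p of (r, z) \<Rightarrow> \<alpha> (r - \<tau>) * \<beta> (z - x)))"
      using H by (intro AE_I2) (auto simp: abs_mult mult_ac intro!: mult_right_mono mult_left_mono)
  qed measurable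
  have "avg \<alpha> (\<lambda>r. avg \<beta> (h r) x) \<tau> = (LINT r|lborel. LINT z|lborel. \<alpha> (r - \<tau>) * \<beta> (z - x) * h r z)"
    unfolding avg_def by (simp add: mult.assoc)
  also have "\<dots> = (LINT z|lborel. LINT r|lborel. \<alpha> (r - \<tau>) * \<beta> (z - x) * h r z)"
    using lborel_pair.Fubini_integral[OF i] by simp
  also have "\<dots> = avg \<beta> (\<lambda>z. avg \<alpha> (\<lambda>r. h r z) \<tau>) x"
    unfolding avg_def by (simp add: mult_ac flip: integral_mult_right_zero)
  finally show "avg \<alpha> (\<lambda>r. avg \<beta> (h r) x) \<tau> = avg \<beta> (\<lambda>z. avg \<alpha> (\<lambda>r. h r z) \<tau>) x" .
qed

section \<open>Averages in time and space\<close>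

definition conv :: "(real \<Rightarrow> real) \<Rightarrow> (real \<Rightarrow> real) \<Rightarrow> (real \<Rightarrow> real \<Rightarrow> real) \<Rightarrow> real \<Rightarrow> real \<Rightarrow> real" where
  "conv \<alpha> \<beta> h \<tau> x = avg \<alpha> (\<lambda>r. avg \<beta> (h r) x) \<tau>"

lemma conv_deriv_t:
  assumes "bump_on N \<alpha>" "bump_on N' \<beta>" "bdd_borel (case_prod h)"
  shows "((\<lambda>\<tau>. conv \<alpha> \<beta> h \<tau> x) has_real_derivative - conv (deriv \<alpha>) \<beta> h \<tau> x) (at \<tau>)"
  unfolding conv_def by (rule avg_deriv[OF assms(1) avg_param_bdd_borel[OF assms(2,3)]])

lemma conv_deriv_x:
  assumes "bump_on N \<alpha>" "bump_on N' \<beta>" "bdd_borel (case_prod h)"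
  shows "((\<lambda>x. conv \<alpha> \<beta> h \<tau> x) has_real_derivative - conv \<alpha> (deriv \<beta>) h \<tau> x) (at x)"
  unfolding conv_def avg_swap(1)[OF assms] avg_swap(1)[OF assms(1) bump_on_deriv[OF assms(2)] assms(3)]
  by (rule avg_deriv[OF assms(2) avg_param_bdd_borel[OF assms(1) bdd_borel_swap[OF assms(3)]]])

lemma conv_bound:
  assumes "bump_on N \<alpha>" "bump_on N' \<beta>" "bdd_borel (case_prod h)" "\<And>r z. \<bar>h r z\<bar> \<le> H"
  shows "\<bar>conv \<alpha> \<beta> h \<tau> x\<bar> \<le> (LINT z|lborel. \<bar>\<alpha> z\<bar>) * ((LINT z|lborel. \<bar>\<beta> z\<bar>) * H)"
  unfolding conv_def
  by (rule avg_bound[OF assms(1) avg_param_bdd_borel[OF assms(2,3)]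
        avg_bound[OF assms(2) bdd_borel_section1[OF assms(3)] assms(4)]])

lemma continuous_on_if_lipschitz2:
  fixes h :: "real \<Rightarrow> real \<Rightarrow> real"
  assumes "\<And>\<tau> \<tau>' x. \<tau> \<in> S \<Longrightarrow> \<tau>' \<in> S \<Longrightarrow> x \<in> T \<Longrightarrow> \<bar>h \<tau> x - h \<tau>' x\<bar> \<le> K1 * \<bar>\<tau> - \<tau>'\<bar>"
    and "\<And>\<tau> x x'. \<tau> \<in> S \<Longrightarrow> x \<in> T \<Longrightarrow> x' \<in> T \<Longrightarrow> \<bar>h \<tau> x - h \<tau> x'\<bar> \<le> K2 * \<bar>x - x'\<bar>"
  shows "continuous_on (S \<times> T) (\<lambda>(\<tau>, x). h \<tau> x)"
  unfolding continuous_on_def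
proof
  fix p0 assume p0: "p0 \<in> S \<times> T"
  obtain \<tau>0 x0 where p: "p0 = (\<tau>0, x0)" by fastforce
  have in0: "\<tau>0 \<in> S" "x0 \<in> T" using p0 p by auto
  have "((\<lambda>(\<tau>, x). h \<tau> x) \<longlongrightarrow> h \<tau>0 x0) (at (\<tau>0, x0) within S \<times> T)"
  proof (rule LIM_zero_cancel, rule Lim_null_comparison)
    show "\<forall>\<^sub>F q in at (\<tau>0, x0) within S \<times> T. norm ((case q of (\<tau>, x) \<Rightarrow> h \<tau> x) - h \<tau>0 x0)
         \<le> K1 * \<bar>fst q - \<tau>0\<bar> + K2 * \<bar>snd q - x0\<bar>"
      unfolding eventually_at
    proof (intro exI[of _ 1] conjI ballI impI)
      fix q assume "q \<in> S \<times> T"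
      then show "norm ((case q of (\<tau>, x) \<Rightarrow> h \<tau> x) - h \<tau>0 x0) \<le> K1 * \<bar>fst q - \<tau>0\<bar> + K2 * \<bar>snd q - x0\<bar>"
        using assms(1)[of "fst q" \<tau>0 "snd q"] assms(2)[of \<tau>0 "snd q" x0] in0 by (simp add: split_beta mem_Times_iff)
    qed simp
    have "((\<lambda>q. K1 * \<bar>fst q - \<tau>0\<bar> + K2 * \<bar>snd q - x0\<bar>) \<longlongrightarrow> K1 * \<bar>fst (\<tau>0, x0) - \<tau>0\<bar> + K2 * \<bar>snd (\<tau>0, x0) - x0\<bar>)
       (at (\<tau>0, x0) within S \<times> T)"
      by (intro tendsto_intros)
    then show "((\<lambda>q. K1 * \<bar>fst q - \<tau>0\<bar> + K2 * \<bar>snd q - x0\<bar>) \<longlongrightarrow> 0) (at (\<tau>0, x0) within S \<times> T)" by simp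
  qed
  then show "((\<lambda>(\<tau>, x). h \<tau> x) \<longlongrightarrow> (case p0 of (\<tau>, x) \<Rightarrow> h \<tau> x)) (at p0 within S \<times> T)"
    by (simp add: p)
qed

lemma conv_continuous:
  assumes "bump_on N \<alpha>" "bump_on N' \<beta>" "bdd_borel (case_prod h)"
  shows "continuous_on A (\<lambda>(\<tau>, x). conv \<alpha> \<beta> h \<tau> x)"
proof -
  obtain H where H: "H \<ge> 0" "\<And>p. \<bar>case_prod h p\<bar> \<le> H" using bdd_borelE[OF assms(3)] by blast
  have H': "\<bar>h r z\<bar> \<le> H" for r z using H(2)[of "(r, z)"] by simp
  define K1 where "K1 = (LINT z|lborel. \<bar>deriv \<alpha> z\<bar>) * ((LINT z|lborel. \<bar>\<beta> z\<bar>) * H)"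
  define K2 where "K2 = (LINT z|lborel. \<bar>deriv \<beta> z\<bar>) * ((LINT z|lborel. \<bar>\<alpha> z\<bar>) * H)"
  have 1: "\<bar>conv \<alpha> \<beta> h \<tau> x - conv \<alpha> \<beta> h \<tau>' x\<bar> \<le> K1 * \<bar>\<tau> - \<tau>'\<bar>" for \<tau> \<tau>' x
    unfolding conv_def K1_def
    by (rule avg_lipschitz[OF assms(1) avg_param_bdd_borel[OF assms(2,3)]
          avg_bound[OF assms(2) bdd_borel_section1[OF assms(3)] H']])
  have 2: "\<bar>conv \<alpha> \<beta> h \<tau> x - conv \<alpha> \<beta> h \<tau> x'\<bar> \<le> K2 * \<bar>x - x'\<bar>" for \<tau> x x'
    unfolding conv_def K2_def avg_swap(1)[OF assms]
    by (rule avg_lipschitz[OF assms(2) avg_param_bdd_borel[OF assms(1) bdd_borel_swap[OF assms(3)]]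
          avg_bound[OF assms(1) bdd_borel_section2[OF assms(3)] H']])
  have "continuous_on (UNIV \<times> UNIV) (\<lambda>(\<tau>, x). conv \<alpha> \<beta> h \<tau> x)"
    by (rule continuous_on_if_lipschitz2[OF 1 2])
  then show ?thesis using continuous_on_subset by (metis UNIV_Times_UNIV subset_UNIV)
qed

section \<open>Algebra and integrals of bounded Borel functions\<close>

lemma bdd_borel_diff: assumes "bdd_borel g" "bdd_borel h" shows "bdd_borel (\<lambda>x. g x - h x)"
proof -
  obtain G where G: "G \<ge> 0" "\<And>z. \<bar>g z\<bar> \<le> G" using bdd_borelE[OF assms(1)] by blast
  obtain H where H: "H \<ge> 0" "\<And>z. \<bar>h z\<bar> \<le> H" using bdd_borelE[OF assms(2)] by blast
  have "\<bar>g z - h z\<bar> \<le> G + H" for z using G(2)[of z] H(2)[of z] by linarith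
  then show ?thesis using assms[THEN bdd_borelD] by (intro bdd_borelI) auto
qed

lemma bdd_borel_add: assumes "bdd_borel g" "bdd_borel h" shows "bdd_borel (\<lambda>x. g x + h x)"
proof -
  obtain G where G: "G \<ge> 0" "\<And>z. \<bar>g z\<bar> \<le> G" using bdd_borelE[OF assms(1)] by blast
  obtain H where H: "H \<ge> 0" "\<And>z. \<bar>h z\<bar> \<le> H" using bdd_borelE[OF assms(2)] by blast
  have "\<bar>g z + h z\<bar> \<le> G + H" for z using G(2)[of z] H(2)[of z] by linarith
  then show ?thesis using assms[THEN bdd_borelD] by (intro bdd_borelI) auto
qed

lemma bdd_borel_mult: assumes "bdd_borel g" "bdd_borel h" shows "bdd_borel (\<lambda>x. g x * h x)"
proof -
  obtain G where G: "G \<ge> 0" "\<And>z. \<bar>g z\<bar> \<le> G" using bdd_borelE[OF assms(1)] by blast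
  obtain H where H: "H \<ge> 0" "\<And>z. \<bar>h z\<bar> \<le> H" using bdd_borelE[OF assms(2)] by blast
  have "\<bar>g z * h z\<bar> \<le> G * H" for z using G(2)[of z] H(2)[of z] by (simp add: abs_mult mult_mono G(1))
  then show ?thesis using assms[THEN bdd_borelD] by (intro bdd_borelI) auto
qed

lemma bdd_borel_abs: "bdd_borel g \<Longrightarrow> bdd_borel (\<lambda>x. \<bar>g x\<bar>)"
  unfolding bdd_borel_def by auto

lemma bdd_borel_const: "bdd_borel (\<lambda>x. c)"
  by (rule bdd_borelI[of _ "\<bar>c\<bar>"]) auto

lemma bdd_borel_shift: "bdd_borel g \<Longrightarrow> bdd_borel (\<lambda>x::real. g (x + y))"
  unfolding bdd_borel_def using measurable_compose[of "\<lambda>x. x + y" borel borel g borel] by auto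

lemma bdd_borel_integrable:
  fixes h :: "real \<Rightarrow> real"
  assumes "bdd_borel h"
  shows "integrable lborel (\<lambda>x. indicator {a..b} x * h x)"
proof -
  obtain H where H: "H \<ge> 0" "\<And>x. \<bar>h x\<bar> \<le> H" using bdd_borelE[OF assms] by blast
  note [measurable] = bdd_borelD[OF assms]
  show ?thesis
    by (rule integrable_on_segment(1)[where a = a and b = b and B = H])
       (use H in \<open>auto simp: indicator_def\<close>)
qed

text \<open>Bridge between the two integrals in use: the gauge integral for the fundamental theorem
  and differentiation under the integral, the Lebesgue integral for Fubini and Fatou.\<close>

lemma bdd_borel_integrable_on:
  fixes h :: "real \<Rightarrow> real"
  assumes "bdd_borel h"
  shows "h integrable_on {a..b}" "integral {a..b} h = (LINT x|lborel. indicator {a..b} x * h x)"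
  using set_borel_integral_eq_integral[of "{a..b}" h] bdd_borel_integrable[OF assms]
  by (auto simp: set_integrable_def set_lebesgue_integral_def)

lemma bdd_borel_nn_integral:
  fixes h :: "real \<Rightarrow> real"
  assumes "bdd_borel h" "\<And>x. x \<in> {a..b} \<Longrightarrow> 0 \<le> h x"
  shows "(\<integral>\<^sup>+x. ennreal (indicator {a..b} x * h x) \<partial>lborel) = ennreal (integral {a..b} h)"
  unfolding bdd_borel_integrable_on(2)[OF assms(1)]
  by (rule nn_integral_eq_integral[OF bdd_borel_integrable[OF assms(1)]])
     (auto simp: indicator_def assms(2))

lemma integral_Icc_bound:
  fixes h :: "real \<Rightarrow> real"
  assumes "bdd_borel h" "a \<le> b" "\<And>x. x \<in> {a..b} \<Longrightarrow> \<bar>h x\<bar> \<le> B"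
  shows "\<bar>integral {a..b} h\<bar> \<le> B * (b - a)"
  using has_integral_bound_real[of B "{}" h "integral {a..b} h" a b] 
    bdd_borel_integrable_on(1)[OF assms(1)] assms(2,3) order_trans[OF abs_ge_zero assms(3), of a]
  by (simp add: integrable_integral)

section \<open>Mollification\<close>

text \<open>\<open>measurable_on\<close> supplies continuous functions converging to
  \<open>h\<close> off a negligible set. Truncating them at the bound \<open>H\<close> changes
  nothing in the limit and makes dominated convergence applicable.\<close>

lemma approx_by_continuous:
  fixes h :: "real \<Rightarrow> real"
  assumes "bdd_borel h" "\<And>x. \<bar>h x\<bar> \<le> H" "e > 0"
  shows "\<exists>g. continuous_on UNIV g \<and> (\<forall>x. \<bar>g x\<bar> \<le> H) \<and> integral {a..b} (\<lambda>x::real. \<bar>g x - h x\<bar>) < e"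
proof -
  have H: "0 \<le> H" using assms(2)[of 0] by linarith
  have "h \<in> borel_measurable lebesgue" using bdd_borelD[OF assms(1)] by (simp add: measurable_completion)
  then have "h measurable_on {a..b}" by (intro lebesgue_measurable_imp_measurable_on) auto
  then obtain N g where N: "negligible N" and g: "\<And>n. continuous_on UNIV (g n)"
    and lim: "\<And>x. x \<notin> N \<Longrightarrow> (\<lambda>n::nat. g n x) \<longlonglongrightarrow> (if x \<in> {a..b} then h x else 0)"
    unfolding measurable_on_def by blast
  define g' where "g' n x = max (-H) (min H (g n x))" for n x
  have cont: "continuous_on UNIV (g' n)" for n unfolding g'_def
    by (intro continuous_intros g)
  have bd: "\<bar>g' n x\<bar> \<le> H" for n x unfolding g'_def using H by auto
  have bb: "bdd_borel (g' n)" for n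
    by (rule bdd_borelI[OF borel_measurable_continuous_onI[OF cont] bd])
  have "(\<lambda>n. LINT x|lborel. indicator {a..b} x * \<bar>g' n x - h x\<bar>) \<longlonglongrightarrow> (LINT x::real|lborel. (0::real))"
  proof (rule integral_dominated_convergence[where f = "\<lambda>_. 0" and w = "\<lambda>x. indicator {a..b} x * (2 * H)"])
    show "integrable lborel (\<lambda>x. indicator {a..b} x * (2 * H))"
      by (rule bdd_borel_integrable[OF bdd_borel_const])
    show "(\<lambda>x. indicator {a..b} x * \<bar>g' n x - h x\<bar>) \<in> borel_measurable lborel" for n
      using bdd_borelD[OF bb] bdd_borelD[OF assms(1)] by measurable
    show "AE x in lborel. norm (indicator {a..b} x * \<bar>g' n x - h x\<bar>) \<le> indicator {a..b} x * (2 * H)" for n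
    proof (rule AE_I2)
      fix x
      have "\<bar>g' n x - h x\<bar> \<le> 2 * H" using bd[of n x] assms(2)[of x] by linarith
      then show "norm (indicator {a..b} x * \<bar>g' n x - h x\<bar>) \<le> indicator {a..b} x * (2 * H)"
        by (auto simp: indicator_def)
    qed
    have "AE x in lebesgue. x \<notin> N" using N by (simp add: AE_not_in negligible_iff_null_sets)
    then have "AE x in lborel. x \<notin> N" by (simp add: AE_completion_iff)
    then show "AE x in lborel. (\<lambda>n. indicator {a..b} x * \<bar>g' n x - h x\<bar>) \<longlonglongrightarrow> 0"
    proof (rule AE_mp, intro AE_I2 impI)
      fix x assume x: "x \<notin> N"
      show "(\<lambda>n. indicator {a..b} x * \<bar>g' n x - h x\<bar>) \<longlonglongrightarrow> 0"
      proof (cases "x \<in> {a..b}")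
        case True
        then have "(\<lambda>n. g' n x) \<longlonglongrightarrow> max (-H) (min H (h x))"
          unfolding g'_def using lim[OF x] by (intro tendsto_intros) auto
        moreover have "max (-H) (min H (h x)) = h x" using assms(2)[of x] by auto
        ultimately have "(\<lambda>n. \<bar>g' n x - h x\<bar>) \<longlonglongrightarrow> \<bar>h x - h x\<bar>" by (intro tendsto_intros) simp
        then show ?thesis using True by simp
      qed simp
    qed
  qed simp
  then have "(\<lambda>n. LINT x|lborel. indicator {a..b} x * \<bar>g' n x - h x\<bar>) \<longlonglongrightarrow> 0" by simp
  from order_tendstoD(2)[OF this \<open>e > 0\<close>]
  obtain n where "(LINT x|lborel. indicator {a..b} x * \<bar>g' n x - h x\<bar>) < e"
    by (auto simp: eventually_sequentially)
  then have "integral {a..b} (\<lambda>x. \<bar>g' n x - h x\<bar>) < e"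
    using bdd_borel_integrable_on(2)[OF bdd_borel_abs[OF bdd_borel_diff[OF bb assms(1)]]] by simp
  then show ?thesis using cont bd by blast
qed

lemma translation_continuous_L1:
  assumes h: "bdd_borel h" and e: "e > 0"
  shows "\<exists>d>0. \<forall>y. \<bar>y\<bar> \<le> d \<longrightarrow> integral {a..b} (\<lambda>x::real. \<bar>h (x + y) - h x\<bar>) < e"
proof -
  obtain H where H: "H \<ge> 0" "\<And>x. \<bar>h x\<bar> \<le> H" using bdd_borelE[OF h] by blast
  \<comment> \<open>The summand 1 keeps \<open>D\<close> positive on degenerate segments; all that
    is used besides is \<open>b - a \<le> D\<close>.\<close>
  define D where "D = \<bar>b - a\<bar> + 1"
  have D: "D > 0" unfolding D_def by simp
  \<comment> \<open>One unit wider on both sides, so that translates by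
    \<open>\<bar>y\<bar> \<le> 1/2\<close> stay inside.\<close>
  obtain g where g: "continuous_on UNIV g" "\<And>x. \<bar>g x\<bar> \<le> H"
    and g3: "integral {a - 1..b + 1} (\<lambda>x. \<bar>g x - h x\<bar>) < e / 3"
    using approx_by_continuous[OF h H(2), of "e/3" "a - 1" "b + 1"] e by auto
  have bg: "bdd_borel g" by (rule bdd_borelI[OF borel_measurable_continuous_onI[OF g(1)] g(2)])
  have "uniformly_continuous_on {a - 1..b + 1} g"
    using g(1) by (intro compact_uniformly_continuous) (auto intro: continuous_on_subset)
  then obtain d where d: "d > 0" 
    "\<And>x x'. x \<in> {a - 1..b + 1} \<Longrightarrow> x' \<in> {a - 1..b + 1} \<Longrightarrow> \<bar>x' - x\<bar> < d \<Longrightarrow> \<bar>g x' - g x\<bar> < e / (3 * D)"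
    unfolding uniformly_continuous_on_def dist_real_def using e D 
    by (metis zero_less_divide_iff zero_less_mult_iff zero_less_numeral)
  have "integral {a..b} (\<lambda>x. \<bar>h (x + y) - h x\<bar>) < e" if y: "\<bar>y\<bar> \<le> min (1/2) (d / 2)" for y
  proof (cases "a \<le> b")
    case ab: True
    let ?e1 = "\<lambda>x. \<bar>g (x + y) - h (x + y)\<bar>" and ?e2 = "\<lambda>x. \<bar>g (x + y) - g x\<bar>" and ?e3 = "\<lambda>x. \<bar>g x - h x\<bar>"
    have b3: "bdd_borel ?e3" by (intro bdd_borel_abs bdd_borel_diff bg h)
    have b1: "bdd_borel ?e1" using bdd_borel_shift[OF b3] .
    have b2: "bdd_borel ?e2" by (rule bdd_borel_abs[OF bdd_borel_diff[OF bdd_borel_shift[OF bg] bg]])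
    have b0: "bdd_borel (\<lambda>x. \<bar>h (x + y) - h x\<bar>)" by (rule bdd_borel_abs[OF bdd_borel_diff[OF bdd_borel_shift[OF h] h]])
    note int = bdd_borel_integrable_on(1)
    have "integral {a..b} (\<lambda>x. \<bar>h (x + y) - h x\<bar>) \<le> integral {a..b} (\<lambda>x. ?e1 x + ?e2 x + ?e3 x)"
      by (intro integral_le int b0 bdd_borel_add[OF bdd_borel_add[OF b1 b2] b3]) auto
    also have "\<dots> = integral {a..b} ?e1 + integral {a..b} ?e2 + integral {a..b} ?e3"
      using int[OF b1, of a b] int[OF b2, of a b] int[OF b3, of a b]
      by (simp add: Henstock_Kurzweil_Integration.integral_add integrable_add)
    also have "integral {a..b} ?e1 = integral {a + y..b + y} ?e3"
      using integral_shift_Icc_real[of a b ?e3 y] by (simp add: add.commute o_def)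
    also have "\<dots> \<le> integral {a - 1..b + 1} ?e3"
      using y by (intro integral_subset_le int b3) auto
    also have "integral {a..b} ?e3 \<le> integral {a - 1..b + 1} ?e3"
      by (intro integral_subset_le int b3) auto
    also have "integral {a..b} ?e2 \<le> e / (3 * D) * (b - a)"
    proof -
      have "\<bar>integral {a..b} ?e2\<bar> \<le> e / (3 * D) * (b - a)"
      proof (rule integral_Icc_bound[OF b2 ab])
        fix x assume x: "x \<in> {a..b}"
        then show "\<bar>\<bar>g (x + y) - g x\<bar>\<bar> \<le> e / (3 * D)"
          using less_imp_le[OF d(2)[of x "x + y"]] abs_le_iff[of y "1/2"] y d(1) by auto
      qed
      then show ?thesis by simp
    qed
    also have "e / (3 * D) * (b - a) \<le> e / 3"
      using e D ab unfolding D_def by (simp add: field_simps)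
    finally show ?thesis using g3 by linarith
  qed (use e in simp)
  then show ?thesis using d(1) by (intro exI[of _ "min (1/2) (d/2)"]) auto
qed

lemma nn_integral_abs_le: 
  "integrable M g \<Longrightarrow> ennreal \<bar>integral\<^sup>L M g\<bar> \<le> (\<integral>\<^sup>+x. ennreal \<bar>g x\<bar> \<partial>M)"
  using integral_norm_bound_ennreal[of M g] by simp

lemma kernel_bump_on: "kernel \<epsilon> k \<Longrightarrow> 0 < \<epsilon> \<Longrightarrow> bump_on (2 * \<epsilon>) k"
  unfolding kernel_def bump_on_def by auto

lemma kernel_nonneg: "kernel \<epsilon> k \<Longrightarrow> 0 \<le> k x"
  unfolding kernel_def by auto

lemma kernel_integral_shift: "kernel \<epsilon> k \<Longrightarrow> (LINT z|lborel. k (z - x)) = 1"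
  using lborel_integral_real_affine[of 1 k "-x"] unfolding kernel_def
  by (auto simp: has_bochner_integral_iff)

lemma kernel_abs_integral: "kernel \<epsilon> k \<Longrightarrow> (LINT z|lborel. \<bar>k z\<bar>) = 1"
  using kernel_integral_shift[of \<epsilon> k 0] kernel_nonneg[of \<epsilon> k] by simp

lemma kernel_nn_integral: 
  assumes "kernel \<epsilon> k" "0 < \<epsilon>" shows "(\<integral>\<^sup>+z. ennreal (k (z - x)) \<partial>lborel) = 1"
proof -
  have "integrable lborel (\<lambda>z. k (z - x))"
    using avg_integrable[OF kernel_bump_on[OF assms] bdd_borel_const[of 1], of x] by simp
  then show ?thesis
    using nn_integral_eq_integral[of lborel "\<lambda>z. k (z - x)"] kernel_nonneg[OF assms(1)]
      kernel_integral_shift[OF assms(1)] by simp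
qed

lemma avg_kernel_minus:
  assumes "kernel \<epsilon> k" "0 < \<epsilon>" "bdd_borel h"
  shows "avg k h x - c = avg k (\<lambda>z. h z - c) x"
proof -
  note b = kernel_bump_on[OF assms(1,2)]
  have "integrable lborel (\<lambda>z. k (z - x) * c)" by (rule avg_integrable[OF b bdd_borel_const])
  then have "avg k (\<lambda>z. h z - c) x = avg k h x - (LINT z|lborel. k (z - x) * c)"
    unfolding avg_def using avg_integrable[OF b assms(3)]
    by (simp add: right_diff_distrib)
  then show ?thesis using kernel_integral_shift[OF assms(1), of x] by simp
qed

lemma avg_kernel_nn_le:
  assumes "kernel \<epsilon> k" "0 < \<epsilon>" "bdd_borel h"
  shows "ennreal \<bar>avg k h x\<bar> \<le> (\<integral>\<^sup>+z. ennreal (k (z - x)) * ennreal \<bar>h z\<bar> \<partial>lborel)"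
  using nn_integral_abs_le[OF avg_integrable[OF kernel_bump_on[OF assms(1,2)] assms(3), of x]]
    kernel_nonneg[OF assms(1)]
  by (simp add: avg_def abs_mult ennreal_mult)

lemma avg_kernel_mono:
  assumes "kernel \<epsilon> k" "0 < \<epsilon>" "bdd_borel g" "bdd_borel h" "\<And>z. g z \<le> h z"
  shows "avg k g x \<le> avg k h x"
  unfolding avg_def
  by (rule integral_mono[OF avg_integrable[OF kernel_bump_on[OF assms(1,2)] assms(3)]
        avg_integrable[OF kernel_bump_on[OF assms(1,2)] assms(4)]
        mult_left_mono[OF assms(5) kernel_nonneg[OF assms(1)]]])

lemma avg_lincomb:
  assumes "bump_on N \<alpha>" "bdd_borel g" "bdd_borel h"
  shows "avg \<alpha> (\<lambda>z. a * g z + b * h z) x = a * avg \<alpha> g x + b * avg \<alpha> h x"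
proof -
  have "avg \<alpha> (\<lambda>z. a * g z + b * h z) x = (LINT z|lborel. a * (\<alpha> (z - x) * g z) + b * (\<alpha> (z - x) * h z))"
    unfolding avg_def by (simp add: algebra_simps)
  also have "\<dots> = a * avg \<alpha> g x + b * avg \<alpha> h x"
    unfolding avg_def using avg_integrable[OF assms(1,2)] avg_integrable[OF assms(1,3)] by simp
  finally show ?thesis .
qed

text \<open>Two Borel representatives of the solution are kept: \<open>w\<close> is jointly measurable, as needed for testing
  on the half-plane, while \<open>v\<close> has the slices that are continuous in time, as needed for statements at a
  fixed time. \<open>C\<close> bounds the solution and \<open>L\<close> is a Lipschitz constant of \<open>f\<close> on \<open>[-C, C]\<close>, the speed of
  propagation.\<close>

locale entropy_evolution =
  fixes f :: "real \<Rightarrow> real" and w v :: "real \<Rightarrow> real \<Rightarrow> real" and C L :: real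
  assumes w_bdd: "bdd_borel (case_prod w)" and w_le: "\<bar>w r z\<bar> \<le> C"
    and v_borel: "0 \<le> t \<Longrightarrow> v t \<in> borel_measurable borel" and v_le: "\<bar>v t z\<bar> \<le> C"
    and w_eq_v: "AE r in lborel. 0 < r \<longrightarrow> (AE z in lborel. w r z = v r z)"
    and v_cont: "0 \<le> t \<Longrightarrow> ((\<lambda>s. integral {-R..R} (\<lambda>z. \<bar>v s z - v t z\<bar>)) \<longlongrightarrow> 0) (at t within {0..})"
    and f_cont: "continuous_on UNIV f" and L_nonneg: "0 \<le> L"
    and f_lip: "\<bar>a\<bar> \<le> C \<Longrightarrow> \<bar>b\<bar> \<le> C \<Longrightarrow> \<bar>f a - f b\<bar> \<le> L * \<bar>a - b\<bar>"
begin

lemma C_nonneg: "0 \<le> C"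
  using w_le[of 0 0] by linarith

lemma v_bdd: "0 \<le> t \<Longrightarrow> bdd_borel (v t)"
  by (rule bdd_borelI[OF v_borel v_le])

definition moll :: "(real \<Rightarrow> real) \<Rightarrow> (real \<Rightarrow> real) \<Rightarrow> real \<Rightarrow> real \<Rightarrow> real" where
  "moll k g \<tau> x = conv k k (\<lambda>r z. g (w r z)) \<tau> x"

text \<open>The Lipschitz bound is restricted to the range \<open>[-C, C]\<close> of the solution,
  since \<open>f\<close> is only locally Lipschitz; continuity on the whole line makes compositions
  Borel.\<close>

definition lipschitz_fun :: "(real \<Rightarrow> real) \<Rightarrow> bool" where
  "lipschitz_fun g \<longleftrightarrow> continuous_on UNIV g \<and>
     (\<exists>G\<ge>0. \<forall>a b. \<bar>a\<bar> \<le> C \<longrightarrow> \<bar>b\<bar> \<le> C \<longrightarrow> \<bar>g a - g b\<bar> \<le> G * \<bar>a - b\<bar>)"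

lemma lipschitz_fun_bdd: 
  assumes "lipschitz_fun g" obtains B where "B \<ge> 0" "\<And>a. \<bar>a\<bar> \<le> C \<Longrightarrow> \<bar>g a\<bar> \<le> B"
proof -
  obtain G where G: "G \<ge> 0" "\<And>a b. \<bar>a\<bar> \<le> C \<Longrightarrow> \<bar>b\<bar> \<le> C \<Longrightarrow> \<bar>g a - g b\<bar> \<le> G * \<bar>a - b\<bar>"
    using assms unfolding lipschitz_fun_def by blast
  have "\<bar>g a\<bar> \<le> \<bar>g 0\<bar> + G * C" if "\<bar>a\<bar> \<le> C" for a
    using G(2)[OF that, of 0] C_nonneg mult_left_mono[OF that G(1)] by auto
  then show thesis using that[of "\<bar>g 0\<bar> + G * C"] G C_nonneg by auto
qed

lemma lipschitz_fun_borel: "lipschitz_fun g \<Longrightarrow> g \<in> borel_measurable borel"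
  unfolding lipschitz_fun_def by (simp add: borel_measurable_continuous_onI)

lemma g_w_bdd: assumes "lipschitz_fun g" shows "bdd_borel (case_prod (\<lambda>r z. g (w r z)))"
proof -
  obtain B where B: "B \<ge> 0" "\<And>a. \<bar>a\<bar> \<le> C \<Longrightarrow> \<bar>g a\<bar> \<le> B" using lipschitz_fun_bdd[OF assms] by blast
  have "(\<lambda>p. g (case_prod w p)) \<in> borel_measurable borel"
    using lipschitz_fun_borel[OF assms] bdd_borelD[OF w_bdd] by measurable
  then show ?thesis by (intro bdd_borelI[of _ B]) (auto simp: split_beta intro!: B w_le)
qed

lemma g_v_bdd: assumes "lipschitz_fun g" "0 \<le> t" shows "bdd_borel (\<lambda>z. g (v t z))"
proof -
  obtain B where B: "B \<ge> 0" "\<And>a. \<bar>a\<bar> \<le> C \<Longrightarrow> \<bar>g a\<bar> \<le> B" using lipschitz_fun_bdd[OF assms(1)] by blast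
  have "(\<lambda>z. g (v t z)) \<in> borel_measurable borel"
    using lipschitz_fun_borel[OF assms(1)] v_borel[OF assms(2)] by measurable
  then show ?thesis by (intro bdd_borelI[of _ B]) (auto intro!: B v_le)
qed

lemma moll_section_bdd:
  assumes "lipschitz_fun g" "kernel \<epsilon> k" "0 < \<epsilon>"
  shows "bdd_borel (moll k g \<tau>)"
proof -
  note b = kernel_bump_on[OF assms(2,3)]
  have eq: "moll k g \<tau> = avg k (\<lambda>z. avg k (\<lambda>r. g (w r z)) \<tau>)"
    unfolding moll_def conv_def by (rule ext, rule avg_swap(1)[OF b b g_w_bdd[OF assms(1)]])
  show ?thesis unfolding eq
    by (rule avg_bdd_borel[OF b avg_param_bdd_borel[OF b bdd_borel_swap[OF g_w_bdd[OF assms(1)]]]])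
qed

text \<open>Split \<open>w r (x + y) - v \<tau> x\<close> at \<open>v \<tau> (x + y)\<close>. One
  part is small by continuity in time, because \<open>w r\<close> is \<open>v r\<close> almost
  everywhere, the other by continuity of translations; each costs \<open>e\<close>, hence
  \<open>2 * e\<close>. Nonnegative extended integrals let Tonelli move the integration in
  \<open>x\<close> inside both averages.\<close>

lemma moll_error:
  assumes g: "lipschitz_fun g" and k: "kernel \<epsilon> k" "0 < \<epsilon>"
    and G: "G \<ge> 0" "\<And>a b. \<bar>a\<bar> \<le> C \<Longrightarrow> \<bar>b\<bar> \<le> C \<Longrightarrow> \<bar>g a - g b\<bar> \<le> G * \<bar>a - b\<bar>"
    and \<tau>: "0 \<le> \<tau>" and e: "0 \<le> e" and \<epsilon>: "2 * \<epsilon> \<le> 1"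
    and space: "\<And>y. \<bar>y\<bar> \<le> 2 * \<epsilon> \<Longrightarrow> integral {-R..R} (\<lambda>x. \<bar>v \<tau> (x + y) - v \<tau> x\<bar>) \<le> e"
    and time: "\<And>r. \<tau> \<le> r \<Longrightarrow> r \<le> \<tau> + 2 * \<epsilon> \<Longrightarrow> integral {-(R+1)..R+1} (\<lambda>x. \<bar>v r x - v \<tau> x\<bar>) \<le> e"
  shows "integral {-R..R} (\<lambda>x. \<bar>moll k g \<tau> x - g (v \<tau> x)\<bar>) \<le> G * (2 * e)"
proof -
  note b = kernel_bump_on[OF k]
  note [measurable] = bump_on_borel[OF b] v_borel[OF \<tau>]
  have [measurable]: "case_prod w \<in> borel_measurable (borel \<Otimes>\<^sub>M borel)"
    using bdd_borelD[OF w_bdd] borel_prod by metis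
  let ?I = "\<lambda>x. indicator {-R..R} x :: ennreal"
  have pw: "ennreal \<bar>moll k g \<tau> x - g (v \<tau> x)\<bar> \<le>
      ennreal G * (\<integral>\<^sup>+r. ennreal (k (r - \<tau>)) * (\<integral>\<^sup>+y. ennreal (k y) * ennreal \<bar>w r (x + y) - v \<tau> x\<bar> \<partial>lborel) \<partial>lborel)" for x
  proof -
    define c where "c = g (v \<tau> x)"
    have gb: "bdd_borel (\<lambda>z. g (w r z))" for r using bdd_borel_section1[OF g_w_bdd[OF g]] .
    have gb2: "bdd_borel (\<lambda>r. avg k (\<lambda>z. g (w r z)) x)" by (rule avg_param_bdd_borel[OF b g_w_bdd[OF g]])
    have "moll k g \<tau> x - c = avg k (\<lambda>r. avg k (\<lambda>z. g (w r z) - c) x) \<tau>"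
      unfolding moll_def conv_def avg_kernel_minus[OF k gb2] by (subst avg_kernel_minus[OF k gb]) (rule refl)
    moreover have "bdd_borel (\<lambda>r. avg k (\<lambda>z. g (w r z) - c) x)"
      using bdd_borel_diff[OF gb2 bdd_borel_const[of c]] by (subst (asm) avg_kernel_minus[OF k gb])
    ultimately have "ennreal \<bar>moll k g \<tau> x - c\<bar> \<le>
        (\<integral>\<^sup>+r. ennreal (k (r - \<tau>)) * ennreal \<bar>avg k (\<lambda>z. g (w r z) - c) x\<bar> \<partial>lborel)"
      using avg_kernel_nn_le[OF k] by simp
    also have "\<dots> \<le> (\<integral>\<^sup>+r. ennreal (k (r - \<tau>)) *
        (\<integral>\<^sup>+z. ennreal (k (z - x)) * ennreal \<bar>g (w r z) - c\<bar> \<partial>lborel) \<partial>lborel)"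
      by (intro nn_integral_mono mult_left_mono avg_kernel_nn_le[OF k] bdd_borel_diff gb bdd_borel_const) auto
    also have "\<dots> \<le> (\<integral>\<^sup>+r. ennreal (k (r - \<tau>)) *
        (\<integral>\<^sup>+z. ennreal (k (z - x)) * ennreal (G * \<bar>w r z - v \<tau> x\<bar>) \<partial>lborel) \<partial>lborel)"
      unfolding c_def by (intro nn_integral_mono mult_left_mono ennreal_leI G w_le v_le) auto
    also have "\<dots> = (\<integral>\<^sup>+r. ennreal (k (r - \<tau>)) *
        (ennreal G * (\<integral>\<^sup>+z. ennreal (k (z - x)) * ennreal \<bar>w r z - v \<tau> x\<bar> \<partial>lborel)) \<partial>lborel)"
      using G(1) by (subst nn_integral_cmult[symmetric]) (auto simp: ennreal_mult mult_ac)
    also have "\<dots> = ennreal G * (\<integral>\<^sup>+r. ennreal (k (r - \<tau>)) *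
         (\<integral>\<^sup>+z. ennreal (k (z - x)) * ennreal \<bar>w r z - v \<tau> x\<bar> \<partial>lborel) \<partial>lborel)"
      by (subst nn_integral_cmult[symmetric]) (auto simp: mult_ac)
    also have "(\<lambda>r. \<integral>\<^sup>+z. ennreal (k (z - x)) * ennreal \<bar>w r z - v \<tau> x\<bar> \<partial>lborel) =
       (\<lambda>r. \<integral>\<^sup>+y. ennreal (k y) * ennreal \<bar>w r (x + y) - v \<tau> x\<bar> \<partial>lborel)"
      by (rule ext, subst nn_integral_real_affine[where c = 1 and t = x]) auto
    finally show ?thesis unfolding c_def .
  qed
  \<comment> \<open>\<open>w r\<close> and \<open>v r\<close> agree for almost every
    \<open>r > 0\<close> only; the factor \<open>k (r - \<tau>)\<close> confines \<open>r\<close> to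
    positive times even if \<open>\<tau> = 0\<close>.\<close>
  have inner: "AE r in lborel. ennreal (k (r - \<tau>)) * (\<integral>\<^sup>+y. ennreal (k y) * (\<integral>\<^sup>+x. ?I x * ennreal \<bar>w r (x + y) - v \<tau> x\<bar> \<partial>lborel) \<partial>lborel)
     \<le> ennreal (k (r - \<tau>)) * ennreal (2 * e)"
    using w_eq_v
  proof (rule AE_mp, intro AE_I2 impI)
    fix r assume r: "0 < r \<longrightarrow> (AE z in lborel. w r z = v r z)"
    show "ennreal (k (r - \<tau>)) * (\<integral>\<^sup>+y. ennreal (k y) * (\<integral>\<^sup>+x. ?I x * ennreal \<bar>w r (x + y) - v \<tau> x\<bar> \<partial>lborel) \<partial>lborel)
     \<le> ennreal (k (r - \<tau>)) * ennreal (2 * e)"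
    proof (cases "r - \<tau> \<in> {\<epsilon>..2 * \<epsilon>}")
      case False
      then have "k (r - \<tau>) = 0" using k unfolding kernel_def by blast
      then show ?thesis by simp
    next
      case True
      then have r0: "0 < r" "\<tau> \<le> r" "r \<le> \<tau> + 2 * \<epsilon>" using k(2) \<tau> by auto
      then have [measurable]: "v r \<in> borel_measurable borel" using v_borel \<tau> by auto
      have vb: "bdd_borel (\<lambda>x. \<bar>v r x - v \<tau> x\<bar>)" "bdd_borel (\<lambda>x. \<bar>v \<tau> (x + y) - v \<tau> x\<bar>)" for y
        by (intro bdd_borel_abs bdd_borel_diff bdd_borel_shift v_bdd; use r0 \<tau> in simp)+
      have *: "ennreal (k y) * (\<integral>\<^sup>+x. ?I x * ennreal \<bar>w r (x + y) - v \<tau> x\<bar> \<partial>lborel) \<le> ennreal (k y) * ennreal (2 * e)" for y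
      proof (cases "y \<in> {\<epsilon>..2 * \<epsilon>}")
        case False
        then have "k y = 0" using k unfolding kernel_def by blast
        then show ?thesis by simp
      next
        case y: True
        have "(\<integral>\<^sup>+x. ?I x * ennreal \<bar>w r (x + y) - v \<tau> x\<bar> \<partial>lborel) \<le>
          (\<integral>\<^sup>+x. (?I x * ennreal \<bar>w r (x + y) - v \<tau> (x + y)\<bar>) + (?I x * ennreal \<bar>v \<tau> (x + y) - v \<tau> x\<bar>) \<partial>lborel)"
          by (intro nn_integral_mono)
            (auto simp: distrib_left[symmetric] ennreal_plus[symmetric] simp del: ennreal_plus intro!: mult_left_mono ennreal_leI)
        also have "\<dots> = (\<integral>\<^sup>+x. ?I x * ennreal \<bar>w r (x + y) - v \<tau> (x + y)\<bar> \<partial>lborel) + (\<integral>\<^sup>+x. ?I x * ennreal \<bar>v \<tau> (x + y) - v \<tau> x\<bar> \<partial>lborel)"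
          by (rule nn_integral_add) measurable
        also have "(\<integral>\<^sup>+x. ?I x * ennreal \<bar>v \<tau> (x + y) - v \<tau> x\<bar> \<partial>lborel) \<le> ennreal e"
        proof -
          have "(\<integral>\<^sup>+x. ?I x * ennreal \<bar>v \<tau> (x + y) - v \<tau> x\<bar> \<partial>lborel) = (\<integral>\<^sup>+x. ennreal (indicator {-R..R} x * \<bar>v \<tau> (x + y) - v \<tau> x\<bar>) \<partial>lborel)"
            by (intro nn_integral_cong) (auto simp: indicator_def)
          then show ?thesis using bdd_borel_nn_integral[OF vb(2)] space[of y] y k(2) by (simp add: ennreal_leI)
        qed
        also have "(\<integral>\<^sup>+x. ?I x * ennreal \<bar>w r (x + y) - v \<tau> (x + y)\<bar> \<partial>lborel) \<le> ennreal e"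
        proof -
          \<comment> \<open>The shift by \<open>y\<close> leaves \<open>[-R, R]\<close> by at most
            \<open>2 * \<epsilon> \<le> 1\<close>, which is why \<open>time\<close> is assumed on
            the larger segment.\<close>
          have "(\<integral>\<^sup>+x. ?I x * ennreal \<bar>w r (x + y) - v \<tau> (x + y)\<bar> \<partial>lborel) \<le>
             (\<integral>\<^sup>+x. indicator {-(R+1)..R+1} (x + y) * ennreal \<bar>w r (x + y) - v \<tau> (x + y)\<bar> \<partial>lborel)"
            using y k(2) \<epsilon> by (intro nn_integral_mono) (auto simp: indicator_def)
          also have "\<dots> = (\<integral>\<^sup>+x. indicator {-(R+1)..R+1} x * ennreal \<bar>w r x - v \<tau> x\<bar> \<partial>lborel)"
            by (subst (2) nn_integral_real_affine[where c = 1 and t = y]) (auto simp: add.commute)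
          also have "\<dots> = (\<integral>\<^sup>+x. ennreal (indicator {-(R+1)..R+1} x * \<bar>v r x - v \<tau> x\<bar>) \<partial>lborel)"
          proof (rule nn_integral_cong_AE)
            have "AE z in lborel. w r z = v r z" using r r0(1) by simp
            then show "AE x in lborel. indicator {-(R+1)..R+1} x * ennreal \<bar>w r x - v \<tau> x\<bar> =
                ennreal (indicator {-(R+1)..R+1} x * \<bar>v r x - v \<tau> x\<bar>)"
              by eventually_elim (simp add: indicator_def)
          qed
          also have "\<dots> \<le> ennreal e"
            using bdd_borel_nn_integral[OF vb(1)] time[OF r0(2,3)] by (simp add: ennreal_leI)
          finally show ?thesis .
        qed
        finally have "(\<integral>\<^sup>+x. ?I x * ennreal \<bar>w r (x + y) - v \<tau> x\<bar> \<partial>lborel) \<le> ennreal e + ennreal e"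
          by (simp add: add_mono)
        then show ?thesis using e by (intro mult_left_mono) (auto simp flip: ennreal_plus)
      qed
      have "(\<integral>\<^sup>+y. ennreal (k y) * (\<integral>\<^sup>+x. ?I x * ennreal \<bar>w r (x + y) - v \<tau> x\<bar> \<partial>lborel) \<partial>lborel) \<le>
        (\<integral>\<^sup>+y. ennreal (k y) * ennreal (2 * e) \<partial>lborel)"
        by (intro nn_integral_mono *)
      also have "\<dots> = ennreal (2 * e)"
        using kernel_nn_integral[OF k, of 0] by (subst nn_integral_multc) auto
      finally show ?thesis by (intro mult_left_mono) auto
    qed
  qed
  have "(\<integral>\<^sup>+x. ennreal (indicator {-R..R} x * \<bar>moll k g \<tau> x - g (v \<tau> x)\<bar>) \<partial>lborel)
     = (\<integral>\<^sup>+x. ?I x * ennreal \<bar>moll k g \<tau> x - g (v \<tau> x)\<bar> \<partial>lborel)"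
    by (intro nn_integral_cong) (auto simp: indicator_def)
  also have "\<dots> \<le> (\<integral>\<^sup>+x. ?I x * (ennreal G * (\<integral>\<^sup>+r. ennreal (k (r - \<tau>)) *
       (\<integral>\<^sup>+y. ennreal (k y) * ennreal \<bar>w r (x + y) - v \<tau> x\<bar> \<partial>lborel) \<partial>lborel)) \<partial>lborel)"
    by (intro nn_integral_mono mult_left_mono pw) auto
  also have "\<dots> = ennreal G * (\<integral>\<^sup>+x. (\<integral>\<^sup>+r. ?I x * (ennreal (k (r - \<tau>)) *
       (\<integral>\<^sup>+y. ennreal (k y) * ennreal \<bar>w r (x + y) - v \<tau> x\<bar> \<partial>lborel)) \<partial>lborel) \<partial>lborel)"
  proof -
    have "(\<integral>\<^sup>+r. ?I x * (ennreal (k (r - \<tau>)) * (\<integral>\<^sup>+y. ennreal (k y) * ennreal \<bar>w r (x + y) - v \<tau> x\<bar> \<partial>lborel)) \<partial>lborel)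
       = ?I x * (\<integral>\<^sup>+r. ennreal (k (r - \<tau>)) * (\<integral>\<^sup>+y. ennreal (k y) * ennreal \<bar>w r (x + y) - v \<tau> x\<bar> \<partial>lborel) \<partial>lborel)" for x
      by (rule nn_integral_cmult) measurable
    then show ?thesis
      by (subst nn_integral_cmult[symmetric], measurable) (simp add: mult.left_commute)
  qed
  also have "(\<integral>\<^sup>+x. (\<integral>\<^sup>+r. ?I x * (ennreal (k (r - \<tau>)) *
       (\<integral>\<^sup>+y. ennreal (k y) * ennreal \<bar>w r (x + y) - v \<tau> x\<bar> \<partial>lborel)) \<partial>lborel) \<partial>lborel)
     = (\<integral>\<^sup>+r. (\<integral>\<^sup>+x. ?I x * (ennreal (k (r - \<tau>)) *
       (\<integral>\<^sup>+y. ennreal (k y) * ennreal \<bar>w r (x + y) - v \<tau> x\<bar> \<partial>lborel)) \<partial>lborel) \<partial>lborel)"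
    by (rule lborel_pair.Fubini') measurable
  also have "\<dots> = (\<integral>\<^sup>+r. ennreal (k (r - \<tau>)) * (\<integral>\<^sup>+x. (\<integral>\<^sup>+y. ?I x * (ennreal (k y) * ennreal \<bar>w r (x + y) - v \<tau> x\<bar>) \<partial>lborel) \<partial>lborel) \<partial>lborel)"
  proof (rule nn_integral_cong)
    fix r
    have "(\<integral>\<^sup>+y. ?I x * (ennreal (k y) * ennreal \<bar>w r (x + y) - v \<tau> x\<bar>) \<partial>lborel) =
        ?I x * (\<integral>\<^sup>+y. ennreal (k y) * ennreal \<bar>w r (x + y) - v \<tau> x\<bar> \<partial>lborel)" for x
      by (rule nn_integral_cmult) measurable
    then show "(\<integral>\<^sup>+x. ?I x * (ennreal (k (r - \<tau>)) * (\<integral>\<^sup>+y. ennreal (k y) * ennreal \<bar>w r (x + y) - v \<tau> x\<bar> \<partial>lborel)) \<partial>lborel) =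
       ennreal (k (r - \<tau>)) * (\<integral>\<^sup>+x. (\<integral>\<^sup>+y. ?I x * (ennreal (k y) * ennreal \<bar>w r (x + y) - v \<tau> x\<bar>) \<partial>lborel) \<partial>lborel)"
      by (subst nn_integral_cmult[symmetric], measurable) (simp add: mult.left_commute)
  qed
  also have "\<dots> = (\<integral>\<^sup>+r. ennreal (k (r - \<tau>)) * (\<integral>\<^sup>+y. (\<integral>\<^sup>+x. ?I x * (ennreal (k y) * ennreal \<bar>w r (x + y) - v \<tau> x\<bar>) \<partial>lborel) \<partial>lborel) \<partial>lborel)"
    by (intro nn_integral_cong arg_cong2[where f = "(*)"] refl lborel_pair.Fubini') measurable
  also have "\<dots> = (\<integral>\<^sup>+r. ennreal (k (r - \<tau>)) * (\<integral>\<^sup>+y. ennreal (k y) * (\<integral>\<^sup>+x. ?I x * ennreal \<bar>w r (x + y) - v \<tau> x\<bar> \<partial>lborel) \<partial>lborel) \<partial>lborel)"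
    by (intro nn_integral_cong arg_cong2[where f = "(*)"] refl, subst nn_integral_cmult[symmetric], measurable)
      (simp add: mult_ac)
  also have "\<dots> \<le> (\<integral>\<^sup>+r. ennreal (k (r - \<tau>)) * ennreal (2 * e) \<partial>lborel)"
    by (rule nn_integral_mono_AE[OF inner])
  also have "\<dots> = ennreal (2 * e)"
    using kernel_nn_integral[OF k] by (subst nn_integral_multc) auto
  finally have "(\<integral>\<^sup>+x. ennreal (indicator {-R..R} x * \<bar>moll k g \<tau> x - g (v \<tau> x)\<bar>) \<partial>lborel) \<le> ennreal (G * (2 * e))"
    using G(1) e by (simp add: mult_left_mono ennreal_mult)
  moreover have "bdd_borel (\<lambda>x. \<bar>moll k g \<tau> x - g (v \<tau> x)\<bar>)"
    by (intro bdd_borel_abs bdd_borel_diff moll_section_bdd[OF g k] g_v_bdd g \<tau>)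
  ultimately show ?thesis using bdd_borel_nn_integral[of "\<lambda>x. \<bar>moll k g \<tau> x - g (v \<tau> x)\<bar>" "-R" R] G(1) e
    by simp
qed

lemma moll_tendsto:
  assumes g: "lipschitz_fun g" and k: "\<And>n. kernel (1 / Suc n) (k n)" and \<tau>: "0 \<le> \<tau>"
  shows "(\<lambda>n. integral {-R..R} (\<lambda>x. \<bar>moll (k n) g \<tau> x - g (v \<tau> x)\<bar>)) \<longlonglongrightarrow> 0"
proof (rule LIMSEQ_I)
  fix e :: real assume "0 < e"
  obtain G where G: "G \<ge> 0" "\<And>a b. \<bar>a\<bar> \<le> C \<Longrightarrow> \<bar>b\<bar> \<le> C \<Longrightarrow> \<bar>g a - g b\<bar> \<le> G * \<bar>a - b\<bar>"
    using g unfolding lipschitz_fun_def by blast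
  \<comment> \<open>The summand 1 avoids a division by 0 when \<open>G = 0\<close>.\<close>
  define e' where "e' = e / (4 * (G + 1))"
  have e': "e' > 0" "G * (2 * e') < e" using \<open>0 < e\<close> G(1) by (auto simp: e'_def field_simps add_pos_nonneg)
  obtain d1 where d1: "d1 > 0" "\<And>y. \<bar>y\<bar> \<le> d1 \<Longrightarrow> integral {-R..R} (\<lambda>x. \<bar>v \<tau> (x + y) - v \<tau> x\<bar>) < e'"
    using translation_continuous_L1[OF v_bdd[OF \<tau>] e'(1), of "-R" R] by blast
  have "\<forall>\<^sub>F s in at \<tau> within {0..}. integral {-(R+1)..R+1} (\<lambda>z. \<bar>v s z - v \<tau> z\<bar>) < e'"
    by (rule order_tendstoD(2)[OF v_cont[OF \<tau>] e'(1)])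
  then obtain d2 where d2: "d2 > 0" "\<And>s. 0 \<le> s \<Longrightarrow> s \<noteq> \<tau> \<Longrightarrow> \<bar>s - \<tau>\<bar> < d2 \<Longrightarrow> integral {-(R+1)..R+1} (\<lambda>z. \<bar>v s z - v \<tau> z\<bar>) < e'"
    unfolding eventually_at dist_real_def by auto
  define d where "d = Min {d1, d2/2, 1}"
  have d: "d > 0" "d \<le> d1" "d \<le> d2 / 2" "d \<le> 1" using d1 d2 unfolding d_def by auto
  obtain N :: nat where N: "2 / d < real N" using reals_Archimedean2 by blast
  show "\<exists>no. \<forall>n\<ge>no. norm (integral {-R..R} (\<lambda>x. \<bar>moll (k n) g \<tau> x - g (v \<tau> x)\<bar>) - 0) < e"
  proof (intro exI[of _ N] allI impI)
    fix n assume "N \<le> n"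
    have pos: "0 < 1 / real (Suc n)" by simp
    have "2 / d < real (Suc n)" using N \<open>N \<le> n\<close> by linarith
    then have small: "2 * (1 / real (Suc n)) \<le> d" using d(1) by (simp add: field_simps)
    have "integral {-R..R} (\<lambda>x. \<bar>moll (k n) g \<tau> x - g (v \<tau> x)\<bar>) \<le> G * (2 * e')"
    proof (rule moll_error[OF g k pos G \<tau>])
      show "integral {-R..R} (\<lambda>x. \<bar>v \<tau> (x + y) - v \<tau> x\<bar>) \<le> e'" if "\<bar>y\<bar> \<le> 2 * (1 / real (Suc n))" for y
        using d1(2)[of y] that small d by linarith
      show "integral {-(R+1)..R+1} (\<lambda>x. \<bar>v r x - v \<tau> x\<bar>) \<le> e'" if "\<tau> \<le> r" "r \<le> \<tau> + 2 * (1 / real (Suc n))" for r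
      \<comment> \<open>The limit in \<open>v_cont\<close> is punctured at \<open>\<tau>\<close>;
        there the integrand is 0.\<close>
      proof (cases "r = \<tau>")
        case False
        then show ?thesis using d2(2)[of r] that small d \<tau> by fastforce
      qed (use e' in simp)
      show "2 * (1 / real (Suc n)) \<le> 1" using small d by linarith
    qed (use e' in auto)
    moreover have "0 \<le> integral {-R..R} (\<lambda>x. \<bar>moll (k n) g \<tau> x - g (v \<tau> x)\<bar>)"
      by (rule integral_nonneg[OF bdd_borel_integrable_on(1)])
        (auto intro!: bdd_borel_abs bdd_borel_diff moll_section_bdd[OF g k pos] g_v_bdd g \<tau>)
    ultimately show "norm (integral {-R..R} (\<lambda>x. \<bar>moll (k n) g \<tau> x - g (v \<tau> x)\<bar>) - 0) < e"
      using e'(2) by simp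
  qed
qed

end

section \<open>Testing with smooth weights and the cone estimate\<close>

lemma continuous_on_section2:
  "continuous_on (S \<times> T) (\<lambda>(\<tau>, x). h \<tau> x) \<Longrightarrow> \<tau> \<in> S \<Longrightarrow> continuous_on T (\<lambda>x. h \<tau> x)"
  by (rule continuous_on_compose2[of "S \<times> T" "\<lambda>(\<tau>, x). h \<tau> x" T "\<lambda>x. (\<tau>, x)", unfolded split]) 
     (auto intro!: continuous_intros)

lemma continuous_on_mult2:
  fixes g h :: "real \<Rightarrow> real \<Rightarrow> real"
  shows "continuous_on S (\<lambda>(\<tau>, x). g \<tau> x) \<Longrightarrow> continuous_on S (\<lambda>(\<tau>, x). h \<tau> x) \<Longrightarrow> 
   continuous_on S (\<lambda>(\<tau>, x). g \<tau> x * h \<tau> x)"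
  unfolding split_beta by (intro continuous_intros)

lemma continuous_on_add2:
  fixes g h :: "real \<Rightarrow> real \<Rightarrow> real"
  shows "continuous_on S (\<lambda>(\<tau>, x). g \<tau> x) \<Longrightarrow> continuous_on S (\<lambda>(\<tau>, x). h \<tau> x) \<Longrightarrow> 
   continuous_on S (\<lambda>(\<tau>, x). g \<tau> x + h \<tau> x)"
  unfolding split_beta by (intro continuous_intros)

lemma continuous_on_diff2:
  fixes g h :: "real \<Rightarrow> real \<Rightarrow> real"
  shows "continuous_on S (\<lambda>(\<tau>, x). g \<tau> x) \<Longrightarrow> continuous_on S (\<lambda>(\<tau>, x). h \<tau> x) \<Longrightarrow> 
   continuous_on S (\<lambda>(\<tau>, x). g \<tau> x - h \<tau> x)"
  unfolding split_beta by (intro continuous_intros)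

lemma continuous_on_integral_param:
  fixes h :: "real \<Rightarrow> real \<Rightarrow> real"
  assumes "continuous_on (S \<times> {a..b}) (\<lambda>(\<tau>, x). h \<tau> x)"
  shows "continuous_on S (\<lambda>\<tau>. integral {a..b} (h \<tau>))"
  using integral_continuous_on_param[of S a b h] assms by simp

text \<open>Green's formula on a rectangle: differentiate \<open>\<integral> A \<psi>\<close> in
  time, bound \<open>At\<close> by \<open>- Bx\<close>, and integrate by parts in \<open>x\<close>,
  where \<open>\<psi>\<close> kills the boundary terms. Since \<open>A\<close> and \<open>B\<close>
  are already differentiable, \<open>\<psi>\<close> may be a mere \<open>C^1\<close> function and
  may depend on the solution.\<close>

lemma divergence_test:
  fixes A At B Bx \<psi> \<psi>t \<psi>x :: "real \<Rightarrow> real \<Rightarrow> real"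
  assumes st: "s \<le> t" and ab: "a \<le> b"
    and At: "\<And>\<tau> x. ((\<lambda>\<tau>. A \<tau> x) has_real_derivative At \<tau> x) (at \<tau>)"
    and Bx: "\<And>\<tau> x. ((\<lambda>x. B \<tau> x) has_real_derivative Bx \<tau> x) (at x)"
    and \<psi>t: "\<And>\<tau> x. \<tau> \<in> {s..t} \<Longrightarrow> x \<in> {a..b} \<Longrightarrow> ((\<lambda>\<tau>. \<psi> \<tau> x) has_real_derivative \<psi>t \<tau> x) (at \<tau> within {s..t})"
    and \<psi>x: "\<And>\<tau> x. \<tau> \<in> {s..t} \<Longrightarrow> x \<in> {a..b} \<Longrightarrow> ((\<lambda>x. \<psi> \<tau> x) has_real_derivative \<psi>x \<tau> x) (at x within {a..b})"
    and c: "continuous_on ({s..t} \<times> {a..b}) (\<lambda>(\<tau>, x). A \<tau> x)" 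
      "continuous_on ({s..t} \<times> {a..b}) (\<lambda>(\<tau>, x). At \<tau> x)" 
      "continuous_on ({s..t} \<times> {a..b}) (\<lambda>(\<tau>, x). B \<tau> x)" 
      "continuous_on ({s..t} \<times> {a..b}) (\<lambda>(\<tau>, x). Bx \<tau> x)" 
      "continuous_on ({s..t} \<times> {a..b}) (\<lambda>(\<tau>, x). \<psi> \<tau> x)" 
      "continuous_on ({s..t} \<times> {a..b}) (\<lambda>(\<tau>, x). \<psi>t \<tau> x)" 
      "continuous_on ({s..t} \<times> {a..b}) (\<lambda>(\<tau>, x). \<psi>x \<tau> x)"
    and ineq: "\<And>\<tau> x. \<tau> \<in> {s..t} \<Longrightarrow> x \<in> {a..b} \<Longrightarrow> At \<tau> x + Bx \<tau> x \<le> 0"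
    and nonneg: "\<And>\<tau> x. \<tau> \<in> {s..t} \<Longrightarrow> x \<in> {a..b} \<Longrightarrow> 0 \<le> \<psi> \<tau> x"
    and bdry: "\<And>\<tau>. \<tau> \<in> {s..t} \<Longrightarrow> \<psi> \<tau> a = 0" "\<And>\<tau>. \<tau> \<in> {s..t} \<Longrightarrow> \<psi> \<tau> b = 0"
  shows "integral {a..b} (\<lambda>x. A t x * \<psi> t x) - integral {a..b} (\<lambda>x. A s x * \<psi> s x) \<le>
     integral {s..t} (\<lambda>\<tau>. integral {a..b} (\<lambda>x. A \<tau> x * \<psi>t \<tau> x + B \<tau> x * \<psi>x \<tau> x))"
proof -
  define J where "J \<tau> = integral {a..b} (\<lambda>x. A \<tau> x * \<psi> \<tau> x)" for \<tau>
  define J' where "J' \<tau> = integral {a..b} (\<lambda>x. At \<tau> x * \<psi> \<tau> x + A \<tau> x * \<psi>t \<tau> x)" for \<tau>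
  define K where "K \<tau> = integral {a..b} (\<lambda>x. A \<tau> x * \<psi>t \<tau> x + B \<tau> x * \<psi>x \<tau> x)" for \<tau>
  note cc = continuous_on_add2 continuous_on_mult2 c
  have cJ': "continuous_on ({s..t} \<times> {a..b}) (\<lambda>(\<tau>, x). At \<tau> x * \<psi> \<tau> x + A \<tau> x * \<psi>t \<tau> x)"
    by (intro cc)
  have cK: "continuous_on ({s..t} \<times> {a..b}) (\<lambda>(\<tau>, x). A \<tau> x * \<psi>t \<tau> x + B \<tau> x * \<psi>x \<tau> x)"
    by (intro cc)
  have dJ: "(J has_real_derivative J' \<tau>) (at \<tau> within {s..t})" if \<tau>: "\<tau> \<in> {s..t}" for \<tau>
  proof -
    have "((\<lambda>\<tau>. integral (cbox a b) (\<lambda>x. A \<tau> x * \<psi> \<tau> x)) has_field_derivative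
        integral (cbox a b) (\<lambda>x. At \<tau> x * \<psi> \<tau> x + A \<tau> x * \<psi>t \<tau> x)) (at \<tau> within {s..t})"
    proof (rule leibniz_rule_field_derivative)
      fix \<tau> x assume *: "\<tau> \<in> {s..t}" "x \<in> cbox a b"
      show "((\<lambda>\<tau>. A \<tau> x * \<psi> \<tau> x) has_real_derivative At \<tau> x * \<psi> \<tau> x + A \<tau> x * \<psi>t \<tau> x) (at \<tau> within {s..t})"
        using DERIV_mult[OF has_field_derivative_at_within[OF At] \<psi>t, of \<tau> x] *
        by (simp add: mult.commute add.commute)
    next
      fix \<tau> assume *: "\<tau> \<in> {s..t}"
      have "continuous_on {a..b} (\<lambda>x. A \<tau> x * \<psi> \<tau> x)"
        by (rule continuous_on_section2[OF _ *, where h = "\<lambda>\<tau> x. A \<tau> x * \<psi> \<tau> x"]) (intro cc)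
      then show "(\<lambda>x. A \<tau> x * \<psi> \<tau> x) integrable_on cbox a b"
        by (simp add: integrable_continuous_real)
    qed (use \<tau> cJ' in auto)
    then show ?thesis unfolding J_def J'_def by simp
  qed
  have "(J' has_integral J t - J s) {s..t}"
    using dJ by (intro fundamental_theorem_of_calculus st) (auto simp: has_real_derivative_iff_has_vector_derivative)
  moreover have "(K has_integral integral {s..t} K) {s..t}"
    unfolding K_def by (intro integrable_integral integrable_continuous_real continuous_on_integral_param cK)
  moreover have "J' \<tau> \<le> K \<tau>" if \<tau>: "\<tau> \<in> {s..t}" for \<tau>
  proof -
    have "((\<lambda>x. B \<tau> x * \<psi> \<tau> x) has_real_derivative Bx \<tau> x * \<psi> \<tau> x + B \<tau> x * \<psi>x \<tau> x) (at x within {a..b})"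
      if "x \<in> {a..b}" for x
      using DERIV_mult[OF has_field_derivative_at_within[OF Bx] \<psi>x[OF \<tau> that], of \<tau>]
      by (simp add: mult.commute add.commute)
    then have I0: "((\<lambda>x. Bx \<tau> x * \<psi> \<tau> x + B \<tau> x * \<psi>x \<tau> x) has_integral B \<tau> b * \<psi> \<tau> b - B \<tau> a * \<psi> \<tau> a) {a..b}"
      by (intro fundamental_theorem_of_calculus ab) (auto simp: has_real_derivative_iff_has_vector_derivative)
    then have I: "((\<lambda>x. Bx \<tau> x * \<psi> \<tau> x + B \<tau> x * \<psi>x \<tau> x) has_integral 0) {a..b}"
      using bdry[OF \<tau>] by simp
    have I1: "((\<lambda>x. At \<tau> x * \<psi> \<tau> x + A \<tau> x * \<psi>t \<tau> x) has_integral J' \<tau>) {a..b}"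
      unfolding J'_def by (intro integrable_integral integrable_continuous_real
         continuous_on_section2[OF cJ' \<tau>])
    have I2: "((\<lambda>x. A \<tau> x * \<psi>t \<tau> x + B \<tau> x * \<psi>x \<tau> x) has_integral K \<tau>) {a..b}"
      unfolding K_def by (intro integrable_integral integrable_continuous_real
         continuous_on_section2[OF cK \<tau>])
    have "J' \<tau> + 0 \<le> K \<tau>"
    proof (rule has_integral_le[OF has_integral_add[OF I1 I] has_integral_add[OF I2 has_integral_0, unfolded add_0_right]])
      fix x assume x: "x \<in> {a..b}"
      have "(At \<tau> x + Bx \<tau> x) * \<psi> \<tau> x \<le> 0"
        using ineq[OF \<tau> x] nonneg[OF \<tau> x] by (simp add: mult_nonpos_nonneg)
      then show "At \<tau> x * \<psi> \<tau> x + A \<tau> x * \<psi>t \<tau> x + (Bx \<tau> x * \<psi> \<tau> x + B \<tau> x * \<psi>x \<tau> x)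
         \<le> A \<tau> x * \<psi>t \<tau> x + B \<tau> x * \<psi>x \<tau> x" by (simp add: algebra_simps)
    qed
    then show ?thesis by simp
  qed
  ultimately have "J t - J s \<le> integral {s..t} K" by (rule has_integral_le)
  then show ?thesis unfolding J_def K_def by simp
qed

section \<open>A one-sided weight\<close>

lemma DERIV_max0_square: "((\<lambda>z. (max 0 z)\<^sup>2) has_real_derivative 2 * max 0 z) (at (z::real))"
proof -
  consider "z < 0" | "z = 0" | "z > 0" by linarith
  then show ?thesis
  proof cases
    case 1
    have "((\<lambda>z. 0) has_real_derivative 0) (at z)" by simp
    then have "((\<lambda>z. (max 0 z)\<^sup>2) has_real_derivative 0) (at z)"
      by (rule has_field_derivative_transform_within_open[where S = "{..<0}"]) (use 1 in \<open>auto simp: max_def\<close>)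
    then show ?thesis using 1 by simp
  next
    case 2
    have "((\<lambda>h. (max 0 h)\<^sup>2 / h) \<longlongrightarrow> 0) (at (0::real))"
    proof (rule Lim_null_comparison)
      show "\<forall>\<^sub>F h::real in at 0. norm ((max 0 h)\<^sup>2 / h) \<le> \<bar>h\<bar>"
        by (intro always_eventually allI) (auto simp: max_def power2_eq_square)
      show "((\<lambda>h::real. \<bar>h\<bar>) \<longlongrightarrow> 0) (at 0)" by (auto intro!: tendsto_eq_intros)
    qed
    then show ?thesis using 2 by (simp add: has_field_derivative_iff)
  next
    case 3
    have "((\<lambda>z. z\<^sup>2) has_real_derivative 2 * z) (at z)" by (auto intro!: derivative_eq_intros)
    then have "((\<lambda>z. (max 0 z)\<^sup>2) has_real_derivative 2 * z) (at z)"
      by (rule has_field_derivative_transform_within_open[where S = "{0<..}"]) (use 3 in \<open>auto simp: max_def\<close>)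
    then show ?thesis using 3 by simp
  qed
qed

text \<open>A \<open>C^1\<close> step from 0 to 1 starting at 0, with slope at most 1. The rational
  form is chosen for its primitive: \<open>z\<^sup>2 / (1 + z\<^sup>2)\<close> integrates to
  \<open>z - arctan z\<close>, which lags behind \<open>z\<close> by at most
  \<open>pi / 2\<close>.\<close>

definition ramp :: "real \<Rightarrow> real" where "ramp z = (max 0 z)\<^sup>2 / (1 + (max 0 z)\<^sup>2)"

definition ramp' :: "real \<Rightarrow> real" where "ramp' z = 2 * max 0 z / (1 + (max 0 z)\<^sup>2)\<^sup>2"

lemma one_plus_square_pos: "1 + (y::real)\<^sup>2 > 0"
  by (simp add: add_pos_nonneg)

lemma one_plus_square_nonzero: "1 + (y::real)\<^sup>2 \<noteq> 0"
  using one_plus_square_pos[of y] by linarith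

lemma ramp_deriv: "(ramp has_real_derivative ramp' z) (at z)"
proof -
  have "((\<lambda>y. y / (1 + y)) has_real_derivative 1 / (1 + y)\<^sup>2) (at y)" if "y \<ge> 0" for y :: real
    using that by (auto intro!: derivative_eq_intros simp: power2_eq_square field_simps)
  from DERIV_chain2[OF this DERIV_max0_square, of z] show ?thesis
    unfolding ramp_def[abs_def] ramp'_def by simp
qed

lemma ramp_bounds: "0 \<le> ramp z" "ramp z \<le> 1" "0 \<le> ramp' z" "z \<le> 0 \<Longrightarrow> ramp z = 0"
  using one_plus_square_pos[of "max 0 z"] by (auto simp: ramp_def ramp'_def field_simps max_def)

lemma ramp_ge_half: "1 \<le> z \<Longrightarrow> 1 / 2 \<le> ramp z"
  using one_plus_square_pos[of z] by (auto simp: ramp_def field_simps max_def)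

lemma ramp_tendsto: "(ramp \<longlongrightarrow> 1) at_top"
proof -
  have "((\<lambda>z::real. 1 - 1 / (1 + z\<^sup>2)) \<longlongrightarrow> 1 - 0) at_top"
    by (intro tendsto_intros tendsto_divide_0[OF tendsto_const] filterlim_at_top_imp_at_infinity
        filterlim_tendsto_add_at_top[OF tendsto_const] filterlim_pow_at_top filterlim_ident) auto
  moreover have "\<forall>\<^sub>F z in at_top. 1 - 1 / (1 + z\<^sup>2) = ramp z"
    using eventually_ge_at_top[of 0]
    by eventually_elim (simp add: ramp_def diff_divide_eq_iff one_plus_square_nonzero)
  ultimately show ?thesis using Lim_transform_eventually by fastforce
qed

lemma ramp_continuous: "continuous_on S ramp" "continuous_on S ramp'"
proof -
  show "continuous_on S ramp"
    using ramp_deriv by (intro DERIV_continuous_on[where D = ramp']) (blast intro: has_field_derivative_at_within)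
  show "continuous_on S ramp'" unfolding ramp'_def[abs_def]
    by (intro continuous_intros) (simp add: one_plus_square_nonzero)
qed

context entropy_evolution
begin

text \<open>The inequality \<open>\<partial>\<^sub>t g(u) + \<partial>\<^sub>x q(u) \<le> 0\<close>, tested with translates of \<open>k \<otimes> k\<close> only. The sign is that of
  the weak formulation, the derivatives falling on the kernel.\<close>

definition entropy_ineq :: "(real \<Rightarrow> real) \<Rightarrow> (real \<Rightarrow> real) \<Rightarrow> bool" where
  "entropy_ineq g q \<longleftrightarrow> (\<forall>\<epsilon> k \<tau> x. 0 < \<epsilon> \<longrightarrow> kernel \<epsilon> k \<longrightarrow> 0 \<le> \<tau> \<longrightarrow>
     0 \<le> conv (deriv k) k (\<lambda>r z. g (w r z)) \<tau> x + conv k (deriv k) (\<lambda>r z. q (w r z)) \<tau> x)"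

definition moll_t :: "(real \<Rightarrow> real) \<Rightarrow> (real \<Rightarrow> real) \<Rightarrow> real \<Rightarrow> real \<Rightarrow> real" where
  "moll_t k g \<tau> x = - conv (deriv k) k (\<lambda>r z. g (w r z)) \<tau> x"

definition moll_x :: "(real \<Rightarrow> real) \<Rightarrow> (real \<Rightarrow> real) \<Rightarrow> real \<Rightarrow> real \<Rightarrow> real" where
  "moll_x k g \<tau> x = - conv k (deriv k) (\<lambda>r z. g (w r z)) \<tau> x"

lemma moll_calculus:
  assumes "lipschitz_fun g" "kernel \<epsilon> k" "0 < \<epsilon>"
  shows "((\<lambda>\<tau>. moll k g \<tau> x) has_real_derivative moll_t k g \<tau> x) (at \<tau>)"
    and "((\<lambda>x. moll k g \<tau> x) has_real_derivative moll_x k g \<tau> x) (at x)"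
    and "continuous_on S (\<lambda>(\<tau>, x). moll k g \<tau> x)"
    and "continuous_on S (\<lambda>(\<tau>, x). moll_t k g \<tau> x)"
    and "continuous_on S (\<lambda>(\<tau>, x). moll_x k g \<tau> x)"
proof -
  note b = kernel_bump_on[OF assms(2,3)] and d = bump_on_deriv[OF kernel_bump_on[OF assms(2,3)]]
    and h = g_w_bdd[OF assms(1)]
  show "((\<lambda>\<tau>. moll k g \<tau> x) has_real_derivative moll_t k g \<tau> x) (at \<tau>)"
    unfolding moll_def moll_t_def by (rule conv_deriv_t[OF b b h])
  show "((\<lambda>x. moll k g \<tau> x) has_real_derivative moll_x k g \<tau> x) (at x)"
    unfolding moll_def moll_x_def by (rule conv_deriv_x[OF b b h])
  show "continuous_on S (\<lambda>(\<tau>, x). moll k g \<tau> x)"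
    unfolding moll_def by (rule conv_continuous[OF b b h])
  show "continuous_on S (\<lambda>(\<tau>, x). moll_t k g \<tau> x)"
    using continuous_on_minus[OF conv_continuous[OF d b h]] unfolding moll_t_def split_beta .
  show "continuous_on S (\<lambda>(\<tau>, x). moll_x k g \<tau> x)"
    using continuous_on_minus[OF conv_continuous[OF b d h]] unfolding moll_x_def split_beta .
qed

lemma moll_entropy:
  "entropy_ineq g q \<Longrightarrow> kernel \<epsilon> k \<Longrightarrow> 0 < \<epsilon> \<Longrightarrow> 0 \<le> \<tau> \<Longrightarrow> moll_t k g \<tau> x + moll_x k q \<tau> x \<le> 0"
  unfolding entropy_ineq_def moll_t_def moll_x_def by (metis (no_types) add.commute add_neg_numeral_simps(3) neg_le_0_iff_le minus_add_distrib)

text \<open>Positivity of the kernel. Together with \<open>moll_lincomb\<close> it carries the speed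
  bound \<open>\<bar>q\<bar> \<le> L * g\<close> over to the mollified pair.\<close>

lemma moll_mono:
  assumes k: "kernel \<epsilon> k" "0 < \<epsilon>" and g: "lipschitz_fun g" and h: "lipschitz_fun h"
    and le: "\<And>a. \<bar>a\<bar> \<le> C \<Longrightarrow> g a \<le> h a"
  shows "moll k g \<tau> x \<le> moll k h \<tau> x"
proof -
  note b = kernel_bump_on[OF k]
  have "avg k (\<lambda>z. g (w r z)) x \<le> avg k (\<lambda>z. h (w r z)) x" for r
    by (rule avg_kernel_mono[OF k bdd_borel_section1[OF g_w_bdd[OF g]] bdd_borel_section1[OF g_w_bdd[OF h]] le[OF w_le]])
  then show ?thesis unfolding moll_def conv_def
    by (rule avg_kernel_mono[OF k avg_param_bdd_borel[OF b g_w_bdd[OF g]] avg_param_bdd_borel[OF b g_w_bdd[OF h]]])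
qed

lemma conv_lincomb:
  assumes "bump_on N \<alpha>" "bump_on N' \<beta>" "lipschitz_fun g" "lipschitz_fun h"
  shows "conv \<alpha> \<beta> (\<lambda>r z. a * g (w r z) + b * h (w r z)) \<tau> x =
     a * conv \<alpha> \<beta> (\<lambda>r z. g (w r z)) \<tau> x + b * conv \<alpha> \<beta> (\<lambda>r z. h (w r z)) \<tau> x"
proof -
  note g = g_w_bdd[OF assms(3)] and h = g_w_bdd[OF assms(4)]
  have "(\<lambda>r. avg \<beta> (\<lambda>z. a * g (w r z) + b * h (w r z)) x) =
      (\<lambda>r. a * avg \<beta> (\<lambda>z. g (w r z)) x + b * avg \<beta> (\<lambda>z. h (w r z)) x)"
    by (rule ext, rule avg_lincomb[OF assms(2) bdd_borel_section1[OF g] bdd_borel_section1[OF h]])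
  then show ?thesis unfolding conv_def
    by (simp add: avg_lincomb[OF assms(1) avg_param_bdd_borel[OF assms(2) g] avg_param_bdd_borel[OF assms(2) h]])
qed

lemma lipschitz_fun_lincomb:
  assumes "lipschitz_fun g" "lipschitz_fun h" shows "lipschitz_fun (\<lambda>y. a * g y + b * h y)"
proof -
  obtain G where G: "G \<ge> 0" "\<And>y z. \<bar>y\<bar> \<le> C \<Longrightarrow> \<bar>z\<bar> \<le> C \<Longrightarrow> \<bar>g y - g z\<bar> \<le> G * \<bar>y - z\<bar>"
    using assms(1) unfolding lipschitz_fun_def by blast
  obtain H where H: "H \<ge> 0" "\<And>y z. \<bar>y\<bar> \<le> C \<Longrightarrow> \<bar>z\<bar> \<le> C \<Longrightarrow> \<bar>h y - h z\<bar> \<le> H * \<bar>y - z\<bar>"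
    using assms(2) unfolding lipschitz_fun_def by blast
  have "\<bar>(a * g y + b * h y) - (a * g z + b * h z)\<bar> \<le> (\<bar>a\<bar> * G + \<bar>b\<bar> * H) * \<bar>y - z\<bar>"
    if "\<bar>y\<bar> \<le> C" "\<bar>z\<bar> \<le> C" for y z
  proof -
    have "\<bar>(a * g y + b * h y) - (a * g z + b * h z)\<bar> = \<bar>a * (g y - g z) + b * (h y - h z)\<bar>"
      by (simp add: algebra_simps)
    also have "\<dots> \<le> \<bar>a\<bar> * \<bar>g y - g z\<bar> + \<bar>b\<bar> * \<bar>h y - h z\<bar>"
      using abs_triangle_ineq[of "a * (g y - g z)" "b * (h y - h z)"] by (simp add: abs_mult)
    also have "\<dots> \<le> \<bar>a\<bar> * (G * \<bar>y - z\<bar>) + \<bar>b\<bar> * (H * \<bar>y - z\<bar>)"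
      by (intro add_mono mult_left_mono G H that) auto
    finally show ?thesis by (simp add: algebra_simps)
  qed
  moreover have "continuous_on UNIV (\<lambda>y. a * g y + b * h y)"
    using assms unfolding lipschitz_fun_def by (intro continuous_intros) auto
  ultimately show ?thesis unfolding lipschitz_fun_def using G H
    by (intro conjI exI[of _ "\<bar>a\<bar> * G + \<bar>b\<bar> * H"]) auto
qed

lemma moll_lincomb:
  assumes "kernel \<epsilon> k" "0 < \<epsilon>" "lipschitz_fun g" "lipschitz_fun h"
  shows "moll k (\<lambda>y. a * g y + b * h y) \<tau> x = a * moll k g \<tau> x + b * moll k h \<tau> x"
    and "moll_t k (\<lambda>y. a * g y + b * h y) \<tau> x = a * moll_t k g \<tau> x + b * moll_t k h \<tau> x"
    and "moll_x k (\<lambda>y. a * g y + b * h y) \<tau> x = a * moll_x k g \<tau> x + b * moll_x k h \<tau> x"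
proof -
  note b = kernel_bump_on[OF assms(1,2)] and d = bump_on_deriv[OF kernel_bump_on[OF assms(1,2)]]
  show "moll k (\<lambda>y. a * g y + b * h y) \<tau> x = a * moll k g \<tau> x + b * moll k h \<tau> x"
    unfolding moll_def by (rule conv_lincomb[OF b b assms(3,4)])
  show "moll_t k (\<lambda>y. a * g y + b * h y) \<tau> x = a * moll_t k g \<tau> x + b * moll_t k h \<tau> x"
    unfolding moll_t_def by (simp add: conv_lincomb[OF d b assms(3,4)])
  show "moll_x k (\<lambda>y. a * g y + b * h y) \<tau> x = a * moll_x k g \<tau> x + b * moll_x k h \<tau> x"
    unfolding moll_x_def by (simp add: conv_lincomb[OF b d assms(3,4)])
qed

lemma moll_bounded:
  assumes "lipschitz_fun g" obtains B where "B \<ge> 0" "\<And>\<epsilon> k \<tau> x. kernel \<epsilon> k \<Longrightarrow> 0 < \<epsilon> \<Longrightarrow> \<bar>moll k g \<tau> x\<bar> \<le> B"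
proof -
  obtain B where B: "B \<ge> 0" "\<And>a. \<bar>a\<bar> \<le> C \<Longrightarrow> \<bar>g a\<bar> \<le> B" using lipschitz_fun_bdd[OF assms] by blast
  have "\<bar>moll k g \<tau> x\<bar> \<le> B" if "kernel \<epsilon> k" "0 < \<epsilon>" for \<epsilon> k \<tau> x
    using conv_bound[OF kernel_bump_on[OF that] kernel_bump_on[OF that] g_w_bdd[OF assms] B(2)[OF w_le]]
    unfolding moll_def kernel_abs_integral[OF that(1)] by simp
  with B(1) show thesis using that by blast
qed

lemma moll_weighted_tendsto:
  assumes g: "lipschitz_fun g" and k: "\<And>n. kernel (1 / Suc n) (k n)" and \<tau>: "0 \<le> \<tau>"
    and \<psi>: "bdd_borel \<psi>"
  shows "(\<lambda>n. integral {a..b} (\<lambda>x. moll (k n) g \<tau> x * \<psi> x)) \<longlonglongrightarrow> integral {a..b} (\<lambda>x. g (v \<tau> x) * \<psi> x)"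
proof -
  obtain H where H: "H \<ge> 0" "\<And>x. \<bar>\<psi> x\<bar> \<le> H" using bdd_borelE[OF \<psi>] by blast
  define R where "R = max \<bar>a\<bar> \<bar>b\<bar>"
  show ?thesis
  proof (rule LIM_zero_cancel, rule Lim_null_comparison)
    show "(\<lambda>n. H * integral {-R..R} (\<lambda>x. \<bar>moll (k n) g \<tau> x - g (v \<tau> x)\<bar>)) \<longlonglongrightarrow> 0"
      using tendsto_mult_right_zero[OF moll_tendsto[OF g k \<tau>]] by simp
    show "\<forall>\<^sub>F n in sequentially. norm (integral {a..b} (\<lambda>x. moll (k n) g \<tau> x * \<psi> x) - integral {a..b} (\<lambda>x. g (v \<tau> x) * \<psi> x)) \<le>
       H * integral {-R..R} (\<lambda>x. \<bar>moll (k n) g \<tau> x - g (v \<tau> x)\<bar>)"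
    proof (intro always_eventually allI)
      fix n
      have bm: "bdd_borel (moll (k n) g \<tau>)" by (rule moll_section_bdd[OF g k]) simp
      note bv = g_v_bdd[OF g \<tau>]
      note bd = bdd_borel_abs[OF bdd_borel_diff[OF bm bv]]
      note i = bdd_borel_integrable_on(1)
      have eq: "integral {a..b} (\<lambda>x. moll (k n) g \<tau> x * \<psi> x) - integral {a..b} (\<lambda>x. g (v \<tau> x) * \<psi> x) =
        integral {a..b} (\<lambda>x. (moll (k n) g \<tau> x - g (v \<tau> x)) * \<psi> x)"
        unfolding left_diff_distrib
        by (rule Henstock_Kurzweil_Integration.integral_diff[symmetric])
           (rule i[OF bdd_borel_mult[OF bm \<psi>]] i[OF bdd_borel_mult[OF bv \<psi>]])+
      have "norm (integral {a..b} (\<lambda>x. (moll (k n) g \<tau> x - g (v \<tau> x)) * \<psi> x)) \<le> integral {a..b} (\<lambda>x. H * \<bar>moll (k n) g \<tau> x - g (v \<tau> x)\<bar>)"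
      proof (rule integral_norm_bound_integral)
        show "(\<lambda>x. (moll (k n) g \<tau> x - g (v \<tau> x)) * \<psi> x) integrable_on {a..b}"
          by (rule i[OF bdd_borel_mult[OF bdd_borel_diff[OF bm bv] \<psi>]])
        show "(\<lambda>x. H * \<bar>moll (k n) g \<tau> x - g (v \<tau> x)\<bar>) integrable_on {a..b}"
          by (rule i[OF bdd_borel_mult[OF bdd_borel_const bd]])
        fix x show "norm ((moll (k n) g \<tau> x - g (v \<tau> x)) * \<psi> x) \<le> H * \<bar>moll (k n) g \<tau> x - g (v \<tau> x)\<bar>"
          unfolding real_norm_def abs_mult mult.commute[of H]
          by (rule mult_left_mono[OF H(2) abs_ge_zero])
      qed
      also have "\<dots> = H * integral {a..b} (\<lambda>x. \<bar>moll (k n) g \<tau> x - g (v \<tau> x)\<bar>)"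
        by (rule Henstock_Kurzweil_Integration.integral_mult_right)
      also have "\<dots> \<le> H * integral {-R..R} (\<lambda>x. \<bar>moll (k n) g \<tau> x - g (v \<tau> x)\<bar>)"
        by (rule mult_left_mono[OF integral_subset_le[OF _ i[OF bd] i[OF bd]] H(1)]) (auto simp: R_def)
      finally show "norm (integral {a..b} (\<lambda>x. moll (k n) g \<tau> x * \<psi> x) - integral {a..b} (\<lambda>x. g (v \<tau> x) * \<psi> x)) \<le>
       H * integral {-R..R} (\<lambda>x. \<bar>moll (k n) g \<tau> x - g (v \<tau> x)\<bar>)" unfolding eq .
    qed
  qed
qed

text \<open>Finite speed of propagation. Both flanks of the weight \<open>\<psi>\<close> move
  inwards with speed \<open>L\<close>, so \<open>\<psi>t = - L * (X + Y)\<close> and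
  \<open>\<psi>x = X - Y\<close> with \<open>X, Y \<ge> 0\<close>, one for each flank; then
  \<open>\<bar>q\<bar> \<le> L * g\<close> gives \<open>g \<psi>t + q \<psi>x \<le> 0\<close>. The
  inequality is obtained for mollified functions and survives the limit because the weights are
  fixed.\<close>

lemma cone_contraction:
  assumes g: "lipschitz_fun g" "lipschitz_fun q" and e: "entropy_ineq g q"
    and q: "\<And>y. \<bar>y\<bar> \<le> C \<Longrightarrow> \<bar>q y\<bar> \<le> L * g y"
    and st: "0 \<le> s" "s \<le> t" and ab: "\<alpha> \<le> \<beta>"
  shows "integral {\<alpha>..\<beta>} (\<lambda>x. g (v t x) * (ramp (x - \<alpha> - L * (t - s)) * ramp (\<beta> - L * (t - s) - x)))
    \<le> integral {\<alpha>..\<beta>} (\<lambda>x. g (v s x) * (ramp (x - \<alpha>) * ramp (\<beta> - x)))"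
proof -
  define \<psi> where "\<psi> \<tau> x = ramp (x - \<alpha> - L * (\<tau> - s)) * ramp (\<beta> - L * (\<tau> - s) - x)" for \<tau> x
  define \<psi>t where "\<psi>t \<tau> x = - L * (ramp' (x - \<alpha> - L * (\<tau> - s)) * ramp (\<beta> - L * (\<tau> - s) - x) +
     ramp (x - \<alpha> - L * (\<tau> - s)) * ramp' (\<beta> - L * (\<tau> - s) - x))" for \<tau> x
  define \<psi>x where "\<psi>x \<tau> x = ramp' (x - \<alpha> - L * (\<tau> - s)) * ramp (\<beta> - L * (\<tau> - s) - x) -
     ramp (x - \<alpha> - L * (\<tau> - s)) * ramp' (\<beta> - L * (\<tau> - s) - x)" for \<tau> x
  have c1: "continuous_on S (\<lambda>p. ramp (h p))" "continuous_on S (\<lambda>p. ramp' (h p))" if "continuous_on S h" 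
    for S and h :: "real \<times> real \<Rightarrow> real"
    by (rule continuous_on_compose2[OF ramp_continuous(1) that subset_UNIV]
         continuous_on_compose2[OF ramp_continuous(2) that subset_UNIV])+
  have cont: "continuous_on S (\<lambda>(\<tau>, x). \<psi> \<tau> x)" "continuous_on S (\<lambda>(\<tau>, x). \<psi>t \<tau> x)" "continuous_on S (\<lambda>(\<tau>, x). \<psi>x \<tau> x)" for S
    unfolding \<psi>_def \<psi>t_def \<psi>x_def split_beta by (intro continuous_intros c1)+
  have dt: "((\<lambda>\<tau>. \<psi> \<tau> x) has_real_derivative \<psi>t \<tau> x) (at \<tau> within S)" for \<tau> x S
  proof -
    have "((\<lambda>\<tau>. ramp (x - \<alpha> - L * (\<tau> - s))) has_real_derivative ramp' (x - \<alpha> - L * (\<tau> - s)) * (- L)) (at \<tau> within S)"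
      "((\<lambda>\<tau>. ramp (\<beta> - L * (\<tau> - s) - x)) has_real_derivative ramp' (\<beta> - L * (\<tau> - s) - x) * (- L)) (at \<tau> within S)"
      by ((rule DERIV_chain2[OF ramp_deriv], (auto intro!: derivative_eq_intros)[1])+)
    from DERIV_mult[OF this] show ?thesis unfolding \<psi>_def \<psi>t_def by (simp add: algebra_simps)
  qed
  have dx: "((\<lambda>x. \<psi> \<tau> x) has_real_derivative \<psi>x \<tau> x) (at x within S)" for \<tau> x S
  proof -
    have "((\<lambda>x. ramp (x - \<alpha> - L * (\<tau> - s))) has_real_derivative ramp' (x - \<alpha> - L * (\<tau> - s)) * 1) (at x within S)"
      "((\<lambda>x. ramp (\<beta> - L * (\<tau> - s) - x)) has_real_derivative ramp' (\<beta> - L * (\<tau> - s) - x) * (- 1)) (at x within S)"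
      by ((rule DERIV_chain2[OF ramp_deriv], (auto intro!: derivative_eq_intros)[1])+)
    from DERIV_mult[OF this] show ?thesis unfolding \<psi>_def \<psi>x_def by (simp add: algebra_simps)
  qed
  have \<psi>01: "0 \<le> \<psi> \<tau> x" "\<psi> \<tau> x \<le> 1" for \<tau> x
    unfolding \<psi>_def using ramp_bounds by (auto intro!: mult_le_one)
  have \<psi>b: "bdd_borel (\<psi> \<tau>)" for \<tau>
  proof (rule bdd_borelI)
    have "continuous_on UNIV (\<psi> \<tau>)" using dx by (intro DERIV_continuous_on)
    then show "\<psi> \<tau> \<in> borel_measurable borel" by (rule borel_measurable_continuous_onI)
    show "\<bar>\<psi> \<tau> z\<bar> \<le> 1" for z using \<psi>01 by simp
  qed
  have key: "integral {\<alpha>..\<beta>} (\<lambda>x. moll k g t x * \<psi> t x) \<le> integral {\<alpha>..\<beta>} (\<lambda>x. moll k g s x * \<psi> s x)"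
    if k: "kernel \<epsilon> k" "0 < \<epsilon>" for \<epsilon> k
  proof -
    have "integral {\<alpha>..\<beta>} (\<lambda>x. moll k g t x * \<psi> t x) - integral {\<alpha>..\<beta>} (\<lambda>x. moll k g s x * \<psi> s x) \<le>
       integral {s..t} (\<lambda>\<tau>. integral {\<alpha>..\<beta>} (\<lambda>x. moll k g \<tau> x * \<psi>t \<tau> x + moll k q \<tau> x * \<psi>x \<tau> x))"
    proof (rule divergence_test[OF st(2) ab moll_calculus(1)[OF g(1) k] moll_calculus(2)[OF g(2) k] dt dx])
      fix \<tau> x assume "\<tau> \<in> {s..t}" 
      then have "0 \<le> \<tau>" using st by auto
      then show "moll_t k g \<tau> x + moll_x k q \<tau> x \<le> 0" by (rule moll_entropy[OF e k])
    next
      fix \<tau> assume "\<tau> \<in> {s..t}"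
      then have "0 \<le> L * (\<tau> - s)" using L_nonneg by auto
      then show "\<psi> \<tau> \<alpha> = 0" "\<psi> \<tau> \<beta> = 0" unfolding \<psi>_def by (simp_all add: ramp_bounds(4))
    qed (intro moll_calculus[OF g(1) k] moll_calculus[OF g(2) k] cont \<psi>01)+
    also have "\<dots> \<le> integral {s..t} (\<lambda>\<tau>. 0)"
    proof (rule integral_le)
      have c: "continuous_on ({s..t} \<times> {\<alpha>..\<beta>}) (\<lambda>(\<tau>, x). moll k g \<tau> x * \<psi>t \<tau> x + moll k q \<tau> x * \<psi>x \<tau> x)"
        by (intro continuous_on_add2 continuous_on_mult2 moll_calculus[OF g(1) k] moll_calculus[OF g(2) k] cont)
      then show "(\<lambda>\<tau>. integral {\<alpha>..\<beta>} (\<lambda>x. moll k g \<tau> x * \<psi>t \<tau> x + moll k q \<tau> x * \<psi>x \<tau> x)) integrable_on {s..t}"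
        by (intro integrable_continuous_real continuous_on_integral_param)
      fix \<tau> assume \<tau>: "\<tau> \<in> {s..t}"
      have "integral {\<alpha>..\<beta>} (\<lambda>x. moll k g \<tau> x * \<psi>t \<tau> x + moll k q \<tau> x * \<psi>x \<tau> x) \<le> integral {\<alpha>..\<beta>} (\<lambda>x. 0)"
      proof (rule integral_le)
        show "(\<lambda>x. moll k g \<tau> x * \<psi>t \<tau> x + moll k q \<tau> x * \<psi>x \<tau> x) integrable_on {\<alpha>..\<beta>}"
          by (intro integrable_continuous_real continuous_on_section2[OF c \<tau>])
        fix x assume "x \<in> {\<alpha>..\<beta>}"
        \<comment> \<open>The summands with coefficient 0 give the shape that
          \<open>moll_lincomb\<close> expects.\<close>
        have L1: "lipschitz_fun (\<lambda>y. L * g y + 0 * g y)" by (rule lipschitz_fun_lincomb[OF g(1) g(1)])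
        have q': "q y \<le> L * g y + 0 * g y" "(-1) * q y + 0 * q y \<le> L * g y + 0 * g y" if "\<bar>y\<bar> \<le> C" for y using q[OF that] by auto
        have "moll k q \<tau> x \<le> L * moll k g \<tau> x"
          using moll_mono[OF k g(2) L1 q'(1), of \<tau> x]
          by (simp only: moll_lincomb(1)[OF k g(1) g(1)]) simp
        moreover have "- moll k q \<tau> x \<le> L * moll k g \<tau> x"
          using moll_mono[OF k lipschitz_fun_lincomb[OF g(2) g(2)] L1 q'(2), of \<tau> x] 
          by (simp only: moll_lincomb(1)[OF k g(1) g(1)] moll_lincomb(1)[OF k g(2) g(2)]) simp
        ultimately have B: "\<bar>moll k q \<tau> x\<bar> \<le> L * moll k g \<tau> x" by simp
        define X where "X = ramp' (x - \<alpha> - L * (\<tau> - s)) * ramp (\<beta> - L * (\<tau> - s) - x)"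
        define Y where "Y = ramp (x - \<alpha> - L * (\<tau> - s)) * ramp' (\<beta> - L * (\<tau> - s) - x)"
        have XY: "0 \<le> X" "0 \<le> Y" unfolding X_def Y_def using ramp_bounds by auto
        have "moll k q \<tau> x * X \<le> L * moll k g \<tau> x * X" "- moll k q \<tau> x * Y \<le> L * moll k g \<tau> x * Y"
          using B XY by (intro mult_right_mono; simp)+
        then show "moll k g \<tau> x * \<psi>t \<tau> x + moll k q \<tau> x * \<psi>x \<tau> x \<le> 0"
          unfolding \<psi>t_def \<psi>x_def X_def[symmetric] Y_def[symmetric] by (simp add: algebra_simps)
      qed (rule integrable_0)
      then show "integral {\<alpha>..\<beta>} (\<lambda>x. moll k g \<tau> x * \<psi>t \<tau> x + moll k q \<tau> x * \<psi>x \<tau> x) \<le> 0" by simp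
    qed (rule integrable_0)
    finally show ?thesis by simp
  qed
  have "\<forall>n::nat. \<exists>k. kernel (1 / Suc n) k" using kernel_exists by simp
  then obtain k :: "nat \<Rightarrow> real \<Rightarrow> real" where k: "\<And>n. kernel (1 / Suc n) (k n)" by metis
  have t0: "0 \<le> t" using st by simp
  have "integral {\<alpha>..\<beta>} (\<lambda>x. g (v t x) * \<psi> t x) \<le> integral {\<alpha>..\<beta>} (\<lambda>x. g (v s x) * \<psi> s x)"
  proof (rule LIMSEQ_le[OF moll_weighted_tendsto[OF g(1) k t0 \<psi>b] moll_weighted_tendsto[OF g(1) k st(1) \<psi>b]], intro exI allI impI)
    fix n show "integral {\<alpha>..\<beta>} (\<lambda>x. moll (k n) g t x * \<psi> t x) \<le> integral {\<alpha>..\<beta>} (\<lambda>x. moll (k n) g s x * \<psi> s x)"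
      by (rule key[OF k]) simp
  qed
  then show ?thesis unfolding \<psi>_def by simp
qed

end

section \<open>The level estimate for smooth data\<close>

text \<open>\<open>C\<^sup>1\<close>, equal to \<open>1\<close> on \<open>[-R, R]\<close> and vanishing at \<open>\<plusminus>2R\<close>; only its values on \<open>[-2R, 2R]\<close> matter.\<close>

definition cutoff :: "real \<Rightarrow> real \<Rightarrow> real" where
  "cutoff R x = 1 - ((max 0 (x - R))\<^sup>2 + (max 0 (- x - R))\<^sup>2) / R\<^sup>2"

text \<open>The derivative of \<open>cutoff\<close> is \<open>slope_left - slope_right\<close>. The
  two flanks are kept apart because different fluxes are small there: that of
  \<open>(u - c)\<^sup>+\<close> far to the left, that of \<open>(c - u)\<^sup>+\<close> far to the
  right.\<close>

definition slope_left :: "real \<Rightarrow> real \<Rightarrow> real" where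
  "slope_left R x = 2 * max 0 (- x - R) / R\<^sup>2"

definition slope_right :: "real \<Rightarrow> real \<Rightarrow> real" where
  "slope_right R x = 2 * max 0 (x - R) / R\<^sup>2"

lemma cutoff_deriv: "(cutoff R has_real_derivative slope_left R x - slope_right R x) (at x)"
proof -
  have "((\<lambda>x. (max 0 (x - R))\<^sup>2) has_real_derivative 2 * max 0 (x - R) * 1) (at x)"
    by (rule DERIV_chain2[OF DERIV_max0_square]) (auto intro!: derivative_eq_intros)
  moreover have "((\<lambda>x. (max 0 (- x - R))\<^sup>2) has_real_derivative 2 * max 0 (- x - R) * (-1)) (at x)"
    by (rule DERIV_chain2[OF DERIV_max0_square]) (auto intro!: derivative_eq_intros)
  ultimately show ?thesis
    unfolding cutoff_def[abs_def] slope_left_def slope_right_def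
    by (rule DERIV_cong[OF DERIV_diff[OF DERIV_const DERIV_cdivide[OF DERIV_add]]])
       (simp add: diff_divide_distrib)
qed

lemma cutoff_props:
  assumes "R > 0"
  shows "\<bar>x\<bar> \<le> R \<Longrightarrow> cutoff R x = 1" "cutoff R (- 2 * R) = 0" "cutoff R (2 * R) = 0"
    "\<bar>x\<bar> \<le> 2 * R \<Longrightarrow> 0 \<le> cutoff R x" "cutoff R x \<le> 1"
    "0 \<le> slope_left R x" "0 \<le> slope_right R x" "- R \<le> x \<Longrightarrow> slope_left R x = 0" "x \<le> R \<Longrightarrow> slope_right R x = 0"
    "- 2 * R \<le> x \<Longrightarrow> slope_left R x \<le> 2 / R" "x \<le> 2 * R \<Longrightarrow> slope_right R x \<le> 2 / R"
proof -
  show "0 \<le> cutoff R x" if x: "\<bar>x\<bar> \<le> 2 * R"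
  proof -
    have "(max 0 (x - R))\<^sup>2 + (max 0 (- x - R))\<^sup>2 \<le> R\<^sup>2"
    proof (cases "x \<le> R")
      case True
      then have "max 0 (x - R) = 0" by simp
      moreover have "(max 0 (- x - R))\<^sup>2 \<le> R\<^sup>2" using x assms by (intro power_mono) auto
      ultimately show ?thesis by simp
    next
      case False
      then have "max 0 (- x - R) = 0" using assms by simp
      moreover have "(max 0 (x - R))\<^sup>2 \<le> R\<^sup>2" using x assms by (intro power_mono) auto
      ultimately show ?thesis by simp
    qed
    then show ?thesis using assms by (simp add: cutoff_def divide_simps)
  qed
  show "cutoff R x \<le> 1" by (simp add: cutoff_def)
  show "slope_left R x \<le> 2 / R" if "- 2 * R \<le> x"
    using that assms by (auto simp: slope_left_def divide_simps power2_eq_square max_def)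
  show "slope_right R x \<le> 2 / R" if "x \<le> 2 * R"
    using that assms by (auto simp: slope_right_def divide_simps power2_eq_square max_def)
qed (use assms in \<open>auto simp: cutoff_def slope_left_def slope_right_def max_def\<close>)

lemma cutoff_continuous:
  "continuous_on S (cutoff R)" "continuous_on S (slope_left R)" "continuous_on S (slope_right R)"
  unfolding cutoff_def[abs_def] slope_left_def[abs_def] slope_right_def[abs_def] divide_inverse
  by (intro continuous_intros)+

definition ramp_int :: "real \<Rightarrow> real" where "ramp_int z = max 0 z - arctan (max 0 z)"

lemma ramp_int_deriv: "(ramp_int has_real_derivative ramp z) (at z)"
proof -
  have d: "((\<lambda>y. y - arctan y) has_real_derivative y\<^sup>2 / (1 + y\<^sup>2)) (at y)" for y :: real
    using one_plus_square_nonzero[of y]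
    by (auto intro!: derivative_eq_intros simp: field_simps)
  consider "z < 0" | "z = 0" | "z > 0" by linarith
  then show ?thesis
  proof cases
    case 1
    have "((\<lambda>z. 0) has_real_derivative 0) (at z)" by simp
    then have "(ramp_int has_real_derivative 0) (at z)"
      by (rule has_field_derivative_transform_within_open[where S = "{..<0}"]) (use 1 in \<open>auto simp: ramp_int_def max_def\<close>)
    then show ?thesis using 1 by (simp add: ramp_def)
  next
    case 2
    have "((\<lambda>h. ramp_int h / h) \<longlongrightarrow> 0) (at 0)"
    proof (rule Lim_null_comparison)
      have "((\<lambda>h::real. (h - arctan h) / h) \<longlongrightarrow> 0) (at 0)"
        using d[of 0] by (simp add: has_field_derivative_iff)
      then show "((\<lambda>h::real. \<bar>(h - arctan h) / h\<bar>) \<longlongrightarrow> 0) (at 0)" by (rule tendsto_rabs_zero)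
      show "\<forall>\<^sub>F h::real in at 0. norm (ramp_int h / h) \<le> \<bar>(h - arctan h) / h\<bar>"
      proof (intro always_eventually allI)
        fix h :: real show "norm (ramp_int h / h) \<le> \<bar>(h - arctan h) / h\<bar>"
        proof (cases "h \<ge> 0")
          case False
          then have "ramp_int h = 0" by (simp add: ramp_int_def)
          then show ?thesis by (simp only: div_0 norm_zero abs_ge_zero)
        qed (simp add: ramp_int_def)
      qed
    qed
    then show ?thesis using 2 by (simp add: has_field_derivative_iff ramp_int_def ramp_def)
  next
    case 3
    have "(ramp_int has_real_derivative z\<^sup>2 / (1 + z\<^sup>2)) (at z)"
      by (rule has_field_derivative_transform_within_open[OF d, where S = "{0<..}"]) (use 3 in \<open>auto simp: ramp_int_def max_def\<close>)
    then show ?thesis using 3 by (simp add: ramp_def)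
  qed
qed

lemma ramp_int_ge: "z - pi / 2 \<le> ramp_int z"
proof (cases "z \<ge> 0")
  case True
  then show ?thesis using arctan_ubound[of z] by (simp add: ramp_int_def)
next
  case False
  then have "z < 0" "ramp_int z = 0" by (auto simp: ramp_int_def max_def)
  then show ?thesis using pi_gt_zero by linarith
qed

lemma ramp'_le_1: "ramp' z \<le> 1"
proof -
  define p where "p = max 0 z"
  have "2 * p \<le> 1 + p\<^sup>2" using zero_le_power2[of "p - 1"] by (simp add: power2_eq_square algebra_simps)
  also have "\<dots> \<le> (1 + p\<^sup>2)\<^sup>2" using one_plus_square_pos[of p] by (simp add: power2_eq_square)
  finally show ?thesis using one_plus_square_pos[of p] by (simp add: ramp'_def p_def[symmetric])
qed

lemma continuous_on_const2:
  assumes "continuous_on T h" shows "continuous_on (S \<times> T) (\<lambda>(\<tau>, x). h x)"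
  unfolding split_beta by (rule continuous_on_compose2[OF assms]) (auto intro!: continuous_intros)

text \<open>Model: \<open>A = \<bar>u - c\<bar>\<close>, \<open>v = u - c\<close>, \<open>B\<close> and \<open>F\<close> are their fluxes, all mollified. Then \<open>(A + v) / 2\<close> and
  \<open>(A - v) / 2\<close> stand for \<open>(u - c)\<^sup>+\<close> and \<open>(c - u)\<^sup>+\<close>. Before mollification \<open>B v = A F\<close>.\<close>

locale potential_strip =
  fixes s t R :: real and A At B Bx v F U :: "real \<Rightarrow> real \<Rightarrow> real"
  assumes st: "s \<le> t" and R: "R > 0"
    and At: "\<And>\<tau> x. ((\<lambda>\<tau>. A \<tau> x) has_real_derivative At \<tau> x) (at \<tau>)"
    and Bx: "\<And>\<tau> x. ((\<lambda>x. B \<tau> x) has_real_derivative Bx \<tau> x) (at x)"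
    and Ut: "\<And>\<tau> x. \<tau> \<in> {s..t} \<Longrightarrow> x \<in> {-2*R..2*R} \<Longrightarrow> ((\<lambda>\<tau>. U \<tau> x) has_real_derivative - F \<tau> x) (at \<tau> within {s..t})"
    and Ux: "\<And>\<tau> x. \<tau> \<in> {s..t} \<Longrightarrow> x \<in> {-2*R..2*R} \<Longrightarrow> ((\<lambda>x. U \<tau> x) has_real_derivative v \<tau> x) (at x within {-2*R..2*R})"
    and cont: "continuous_on ({s..t} \<times> {-2*R..2*R}) (\<lambda>(\<tau>, x). A \<tau> x)" 
      "continuous_on ({s..t} \<times> {-2*R..2*R}) (\<lambda>(\<tau>, x). At \<tau> x)" 
      "continuous_on ({s..t} \<times> {-2*R..2*R}) (\<lambda>(\<tau>, x). B \<tau> x)" 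
      "continuous_on ({s..t} \<times> {-2*R..2*R}) (\<lambda>(\<tau>, x). Bx \<tau> x)" 
      "continuous_on ({s..t} \<times> {-2*R..2*R}) (\<lambda>(\<tau>, x). v \<tau> x)" 
      "continuous_on ({s..t} \<times> {-2*R..2*R}) (\<lambda>(\<tau>, x). F \<tau> x)" 
      "continuous_on ({s..t} \<times> {-2*R..2*R}) (\<lambda>(\<tau>, x). U \<tau> x)"
    and ineq: "\<And>\<tau> x. \<tau> \<in> {s..t} \<Longrightarrow> x \<in> {-2*R..2*R} \<Longrightarrow> At \<tau> x + Bx \<tau> x \<le> 0"
    and v_le_A: "\<And>\<tau> x. \<tau> \<in> {s..t} \<Longrightarrow> x \<in> {-2*R..2*R} \<Longrightarrow> \<bar>v \<tau> x\<bar> \<le> A \<tau> x"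
begin

definition energy :: "real \<Rightarrow> real \<Rightarrow> real" where
  "energy \<tau> y = integral {-2*R..y} (\<lambda>x. (A \<tau> x + v \<tau> x) / 2 * cutoff R x) +
     integral {y..2*R} (\<lambda>x. (A \<tau> x - v \<tau> x) / 2 * cutoff R x)"

lemma sections:
  assumes "\<tau> \<in> {s..t}"
  shows "continuous_on {-2*R..2*R} (A \<tau>)" "continuous_on {-2*R..2*R} (v \<tau>)" "continuous_on {-2*R..2*R} (U \<tau>)"
    "continuous_on {-2*R..2*R} (B \<tau>)" "continuous_on {-2*R..2*R} (F \<tau>)"
  using continuous_on_section2[OF cont(1) assms] continuous_on_section2[OF cont(5) assms]
    continuous_on_section2[OF cont(7) assms] continuous_on_section2[OF cont(3) assms] continuous_on_section2[OF cont(6) assms] by auto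

text \<open>Integration by parts of \<open>v = U\<^sub>x\<close> against the cutoff on both sides of
  \<open>y\<close>, where the cutoff is 1. The position \<open>y\<close> enters through
  \<open>U \<tau> y\<close> alone; the mean of \<open>U\<close> over the two flanks takes the place
  of a normalisation at infinity.\<close>

lemma energy_eq:
  assumes \<tau>: "\<tau> \<in> {s..t}" and y: "\<bar>y\<bar> \<le> R"
  shows "energy \<tau> y = U \<tau> y + integral {-2*R..2*R} (\<lambda>x. A \<tau> x * cutoff R x) / 2
     - integral {-2*R..2*R} (\<lambda>x. U \<tau> x * (slope_left R x + slope_right R x)) / 2"
proof -
  have ab: "-2*R \<le> y" "y \<le> 2*R" using y R by auto
  note secs = sections[OF \<tau>] 
  have sub: "{-2*R..y} \<subseteq> {-2*R..2*R}" "{y..2*R} \<subseteq> {-2*R..2*R}" using ab by auto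
  have contl: "continuous_on {-2*R..y} h" "continuous_on {y..2*R} h" if "continuous_on {-2*R..2*R} h" for h :: "real \<Rightarrow> real"
    using continuous_on_subset[OF that sub(1)] continuous_on_subset[OF that sub(2)] by auto
  let ?\<chi> = "cutoff R" and ?\<sigma> = "\<lambda>x. slope_left R x + slope_right R x"
  let ?v\<chi> = "\<lambda>x. v \<tau> x * ?\<chi> x" and ?A\<chi> = "\<lambda>x. A \<tau> x * ?\<chi> x" and ?U\<sigma> = "\<lambda>x. U \<tau> x * ?\<sigma> x"
  have d: "((\<lambda>x. U \<tau> x * ?\<chi> x) has_real_derivative v \<tau> x * ?\<chi> x + U \<tau> x * (slope_left R x - slope_right R x)) (at x within S)"
    if "x \<in> {-2*R..2*R}" "S \<subseteq> {-2*R..2*R}" for x S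
    using DERIV_mult[OF DERIV_subset[OF Ux[OF \<tau> that(1)] that(2)] has_field_derivative_at_within[OF cutoff_deriv]]
    by (simp add: mult_ac add.commute)
  have cA: "continuous_on {-2*R..2*R} ?A\<chi>" and cv: "continuous_on {-2*R..2*R} ?v\<chi>" 
    and cU: "continuous_on {-2*R..2*R} ?U\<sigma>"
    by (intro continuous_intros secs cutoff_continuous)+
  have hl: "(h has_integral integral {-2*R..y} h) {-2*R..y}" and hr: "(h has_integral integral {y..2*R} h) {y..2*R}"
    if "continuous_on {-2*R..2*R} h" for h :: "real \<Rightarrow> real"
    using contl[OF that] by (auto intro!: integrable_integral integrable_continuous_real)
  have L: "integral {-2*R..y} ?v\<chi> = U \<tau> y - integral {-2*R..y} ?U\<sigma>"
  proof -
    have "((\<lambda>x. v \<tau> x * ?\<chi> x + U \<tau> x * (slope_left R x - slope_right R x)) has_integral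
       U \<tau> y * ?\<chi> y - U \<tau> (-2*R) * ?\<chi> (-2*R)) {-2*R..y}"
      by (rule fundamental_theorem_of_calculus[OF ab(1)])
        (auto simp: has_real_derivative_iff_has_vector_derivative[symmetric] intro!: d, use ab in auto)
    \<comment> \<open>Left of \<open>y \<le> R\<close> the right slope vanishes and the derivative
      of the cutoff is \<open>?\<sigma>\<close>; right of \<open>y\<close> it is
      \<open>- ?\<sigma>\<close>.\<close>
    then have "((\<lambda>x. ?v\<chi> x + ?U\<sigma> x) has_integral U \<tau> y) {-2*R..y}"
      using cutoff_props(1)[OF R y] cutoff_props(2)[OF R] y
      by (auto elim!: has_integral_eq[rotated] simp: cutoff_props(9)[OF R])
    from has_integral_unique[OF this has_integral_add[OF hl[OF cv] hl[OF cU]]] show ?thesis by simp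
  qed
  have Rr: "integral {y..2*R} ?v\<chi> = - U \<tau> y + integral {y..2*R} ?U\<sigma>"
  proof -
    have "((\<lambda>x. v \<tau> x * ?\<chi> x + U \<tau> x * (slope_left R x - slope_right R x)) has_integral
       U \<tau> (2*R) * ?\<chi> (2*R) - U \<tau> y * ?\<chi> y) {y..2*R}"
      by (rule fundamental_theorem_of_calculus[OF ab(2)])
        (auto simp: has_real_derivative_iff_has_vector_derivative[symmetric] intro!: d, use ab in auto)
    then have "((\<lambda>x. ?v\<chi> x - ?U\<sigma> x) has_integral - U \<tau> y) {y..2*R}"
      using cutoff_props(1)[OF R y] cutoff_props(3)[OF R] y
      by (auto elim!: has_integral_eq[rotated] simp: cutoff_props(8)[OF R])
    from has_integral_unique[OF this has_integral_diff[OF hr[OF cv] hr[OF cU]]] show ?thesis by simp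
  qed
  have E1: "integral {-2*R..y} (\<lambda>x. (A \<tau> x + v \<tau> x) / 2 * ?\<chi> x) = (integral {-2*R..y} ?A\<chi> + integral {-2*R..y} ?v\<chi>) / 2"
    using has_integral_divide[OF has_integral_add[OF hl[OF cA] hl[OF cv]], where c = 2]
    by (intro integral_unique) (simp add: algebra_simps add_divide_distrib)
  have E2: "integral {y..2*R} (\<lambda>x. (A \<tau> x - v \<tau> x) / 2 * ?\<chi> x) = (integral {y..2*R} ?A\<chi> - integral {y..2*R} ?v\<chi>) / 2"
    using has_integral_divide[OF has_integral_diff[OF hr[OF cA] hr[OF cv]], where c = 2]
    by (intro integral_unique) (simp add: algebra_simps diff_divide_distrib)
  have comb: "integral {-2*R..y} h + integral {y..2*R} h = integral {-2*R..2*R} h" if "continuous_on {-2*R..2*R} h" for h :: "real \<Rightarrow> real"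
    using that by (intro Henstock_Kurzweil_Integration.integral_combine ab integrable_continuous_real)
  show ?thesis
    unfolding energy_def E1 E2 L Rr comb[OF cA, symmetric] comb[OF cU, symmetric]
    by (simp add: field_simps)
qed

text \<open>\<open>energy_eq\<close> contains the mean of \<open>U\<close> over the flanks, which
  moves in time by \<open>U\<^sub>t = - F\<close>. This change is later combined with the flux
  \<open>B\<close> through the flanks.\<close>

lemma potential_flux:
  "integral {-2*R..2*R} (\<lambda>x. U t x * (slope_left R x + slope_right R x)) -
   integral {-2*R..2*R} (\<lambda>x. U s x * (slope_left R x + slope_right R x)) =
   - integral {s..t} (\<lambda>\<tau>. integral {-2*R..2*R} (\<lambda>x. F \<tau> x * (slope_left R x + slope_right R x)))"
proof -
  let ?\<sigma> = "\<lambda>x. slope_left R x + slope_right R x"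
  define J where "J \<tau> = integral {-2*R..2*R} (\<lambda>x. U \<tau> x * ?\<sigma> x)" for \<tau>
  define J' where "J' \<tau> = integral {-2*R..2*R} (\<lambda>x. - (F \<tau> x * ?\<sigma> x))" for \<tau>
  have c\<sigma>: "continuous_on S ?\<sigma>" for S by (intro continuous_intros cutoff_continuous)
  have "(J has_real_derivative J' \<tau>) (at \<tau> within {s..t})" if \<tau>: "\<tau> \<in> {s..t}" for \<tau>
  proof -
    have "((\<lambda>\<tau>. integral (cbox (-2*R) (2*R)) (\<lambda>x. U \<tau> x * ?\<sigma> x)) has_field_derivative
        integral (cbox (-2*R) (2*R)) (\<lambda>x. - (F \<tau> x * ?\<sigma> x))) (at \<tau> within {s..t})"
    proof (rule leibniz_rule_field_derivative)
      fix \<tau> x assume "\<tau> \<in> {s..t}" "x \<in> cbox (-2*R) (2*R)"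
      then show "((\<lambda>\<tau>. U \<tau> x * ?\<sigma> x) has_real_derivative - (F \<tau> x * ?\<sigma> x)) (at \<tau> within {s..t})"
        using DERIV_cmult_right[OF Ut, of \<tau> x "?\<sigma> x"] by simp
    next
      fix \<tau> assume "\<tau> \<in> {s..t}"
      then show "(\<lambda>x. U \<tau> x * ?\<sigma> x) integrable_on cbox (-2*R) (2*R)"
        using sections(3)[of \<tau>] by (simp, intro integrable_continuous_real continuous_intros cutoff_continuous)
    next
      have "continuous_on ({s..t} \<times> {-2*R..2*R}) (\<lambda>(\<tau>, x). (-1) * (F \<tau> x * ?\<sigma> x))"
        by (rule continuous_on_mult2[OF _ continuous_on_mult2[OF cont(6) continuous_on_const2[OF c\<sigma>]]])
           (simp add: split_beta)
      then show "continuous_on ({s..t} \<times> cbox (-2*R) (2*R)) (\<lambda>(\<tau>, x). - (F \<tau> x * ?\<sigma> x))" by simp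
    qed (use \<tau> in auto)
    then show ?thesis unfolding J_def J'_def by simp
  qed
  then have "(J' has_integral J t - J s) {s..t}"
    by (intro fundamental_theorem_of_calculus st) (auto simp: has_real_derivative_iff_has_vector_derivative)
  then have "J t - J s = integral {s..t} J'" by (simp add: integral_unique)
  also have "\<dots> = - integral {s..t} (\<lambda>\<tau>. integral {-2*R..2*R} (\<lambda>x. F \<tau> x * ?\<sigma> x))"
    unfolding J'_def by simp
  finally show ?thesis unfolding J_def .
qed

text \<open>\<open>\<integral> \<bar>U\<^sub>x\<bar>\<close> over \<open>{U < m}\<close> is at least twice the depth \<open>m - U \<tau> y\<close>; the \<open>pi / 2\<close> is the price of
  replacing the indicator by the smooth \<open>ramp\<close>, whose primitive is \<open>z - arctan z\<close>.\<close>

lemma variation_below: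
  assumes \<tau>: "\<tau> \<in> {s..t}" and \<delta>: "\<delta> > 0" and y: "\<bar>y\<bar> \<le> R"
    and far: "m \<le> U \<tau> (- R)" "m \<le> U \<tau> R"
  shows "2 * (m - U \<tau> y - \<delta> * (pi / 2)) \<le> integral {-2*R..2*R} (\<lambda>x. A \<tau> x * (ramp ((m - U \<tau> x) / \<delta>) * cutoff R x))"
proof -
  define \<Theta> where "\<Theta> x = \<delta> * ramp_int ((m - U \<tau> x) / \<delta>)" for x
  define r where "r x = ramp ((m - U \<tau> x) / \<delta>)" for x
  have d\<Theta>: "(\<Theta> has_real_derivative - (r x * v \<tau> x)) (at x within S)" if "x \<in> {-2*R..2*R}" "S \<subseteq> {-2*R..2*R}" for x S
  proof -
    have "((\<lambda>x. (m - U \<tau> x) / \<delta>) has_real_derivative - v \<tau> x / \<delta>) (at x within S)"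
      using DERIV_cdivide[OF DERIV_diff[OF DERIV_const DERIV_subset[OF Ux[OF \<tau> that(1)] that(2)]], of m \<delta>] by simp
    from DERIV_cmult[OF DERIV_chain2[OF ramp_int_deriv this], of \<delta>] show ?thesis
      using \<delta> unfolding \<Theta>_def[abs_def] r_def by (simp add: mult.commute)
  qed
  have r0: "0 \<le> r x" for x unfolding r_def by (rule ramp_bounds)
  have cr: "continuous_on {-2*R..2*R} r" unfolding r_def[abs_def]
    by (rule continuous_on_compose2[OF ramp_continuous(1) _ subset_UNIV], intro continuous_intros sections[OF \<tau>])
       (use \<delta> in simp)
  have y': "- R \<le> y" "y \<le> R" using y by auto
  have sub: "{-R..y} \<subseteq> {-2*R..2*R}" "{y..R} \<subseteq> {-2*R..2*R}" "{-R..R} \<subseteq> {-2*R..2*R}" using y R by auto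
  have cw: "continuous_on {-2*R..2*R} (\<lambda>x. A \<tau> x * (r x * cutoff R x))"
    by (intro continuous_intros sections[OF \<tau>] cr cutoff_continuous)
  have ci: "(\<lambda>x. A \<tau> x * (r x * cutoff R x)) integrable_on S" if "S = {-R..y} \<or> S = {y..R} \<or> S = {-R..R} \<or> S = {-2*R..2*R}" for S
    using that sub continuous_on_subset[OF cw] by (auto intro!: integrable_continuous_real)
  have \<Theta>far: "\<Theta> (- R) = 0" "\<Theta> R = 0" using far \<delta> by (auto simp: \<Theta>_def ramp_int_def max_def divide_simps)
  have v_le: "\<bar>r x * v \<tau> x\<bar> \<le> A \<tau> x * (r x * cutoff R x)" if "x \<in> {-R..R}" for x
  proof -
    have "cutoff R x = 1" using that by (intro cutoff_props(1)[OF R]) auto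
    moreover have "\<bar>v \<tau> x\<bar> \<le> A \<tau> x" using that sub by (intro v_le_A[OF \<tau>]) auto
    ultimately show ?thesis using r0[of x] by (simp add: abs_mult mult.commute[of "A \<tau> x"] mult_left_mono)
  qed
  have "\<Theta> R - \<Theta> y \<ge> - integral {y..R} (\<lambda>x. A \<tau> x * (r x * cutoff R x))"
  proof -
    have 1: "((\<lambda>x. - (r x * v \<tau> x)) has_integral \<Theta> R - \<Theta> y) {y..R}"
      by (rule fundamental_theorem_of_calculus) (use y sub in \<open>auto simp: has_real_derivative_iff_has_vector_derivative[symmetric] intro!: d\<Theta>\<close>)
    have 2: "((\<lambda>x. - (A \<tau> x * (r x * cutoff R x))) has_integral - integral {y..R} (\<lambda>x. A \<tau> x * (r x * cutoff R x))) {y..R}"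
      by (intro has_integral_neg integrable_integral ci) simp
    show ?thesis
    proof (rule has_integral_le[OF 2 1])
      fix x assume "x \<in> {y..R}"
      then show "- (A \<tau> x * (r x * cutoff R x)) \<le> - (r x * v \<tau> x)" using v_le[of x] y' by auto
    qed
  qed
  moreover have "\<Theta> y - \<Theta> (-R) \<le> integral {-R..y} (\<lambda>x. A \<tau> x * (r x * cutoff R x))"
  proof -
    have 1: "((\<lambda>x. - (r x * v \<tau> x)) has_integral \<Theta> y - \<Theta> (-R)) {-R..y}"
      by (rule fundamental_theorem_of_calculus) (use y sub in \<open>auto simp: has_real_derivative_iff_has_vector_derivative[symmetric] intro!: d\<Theta>\<close>)
    have 2: "((\<lambda>x. (A \<tau> x * (r x * cutoff R x))) has_integral integral {-R..y} (\<lambda>x. A \<tau> x * (r x * cutoff R x))) {-R..y}"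
      by (intro integrable_integral ci) simp
    show ?thesis
    proof (rule has_integral_le[OF 1 2])
      fix x assume "x \<in> {-R..y}"
      then show "- (r x * v \<tau> x) \<le> A \<tau> x * (r x * cutoff R x)" using v_le[of x] y' by auto
    qed
  qed
  moreover have "integral {-R..y} (\<lambda>x. A \<tau> x * (r x * cutoff R x)) + integral {y..R} (\<lambda>x. A \<tau> x * (r x * cutoff R x)) =
      integral {-R..R} (\<lambda>x. A \<tau> x * (r x * cutoff R x))"
    by (rule Henstock_Kurzweil_Integration.integral_combine) (use y ci in auto)
  moreover have "integral {-R..R} (\<lambda>x. A \<tau> x * (r x * cutoff R x)) \<le> integral {-2*R..2*R} (\<lambda>x. A \<tau> x * (r x * cutoff R x))"
  proof (rule integral_subset_le[OF sub(3)])
    show "(\<lambda>x. A \<tau> x * (r x * cutoff R x)) integrable_on {-R..R}"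
      "(\<lambda>x. A \<tau> x * (r x * cutoff R x)) integrable_on {-2*R..2*R}" by (rule ci, simp)+
    show "\<forall>x\<in>{-2*R..2*R}. 0 \<le> A \<tau> x * (r x * cutoff R x)"
    proof
      fix x assume x: "x \<in> {-2*R..2*R}"
      then have "0 \<le> A \<tau> x" "0 \<le> cutoff R x" using v_le_A[OF \<tau> x] cutoff_props(4)[OF R, of x] by auto
      then show "0 \<le> A \<tau> x * (r x * cutoff R x)" using r0 by simp
    qed
  qed
  moreover have "m - U \<tau> y - \<delta> * (pi / 2) \<le> \<Theta> y"
  proof -
    have "\<delta> * ((m - U \<tau> y) / \<delta> - pi / 2) \<le> \<Theta> y"
      unfolding \<Theta>_def using \<delta> by (intro mult_left_mono ramp_int_ge) simp
    moreover have "\<delta> * ((m - U \<tau> y) / \<delta> - pi / 2) = m - U \<tau> y - \<delta> * (pi / 2)"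
      using \<delta> by (simp add: field_simps)
    ultimately show ?thesis by simp
  qed
  moreover define d where "d = m - U \<tau> y - \<delta> * (pi / 2)"
  ultimately have "2 * d \<le> integral {-2*R..2*R} (\<lambda>x. A \<tau> x * (r x * cutoff R x))"
    using \<Theta>far by linarith
  then show ?thesis unfolding r_def d_def .
qed

text \<open>The weight is \<open>(1 - ramp ((m - U) / \<delta>)) * cutoff\<close>. The steepness
  \<open>1 / \<delta>\<close>, halved by the factor 1/2 of \<open>energy_eq\<close>, gives the
  interior error; the smooth step costs \<open>\<delta> * (pi / 2)\<close>. The hypothesis
  \<open>far\<close> is used twice: it makes the first factor 1 on both flanks at all times, and it
  puts \<open>U s\<close> above \<open>m\<close> at the points \<open>-R\<close> and
  \<open>R\<close>, as \<open>variation_below\<close> demands.\<close>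

lemma level_estimate:
  assumes \<delta>: "\<delta> > 0" and y: "\<bar>y\<bar> \<le> R" "\<bar>y'\<bar> \<le> R" and m: "U t y' = m"
    and min: "\<And>x. x \<in> {-2*R..2*R} \<Longrightarrow> m \<le> U t x"
    and far: "\<And>\<tau> x. \<tau> \<in> {s..t} \<Longrightarrow> x \<in> {-2*R..2*R} \<Longrightarrow> R \<le> \<bar>x\<bar> \<Longrightarrow> m \<le> U \<tau> x"
  shows "energy t y' \<le> energy s y + \<delta> * (pi / 2) + integral {s..t} (\<lambda>\<tau>. integral {-2*R..2*R} (\<lambda>x.
     \<bar>B \<tau> x * v \<tau> x - A \<tau> x * F \<tau> x\<bar> / (2 * \<delta>) +
     (\<bar>B \<tau> x + F \<tau> x\<bar> / 2 * slope_left R x + \<bar>B \<tau> x - F \<tau> x\<bar> / 2 * slope_right R x)))"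
proof -
  let ?S = "{s..t} \<times> {-2*R..2*R}"
  define \<rho> where "\<rho> \<tau> x = 1 - ramp ((m - U \<tau> x) / \<delta>)" for \<tau> x
  define \<rho>' where "\<rho>' \<tau> x = ramp' ((m - U \<tau> x) / \<delta>) / \<delta>" for \<tau> x
  define \<psi> where "\<psi> \<tau> x = \<rho> \<tau> x * cutoff R x" for \<tau> x
  define \<psi>t where "\<psi>t \<tau> x = - (\<rho>' \<tau> x * F \<tau> x * cutoff R x)" for \<tau> x
  define \<psi>x where "\<psi>x \<tau> x = \<rho>' \<tau> x * v \<tau> x * cutoff R x + \<rho> \<tau> x * (slope_left R x - slope_right R x)" for \<tau> x
  define k where "k \<tau> x = A \<tau> x * \<psi>t \<tau> x + B \<tau> x * \<psi>x \<tau> x" for \<tau> x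
  define e where "e \<tau> x = \<bar>B \<tau> x * v \<tau> x - A \<tau> x * F \<tau> x\<bar> / (2 * \<delta>) +
     (\<bar>B \<tau> x + F \<tau> x\<bar> / 2 * slope_left R x + \<bar>B \<tau> x - F \<tau> x\<bar> / 2 * slope_right R x)" for \<tau> x
  define F\<sigma> where "F\<sigma> \<tau> x = F \<tau> x * (slope_left R x + slope_right R x)" for \<tau> x
  have cU: "continuous_on ?S (\<lambda>p. (m - U (fst p) (snd p)) / \<delta>)"
    using cont(7) \<delta> unfolding split_beta by (intro continuous_intros) auto
  have c\<rho>: "continuous_on ?S (\<lambda>p. \<rho> (fst p) (snd p))" "continuous_on ?S (\<lambda>p. \<rho>' (fst p) (snd p))"
    unfolding \<rho>_def \<rho>'_def using \<delta>
    by (intro continuous_intros continuous_on_compose2[OF ramp_continuous(1) cU subset_UNIV]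
        continuous_on_compose2[OF ramp_continuous(2) cU subset_UNIV]; simp)+
  have c\<chi>: "continuous_on ?S (\<lambda>p. cutoff R (snd p))" "continuous_on ?S (\<lambda>p. slope_left R (snd p))" 
      "continuous_on ?S (\<lambda>p. slope_right R (snd p))"
    using continuous_on_const2[OF cutoff_continuous(1)] continuous_on_const2[OF cutoff_continuous(2)]
      continuous_on_const2[OF cutoff_continuous(3)] unfolding split_beta by blast+
  note cs = cont[unfolded split_beta] c\<rho> c\<chi>
  have c\<psi>: "continuous_on ?S (\<lambda>(\<tau>, x). \<psi> \<tau> x)" "continuous_on ?S (\<lambda>(\<tau>, x). \<psi>t \<tau> x)" "continuous_on ?S (\<lambda>(\<tau>, x). \<psi>x \<tau> x)"
    unfolding \<psi>_def \<psi>t_def \<psi>x_def split_beta by (intro continuous_intros cs)+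
  have ck: "continuous_on ?S (\<lambda>(\<tau>, x). k \<tau> x)"
    unfolding k_def by (intro continuous_on_add2 continuous_on_mult2 cont c\<psi>)
  have cF: "continuous_on ?S (\<lambda>(\<tau>, x). F\<sigma> \<tau> x)"
    unfolding F\<sigma>_def split_beta by (intro continuous_intros cs)
  have ce: "continuous_on ?S (\<lambda>(\<tau>, x). e \<tau> x)"
    unfolding e_def split_beta using \<delta> by (intro continuous_intros cs) auto
  have d\<rho>: "((\<lambda>x. \<rho> \<tau> x) has_real_derivative \<rho>' \<tau> x * v \<tau> x) (at x within {-2*R..2*R})"
    "((\<lambda>\<tau>. \<rho> \<tau> x) has_real_derivative - (\<rho>' \<tau> x * F \<tau> x)) (at \<tau> within {s..t})"
    if *: "\<tau> \<in> {s..t}" "x \<in> {-2*R..2*R}" for \<tau> x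
  proof -
    have "((\<lambda>x. (m - U \<tau> x) / \<delta>) has_real_derivative - v \<tau> x / \<delta>) (at x within {-2*R..2*R})"
      using DERIV_cdivide[OF DERIV_diff[OF DERIV_const Ux[OF *]], of m \<delta>] by simp
    from DERIV_diff[OF DERIV_const DERIV_chain2[OF ramp_deriv this]]
    show "((\<lambda>x. \<rho> \<tau> x) has_real_derivative \<rho>' \<tau> x * v \<tau> x) (at x within {-2*R..2*R})"
      unfolding \<rho>_def \<rho>'_def by simp
    have "((\<lambda>\<tau>. (m - U \<tau> x) / \<delta>) has_real_derivative F \<tau> x / \<delta>) (at \<tau> within {s..t})"
      using DERIV_cdivide[OF DERIV_diff[OF DERIV_const Ut[OF *]], of m \<delta>] by simp
    from DERIV_diff[OF DERIV_const DERIV_chain2[OF ramp_deriv this]]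
    show "((\<lambda>\<tau>. \<rho> \<tau> x) has_real_derivative - (\<rho>' \<tau> x * F \<tau> x)) (at \<tau> within {s..t})"
      unfolding \<rho>_def \<rho>'_def by simp
  qed
  have \<rho>01: "0 \<le> \<rho> \<tau> x" "\<rho> \<tau> x \<le> 1" for \<tau> x
    unfolding \<rho>_def using ramp_bounds(1,2)[of "(m - U \<tau> x) / \<delta>"] by auto
  have \<rho>'01: "0 \<le> \<rho>' \<tau> x" "\<rho>' \<tau> x \<le> 1 / \<delta>" for \<tau> x
    unfolding \<rho>'_def using ramp_bounds(3) ramp'_le_1 \<delta> by (auto intro!: divide_right_mono)
  have \<rho>1: "\<rho> \<tau> x = 1" if "m \<le> U \<tau> x" for \<tau> x
    using that \<delta> unfolding \<rho>_def by (simp add: ramp_bounds(4) divide_nonpos_pos)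
  have test: "integral {-2*R..2*R} (\<lambda>x. A t x * \<psi> t x) - integral {-2*R..2*R} (\<lambda>x. A s x * \<psi> s x) \<le>
     integral {s..t} (\<lambda>\<tau>. integral {-2*R..2*R} (k \<tau>))"
    unfolding k_def
  proof (rule divergence_test[OF st _ At Bx _ _ cont(1-4) c\<psi> ineq])
    show "((\<lambda>\<tau>. \<psi> \<tau> x) has_real_derivative \<psi>t \<tau> x) (at \<tau> within {s..t})"
      "((\<lambda>x. \<psi> \<tau> x) has_real_derivative \<psi>x \<tau> x) (at x within {-2*R..2*R})"
      if *: "\<tau> \<in> {s..t}" "x \<in> {-2*R..2*R}" for \<tau> x
      using DERIV_cmult_right[OF d\<rho>(2)[OF *], of "cutoff R x"]
        DERIV_mult[OF d\<rho>(1)[OF *] has_field_derivative_at_within[OF cutoff_deriv]]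
      unfolding \<psi>_def \<psi>t_def \<psi>x_def by (simp_all add: mult.commute mult.left_commute)
    show "0 \<le> \<psi> \<tau> x" if "x \<in> {-2*R..2*R}" for \<tau> x
      unfolding \<psi>_def using that by (intro mult_nonneg_nonneg \<rho>01 cutoff_props(4)[OF R]) auto
  qed (use R cutoff_props(2,3)[OF R] in \<open>auto simp: \<psi>_def\<close>)
  \<comment> \<open>The interior part of \<open>k\<close> is a multiple of \<open>B v - A F\<close>; on the support of the slopes \<open>\<rho> = 1\<close> by \<open>far\<close>.\<close>
  have bound: "k \<tau> x + F\<sigma> \<tau> x \<le> 2 * e \<tau> x" if *: "\<tau> \<in> {s..t}" "x \<in> {-2*R..2*R}" for \<tau> x
  proof -
    have \<chi>: "0 \<le> cutoff R x" "cutoff R x \<le> 1" using * cutoff_props(4,5)[OF R, of x] by auto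
    have l: "0 \<le> slope_left R x" "0 \<le> slope_right R x" using cutoff_props[OF R] by auto
    have "\<rho> \<tau> x * (slope_left R x - slope_right R x) = slope_left R x - slope_right R x"
    proof (cases "\<bar>x\<bar> < R")
      case True
      then show ?thesis using cutoff_props(8,9)[OF R, of x] by auto
    next
      case False
      then show ?thesis using \<rho>1[OF far[OF *]] by simp
    qed
    then have keq: "k \<tau> x = \<rho>' \<tau> x * cutoff R x * (B \<tau> x * v \<tau> x - A \<tau> x * F \<tau> x) + B \<tau> x * (slope_left R x - slope_right R x)"
      unfolding k_def \<psi>t_def \<psi>x_def by (simp only:) (simp add: algebra_simps)
    have "\<rho>' \<tau> x * cutoff R x \<le> 1 / \<delta>" using \<rho>'01[of \<tau> x] \<chi> mult_mono[of "\<rho>' \<tau> x" "1/\<delta>" "cutoff R x" 1] \<delta> by simp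
    then have "\<rho>' \<tau> x * cutoff R x * \<bar>B \<tau> x * v \<tau> x - A \<tau> x * F \<tau> x\<bar> \<le> 1 / \<delta> * \<bar>B \<tau> x * v \<tau> x - A \<tau> x * F \<tau> x\<bar>"
      by (rule mult_right_mono) simp
    moreover have "\<rho>' \<tau> x * cutoff R x * (B \<tau> x * v \<tau> x - A \<tau> x * F \<tau> x) \<le> \<rho>' \<tau> x * cutoff R x * \<bar>B \<tau> x * v \<tau> x - A \<tau> x * F \<tau> x\<bar>"
      using \<rho>'01 \<chi> by (intro mult_left_mono) auto
    \<comment> \<open>Adding the term of \<open>potential_flux\<close> sorts the boundary flux by
      sides. For the intended data \<open>B + F\<close> and \<open>B - F\<close> are twice the
      fluxes of \<open>(u - c)\<^sup>+\<close> and \<open>(c - u)\<^sup>+\<close>.\<close>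
    moreover have "B \<tau> x * (slope_left R x - slope_right R x) + F\<sigma> \<tau> x = 
       (B \<tau> x + F \<tau> x) * slope_left R x - (B \<tau> x - F \<tau> x) * slope_right R x"
      unfolding F\<sigma>_def by (simp add: algebra_simps)
    moreover have "(B \<tau> x + F \<tau> x) * slope_left R x \<le> \<bar>B \<tau> x + F \<tau> x\<bar> * slope_left R x" 
      "- ((B \<tau> x - F \<tau> x) * slope_right R x) \<le> \<bar>B \<tau> x - F \<tau> x\<bar> * slope_right R x"
      using l abs_ge_minus_self[of "(B \<tau> x - F \<tau> x) * slope_right R x"] 
      by (auto intro: mult_right_mono simp: abs_mult)
    moreover have "2 * e \<tau> x = 1 / \<delta> * \<bar>B \<tau> x * v \<tau> x - A \<tau> x * F \<tau> x\<bar> +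
      (\<bar>B \<tau> x + F \<tau> x\<bar> * slope_left R x + \<bar>B \<tau> x - F \<tau> x\<bar> * slope_right R x)"
      unfolding e_def by simp
    ultimately show ?thesis unfolding keq by linarith
  qed
  have "integral {s..t} (\<lambda>\<tau>. integral {-2*R..2*R} (k \<tau>)) + integral {s..t} (\<lambda>\<tau>. integral {-2*R..2*R} (F\<sigma> \<tau>))
    \<le> 2 * integral {s..t} (\<lambda>\<tau>. integral {-2*R..2*R} (e \<tau>))"
  proof -
    have i: "((\<lambda>\<tau>. integral {-2*R..2*R} (h \<tau>)) has_integral integral {s..t} (\<lambda>\<tau>. integral {-2*R..2*R} (h \<tau>))) {s..t}"
      "\<And>\<tau>. \<tau> \<in> {s..t} \<Longrightarrow> (h \<tau> has_integral integral {-2*R..2*R} (h \<tau>)) {-2*R..2*R}"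
      if "continuous_on ?S (\<lambda>(\<tau>, x). h \<tau> x)" for h :: "real \<Rightarrow> real \<Rightarrow> real"
      using that by (auto intro!: integrable_integral integrable_continuous_real continuous_on_integral_param continuous_on_section2[of "{s..t}"])
    show ?thesis
    proof (rule has_integral_le[OF has_integral_add[OF i(1)[OF ck] i(1)[OF cF]] has_integral_mult_right[OF i(1)[OF ce]]])
      fix \<tau> assume \<tau>: "\<tau> \<in> {s..t}"
      show "integral {-2*R..2*R} (k \<tau>) + integral {-2*R..2*R} (F\<sigma> \<tau>) \<le> 2 * integral {-2*R..2*R} (e \<tau>)"
        by (rule has_integral_le[OF has_integral_add[OF i(2)[OF ck \<tau>] i(2)[OF cF \<tau>]] has_integral_mult_right[OF i(2)[OF ce \<tau>]]])
           (rule bound[OF \<tau>])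
    qed
  qed
  moreover have "integral {-2*R..2*R} (\<lambda>x. A t x * \<psi> t x) = integral {-2*R..2*R} (\<lambda>x. A t x * cutoff R x)"
    by (rule integral_cong) (simp add: \<psi>_def \<rho>1[OF min])
  moreover have "integral {-2*R..2*R} (\<lambda>x. A s x * \<psi> s x) = integral {-2*R..2*R} (\<lambda>x. A s x * cutoff R x)
     - integral {-2*R..2*R} (\<lambda>x. A s x * (ramp ((m - U s x) / \<delta>) * cutoff R x))"
  proof -
    have s: "s \<in> {s..t}" using st by simp
    have r: "continuous_on {-2*R..2*R} (\<lambda>x. ramp ((m - U s x) / \<delta>))"
      by (rule continuous_on_compose2[OF ramp_continuous(1) _ subset_UNIV], intro continuous_intros sections[OF s])
       (use \<delta> in simp)
    have "(\<lambda>x. A s x * cutoff R x) integrable_on {-2*R..2*R}"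
      "(\<lambda>x. A s x * (ramp ((m - U s x) / \<delta>) * cutoff R x)) integrable_on {-2*R..2*R}"
      by (intro integrable_continuous_real continuous_intros sections[OF s] cutoff_continuous r)+
    from Henstock_Kurzweil_Integration.integral_diff[OF this] show ?thesis
      unfolding \<psi>_def \<rho>_def by (simp add: left_diff_distrib right_diff_distrib)
  qed
  moreover have "2 * (m - U s y - \<delta> * (pi / 2)) \<le> integral {-2*R..2*R} (\<lambda>x. A s x * (ramp ((m - U s x) / \<delta>) * cutoff R x))"
    by (rule variation_below[OF _ \<delta> y(1)]) (use far[of s "-R"] far[of s R] R st in auto)
  moreover note test potential_flux
  \<comment> \<open>By \<open>energy_eq\<close> the difference of the energies contains
    \<open>m - U s y\<close>; half of the mass missing at time \<open>s\<close> cancels it up to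
    \<open>\<delta> * (pi / 2)\<close>.\<close>
  ultimately show ?thesis
    using energy_eq[OF _ y(2), of t] energy_eq[OF _ y(1), of s] st m 
    unfolding e_def[symmetric] F\<sigma>_def[symmetric] by simp
qed

end

section \<open>The level estimate for an entropy solution\<close>

text \<open>Outside \<open>[-2R, 2R]\<close> the slopes and the cutoff are unbounded; set to 0 there
  they become globally bounded Borel functions with the same integrals over subsets of that
  segment.\<close>

definition slope_left_ext :: "real \<Rightarrow> real \<Rightarrow> real" where
  "slope_left_ext R x = (if \<bar>x\<bar> \<le> 2 * R then slope_left R x else 0)"

definition slope_right_ext :: "real \<Rightarrow> real \<Rightarrow> real" where
  "slope_right_ext R x = (if \<bar>x\<bar> \<le> 2 * R then slope_right R x else 0)"

definition cutoff_ext :: "real \<Rightarrow> real \<Rightarrow> real" where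
  "cutoff_ext R x = (if \<bar>x\<bar> \<le> 2 * R then cutoff R x else 0)"

lemma ext_bdd_borel:
  assumes "R > 0"
  shows "bdd_borel (slope_left_ext R)" "bdd_borel (slope_right_ext R)" "bdd_borel (cutoff_ext R)"
proof -
  have [measurable]: "cutoff R \<in> borel_measurable borel" "slope_left R \<in> borel_measurable borel" "slope_right R \<in> borel_measurable borel"
    by (intro borel_measurable_continuous_onI cutoff_continuous)+
  have b: "\<bar>slope_left_ext R x\<bar> \<le> 2 / R" "\<bar>slope_right_ext R x\<bar> \<le> 2 / R" "\<bar>cutoff_ext R x\<bar> \<le> 1" for x
    using cutoff_props(4-7,10,11)[OF assms, of x] assms by (auto simp: slope_left_ext_def slope_right_ext_def cutoff_ext_def)
  have m: "slope_left_ext R \<in> borel_measurable borel" "slope_right_ext R \<in> borel_measurable borel" "cutoff_ext R \<in> borel_measurable borel"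
    unfolding slope_left_ext_def[abs_def] slope_right_ext_def[abs_def] cutoff_ext_def[abs_def] by measurable
  show "bdd_borel (slope_left_ext R)" "bdd_borel (slope_right_ext R)" "bdd_borel (cutoff_ext R)"
    by (rule bdd_borelI[OF m(1) b(1)] bdd_borelI[OF m(2) b(2)] bdd_borelI[OF m(3) b(3)])+
qed

text \<open>Kruzhkov's entropies, split into their one-sided halves. The linear entropies of both
  signs together say that the conservation law holds with equality, which is what makes the
  potential exist.\<close>

locale entropy_solution = entropy_evolution +
  assumes ent_pos: "\<bar>c\<bar> \<le> C \<Longrightarrow> entropy_ineq (\<lambda>y. max 0 (y - c)) (\<lambda>y. f (max c y) - f c)"
    and ent_neg: "\<bar>c\<bar> \<le> C \<Longrightarrow> entropy_ineq (\<lambda>y. max 0 (c - y)) (\<lambda>y. f c - f (min c y))"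
    and conservation: "\<bar>c\<bar> \<le> C \<Longrightarrow> entropy_ineq (\<lambda>y. y - c) (\<lambda>y. f y - f c)"
      "\<bar>c\<bar> \<le> C \<Longrightarrow> entropy_ineq (\<lambda>y. c - y) (\<lambda>y. f c - f y)"
begin

definition "pos c y = max 0 (y - c)"
definition "neg c y = max 0 (c - (y::real))"
definition "fpos c y = f (max c y) - f c"
definition "fneg c y = f c - f (min c y)"

lemma lipschitz_levels:
  assumes c: "\<bar>c\<bar> \<le> C"
  shows "lipschitz_fun (pos c)" "lipschitz_fun (neg c)" "lipschitz_fun (fpos c)" "lipschitz_fun (fneg c)"
proof -
  have cf: "continuous_on UNIV (\<lambda>y. f (h y))" if "continuous_on UNIV h" for h :: "real \<Rightarrow> real"
    by (rule continuous_on_compose2[OF f_cont that subset_UNIV])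
  show "lipschitz_fun (pos c)" "lipschitz_fun (neg c)"
    unfolding lipschitz_fun_def pos_def neg_def
    by (intro conjI exI[of _ 1] continuous_intros; auto)+
  have mx: "\<bar>max c a\<bar> \<le> C" "\<bar>min c a\<bar> \<le> C" if "\<bar>a\<bar> \<le> C" for a using c that by auto
  have "\<bar>f (max c a) - f (max c b)\<bar> \<le> L * \<bar>a - b\<bar>" "\<bar>f (min c a) - f (min c b)\<bar> \<le> L * \<bar>a - b\<bar>"
    if "\<bar>a\<bar> \<le> C" "\<bar>b\<bar> \<le> C" for a b
  proof -
    have 1: "L * \<bar>max c a - max c b\<bar> \<le> L * \<bar>a - b\<bar>" "L * \<bar>min c a - min c b\<bar> \<le> L * \<bar>a - b\<bar>"
      using L_nonneg by (intro mult_left_mono; auto)+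
    show "\<bar>f (max c a) - f (max c b)\<bar> \<le> L * \<bar>a - b\<bar>" "\<bar>f (min c a) - f (min c b)\<bar> \<le> L * \<bar>a - b\<bar>"
      using order_trans[OF f_lip[OF mx(1)[OF that(1)] mx(1)[OF that(2)]] 1(1)]
        order_trans[OF f_lip[OF mx(2)[OF that(1)] mx(2)[OF that(2)]] 1(2)] by auto
  qed
  then show "lipschitz_fun (fpos c)" "lipschitz_fun (fneg c)"
    unfolding lipschitz_fun_def fpos_def fneg_def using L_nonneg
    by (auto intro!: continuous_intros cf exI[of _ L] simp: abs_minus_commute)
qed

text \<open>The two vanishing products are the cancellation before mollification: for sums
  \<open>A\<close>, \<open>B\<close> and differences \<open>v\<close>, \<open>F\<close> of the
  one-sided pairs, \<open>B v - A F = 2 (fneg pos - fpos neg)\<close>.\<close>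

lemma level_facts:
  "pos c y - neg c y = y - c" "fpos c y - fneg c y = f y - f c" "0 \<le> pos c y" "0 \<le> neg c y"
  "fneg c y * pos c y = 0" "fpos c y * neg c y = 0"
  by (auto simp: pos_def neg_def fpos_def fneg_def max_def min_def)

lemma flux_le:
  assumes "\<bar>c\<bar> \<le> C" "\<bar>y\<bar> \<le> C"
  shows "\<bar>fpos c y\<bar> \<le> L * pos c y" "\<bar>fneg c y\<bar> \<le> L * neg c y"
  using f_lip[OF assms(2,1)] f_lip[OF assms(1,2)] by (auto simp: pos_def neg_def fpos_def fneg_def max_def min_def)

lemma moll_conservation:
  assumes c: "\<bar>c\<bar> \<le> C" and k: "kernel \<epsilon> k" "0 < \<epsilon>" and \<tau>: "0 \<le> \<tau>"
  shows "(moll_t k (pos c) \<tau> x - moll_t k (neg c) \<tau> x) + (moll_x k (fpos c) \<tau> x - moll_x k (fneg c) \<tau> x) = 0"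
proof -
  note l = lipschitz_levels[OF c]
  have e: "(\<lambda>y. y - c) = (\<lambda>y. 1 * pos c y + (-1) * neg c y)" "(\<lambda>y. f y - f c) = (\<lambda>y. 1 * fpos c y + (-1) * fneg c y)"
    "(\<lambda>y. c - y) = (\<lambda>y. (-1) * pos c y + 1 * neg c y)" "(\<lambda>y. f c - f y) = (\<lambda>y. (-1) * fpos c y + 1 * fneg c y)"
    by (auto simp: fun_eq_iff pos_def neg_def fpos_def fneg_def max_def min_def)
  have "1 * moll_t k (pos c) \<tau> x + (-1) * moll_t k (neg c) \<tau> x + (1 * moll_x k (fpos c) \<tau> x + (-1) * moll_x k (fneg c) \<tau> x) \<le> 0"
    using moll_entropy[OF conservation(1)[OF c] k \<tau>, of x] unfolding e
    by (simp only: moll_lincomb[OF k l(1,2)] moll_lincomb[OF k l(3,4)])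
  moreover have "(-1) * moll_t k (pos c) \<tau> x + 1 * moll_t k (neg c) \<tau> x + ((-1) * moll_x k (fpos c) \<tau> x + 1 * moll_x k (fneg c) \<tau> x) \<le> 0"
    using moll_entropy[OF conservation(2)[OF c] k \<tau>, of x] unfolding e
    by (simp only: moll_lincomb[OF k l(1,2)] moll_lincomb[OF k l(3,4)])
  ultimately show ?thesis by simp
qed

text \<open>The term at \<open>x = a\<close> is chosen so that \<open>\<partial>\<^sub>\<tau>\<close> of the potential is minus the flux at \<open>x\<close>, without a
  contribution of the left end point.\<close>

definition potential :: "(real \<Rightarrow> real) \<Rightarrow> real \<Rightarrow> real \<Rightarrow> real \<Rightarrow> real \<Rightarrow> real \<Rightarrow> real" where
  "potential k c s a \<tau> x = integral {a..x} (\<lambda>z. moll k (pos c) \<tau> z - moll k (neg c) \<tau> z) -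
     integral {s..\<tau>} (\<lambda>r. moll k (fpos c) r a - moll k (fneg c) r a)"

lemma moll_nonneg:
  assumes "kernel \<epsilon> k" "\<And>y. 0 \<le> g y" shows "0 \<le> moll k g \<tau> x"
  unfolding moll_def conv_def avg_def
  by (intro Bochner_Integration.integral_nonneg mult_nonneg_nonneg kernel_nonneg[OF assms(1)] assms(2))

lemma moll_continuous_x: "lipschitz_fun g \<Longrightarrow> kernel \<epsilon> k \<Longrightarrow> 0 < \<epsilon> \<Longrightarrow> continuous_on S (\<lambda>x. moll k g \<tau> x)"
  by (rule DERIV_continuous_on[OF has_field_derivative_at_within[OF moll_calculus(2)]])

lemma moll_continuous_t: "lipschitz_fun g \<Longrightarrow> kernel \<epsilon> k \<Longrightarrow> 0 < \<epsilon> \<Longrightarrow> continuous_on S (\<lambda>\<tau>. moll k g \<tau> x)"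
  by (rule DERIV_continuous_on[OF has_field_derivative_at_within[OF moll_calculus(1)]])

lemma potential_deriv:
  assumes c: "\<bar>c\<bar> \<le> C" and k: "kernel \<epsilon> k" "0 < \<epsilon>" and s: "0 \<le> s"
    and \<tau>: "\<tau> \<in> {s..t}" and x: "x \<in> {a..b}"
  shows "((\<lambda>x. potential k c s a \<tau> x) has_real_derivative moll k (pos c) \<tau> x - moll k (neg c) \<tau> x) (at x within {a..b})"
    and "((\<lambda>\<tau>. potential k c s a \<tau> x) has_real_derivative - (moll k (fpos c) \<tau> x - moll k (fneg c) \<tau> x)) (at \<tau> within {s..t})"
proof -
  note l = lipschitz_levels[OF c]
  let ?v = "\<lambda>\<tau> x. moll k (pos c) \<tau> x - moll k (neg c) \<tau> x" and ?F = "\<lambda>\<tau> x. moll k (fpos c) \<tau> x - moll k (fneg c) \<tau> x"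
  have "((\<lambda>x. integral {a..x} (?v \<tau>)) has_real_derivative ?v \<tau> x) (at x within {a..b})"
    by (rule integral_has_real_derivative[OF _ x]) (intro continuous_intros moll_continuous_x[OF _ k] l)
  from DERIV_diff[OF this DERIV_const] show "((\<lambda>x. potential k c s a \<tau> x) has_real_derivative ?v \<tau> x) (at x within {a..b})"
    unfolding potential_def by simp
  have 1: "((\<lambda>\<tau>. integral {s..\<tau>} (\<lambda>r. ?F r a)) has_real_derivative ?F \<tau> a) (at \<tau> within {s..t})"
    by (rule integral_has_real_derivative[OF _ \<tau>]) (intro continuous_intros moll_continuous_t[OF _ k] l)
  let ?vt = "\<lambda>\<tau> x. moll_t k (pos c) \<tau> x - moll_t k (neg c) \<tau> x" and ?Fx = "\<lambda>\<tau> x. moll_x k (fpos c) \<tau> x - moll_x k (fneg c) \<tau> x"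
  have 2: "((\<lambda>\<tau>. integral (cbox a x) (?v \<tau>)) has_field_derivative integral (cbox a x) (?vt \<tau>)) (at \<tau> within {s..t})"
  proof (rule leibniz_rule_field_derivative)
    fix \<tau> z show "((\<lambda>\<tau>. ?v \<tau> z) has_real_derivative ?vt \<tau> z) (at \<tau> within {s..t})"
      by (intro DERIV_diff has_field_derivative_at_within[OF moll_calculus(1)[OF _ k]] l)
    show "?v \<tau> integrable_on cbox a x"
      by (simp, intro integrable_continuous_real continuous_intros moll_continuous_x[OF _ k] l)
    show "continuous_on ({s..t} \<times> cbox a x) (\<lambda>(\<tau>, x). ?vt \<tau> x)"
      by (intro continuous_on_diff2 moll_calculus(4)[OF _ k] l)
  qed (use \<tau> in auto)
  have "integral {a..x} (?vt \<tau>) = - (?F \<tau> x - ?F \<tau> a)"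
  proof (rule integral_unique)
    have d: "((\<lambda>z. - ?F \<tau> z) has_real_derivative - ?Fx \<tau> z) (at z within {a..x})" for z
      by (intro DERIV_minus DERIV_diff has_field_derivative_at_within[OF moll_calculus(2)[OF _ k]] l)
    have "((\<lambda>z. - ?Fx \<tau> z) has_integral (- ?F \<tau> x) - (- ?F \<tau> a)) {a..x}"
      using x d by (intro fundamental_theorem_of_calculus) (auto simp: has_real_derivative_iff_has_vector_derivative)
    moreover have "(\<lambda>z. - ?Fx \<tau> z) = ?vt \<tau>"
    proof
      fix z show "- ?Fx \<tau> z = ?vt \<tau> z" using moll_conservation[OF c k, of \<tau> z] \<tau> s by auto
    qed
    moreover have "(- ?F \<tau> x) - (- ?F \<tau> a) = - (?F \<tau> x - ?F \<tau> a)" by simp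
    ultimately show "(?vt \<tau> has_integral - (?F \<tau> x - ?F \<tau> a)) {a..x}" by metis
  qed
  with DERIV_diff[OF 2 1] show "((\<lambda>\<tau>. potential k c s a \<tau> x) has_real_derivative - ?F \<tau> x) (at \<tau> within {s..t})"
    unfolding potential_def by simp
qed

text \<open>\<open>\<bar>u - c\<bar>\<close> and \<open>u - c\<close> are the sum and the difference
  of the one-sided entropies, and likewise for the fluxes; mollification preserves these linear
  relations, and positivity gives \<open>\<bar>v\<bar> \<le> A\<close>.\<close>

lemma level_moll:
  assumes c: "\<bar>c\<bar> \<le> C" and k: "kernel \<epsilon> k" "0 < \<epsilon>" and s: "0 \<le> s" and st: "s \<le> t" and R: "0 < R"
  shows "potential_strip s t R (\<lambda>\<tau> x. moll k (pos c) \<tau> x + moll k (neg c) \<tau> x)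
    (\<lambda>\<tau> x. moll_t k (pos c) \<tau> x + moll_t k (neg c) \<tau> x)
    (\<lambda>\<tau> x. moll k (fpos c) \<tau> x + moll k (fneg c) \<tau> x) 
    (\<lambda>\<tau> x. moll_x k (fpos c) \<tau> x + moll_x k (fneg c) \<tau> x) 
    (\<lambda>\<tau> x. moll k (pos c) \<tau> x - moll k (neg c) \<tau> x)
    (\<lambda>\<tau> x. moll k (fpos c) \<tau> x - moll k (fneg c) \<tau> x)
    (potential k c s (- 2 * R))"
proof
  note l = lipschitz_levels[OF c]
  note d = potential_deriv[OF c k s]
  let ?v = "\<lambda>\<tau> x. moll k (pos c) \<tau> x - moll k (neg c) \<tau> x" and ?F = "\<lambda>\<tau> x. moll k (fpos c) \<tau> x - moll k (fneg c) \<tau> x"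
  show "((\<lambda>\<tau>. potential k c s (- 2 * R) \<tau> x) has_real_derivative - ?F \<tau> x) (at \<tau> within {s..t})"
    "((\<lambda>x. potential k c s (- 2 * R) \<tau> x) has_real_derivative ?v \<tau> x) (at x within {- 2 * R..2 * R})"
    if "\<tau> \<in> {s..t}" "x \<in> {- 2 * R..2 * R}" for \<tau> x using d[OF that] by auto
  show "continuous_on ({s..t} \<times> {- 2 * R..2 * R}) (\<lambda>(\<tau>, x). potential k c s (- 2 * R) \<tau> x)"
  proof -
    obtain B1 where B1: "\<bar>moll k (pos c) \<tau> x\<bar> \<le> B1" for \<tau> x using moll_bounded[OF l(1)] k by metis
    obtain B2 where B2: "\<bar>moll k (neg c) \<tau> x\<bar> \<le> B2" for \<tau> x using moll_bounded[OF l(2)] k by metis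
    obtain B3 where B3: "\<bar>moll k (fpos c) \<tau> x\<bar> \<le> B3" for \<tau> x using moll_bounded[OF l(3)] k by metis
    obtain B4 where B4: "\<bar>moll k (fneg c) \<tau> x\<bar> \<le> B4" for \<tau> x using moll_bounded[OF l(4)] k by metis
    show ?thesis
    proof (rule continuous_on_if_lipschitz2)
      show "\<bar>potential k c s (- 2 * R) \<tau> x - potential k c s (- 2 * R) \<tau>' x\<bar> \<le> (B3 + B4) * \<bar>\<tau> - \<tau>'\<bar>"
        if *: "\<tau> \<in> {s..t}" "\<tau>' \<in> {s..t}" "x \<in> {- 2 * R..2 * R}" for \<tau> \<tau>' x
      proof -
        have "norm (- ?F r x) \<le> B3 + B4" for r using B3[of r x] B4[of r x] by simp
        from field_differentiable_bound[OF _ d(2)[OF _ *(3)] this *(1,2)] show ?thesis by simp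
      qed
      show "\<bar>potential k c s (- 2 * R) \<tau> x - potential k c s (- 2 * R) \<tau> x'\<bar> \<le> (B1 + B2) * \<bar>x - x'\<bar>"
        if *: "\<tau> \<in> {s..t}" "x \<in> {- 2 * R..2 * R}" "x' \<in> {- 2 * R..2 * R}" for \<tau> x x'
      proof -
        have "norm (?v \<tau> z) \<le> B1 + B2" for z using B1[of \<tau> z] B2[of \<tau> z] by simp
        from field_differentiable_bound[OF _ d(1)[OF *(1)] this *(2,3)] show ?thesis by simp
      qed
    qed
  qed
  fix \<tau> x assume \<tau>: "\<tau> \<in> {s..t}"
  then have \<tau>0: "0 \<le> \<tau>" using s by simp
  have "moll_t k (pos c) \<tau> x + moll_x k (fpos c) \<tau> x \<le> 0" "moll_t k (neg c) \<tau> x + moll_x k (fneg c) \<tau> x \<le> 0"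
    using moll_entropy[OF ent_pos[OF c] k \<tau>0, of x] moll_entropy[OF ent_neg[OF c] k \<tau>0, of x]
    unfolding pos_def neg_def fpos_def fneg_def by auto
  then show "moll_t k (pos c) \<tau> x + moll_t k (neg c) \<tau> x + (moll_x k (fpos c) \<tau> x + moll_x k (fneg c) \<tau> x) \<le> 0" by simp
  have "0 \<le> moll k (pos c) \<tau> x" "0 \<le> moll k (neg c) \<tau> x"
    by (intro moll_nonneg[OF k(1)] level_facts)+
  then show "\<bar>?v \<tau> x\<bar> \<le> moll k (pos c) \<tau> x + moll k (neg c) \<tau> x" by simp
qed (use st R in \<open>auto intro!: DERIV_add moll_calculus[OF _ k] lipschitz_levels[OF c] continuous_on_add2 continuous_on_diff2\<close>)

definition level_energy :: "real \<Rightarrow> real \<Rightarrow> real \<Rightarrow> real \<Rightarrow> real" where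
  "level_energy c R \<tau> y = integral {-2*R..y} (\<lambda>x. pos c (v \<tau> x) * cutoff R x) + integral {y..2*R} (\<lambda>x. neg c (v \<tau> x) * cutoff R x)"

lemma pos_neg_bdd:
  assumes "\<bar>c\<bar> \<le> C" "0 \<le> \<tau>"
  shows "bdd_borel (\<lambda>x. pos c (v \<tau> x))" "bdd_borel (\<lambda>x. neg c (v \<tau> x))"
    "bdd_borel (\<lambda>x. fpos c (v \<tau> x))" "bdd_borel (\<lambda>x. fneg c (v \<tau> x))"
  by (intro g_v_bdd lipschitz_levels assms)+

text \<open>\<open>level_estimate\<close> for mollified data, first with \<open>n\<close> to
  infinity at fixed \<open>\<delta>\<close>, then with \<open>\<delta>\<close> to 0. Each mollified
  potential has its own minimiser, which is exchanged for \<open>ystar\<close> only at the level of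
  the limit energy. In \<open>far\<close> the summand 1 absorbs the distance of mollified from exact
  potential increments, and \<open>FB * (t - s)\<close> the motion of the potential between
  \<open>s\<close> and \<open>t\<close>.\<close>

lemma level_limit:
  assumes c: "\<bar>c\<bar> \<le> C" and st: "0 \<le> s" "s \<le> t" and R: "0 < R0" "R0 \<le> R"
    and y: "\<bar>y\<bar> \<le> R" and ystar: "\<bar>ystar\<bar> \<le> R"
    and ystar_min: "\<And>x. \<bar>x\<bar> \<le> R \<Longrightarrow> integral {-2*R..ystar} (\<lambda>z. v t z - c) \<le> integral {-2*R..x} (\<lambda>z. v t z - c)"
    and FB: "\<And>\<epsilon> k \<tau> x. kernel \<epsilon> k \<Longrightarrow> 0 < \<epsilon> \<Longrightarrow> \<bar>moll k (fpos c) \<tau> x - moll k (fneg c) \<tau> x\<bar> \<le> FB"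
    and far: "\<And>x. \<bar>x\<bar> \<le> 2 * R \<Longrightarrow> R0 \<le> \<bar>x\<bar> \<Longrightarrow>
       integral {-2*R..0} (\<lambda>z. v t z - c) + 1 + FB * (t - s) \<le> integral {-2*R..x} (\<lambda>z. v t z - c)"
    and K: "\<And>\<tau>. \<tau> \<in> {s..t} \<Longrightarrow> integral {-2*R..2*R} (\<lambda>x. \<bar>fpos c (v \<tau> x)\<bar> * slope_left R x + \<bar>fneg c (v \<tau> x)\<bar> * slope_right R x) \<le> K"
  shows "level_energy c R t ystar \<le> level_energy c R s y + K * (t - s)"
proof -
  note l = lipschitz_levels[OF c]
  have Rpos: "0 < R" using R by simp
  have t0: "0 \<le> t" using st by simp
  have "\<forall>n::nat. \<exists>k. kernel (1 / Suc n) k" using kernel_exists by simp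
  then obtain k :: "nat \<Rightarrow> real \<Rightarrow> real" where k: "\<And>n. kernel (1 / Suc n) (k n)" by metis
  have npos: "0 < 1 / real (Suc n)" for n by simp
  note kk = k npos
  define P where "P n = moll (k n) (pos c)" for n
  define Q where "Q n = moll (k n) (neg c)" for n
  define Fp where "Fp n = moll (k n) (fpos c)" for n
  define Fm where "Fm n = moll (k n) (fneg c)" for n
  note defs = P_def Q_def Fp_def Fm_def
  let ?I = "{-2*R..2*R}"
  define err where "err g n \<tau> = integral ?I (\<lambda>x. \<bar>moll (k n) g \<tau> x - g (v \<tau> x)\<bar>)" for g n \<tau>
  have err_lim: "(\<lambda>n. err g n \<tau>) \<longlonglongrightarrow> 0" if "lipschitz_fun g" "0 \<le> \<tau>" for g \<tau>
    using moll_tendsto[OF that(1) k that(2), of "2*R"] unfolding err_def by simp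
  have mb: "bdd_borel (moll (k n) g \<tau>)" if "lipschitz_fun g" for n g \<tau> by (rule moll_section_bdd[OF that kk])
  have db: "bdd_borel (\<lambda>x. \<bar>moll (k n) g \<tau> x - g (v \<tau> x)\<bar>)" if "lipschitz_fun g" "0 \<le> \<tau>" for n g \<tau>
    by (rule bdd_borel_abs[OF bdd_borel_diff[OF mb[OF that(1)] g_v_bdd[OF that]]])
  note i = bdd_borel_integrable_on(1)
  obtain B1 where B1: "B1 \<ge> 0" "\<And>n \<tau> x. \<bar>P n \<tau> x\<bar> \<le> B1" using moll_bounded[OF l(1)] kk unfolding defs by metis
  obtain B2 where B2: "B2 \<ge> 0" "\<And>n \<tau> x. \<bar>Q n \<tau> x\<bar> \<le> B2" using moll_bounded[OF l(2)] kk unfolding defs by metis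
  obtain B3 where B3: "B3 \<ge> 0" "\<And>n \<tau> x. \<bar>Fp n \<tau> x\<bar> \<le> B3" using moll_bounded[OF l(3)] kk unfolding defs by metis
  obtain B4 where B4: "B4 \<ge> 0" "\<And>n \<tau> x. \<bar>Fm n \<tau> x\<bar> \<le> B4" using moll_bounded[OF l(4)] kk unfolding defs by metis
  obtain C3 where C3: "C3 \<ge> 0" "\<And>a. \<bar>a\<bar> \<le> C \<Longrightarrow> \<bar>fpos c a\<bar> \<le> C3" using lipschitz_fun_bdd[OF l(3)] by blast
  obtain C4 where C4: "C4 \<ge> 0" "\<And>a. \<bar>a\<bar> \<le> C \<Longrightarrow> \<bar>fneg c a\<bar> \<le> C4" using lipschitz_fun_bdd[OF l(4)] by blast
  define E where "E n \<tau> y = integral {-2*R..y} (\<lambda>x. P n \<tau> x * cutoff R x) + integral {y..2*R} (\<lambda>x. Q n \<tau> x * cutoff R x)" for n \<tau> y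
  have cut_eq: "integral S (\<lambda>x. h x * cutoff R x) = integral S (\<lambda>x. h x * cutoff_ext R x)" if "S \<subseteq> ?I" for S and h :: "real \<Rightarrow> real"
  proof (rule integral_cong)
    fix x assume "x \<in> S"
    then have "x \<in> ?I" using that by blast
    then have "\<bar>x\<bar> \<le> 2 * R" by auto
    then show "h x * cutoff R x = h x * cutoff_ext R x" by (simp add: cutoff_ext_def)
  qed
  have E_err: "\<bar>E n \<tau> y - level_energy c R \<tau> y\<bar> \<le> err (pos c) n \<tau> + err (neg c) n \<tau>" if \<tau>: "0 \<le> \<tau>" and y: "\<bar>y\<bar> \<le> R" for n \<tau> y
  proof -
    have sub: "{-2*R..y} \<subseteq> ?I" "{y..2*R} \<subseteq> ?I" using y Rpos by auto
    have part: "\<bar>integral S (\<lambda>x. moll (k n) g \<tau> x * cutoff R x) - integral S (\<lambda>x. g (v \<tau> x) * cutoff R x)\<bar> \<le> err g n \<tau>"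
      if S: "S \<subseteq> ?I" "S = {a..b}" and g: "lipschitz_fun g" for S g a b
    proof -
      note b1 = mb[OF g, of n \<tau>] and b2 = g_v_bdd[OF g \<tau>] and b3 = ext_bdd_borel(3)[OF Rpos]
      have eq: "integral S (\<lambda>x. moll (k n) g \<tau> x * cutoff_ext R x) - integral S (\<lambda>x. g (v \<tau> x) * cutoff_ext R x) =
         integral S (\<lambda>x. (moll (k n) g \<tau> x - g (v \<tau> x)) * cutoff_ext R x)"
        unfolding left_diff_distrib S(2)
        by (rule Henstock_Kurzweil_Integration.integral_diff[symmetric]) (rule i[OF bdd_borel_mult[OF b1 b3]] i[OF bdd_borel_mult[OF b2 b3]])+
      have "norm (integral S (\<lambda>x. (moll (k n) g \<tau> x - g (v \<tau> x)) * cutoff_ext R x)) \<le> integral S (\<lambda>x. \<bar>moll (k n) g \<tau> x - g (v \<tau> x)\<bar>)"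
      proof (rule integral_norm_bound_integral)
        show "(\<lambda>x. (moll (k n) g \<tau> x - g (v \<tau> x)) * cutoff_ext R x) integrable_on S"
          unfolding S(2) by (rule i[OF bdd_borel_mult[OF bdd_borel_diff[OF b1 b2] b3]])
        show "(\<lambda>x. \<bar>moll (k n) g \<tau> x - g (v \<tau> x)\<bar>) integrable_on S" unfolding S(2) by (rule i[OF db[OF g \<tau>]])
        fix x
        have "\<bar>cutoff_ext R x\<bar> \<le> 1" using cutoff_props(4,5)[OF Rpos, of x] by (simp add: cutoff_ext_def)
        then show "norm ((moll (k n) g \<tau> x - g (v \<tau> x)) * cutoff_ext R x) \<le> \<bar>moll (k n) g \<tau> x - g (v \<tau> x)\<bar>"
          using mult_left_mono[of "\<bar>cutoff_ext R x\<bar>" 1 "\<bar>moll (k n) g \<tau> x - g (v \<tau> x)\<bar>"] by (simp add: abs_mult)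
      qed
      also have "\<dots> \<le> err g n \<tau>"
        unfolding err_def S(2) by (rule integral_subset_le[OF S(1)[unfolded S(2)] i[OF db[OF g \<tau>]] i[OF db[OF g \<tau>]]]) simp
      finally show ?thesis unfolding cut_eq[OF S(1)] eq real_norm_def .
    qed
    show ?thesis using part[OF sub(1) refl l(1)] part[OF sub(2) refl l(2)]
      unfolding E_def level_energy_def P_def Q_def by linarith
  qed
  define W where "W x = integral {-2*R..x} (\<lambda>z. v t z - c)" for x
  have bW: "bdd_borel (\<lambda>z. v t z - c)" by (intro bdd_borel_diff v_bdd t0 bdd_borel_const)
  \<comment> \<open>Between two points of \<open>[-R, R]\<close> the cutoff is 1, so differences of
    the energy are differences of the primitive \<open>W\<close>, and \<open>ystar\<close> minimises
    both.\<close>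
  have energy_ge: "level_energy c R t ystar \<le> level_energy c R t x" if x: "\<bar>x\<bar> \<le> R" for x
  proof -
    note bp = pos_neg_bdd(1)[OF c t0] and bn = pos_neg_bdd(2)[OF c t0] and b3 = ext_bdd_borel(3)[OF Rpos]
    have diff: "level_energy c R t b - level_energy c R t a = W b - W a" if ab: "a \<le> b" "\<bar>a\<bar> \<le> R" "\<bar>b\<bar> \<le> R" for a b
    proof -
      have o: "-2*R \<le> a" "b \<le> 2*R" "-2*R \<le> b" "a \<le> 2*R" using ab Rpos by auto
      have sub: "{-2*R..a} \<subseteq> ?I" "{-2*R..b} \<subseteq> ?I" "{a..2*R} \<subseteq> ?I" "{b..2*R} \<subseteq> ?I" "{a..b} \<subseteq> ?I" using o by auto
      have one: "integral {a..b} (\<lambda>x. h x * cutoff_ext R x) = integral {a..b} h" for h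
        using ab by (intro integral_cong) (auto simp: cutoff_ext_def cutoff_props(1)[OF Rpos])
      have 1: "integral {-2*R..b} (\<lambda>x. pos c (v t x) * cutoff_ext R x) = integral {-2*R..a} (\<lambda>x. pos c (v t x) * cutoff_ext R x) + integral {a..b} (\<lambda>x. pos c (v t x))"
        using Henstock_Kurzweil_Integration.integral_combine[OF o(1) ab(1) i[OF bdd_borel_mult[OF bp b3]]] unfolding one by simp
      have 2: "integral {a..2*R} (\<lambda>x. neg c (v t x) * cutoff_ext R x) = integral {a..b} (\<lambda>x. neg c (v t x)) + integral {b..2*R} (\<lambda>x. neg c (v t x) * cutoff_ext R x)"
        using Henstock_Kurzweil_Integration.integral_combine[OF ab(1) o(2) i[OF bdd_borel_mult[OF bn b3]]] unfolding one by simp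
      have 3: "W b = W a + integral {a..b} (\<lambda>z. v t z - c)"
        unfolding W_def by (rule Henstock_Kurzweil_Integration.integral_combine[symmetric, OF o(1) ab(1) i[OF bW]])
      have 4: "integral {a..b} (\<lambda>z. v t z - c) = integral {a..b} (\<lambda>x. pos c (v t x)) - integral {a..b} (\<lambda>x. neg c (v t x))"
        using Henstock_Kurzweil_Integration.integral_diff[OF i[OF bp] i[OF bn], of a b] by (simp only: level_facts(1))
      show ?thesis
        unfolding level_energy_def cut_eq[OF sub(1)] cut_eq[OF sub(2)] cut_eq[OF sub(3)] cut_eq[OF sub(4)] using 1 2 3 4 by simp
    qed
    have "W ystar \<le> W x" using ystar_min[OF x] unfolding W_def .
    then show ?thesis using diff[of x ystar] diff[of ystar x] x ystar by (cases "x \<le> ystar") auto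
  qed
  define e where "e \<delta> n \<tau> x = \<bar>(Fp n \<tau> x + Fm n \<tau> x) * (P n \<tau> x - Q n \<tau> x) - (P n \<tau> x + Q n \<tau> x) * (Fp n \<tau> x - Fm n \<tau> x)\<bar> / (2 * \<delta>) +
     (\<bar>(Fp n \<tau> x + Fm n \<tau> x) + (Fp n \<tau> x - Fm n \<tau> x)\<bar> / 2 * slope_left R x + \<bar>(Fp n \<tau> x + Fm n \<tau> x) - (Fp n \<tau> x - Fm n \<tau> x)\<bar> / 2 * slope_right R x)" for \<delta> n \<tau> x
  have cont_e: "continuous_on ({s..t} \<times> ?I) (\<lambda>(\<tau>, x). e \<delta> n \<tau> x)" if "\<delta> > 0" for \<delta> n
  proof -
    note cm = moll_calculus(3)[OF _ kk, unfolded split_beta]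
    have cs: "continuous_on ({s..t} \<times> ?I) (\<lambda>p. slope_left R (snd p))" "continuous_on ({s..t} \<times> ?I) (\<lambda>p. slope_right R (snd p))"
      using continuous_on_const2[OF cutoff_continuous(2)] continuous_on_const2[OF cutoff_continuous(3)] unfolding split_beta by blast+
    show ?thesis unfolding e_def defs split_beta using that
      by (intro continuous_intros cm[OF l(1)] cm[OF l(2)] cm[OF l(3)] cm[OF l(4)] cs) auto
  qed
  define G where "G \<delta> n \<tau> = integral ?I (e \<delta> n \<tau>)" for \<delta> n \<tau>
  \<comment> \<open>The limit of \<open>e\<close>: the interior term disappears and the boundary
    terms become the one-sided fluxes.\<close>
  define e0 where "e0 \<tau> x = \<bar>fpos c (v \<tau> x)\<bar> * slope_left R x + \<bar>fneg c (v \<tau> x)\<bar> * slope_right R x" for \<tau> x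
  have Glim: "(\<lambda>n. G \<delta> n \<tau>) \<longlonglongrightarrow> integral ?I (e0 \<tau>)" if \<delta>: "\<delta> > 0" and \<tau>: "\<tau> \<in> {s..t}" for \<delta> \<tau>
  proof -
    have \<tau>0: "0 \<le> \<tau>" using \<tau> st by simp
    \<comment> \<open>Dominates the four coefficients of the estimate below. It depends on
      \<open>\<delta>\<close> but not on \<open>n\<close>, so \<open>\<delta>\<close> has to stay
      fixed here.\<close>
    define D where "D = (B1 + B2 + C3 + C4) / \<delta> + 2 / R"
    have D: "B1 / \<delta> + 2 / R \<le> D" "C4 / \<delta> \<le> D" "B2 / \<delta> + 2 / R \<le> D" "C3 / \<delta> \<le> D"
      using B1(1) B2(1) C3(1) C4(1) \<delta> Rpos unfolding D_def add_divide_distrib by auto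
    have pw: "\<bar>e \<delta> n \<tau> x - e0 \<tau> x\<bar> \<le> D * (\<bar>P n \<tau> x - pos c (v \<tau> x)\<bar> + \<bar>Q n \<tau> x - neg c (v \<tau> x)\<bar> + (\<bar>Fp n \<tau> x - fpos c (v \<tau> x)\<bar> + \<bar>Fm n \<tau> x - fneg c (v \<tau> x)\<bar>))"
      if x: "x \<in> ?I" for n x
    proof -
      define p q a b where pq: "p = P n \<tau> x" "q = Q n \<tau> x" "a = Fp n \<tau> x" "b = Fm n \<tau> x"
      define p0 q0 a0 b0 where pq0: "p0 = pos c (v \<tau> x)" "q0 = neg c (v \<tau> x)" "a0 = fpos c (v \<tau> x)" "b0 = fneg c (v \<tau> x)"
      have sl: "0 \<le> slope_left R x" "slope_left R x \<le> 2 / R" "0 \<le> slope_right R x" "slope_right R x \<le> 2 / R"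
        using cutoff_props[OF Rpos] x by auto
      \<comment> \<open>The cancellation \<open>B v = A F\<close>: \<open>(u - c)\<^sup>+\<close> and the flux of \<open>(c - u)\<^sup>+\<close> have disjoint supports.\<close>
      have z: "b0 * p0 = 0" "a0 * q0 = 0" unfolding pq0 by (rule level_facts)+
      have "\<bar>b * p\<bar> \<le> B1 * \<bar>b - b0\<bar> + C4 * \<bar>p - p0\<bar>"
      proof -
        have "b * p = p * (b - b0) + b0 * (p - p0)" using z by (simp add: algebra_simps)
        then have "\<bar>b * p\<bar> \<le> \<bar>p\<bar> * \<bar>b - b0\<bar> + \<bar>b0\<bar> * \<bar>p - p0\<bar>" using abs_triangle_ineq[of "p * (b - b0)" "b0 * (p - p0)"] by (simp add: abs_mult)
        also have "\<dots> \<le> B1 * \<bar>b - b0\<bar> + C4 * \<bar>p - p0\<bar>" unfolding pq pq0 by (intro add_mono mult_right_mono B1 C4 v_le) auto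
        finally show ?thesis .
      qed
      moreover have "\<bar>a * q\<bar> \<le> B2 * \<bar>a - a0\<bar> + C3 * \<bar>q - q0\<bar>"
      proof -
        have "a * q = q * (a - a0) + a0 * (q - q0)" using z by (simp add: algebra_simps)
        then have "\<bar>a * q\<bar> \<le> \<bar>q\<bar> * \<bar>a - a0\<bar> + \<bar>a0\<bar> * \<bar>q - q0\<bar>" using abs_triangle_ineq[of "q * (a - a0)" "a0 * (q - q0)"] by (simp add: abs_mult)
        also have "\<dots> \<le> B2 * \<bar>a - a0\<bar> + C3 * \<bar>q - q0\<bar>" unfolding pq pq0 by (intro add_mono mult_right_mono B2 C3 v_le) auto
        finally show ?thesis .
      qed
      ultimately have bpaq: "\<bar>b * p - a * q\<bar> \<le> B1 * \<bar>b - b0\<bar> + C4 * \<bar>p - p0\<bar> + (B2 * \<bar>a - a0\<bar> + C3 * \<bar>q - q0\<bar>)" by linarith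
      have "(a + b) * (p - q) - (p + q) * (a - b) = 2 * (b * p - a * q)" by (simp add: algebra_simps)
      then have "\<bar>(a + b) * (p - q) - (p + q) * (a - b)\<bar> / (2 * \<delta>) = \<bar>b * p - a * q\<bar> / \<delta>"
        unfolding abs_mult[of 2] by (simp only: abs_mult[of 2] abs_numeral mult_divide_mult_cancel_left[OF zero_neq_numeral[symmetric]])
      then have "\<bar>(a + b) * (p - q) - (p + q) * (a - b)\<bar> / (2 * \<delta>) \<le> (B1 * \<bar>b - b0\<bar> + C4 * \<bar>p - p0\<bar> + (B2 * \<bar>a - a0\<bar> + C3 * \<bar>q - q0\<bar>)) / \<delta>"
        using divide_right_mono[OF bpaq, of \<delta>] \<delta> by simp
      also have "\<dots> = B1 / \<delta> * \<bar>b - b0\<bar> + C4 / \<delta> * \<bar>p - p0\<bar> + (B2 / \<delta> * \<bar>a - a0\<bar> + C3 / \<delta> * \<bar>q - q0\<bar>)"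
        by (simp add: add_divide_distrib)
      finally have 1: "\<bar>(a + b) * (p - q) - (p + q) * (a - b)\<bar> / (2 * \<delta>) \<le> B1 / \<delta> * \<bar>b - b0\<bar> + C4 / \<delta> * \<bar>p - p0\<bar> + (B2 / \<delta> * \<bar>a - a0\<bar> + C3 / \<delta> * \<bar>q - q0\<bar>)" .
      have 2: "\<bar>\<bar>a\<bar> * slope_left R x - \<bar>a0\<bar> * slope_left R x\<bar> \<le> 2 / R * \<bar>a - a0\<bar>" "\<bar>\<bar>b\<bar> * slope_right R x - \<bar>b0\<bar> * slope_right R x\<bar> \<le> 2 / R * \<bar>b - b0\<bar>"
      proof -
        have "\<bar>\<bar>a\<bar> - \<bar>a0\<bar>\<bar> * slope_left R x \<le> \<bar>a - a0\<bar> * (2 / R)" "\<bar>\<bar>b\<bar> - \<bar>b0\<bar>\<bar> * slope_right R x \<le> \<bar>b - b0\<bar> * (2 / R)"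
          using sl by (intro mult_mono; simp)+
        then show "\<bar>\<bar>a\<bar> * slope_left R x - \<bar>a0\<bar> * slope_left R x\<bar> \<le> 2 / R * \<bar>a - a0\<bar>" "\<bar>\<bar>b\<bar> * slope_right R x - \<bar>b0\<bar> * slope_right R x\<bar> \<le> 2 / R * \<bar>b - b0\<bar>"
          unfolding left_diff_distrib[symmetric] abs_mult using sl by (simp_all add: mult.commute)
      qed
      have eqe: "e \<delta> n \<tau> x = \<bar>(a + b) * (p - q) - (p + q) * (a - b)\<bar> / (2 * \<delta>) + (\<bar>a\<bar> * slope_left R x + \<bar>b\<bar> * slope_right R x)"
        "e0 \<tau> x = \<bar>a0\<bar> * slope_left R x + \<bar>b0\<bar> * slope_right R x"
        unfolding e_def e0_def pq pq0 by simp_all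
      have 0: "0 \<le> \<bar>(a + b) * (p - q) - (p + q) * (a - b)\<bar> / (2 * \<delta>)" using \<delta> by simp
      have tri: "\<bar>T + (a1 + b1) - (a0 + b0)\<bar> \<le> T + (\<bar>a1 - a0\<bar> + \<bar>b1 - b0\<bar>)" if "0 \<le> T" for T a1 b1 a0 b0 :: real
        using that by linarith
      have "\<bar>e \<delta> n \<tau> x - e0 \<tau> x\<bar> \<le> \<bar>(a + b) * (p - q) - (p + q) * (a - b)\<bar> / (2 * \<delta>) +
          (\<bar>\<bar>a\<bar> * slope_left R x - \<bar>a0\<bar> * slope_left R x\<bar> + \<bar>\<bar>b\<bar> * slope_right R x - \<bar>b0\<bar> * slope_right R x\<bar>)"
        unfolding eqe by (rule tri[OF 0])
      also have "\<dots> \<le> (B1 / \<delta> * \<bar>b - b0\<bar> + C4 / \<delta> * \<bar>p - p0\<bar> + (B2 / \<delta> * \<bar>a - a0\<bar> + C3 / \<delta> * \<bar>q - q0\<bar>)) + (2 / R * \<bar>a - a0\<bar> + 2 / R * \<bar>b - b0\<bar>)"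
        by (intro add_mono 1 2)
      also have "\<dots> = (B1 / \<delta> + 2 / R) * \<bar>b - b0\<bar> + C4 / \<delta> * \<bar>p - p0\<bar> + ((B2 / \<delta> + 2 / R) * \<bar>a - a0\<bar> + C3 / \<delta> * \<bar>q - q0\<bar>)"
        by (simp only: distrib_right add_ac)
      also have "\<dots> \<le> D * \<bar>b - b0\<bar> + D * \<bar>p - p0\<bar> + (D * \<bar>a - a0\<bar> + D * \<bar>q - q0\<bar>)"
        by (intro add_mono mult_right_mono D abs_ge_zero)
      finally show ?thesis unfolding pq pq0 by (simp only: distrib_left add_ac)
    qed
    have beq: "e0 \<tau> x = \<bar>fpos c (v \<tau> x)\<bar> * slope_left_ext R x + \<bar>fneg c (v \<tau> x)\<bar> * slope_right_ext R x" if "x \<in> ?I" for x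
      using that by (auto simp: e0_def slope_left_ext_def slope_right_ext_def)
    have i0: "e0 \<tau> integrable_on ?I"
    proof (rule integrable_eq)
      show "(\<lambda>x. \<bar>fpos c (v \<tau> x)\<bar> * slope_left_ext R x + \<bar>fneg c (v \<tau> x)\<bar> * slope_right_ext R x) integrable_on ?I"
        by (rule i[OF bdd_borel_add[OF bdd_borel_mult[OF bdd_borel_abs[OF pos_neg_bdd(3)[OF c \<tau>0]] ext_bdd_borel(1)[OF Rpos]]
           bdd_borel_mult[OF bdd_borel_abs[OF pos_neg_bdd(4)[OF c \<tau>0]] ext_bdd_borel(2)[OF Rpos]]]])
    qed (use beq in simp)
    have ie: "e \<delta> n \<tau> integrable_on ?I" for n
      by (intro integrable_continuous_real continuous_on_section2[OF cont_e[OF \<delta>] \<tau>])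
    have ids: "(\<lambda>x. \<bar>P n \<tau> x - pos c (v \<tau> x)\<bar>) integrable_on ?I" "(\<lambda>x. \<bar>Q n \<tau> x - neg c (v \<tau> x)\<bar>) integrable_on ?I"
      "(\<lambda>x. \<bar>Fp n \<tau> x - fpos c (v \<tau> x)\<bar>) integrable_on ?I" "(\<lambda>x. \<bar>Fm n \<tau> x - fneg c (v \<tau> x)\<bar>) integrable_on ?I" for n
      unfolding defs by (rule i[OF db[OF l(1) \<tau>0]] i[OF db[OF l(2) \<tau>0]] i[OF db[OF l(3) \<tau>0]] i[OF db[OF l(4) \<tau>0]])+
    have gb: "norm (G \<delta> n \<tau> - integral ?I (e0 \<tau>)) \<le> D * (err (pos c) n \<tau> + err (neg c) n \<tau> + (err (fpos c) n \<tau> + err (fneg c) n \<tau>))" for n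
    proof -
      have "norm (integral ?I (\<lambda>x. e \<delta> n \<tau> x - e0 \<tau> x)) \<le> integral ?I (\<lambda>x. D * (\<bar>P n \<tau> x - pos c (v \<tau> x)\<bar> + \<bar>Q n \<tau> x - neg c (v \<tau> x)\<bar> + (\<bar>Fp n \<tau> x - fpos c (v \<tau> x)\<bar> + \<bar>Fm n \<tau> x - fneg c (v \<tau> x)\<bar>)))"
        by (rule integral_norm_bound_integral[OF integrable_diff[OF ie i0] integrable_on_mult_right[OF integrable_add[OF integrable_add[OF ids(1,2)] integrable_add[OF ids(3,4)]]]])
           (use pw in simp)
      also have "\<dots> = D * (err (pos c) n \<tau> + err (neg c) n \<tau> + (err (fpos c) n \<tau> + err (fneg c) n \<tau>))"
        unfolding err_def defs[symmetric]
        by (simp only: Henstock_Kurzweil_Integration.integral_mult_right Henstock_Kurzweil_Integration.integral_add[OF ids(1,2)] 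
            Henstock_Kurzweil_Integration.integral_add[OF ids(3,4)]
            Henstock_Kurzweil_Integration.integral_add[OF integrable_add[OF ids(1,2)] integrable_add[OF ids(3,4)]])
      finally show ?thesis unfolding G_def Henstock_Kurzweil_Integration.integral_diff[OF ie i0] .
    qed
    have "(\<lambda>n. D * (err (pos c) n \<tau> + err (neg c) n \<tau> + (err (fpos c) n \<tau> + err (fneg c) n \<tau>))) \<longlonglongrightarrow> D * (0 + 0 + (0 + 0))"
      by (intro tendsto_intros err_lim l \<tau>0)
    then have glim: "(\<lambda>n. D * (err (pos c) n \<tau> + err (neg c) n \<tau> + (err (fpos c) n \<tau> + err (fneg c) n \<tau>))) \<longlonglongrightarrow> 0" by simp
    have "(\<lambda>n. G \<delta> n \<tau> - integral ?I (e0 \<tau>)) \<longlonglongrightarrow> 0"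
      by (rule Lim_null_comparison[OF always_eventually[OF allI[OF gb]] glim])
    then show ?thesis by (rule LIM_zero_cancel)
  qed
  have GI: "(\<lambda>n. integral {s..t} (G \<delta> n)) \<longlonglongrightarrow> integral {s..t} (\<lambda>\<tau>. integral ?I (e0 \<tau>))" (is ?th1)
    and GI2: "(\<lambda>\<tau>. integral ?I (e0 \<tau>)) integrable_on {s..t}" (is ?th2) if \<delta>: "\<delta> > 0" for \<delta>
  proof -
    \<comment> \<open>A bound for \<open>e\<close> that is uniform in \<open>n\<close> and
      \<open>\<tau>\<close>, as dominated convergence in \<open>\<tau>\<close> requires.\<close>
    define H where "H = ((B3 + B4) * (B1 + B2) + (B1 + B2) * (B3 + B4)) / (2 * \<delta>) + ((B3 + B4 + (B3 + B4)) / 2 * (2 / R) + (B3 + B4 + (B3 + B4)) / 2 * (2 / R))"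
    have bd: "norm (G \<delta> n \<tau>) \<le> H * (2*R - (-2*R))" if \<tau>: "\<tau> \<in> {s..t}" for n \<tau>
    proof -
      have eb: "norm (e \<delta> n \<tau> x) \<le> H" if x: "x \<in> ?I" for x
      proof -
        define p q a b where pq: "p = P n \<tau> x" "q = Q n \<tau> x" "a = Fp n \<tau> x" "b = Fm n \<tau> x"
        have bb: "\<bar>p\<bar> \<le> B1" "\<bar>q\<bar> \<le> B2" "\<bar>a\<bar> \<le> B3" "\<bar>b\<bar> \<le> B4" unfolding pq by (rule B1 B2 B3 B4)+
        have s4: "\<bar>a + b\<bar> \<le> B3 + B4" "\<bar>a - b\<bar> \<le> B3 + B4" "\<bar>p + q\<bar> \<le> B1 + B2" "\<bar>p - q\<bar> \<le> B1 + B2" using bb by linarith+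
        have sl: "0 \<le> slope_left R x" "slope_left R x \<le> 2 / R" "0 \<le> slope_right R x" "slope_right R x \<le> 2 / R"
          using cutoff_props[OF Rpos] x by auto
        have "\<bar>(a + b) * (p - q) - (p + q) * (a - b)\<bar> \<le> (B3 + B4) * (B1 + B2) + (B1 + B2) * (B3 + B4)"
        proof (rule order_trans[OF abs_triangle_ineq4 add_mono])
          show "\<bar>(a + b) * (p - q)\<bar> \<le> (B3 + B4) * (B1 + B2)" "\<bar>(p + q) * (a - b)\<bar> \<le> (B1 + B2) * (B3 + B4)"
            unfolding abs_mult using B1(1) B2(1) B3(1) B4(1) by (intro mult_mono s4; simp)+
        qed
        then have 1: "\<bar>(a + b) * (p - q) - (p + q) * (a - b)\<bar> / (2 * \<delta>) \<le> ((B3 + B4) * (B1 + B2) + (B1 + B2) * (B3 + B4)) / (2 * \<delta>)"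
          using \<delta> by (intro divide_right_mono) auto
        have 2: "\<bar>(a + b) + (a - b)\<bar> / 2 * slope_left R x \<le> (B3 + B4 + (B3 + B4)) / 2 * (2 / R)"
          "\<bar>(a + b) - (a - b)\<bar> / 2 * slope_right R x \<le> (B3 + B4 + (B3 + B4)) / 2 * (2 / R)"
        proof -
          have "\<bar>(a + b) + (a - b)\<bar> \<le> B3 + B4 + (B3 + B4)" "\<bar>(a + b) - (a - b)\<bar> \<le> B3 + B4 + (B3 + B4)"
            by (rule order_trans[OF abs_triangle_ineq add_mono[OF s4(1,2)]] order_trans[OF abs_triangle_ineq4 add_mono[OF s4(1,2)]])+
          then show "\<bar>(a + b) + (a - b)\<bar> / 2 * slope_left R x \<le> (B3 + B4 + (B3 + B4)) / 2 * (2 / R)"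
            "\<bar>(a + b) - (a - b)\<bar> / 2 * slope_right R x \<le> (B3 + B4 + (B3 + B4)) / 2 * (2 / R)"
            using sl B3(1) B4(1) by (auto intro!: mult_mono divide_right_mono simp del: times_divide_eq_left times_divide_eq_right)
        qed
        have 3: "0 \<le> \<bar>(a + b) * (p - q) - (p + q) * (a - b)\<bar> / (2 * \<delta>)" "0 \<le> \<bar>(a + b) + (a - b)\<bar> / 2 * slope_left R x"
          "0 \<le> \<bar>(a + b) - (a - b)\<bar> / 2 * slope_right R x" using \<delta> sl by auto
        have "norm (e \<delta> n \<tau> x) = e \<delta> n \<tau> x"
          unfolding e_def pq[symmetric] real_norm_def by (intro abs_of_nonneg add_nonneg_nonneg 3)
        also have "\<dots> \<le> H" unfolding e_def H_def pq[symmetric] by (intro add_mono 1 2)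
        finally show ?thesis .
      qed
      show ?thesis
        unfolding G_def using Rpos by (intro integral_bound[OF _ continuous_on_section2[OF cont_e[OF \<delta>] \<tau>]] eb) auto
    qed
    have iG: "G \<delta> n integrable_on {s..t}" for n
      unfolding G_def by (intro integrable_continuous_real continuous_on_integral_param cont_e \<delta>)
    show ?th1 ?th2
      using dominated_convergence[OF iG integrable_const_ivl bd Glim[OF \<delta>]] by auto
  qed
  have lim_le: "integral {s..t} (\<lambda>\<tau>. integral ?I (e0 \<tau>)) \<le> K * (t - s)"
  proof -
    have "integral {s..t} (\<lambda>\<tau>. integral ?I (e0 \<tau>)) \<le> integral {s..t} (\<lambda>\<tau>. K)"
      using K unfolding e0_def[symmetric] by (intro integral_le GI2[of 1] integrable_const_ivl) auto
    then show ?thesis using st by (simp add: mult.commute)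
  qed
  have main: "level_energy c R t ystar \<le> level_energy c R s y + \<delta> * (pi / 2) + K * (t - s)" if \<delta>: "\<delta> > 0" for \<delta>
  proof -
    define rhs where "rhs n = level_energy c R s y + (err (pos c) n s + err (neg c) n s) + \<delta> * (pi / 2) + integral {s..t} (G \<delta> n) + (err (pos c) n t + err (neg c) n t)" for n
    have lim: "rhs \<longlonglongrightarrow> level_energy c R s y + (0 + 0) + \<delta> * (pi / 2) + integral {s..t} (\<lambda>\<tau>. integral ?I (e0 \<tau>)) + (0 + 0)"
      unfolding rhs_def by (intro tendsto_intros err_lim l GI \<delta> st t0)
    \<comment> \<open>An increment of the potential is a difference of two integrals, each off by at
      most 1/2; together this is the 1 in \<open>far\<close>.\<close>
    have ev: "\<forall>\<^sub>F n in sequentially. err (pos c) n t + err (neg c) n t < 1 / 2"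
    proof -
      have "(\<lambda>n. err (pos c) n t + err (neg c) n t) \<longlonglongrightarrow> 0 + 0" by (intro tendsto_intros err_lim l t0)
      then show ?thesis by (intro order_tendstoD(2)) auto
    qed
    have "\<forall>\<^sub>F n in sequentially. level_energy c R t ystar \<le> rhs n"
      using ev
    proof eventually_elim
      case (elim n)
      define U where "U = potential (k n) c s (- 2 * R)"
      interpret ps: potential_strip s t R "\<lambda>\<tau> x. P n \<tau> x + Q n \<tau> x" "\<lambda>\<tau> x. moll_t (k n) (pos c) \<tau> x + moll_t (k n) (neg c) \<tau> x"
        "\<lambda>\<tau> x. Fp n \<tau> x + Fm n \<tau> x" "\<lambda>\<tau> x. moll_x (k n) (fpos c) \<tau> x + moll_x (k n) (fneg c) \<tau> x"
        "\<lambda>\<tau> x. P n \<tau> x - Q n \<tau> x" "\<lambda>\<tau> x. Fp n \<tau> x - Fm n \<tau> x" U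
        unfolding U_def defs by (rule level_moll[OF c kk st Rpos])
      have tt: "t \<in> {s..t}" using st by simp
      have Wd: "\<bar>(U t x - U t 0) - (W x - W 0)\<bar> \<le> 1" if x: "\<bar>x\<bar> \<le> 2 * R" for x
      proof -
        have part: "\<bar>integral {-2*R..x} (\<lambda>z. P n t z - Q n t z) - W x\<bar> \<le> 1 / 2" if x: "\<bar>x\<bar> \<le> 2 * R" for x
        proof -
          have ib: "(\<lambda>z. P n t z - Q n t z) integrable_on {-2*R..x}" unfolding defs by (rule i[OF bdd_borel_diff[OF mb[OF l(1)] mb[OF l(2)]]])
          have sub: "{-2*R..x} \<subseteq> ?I" using x by auto
          have d: "integral {-2*R..x} (\<lambda>z. P n t z - Q n t z) - W x = integral {-2*R..x} (\<lambda>z. (P n t z - Q n t z) - (v t z - c))"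
            unfolding W_def by (rule Henstock_Kurzweil_Integration.integral_diff[OF ib i[OF bW], symmetric])
          note i1 = i[OF db[OF l(1) t0]] and i2 = i[OF db[OF l(2) t0]]
          have "norm (integral {-2*R..x} (\<lambda>z. (P n t z - Q n t z) - (v t z - c))) \<le> integral {-2*R..x} (\<lambda>z. \<bar>moll (k n) (pos c) t z - pos c (v t z)\<bar> + \<bar>moll (k n) (neg c) t z - neg c (v t z)\<bar>)"
          proof (rule integral_norm_bound_integral[OF integrable_diff[OF ib i[OF bW]] integrable_add[OF i1 i2]])
            fix z
            have "(P n t z - Q n t z) - (v t z - c) = (moll (k n) (pos c) t z - pos c (v t z)) - (moll (k n) (neg c) t z - neg c (v t z))"
              unfolding level_facts(1)[of c "v t z", symmetric] defs by simp
            then show "norm ((P n t z - Q n t z) - (v t z - c)) \<le> \<bar>moll (k n) (pos c) t z - pos c (v t z)\<bar> + \<bar>moll (k n) (neg c) t z - neg c (v t z)\<bar>"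
              by simp
          qed
          also have "\<dots> = integral {-2*R..x} (\<lambda>z. \<bar>moll (k n) (pos c) t z - pos c (v t z)\<bar>) + integral {-2*R..x} (\<lambda>z. \<bar>moll (k n) (neg c) t z - neg c (v t z)\<bar>)"
            by (rule Henstock_Kurzweil_Integration.integral_add[OF i1 i2])
          also have "\<dots> \<le> err (pos c) n t + err (neg c) n t"
            unfolding err_def by (intro add_mono integral_subset_le sub i1 i2) auto
          finally show ?thesis using elim unfolding d by simp
        qed
        have "U t x - U t 0 = integral {-2*R..x} (\<lambda>z. P n t z - Q n t z) - integral {-2*R..0} (\<lambda>z. P n t z - Q n t z)"
          unfolding U_def potential_def defs by simp
        moreover have "\<bar>0::real\<bar> \<le> 2 * R" using Rpos by simp
        ultimately show ?thesis using part[OF x] part[of 0] by arith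
      qed
      have time: "U t x - FB * (t - s) \<le> U \<tau> x" if \<tau>: "\<tau> \<in> {s..t}" and x: "\<bar>x\<bar> \<le> 2 * R" for \<tau> x
      proof -
        have x': "x \<in> ?I" using x by auto
        have "norm (- (Fp n r x - Fm n r x)) \<le> FB" for r using FB[OF kk, of n r x] unfolding defs by simp
        from field_differentiable_bound[OF _ ps.Ut[OF _ x'] this tt \<tau>]
        have "\<bar>U t x - U \<tau> x\<bar> \<le> FB * \<bar>t - \<tau>\<bar>" by simp
        also have "\<dots> \<le> FB * (t - s)" using \<tau> FB[OF kk, of 0 0 0] by (intro mult_left_mono) auto
        finally show ?thesis by linarith
      qed
      have cU: "continuous_on {-R0..R0} (U t)"
        using ps.sections(3)[OF tt] R by (rule_tac continuous_on_subset) auto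
      \<comment> \<open>The minimum over the fixed segment \<open>[-R0, R0]\<close> is a minimum
        over \<open>[-2R, 2R]\<close>, by the margin in \<open>far\<close>.\<close>
      obtain yn where yn: "yn \<in> {-R0..R0}" "\<And>x. x \<in> {-R0..R0} \<Longrightarrow> U t yn \<le> U t x"
        using continuous_attains_inf[OF _ _ cU] R by auto
      have ynR: "\<bar>yn\<bar> \<le> R" using yn(1) R by auto
      have m0: "U t yn \<le> U t 0" using yn(2)[of 0] R by simp
      have FBpos: "0 \<le> FB * (t - s)" using st FB[OF kk, of 0 0 0] by simp
      have farU: "U t yn \<le> U t x - FB * (t - s)" if x: "\<bar>x\<bar> \<le> 2 * R" "R0 \<le> \<bar>x\<bar>" for x
        using far[OF x] Wd[OF x(1)] m0 unfolding W_def[symmetric] by linarith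
      have "ps.energy t yn \<le> ps.energy s y + \<delta> * (pi / 2) + integral {s..t} (\<lambda>\<tau>. integral ?I (e \<delta> n \<tau>))"
        unfolding e_def
      proof (rule ps.level_estimate[OF \<delta> y ynR refl])
        fix x assume x: "x \<in> ?I"
        then have x2: "\<bar>x\<bar> \<le> 2 * R" by auto
        show "U t yn \<le> U t x"
        proof (cases "\<bar>x\<bar> \<le> R0")
          case True then show ?thesis by (intro yn(2)) auto
        next
          case False then show ?thesis using farU[OF x2] FBpos by linarith
        qed
        fix \<tau> assume \<tau>: "\<tau> \<in> {s..t}" and "R \<le> \<bar>x\<bar>"
        then show "U t yn \<le> U \<tau> x" using farU[OF x2] time[OF \<tau> x2] R by linarith
      qed
      then have "E n t yn \<le> E n s y + \<delta> * (pi / 2) + integral {s..t} (G \<delta> n)"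
        unfolding ps.energy_def E_def G_def by simp
      moreover have "level_energy c R t yn \<le> E n t yn + (err (pos c) n t + err (neg c) n t)"
        using E_err[OF t0 ynR, of n] by linarith
      moreover have "E n s y \<le> level_energy c R s y + (err (pos c) n s + err (neg c) n s)"
        using E_err[OF st(1) y, of n] by linarith
      moreover note energy_ge[OF ynR]
      ultimately show ?case unfolding rhs_def by linarith
    qed
    from tendsto_lowerbound[OF lim this] show ?thesis using lim_le by simp
  qed
  have "((\<lambda>\<delta>. level_energy c R s y + \<delta> * (pi / 2) + K * (t - s)) \<longlongrightarrow> level_energy c R s y + 0 * (pi / 2) + K * (t - s)) (at_right 0)"
    by (intro tendsto_intros)
  moreover have "\<forall>\<^sub>F \<delta> in at_right 0. level_energy c R t ystar \<le> level_energy c R s y + \<delta> * (pi / 2) + K * (t - s)"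
    using main by (auto simp: eventually_at_right_field intro!: exI[of _ 1])
  ultimately show ?thesis using tendsto_lowerbound by fastforce
qed

end

section \<open>Contraction on the line and on half-lines\<close>

lemma ramp_sequence: "(\<lambda>n. ramp (real n + a)) \<longlonglongrightarrow> 1"
proof -
  have "filterlim (\<lambda>n. a + real n) at_top sequentially"
    by (rule filterlim_tendsto_add_at_top[OF tendsto_const filterlim_real_sequentially])
  from filterlim_compose[OF ramp_tendsto this] show ?thesis by (simp add: add.commute)
qed

lemma half_line_finite:
  fixes h :: "real \<Rightarrow> real"
  assumes h: "bdd_borel h" "\<And>x. 0 \<le> h x"
  shows "(\<integral>\<^sup>+x. indicator {..<0} x * ennreal (h x) \<partial>lborel) < \<infinity> \<Longrightarrow> (\<integral>\<^sup>+x. indicator {..b} x * ennreal (h x) \<partial>lborel) < \<infinity>"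
    and "(\<integral>\<^sup>+x. indicator {0<..} x * ennreal (h x) \<partial>lborel) < \<infinity> \<Longrightarrow> (\<integral>\<^sup>+x. indicator {-b..} x * ennreal (h x) \<partial>lborel) < \<infinity>"
proof -
  note [measurable] = bdd_borelD[OF h(1)]
  have fin: "(\<integral>\<^sup>+x. indicator {a..b} x * ennreal (h x) \<partial>lborel) < \<infinity>" for a b
  proof -
    have "(\<integral>\<^sup>+x. indicator {a..b} x * ennreal (h x) \<partial>lborel) = (\<integral>\<^sup>+x. ennreal (indicator {a..b} x * h x) \<partial>lborel)"
      by (intro nn_integral_cong) (simp add: indicator_def)
    then show ?thesis using bdd_borel_nn_integral[OF h(1), of a b] h(2) by simp
  qed
  have add: "(\<integral>\<^sup>+x. indicator S x * ennreal (h x) \<partial>lborel) < \<infinity>"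
    if "S \<subseteq> A \<union> {a..b}" "A \<in> sets borel" "(\<integral>\<^sup>+x. indicator A x * ennreal (h x) \<partial>lborel) < \<infinity>" for S A a b
  proof -
    note [measurable] = that(2)
    have "(\<integral>\<^sup>+x. indicator S x * ennreal (h x) \<partial>lborel) \<le> (\<integral>\<^sup>+x. indicator A x * ennreal (h x) + indicator {a..b} x * ennreal (h x) \<partial>lborel)"
      using that(1) by (intro nn_integral_mono) (auto simp: indicator_def)
    also have "\<dots> = (\<integral>\<^sup>+x. indicator A x * ennreal (h x) \<partial>lborel) + (\<integral>\<^sup>+x. indicator {a..b} x * ennreal (h x) \<partial>lborel)"
      by (rule nn_integral_add) measurable
    also have "\<dots> < \<infinity>" using that(3) fin by simp
    finally show ?thesis .
  qed
  show "(\<integral>\<^sup>+x. indicator {..<0} x * ennreal (h x) \<partial>lborel) < \<infinity> \<Longrightarrow> (\<integral>\<^sup>+x. indicator {..b} x * ennreal (h x) \<partial>lborel) < \<infinity>"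
    by (rule add[of _ "{..<0}" 0 b]) auto
  show "(\<integral>\<^sup>+x. indicator {0<..} x * ennreal (h x) \<partial>lborel) < \<infinity> \<Longrightarrow> (\<integral>\<^sup>+x. indicator {-b..} x * ennreal (h x) \<partial>lborel) < \<infinity>"
    by (rule add[of _ "{0<..}" "-b" 0]) auto
qed

lemma integral_le_half_line:
  assumes h: "bdd_borel h" "\<And>x::real. 0 \<le> h x" and K: "0 \<le> K"
  shows "(\<integral>\<^sup>+x. indicator {0<..} x * ennreal (h x) \<partial>lborel) \<le> ennreal K \<Longrightarrow> 0 \<le> a \<Longrightarrow> integral {a..b} h \<le> K"
    and "(\<integral>\<^sup>+x. indicator {..<0} x * ennreal (h x) \<partial>lborel) \<le> ennreal K \<Longrightarrow> b \<le> 0 \<Longrightarrow> integral {a..b} h \<le> K"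
proof -
  have ne: "AE x::real in lborel. x \<noteq> 0" by (rule AE_lborel_singleton)
  have *: "integral {a..b} h \<le> K" if S: "(\<integral>\<^sup>+x. indicator S x * ennreal (h x) \<partial>lborel) \<le> ennreal K" "{a..b} \<subseteq> insert 0 S" for S
  proof -
    have "ennreal (integral {a..b} h) = (\<integral>\<^sup>+x. ennreal (indicator {a..b} x * h x) \<partial>lborel)"
      by (rule bdd_borel_nn_integral[OF h(1) h(2), symmetric])
    also have "\<dots> \<le> (\<integral>\<^sup>+x. indicator S x * ennreal (h x) \<partial>lborel)"
      by (rule nn_integral_mono_AE, rule AE_mp[OF ne], rule AE_I2) (use S(2) in \<open>auto simp: indicator_def\<close>)
    finally show ?thesis using S(1) K by (meson ennreal_le_iff order_trans)
  qed
  show "(\<integral>\<^sup>+x. indicator {0<..} x * ennreal (h x) \<partial>lborel) \<le> ennreal K \<Longrightarrow> 0 \<le> a \<Longrightarrow> integral {a..b} h \<le> K"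
    by (rule *) auto
  show "(\<integral>\<^sup>+x. indicator {..<0} x * ennreal (h x) \<partial>lborel) \<le> ennreal K \<Longrightarrow> b \<le> 0 \<Longrightarrow> integral {a..b} h \<le> K"
    by (rule *) auto
qed

text \<open>The weight is at least 1/2 on \<open>S\<close>, hence the factor 2. The loss is
  harmless: this bound only serves to control tails uniformly in time.\<close>

lemma contraction_from_weight:
  assumes [measurable]: "h \<in> borel_measurable borel" "W \<in> borel_measurable borel" "S \<in> sets borel"
    and h: "\<And>x. 0 \<le> h x" and W: "\<And>x. x \<in> S \<Longrightarrow> 1 / 2 \<le> W x" "\<And>x. 0 \<le> W x"
    and le: "(\<integral>\<^sup>+x. ennreal (h x * W x) \<partial>lborel) \<le> (\<integral>\<^sup>+x. ennreal (h0 x * indicator S0 x) \<partial>lborel)"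
  shows "(\<integral>\<^sup>+x. indicator S x * ennreal (h x) \<partial>lborel) \<le> 2 * (\<integral>\<^sup>+x. indicator S0 x * ennreal (h0 x) \<partial>lborel)"
proof -
  have "(\<integral>\<^sup>+x. indicator S x * ennreal (h x) \<partial>lborel) \<le> (\<integral>\<^sup>+x. 2 * ennreal (h x * W x) \<partial>lborel)"
  proof (rule nn_integral_mono)
    fix x
    show "indicator S x * ennreal (h x) \<le> 2 * ennreal (h x * W x)"
    proof (cases "x \<in> S")
      case True
      then have "h x * (1/2) \<le> h x * W x" by (intro mult_left_mono W h)
      then have "ennreal (h x) \<le> ennreal (2 * (h x * W x))" by (intro ennreal_leI) simp
      then show ?thesis using True by (simp add: ennreal_mult' h W)
    qed simp
  qed
  also have "\<dots> = 2 * (\<integral>\<^sup>+x. ennreal (h x * W x) \<partial>lborel)"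
    by (rule nn_integral_cmult) measurable
  also have "\<dots> \<le> 2 * (\<integral>\<^sup>+x. ennreal (h0 x * indicator S0 x) \<partial>lborel)"
    by (intro mult_left_mono le) simp
  also have "(\<integral>\<^sup>+x. ennreal (h0 x * indicator S0 x) \<partial>lborel) = (\<integral>\<^sup>+x. indicator S0 x * ennreal (h0 x) \<partial>lborel)"
    by (intro nn_integral_cong) (simp add: indicator_def)
  finally show ?thesis .
qed

locale entropy_cauchy = entropy_solution +
  fixes um up :: real
  assumes um_up: "um \<le> up" and um_le: "\<bar>um\<bar> \<le> C" and up_le: "\<bar>up\<bar> \<le> C"
    and init_left: "(\<integral>\<^sup>+x. indicator {..<0} x * ennreal \<bar>v 0 x - um\<bar> \<partial>lborel) < \<infinity>"
    and init_right: "(\<integral>\<^sup>+x. indicator {0<..} x * ennreal \<bar>v 0 x - up\<bar> \<partial>lborel) < \<infinity>"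
begin

text \<open>Cones whose ends may run to infinity. Fatou handles the later time and the majorant
  \<open>W0\<close> the earlier one, so the inequality holds between extended integrals that may be
  infinite.\<close>

lemma cone_fatou:
  assumes g: "lipschitz_fun g" "lipschitz_fun q" and e: "entropy_ineq g q"
    and q: "\<And>y. \<bar>y\<bar> \<le> C \<Longrightarrow> \<bar>q y\<bar> \<le> L * g y" and g0: "\<And>y. 0 \<le> g y"
    and st: "0 \<le> s" "s \<le> t" and ab: "\<And>n::nat. \<alpha> n \<le> \<beta> n"
    and lim: "\<And>x. (\<lambda>n. indicator {\<alpha> n..\<beta> n} x * (ramp (x - \<alpha> n - L * (t - s)) * ramp (\<beta> n - L * (t - s) - x))) \<longlonglongrightarrow> W x"
    and le: "\<And>n x. x \<in> {\<alpha> n..\<beta> n} \<Longrightarrow> ramp (x - \<alpha> n) * ramp (\<beta> n - x) \<le> W0 x"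
    and W0: "\<And>x. 0 \<le> W0 x"
  shows "(\<integral>\<^sup>+x. ennreal (g (v t x) * W x) \<partial>lborel) \<le> (\<integral>\<^sup>+x. ennreal (g (v s x) * W0 x) \<partial>lborel)"
proof -
  have t0: "0 \<le> t" using st by simp
  have [measurable]: "ramp \<in> borel_measurable borel"
    by (rule borel_measurable_continuous_onI[OF ramp_continuous(1)])
  have r01: "0 \<le> ramp x" "ramp x \<le> 1" for x by (rule ramp_bounds)+
  define h where "h a b x = ramp (x - a) * ramp (b - x)" for a b x
  have hb: "bdd_borel (h a b)" for a b
  proof (rule bdd_borelI)
    show "h a b \<in> borel_measurable borel" unfolding h_def[abs_def] by measurable
    show "\<bar>h a b z\<bar> \<le> 1" for z using r01[of "z - a"] r01[of "b - z"] by (simp add: h_def abs_mult mult_le_one)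
  qed
  have h0: "0 \<le> h a b x" for a b x using r01 by (simp add: h_def)
  define \<Delta> where "\<Delta> = L * (t - s)"
  define F where "F n x = ennreal (indicator {\<alpha> n..\<beta> n} x * (g (v t x) * h (\<alpha> n + \<Delta>) (\<beta> n - \<Delta>) x))" for n x
  note bt = g_v_bdd[OF g(1) t0] and bs = g_v_bdd[OF g(1) st(1)]
  have [measurable]: "F n \<in> borel_measurable borel" for n
    unfolding F_def[abs_def] using bdd_borelD[OF bt] bdd_borelD[OF hb[of "\<alpha> n + \<Delta>" "\<beta> n - \<Delta>"]] by measurable
  have limF: "(\<lambda>n. F n x) \<longlonglongrightarrow> ennreal (g (v t x) * W x)" for x
  proof -
    have "(\<lambda>n. g (v t x) * (indicator {\<alpha> n..\<beta> n} x * (ramp (x - \<alpha> n - L * (t - s)) * ramp (\<beta> n - L * (t - s) - x)))) \<longlonglongrightarrow> g (v t x) * W x"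
      by (intro tendsto_intros lim)
    then have "(\<lambda>n. indicator {\<alpha> n..\<beta> n} x * (g (v t x) * h (\<alpha> n + \<Delta>) (\<beta> n - \<Delta>) x)) \<longlonglongrightarrow> g (v t x) * W x"
      unfolding h_def \<Delta>_def by (simp add: mult_ac diff_diff_eq)
    then show ?thesis unfolding F_def by (rule tendsto_ennrealI)
  qed
  have "(\<integral>\<^sup>+x. ennreal (g (v t x) * W x) \<partial>lborel) = (\<integral>\<^sup>+x. liminf (\<lambda>n. F n x) \<partial>lborel)"
    by (intro nn_integral_cong lim_imp_Liminf[symmetric] limF) simp
  also have "\<dots> \<le> liminf (\<lambda>n. \<integral>\<^sup>+x. F n x \<partial>lborel)" by (rule nn_integral_liminf) simp
  also have "\<dots> \<le> liminf (\<lambda>n. (\<integral>\<^sup>+x. ennreal (g (v s x) * W0 x) \<partial>lborel))"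
  proof (rule Liminf_mono, intro always_eventually allI)
    fix n
    have "(\<integral>\<^sup>+x. F n x \<partial>lborel) = ennreal (integral {\<alpha> n..\<beta> n} (\<lambda>x. g (v t x) * h (\<alpha> n + \<Delta>) (\<beta> n - \<Delta>) x))"
      unfolding F_def by (rule bdd_borel_nn_integral[OF bdd_borel_mult[OF bt hb]]) (simp add: g0 h0)
    also have "\<dots> \<le> ennreal (integral {\<alpha> n..\<beta> n} (\<lambda>x. g (v s x) * h (\<alpha> n) (\<beta> n) x))"
      using cone_contraction[OF g e q st ab[of n]] unfolding h_def \<Delta>_def by (intro ennreal_leI) (simp add: diff_diff_eq)
    also have "\<dots> = (\<integral>\<^sup>+x. ennreal (indicator {\<alpha> n..\<beta> n} x * (g (v s x) * h (\<alpha> n) (\<beta> n) x)) \<partial>lborel)"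
      by (rule bdd_borel_nn_integral[OF bdd_borel_mult[OF bs hb], symmetric]) (simp add: g0 h0)
    also have "\<dots> \<le> (\<integral>\<^sup>+x. ennreal (g (v s x) * W0 x) \<partial>lborel)"
      by (intro nn_integral_mono ennreal_leI) 
        (auto simp: indicator_def h_def g0 W0 intro!: mult_left_mono le)
    finally show "(\<integral>\<^sup>+x. F n x \<partial>lborel) \<le> (\<integral>\<^sup>+x. ennreal (g (v s x) * W0 x) \<partial>lborel)" .
  qed
  also have "\<dots> = (\<integral>\<^sup>+x. ennreal (g (v s x) * W0 x) \<partial>lborel)" by (simp add: Liminf_const)
  finally show ?thesis .
qed

lemma contraction_whole_line:
  assumes g: "lipschitz_fun g" "lipschitz_fun q" and e: "entropy_ineq g q"
    and q: "\<And>y. \<bar>y\<bar> \<le> C \<Longrightarrow> \<bar>q y\<bar> \<le> L * g y" and g0: "\<And>y. 0 \<le> g y"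
    and st: "0 \<le> s" "s \<le> t"
  shows "(\<integral>\<^sup>+x. ennreal (g (v t x)) \<partial>lborel) \<le> (\<integral>\<^sup>+x. ennreal (g (v s x)) \<partial>lborel)"
proof -
  have "(\<integral>\<^sup>+x. ennreal (g (v t x) * 1) \<partial>lborel) \<le> (\<integral>\<^sup>+x. ennreal (g (v s x) * 1) \<partial>lborel)"
  proof (rule cone_fatou[OF g e q g0 st, where \<alpha> = "\<lambda>n. - real n" and \<beta> = "\<lambda>n. real n"])
    fix x
    obtain N :: nat where N: "\<bar>x\<bar> \<le> real N" using real_arch_simple by blast
    have l1: "(\<lambda>n. ramp (real n + (x - L * (t - s))) * ramp (real n + (- L * (t - s) - x))) \<longlonglongrightarrow> 1 * 1"
      by (intro tendsto_mult ramp_sequence)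
    have ev: "\<forall>\<^sub>F n in sequentially. ramp (real n + (x - L * (t - s))) * ramp (real n + (- L * (t - s) - x)) =
       indicator {- real n..real n} x * (ramp (x - - real n - L * (t - s)) * ramp (real n - L * (t - s) - x))"
      using eventually_ge_at_top[of N]
    proof eventually_elim
      case (elim n)
      then have "x \<in> {- real n..real n}" using N by (auto simp: abs_le_iff)
      then show ?case by (simp add: algebra_simps)
    qed
    show "(\<lambda>n. indicator {- real n..real n} x * (ramp (x - - real n - L * (t - s)) * ramp (real n - L * (t - s) - x))) \<longlonglongrightarrow> 1"
      using Lim_transform_eventually[OF l1 ev] by simp
  qed (auto intro!: mult_le_one ramp_bounds)
  then show ?thesis by simp
qed

lemma contraction_left:
  assumes g: "lipschitz_fun g" "lipschitz_fun q" and e: "entropy_ineq g q"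
    and q: "\<And>y. \<bar>y\<bar> \<le> C \<Longrightarrow> \<bar>q y\<bar> \<le> L * g y" and g0: "\<And>y. 0 \<le> g y" and t: "0 \<le> t"
  shows "(\<integral>\<^sup>+x. indicator {..<0} x * ennreal (g (v t x)) \<partial>lborel) \<le> 2 * (\<integral>\<^sup>+x. indicator {..L * t + 1} x * ennreal (g (v 0 x)) \<partial>lborel)"
proof -
  note [measurable] = bdd_borelD[OF g_v_bdd[OF g(1) t]] bdd_borelD[OF g_v_bdd[OF g(1) order_refl]]
  have [measurable]: "ramp \<in> borel_measurable borel"
    by (rule borel_measurable_continuous_onI[OF ramp_continuous(1)])
  \<comment> \<open>By time \<open>t\<close> the right flank has moved from \<open>b\<close> by
    \<open>L * t\<close>, which leaves the weight \<open>ramp (1 - x)\<close>: at least 1/2 for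
    \<open>x < 0\<close>, and 0 beyond \<open>b\<close>.\<close>
  define b where "b = L * t + 1"
  have b: "0 \<le> b" unfolding b_def using L_nonneg t by simp
  have "(\<integral>\<^sup>+x. ennreal (g (v t x) * ramp (1 - x)) \<partial>lborel) \<le> (\<integral>\<^sup>+x. ennreal (g (v 0 x) * indicator {..b} x) \<partial>lborel)"
  proof (rule cone_fatou[OF g e q g0 order_refl t, where \<alpha> = "\<lambda>n. - real n" and \<beta> = "\<lambda>n. b"])
    fix x
    obtain N :: nat where N: "\<bar>x\<bar> \<le> real N" using real_arch_simple by blast
    have l1: "(\<lambda>n. indicator {..b} x * (ramp (real n + (x - L * (t - 0))) * ramp (1 - x))) \<longlonglongrightarrow> indicator {..b} x * (1 * ramp (1 - x))"
      by (intro tendsto_mult ramp_sequence tendsto_const)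
    have eq: "indicator {..b} x * (1 * ramp (1 - x)) = ramp (1 - x)"
      using mult_nonneg_nonneg[OF L_nonneg t] ramp_bounds(4)[of "1 - x"] by (auto simp: indicator_def b_def)
    have ev: "\<forall>\<^sub>F n in sequentially. indicator {..b} x * (ramp (real n + (x - L * (t - 0))) * ramp (1 - x)) =
       indicator {- real n..b} x * (ramp (x - - real n - L * (t - 0)) * ramp (b - L * (t - 0) - x))"
      using eventually_ge_at_top[of N]
    proof eventually_elim
      case (elim n)
      then have "- real n \<le> x" using N by (auto simp: abs_le_iff)
      then show ?case by (simp add: algebra_simps b_def indicator_def)
    qed
    show "(\<lambda>n. indicator {- real n..b} x * (ramp (x - - real n - L * (t - 0)) * ramp (b - L * (t - 0) - x))) \<longlonglongrightarrow> ramp (1 - x)"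
      using Lim_transform_eventually[OF l1 ev] unfolding eq .
  qed (use b in \<open>auto intro!: mult_le_one ramp_bounds\<close>)
  then show ?thesis unfolding b_def
    by (intro contraction_from_weight[where W = "\<lambda>x. ramp (1 - x)"] g0 ramp_bounds(1) ramp_ge_half) auto
qed

lemma contraction_right:
  assumes g: "lipschitz_fun g" "lipschitz_fun q" and e: "entropy_ineq g q"
    and q: "\<And>y. \<bar>y\<bar> \<le> C \<Longrightarrow> \<bar>q y\<bar> \<le> L * g y" and g0: "\<And>y. 0 \<le> g y" and t: "0 \<le> t"
  shows "(\<integral>\<^sup>+x. indicator {0<..} x * ennreal (g (v t x)) \<partial>lborel) \<le> 2 * (\<integral>\<^sup>+x. indicator {- (L * t + 1)..} x * ennreal (g (v 0 x)) \<partial>lborel)"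
proof -
  note [measurable] = bdd_borelD[OF g_v_bdd[OF g(1) t]] bdd_borelD[OF g_v_bdd[OF g(1) order_refl]]
  have [measurable]: "ramp \<in> borel_measurable borel"
    by (rule borel_measurable_continuous_onI[OF ramp_continuous(1)])
  define b where "b = L * t + 1"
  have b: "0 \<le> b" unfolding b_def using L_nonneg t by simp
  have "(\<integral>\<^sup>+x. ennreal (g (v t x) * ramp (1 + x)) \<partial>lborel) \<le> (\<integral>\<^sup>+x. ennreal (g (v 0 x) * indicator {-b..} x) \<partial>lborel)"
  proof (rule cone_fatou[OF g e q g0 order_refl t, where \<alpha> = "\<lambda>n. - b" and \<beta> = "\<lambda>n. real n"])
    fix x
    obtain N :: nat where N: "\<bar>x\<bar> \<le> real N" using real_arch_simple by blast
    have l1: "(\<lambda>n. indicator {-b..} x * (ramp (1 + x) * ramp (real n + (- L * (t - 0) - x)))) \<longlonglongrightarrow> indicator {-b..} x * (ramp (1 + x) * 1)"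
      by (intro tendsto_mult ramp_sequence tendsto_const)
    have eq: "indicator {-b..} x * (ramp (1 + x) * 1) = ramp (1 + x)"
      using mult_nonneg_nonneg[OF L_nonneg t] ramp_bounds(4)[of "1 + x"] by (auto simp: indicator_def b_def)
    have ev: "\<forall>\<^sub>F n in sequentially. indicator {-b..} x * (ramp (1 + x) * ramp (real n + (- L * (t - 0) - x))) =
       indicator {-b..real n} x * (ramp (x - - b - L * (t - 0)) * ramp (real n - L * (t - 0) - x))"
      using eventually_ge_at_top[of N]
    proof eventually_elim
      case (elim n)
      then have "x \<le> real n" using N by (auto simp: abs_le_iff)
      then show ?case by (simp add: algebra_simps b_def indicator_def)
    qed
    show "(\<lambda>n. indicator {-b..real n} x * (ramp (x - - b - L * (t - 0)) * ramp (real n - L * (t - 0) - x))) \<longlonglongrightarrow> ramp (1 + x)"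
      using Lim_transform_eventually[OF l1 ev] unfolding eq .
  qed (use b in \<open>auto intro!: mult_le_one ramp_bounds\<close>)
  then show ?thesis unfolding b_def
    by (intro contraction_from_weight[where W = "\<lambda>x. ramp (1 + x)"] g0 ramp_bounds(1) ramp_ge_half) auto
qed

lemma ent_levels:
  assumes "\<bar>c\<bar> \<le> C" shows "entropy_ineq (pos c) (fpos c)" "entropy_ineq (neg c) (fneg c)"
  using ent_pos[OF assms] ent_neg[OF assms] unfolding pos_def[abs_def] neg_def[abs_def] fpos_def[abs_def] fneg_def[abs_def] .

text \<open>One constant serves all times up to \<open>T\<close> because the domains of dependence
  of both half-lines at these times are contained in those at time \<open>T\<close>. They overlap
  the opposite half-line in a bounded segment, where boundedness of the data gives a finite
  contribution.\<close>

lemma tail_bounds: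
  assumes T: "0 \<le> T"
  obtains K where "0 \<le> K"
    "\<And>\<tau>. 0 \<le> \<tau> \<Longrightarrow> \<tau> \<le> T \<Longrightarrow> (\<integral>\<^sup>+x. indicator {..<0} x * ennreal (pos um (v \<tau> x)) \<partial>lborel) \<le> ennreal K"
    "\<And>\<tau>. 0 \<le> \<tau> \<Longrightarrow> \<tau> \<le> T \<Longrightarrow> (\<integral>\<^sup>+x. indicator {..<0} x * ennreal (neg um (v \<tau> x)) \<partial>lborel) \<le> ennreal K"
    "\<And>\<tau>. 0 \<le> \<tau> \<Longrightarrow> \<tau> \<le> T \<Longrightarrow> (\<integral>\<^sup>+x. indicator {0<..} x * ennreal (pos up (v \<tau> x)) \<partial>lborel) \<le> ennreal K"
    "\<And>\<tau>. 0 \<le> \<tau> \<Longrightarrow> \<tau> \<le> T \<Longrightarrow> (\<integral>\<^sup>+x. indicator {0<..} x * ennreal (neg up (v \<tau> x)) \<partial>lborel) \<le> ennreal K"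
proof -
  define b where "b = L * T + 1"
  have abs_ge: "pos um y \<le> \<bar>y - um\<bar>" "neg um y \<le> \<bar>y - um\<bar>" "pos up y \<le> \<bar>y - up\<bar>" "neg up y \<le> \<bar>y - up\<bar>" for y
    by (auto simp: pos_def neg_def)
  define Il where "Il g = (\<integral>\<^sup>+x. indicator {..b} x * ennreal (g (v 0 x)) \<partial>lborel)" for g
  define Ir where "Ir g = (\<integral>\<^sup>+x. indicator {-b..} x * ennreal (g (v 0 x)) \<partial>lborel)" for g
  have fin: "Il (pos um) < \<infinity>" "Il (neg um) < \<infinity>" "Ir (pos up) < \<infinity>" "Ir (neg up) < \<infinity>"
  proof -
    have l: "(\<integral>\<^sup>+x. indicator {..<0} x * ennreal (g (v 0 x)) \<partial>lborel) < \<infinity>" if "\<And>y. g y \<le> \<bar>y - um\<bar>" for g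
      by (rule le_less_trans[OF nn_integral_mono init_left]) (intro mult_left_mono ennreal_leI that, simp)
    have r: "(\<integral>\<^sup>+x. indicator {0<..} x * ennreal (g (v 0 x)) \<partial>lborel) < \<infinity>" if "\<And>y. g y \<le> \<bar>y - up\<bar>" for g
      by (rule le_less_trans[OF nn_integral_mono init_right]) (intro mult_left_mono ennreal_leI that, simp)
    show "Il (pos um) < \<infinity>" unfolding Il_def
      by (rule half_line_finite(1)[OF pos_neg_bdd(1)[OF um_le order_refl] _ l]) (simp_all add: level_facts abs_ge)
    show "Il (neg um) < \<infinity>" unfolding Il_def
      by (rule half_line_finite(1)[OF pos_neg_bdd(2)[OF um_le order_refl] _ l]) (simp_all add: level_facts abs_ge)
    show "Ir (pos up) < \<infinity>" unfolding Ir_def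
      by (rule half_line_finite(2)[OF pos_neg_bdd(1)[OF up_le order_refl] _ r]) (simp_all add: level_facts abs_ge)
    show "Ir (neg up) < \<infinity>" unfolding Ir_def
      by (rule half_line_finite(2)[OF pos_neg_bdd(2)[OF up_le order_refl] _ r]) (simp_all add: level_facts abs_ge)
  qed
  define K where "K = enn2real (2 * (Il (pos um) + Il (neg um) + (Ir (pos up) + Ir (neg up))))"
  have K: "ennreal K = 2 * (Il (pos um) + Il (neg um) + (Ir (pos up) + Ir (neg up)))"
    unfolding K_def using fin by (intro ennreal_enn2real) (simp add: ennreal_mult_less_top)
  have Kge: "2 * Il (pos um) \<le> ennreal K" "2 * Il (neg um) \<le> ennreal K" "2 * Ir (pos up) \<le> ennreal K" "2 * Ir (neg up) \<le> ennreal K"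
    unfolding K by (intro mult_left_mono; simp add: add_increasing add_increasing2)+
  have step_l: "(\<integral>\<^sup>+x. indicator {..<0} x * ennreal (g (v \<tau> x)) \<partial>lborel) \<le> 2 * Il g"
    if "lipschitz_fun g" "lipschitz_fun q" "entropy_ineq g q" "\<And>y. \<bar>y\<bar> \<le> C \<Longrightarrow> \<bar>q y\<bar> \<le> L * g y" "\<And>y. 0 \<le> g y" "0 \<le> \<tau>" "\<tau> \<le> T" for g q \<tau>
  proof -
    have "L * \<tau> + 1 \<le> b" unfolding b_def using that(7) L_nonneg by (simp add: mult_left_mono)
    then have "(\<integral>\<^sup>+x. indicator {..L * \<tau> + 1} x * ennreal (g (v 0 x)) \<partial>lborel) \<le> Il g"
      unfolding Il_def by (intro nn_integral_mono mult_right_mono) (auto simp: indicator_def)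
    then show ?thesis using contraction_left[OF that(1-6)] by (meson mult_left_mono order_trans zero_le)
  qed
  have step_r: "(\<integral>\<^sup>+x. indicator {0<..} x * ennreal (g (v \<tau> x)) \<partial>lborel) \<le> 2 * Ir g"
    if "lipschitz_fun g" "lipschitz_fun q" "entropy_ineq g q" "\<And>y. \<bar>y\<bar> \<le> C \<Longrightarrow> \<bar>q y\<bar> \<le> L * g y" "\<And>y. 0 \<le> g y" "0 \<le> \<tau>" "\<tau> \<le> T" for g q \<tau>
  proof -
    have "L * \<tau> + 1 \<le> b" unfolding b_def using that(7) L_nonneg by (simp add: mult_left_mono)
    then have "(\<integral>\<^sup>+x. indicator {- (L * \<tau> + 1)..} x * ennreal (g (v 0 x)) \<partial>lborel) \<le> Ir g"
      unfolding Ir_def by (intro nn_integral_mono mult_right_mono) (auto simp: indicator_def)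
    then show ?thesis using contraction_right[OF that(1-6)] by (meson mult_left_mono order_trans zero_le)
  qed
  note lm = lipschitz_levels[OF um_le] and lp = lipschitz_levels[OF up_le]
  show thesis
  proof (rule that[of K])
    show "0 \<le> K" unfolding K_def by simp
    fix \<tau> assume \<tau>: "0 \<le> \<tau>" "\<tau> \<le> T"
    show "(\<integral>\<^sup>+x. indicator {..<0} x * ennreal (pos um (v \<tau> x)) \<partial>lborel) \<le> ennreal K"
      by (rule order_trans[OF step_l[OF lm(1) lm(3) ent_levels(1)[OF um_le] flux_le(1)[OF um_le] level_facts(3) \<tau>] Kge(1)])
    show "(\<integral>\<^sup>+x. indicator {..<0} x * ennreal (neg um (v \<tau> x)) \<partial>lborel) \<le> ennreal K"
      by (rule order_trans[OF step_l[OF lm(2) lm(4) ent_levels(2)[OF um_le] flux_le(2)[OF um_le] level_facts(4) \<tau>] Kge(2)])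
    show "(\<integral>\<^sup>+x. indicator {0<..} x * ennreal (pos up (v \<tau> x)) \<partial>lborel) \<le> ennreal K"
      by (rule order_trans[OF step_r[OF lp(1) lp(3) ent_levels(1)[OF up_le] flux_le(1)[OF up_le] level_facts(3) \<tau>] Kge(3)])
    show "(\<integral>\<^sup>+x. indicator {0<..} x * ennreal (neg up (v \<tau> x)) \<partial>lborel) \<le> ennreal K"
      by (rule order_trans[OF step_r[OF lp(2) lp(4) ent_levels(2)[OF up_le] flux_le(2)[OF up_le] level_facts(4) \<tau>] Kge(4)])
  qed
qed

section \<open>The minimal energy of a level decreases\<close>

text \<open>This is \<open>\<integral>\<^bsub>0\<^esub>\<^bsup>y\<^esup> (v - c)\<close> for \<open>y\<close> of either sign, one of the two integrals being over the empty set.\<close>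

definition primitive :: "real \<Rightarrow> real \<Rightarrow> real \<Rightarrow> real" where
  "primitive t c y = integral {0..y} (\<lambda>z. v t z - c) - integral {y..0} (\<lambda>z. v t z - c)"

text \<open>This is the functional \<open>E\<^sub>c(t, y)\<close> of the level decomposition,
  without cutoff. Extended values allow Tonelli and Fatou to be applied directly.\<close>

definition sharp_energy :: "real \<Rightarrow> real \<Rightarrow> real \<Rightarrow> ennreal" where
  "sharp_energy t c y = (\<integral>\<^sup>+x. indicator {..<y} x * ennreal (pos c (v t x)) \<partial>lborel) +
     (\<integral>\<^sup>+x. indicator {y<..} x * ennreal (neg c (v t x)) \<partial>lborel)"

lemma v_minus_bdd: "0 \<le> t \<Longrightarrow> bdd_borel (\<lambda>z. v t z - c)"
  by (intro bdd_borel_diff v_bdd bdd_borel_const)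

lemma primitive_diff:
  assumes t: "0 \<le> t" and ab: "a \<le> b"
  shows "primitive t c b - primitive t c a = integral {a..b} (\<lambda>z. v t z - c)"
proof -
  let ?h = "\<lambda>z. v t z - c"
  have i: "?h integrable_on {x..y}" for x y by (rule bdd_borel_integrable_on(1)[OF v_minus_bdd[OF t]])
  have comb: "integral {x..y} ?h + integral {y..z} ?h = integral {x..z} ?h" if "x \<le> y" "y \<le> z" for x y z
    by (rule Henstock_Kurzweil_Integration.integral_combine[OF that i])
  have emp: "integral {x..y} ?h = 0" if "y \<le> x" for x y
    using that by (cases "x = y") auto
  consider "0 \<le> a" | "a \<le> 0" "0 \<le> b" | "b \<le> 0" using ab by linarith
  then show ?thesis
  proof cases
    case 1 then show ?thesis using comb[of 0 a b] ab emp[where x = a and y = 0] emp[where x = b and y = 0] unfolding primitive_def by simp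
  next
    case 2 then show ?thesis using comb[of a 0 b] emp[where x = a and y = 0] emp[where x = 0 and y = a] emp[where x = b and y = 0] unfolding primitive_def by simp
  next
    case 3 then show ?thesis using comb[of a b 0] ab emp[where x = b and y = 0] emp[where x = 0 and y = b] emp[where x = 0 and y = a] unfolding primitive_def by simp
  qed
qed

lemma primitive_0: "primitive t c 0 = 0"
  by (simp add: primitive_def)

text \<open>Coercivity: on the right \<open>v - c\<close> is at least \<open>up - c > 0\<close> up
  to a function with integral at most \<open>K\<close>, and symmetrically on the left, so the
  primitive is at least \<open>d * \<bar>x\<bar> - K\<close>.\<close>

lemma primitive_far:
  assumes c: "um < c" "c < up" and t: "0 \<le> t"
  shows "\<exists>R0>0. \<forall>x. R0 \<le> \<bar>x\<bar> \<longrightarrow> B \<le> primitive t c x"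
proof -
  obtain K where K0: "0 \<le> K"
    "\<And>\<tau>. 0 \<le> \<tau> \<Longrightarrow> \<tau> \<le> t \<Longrightarrow> (\<integral>\<^sup>+x. indicator {..<0} x * ennreal (pos um (v \<tau> x)) \<partial>lborel) \<le> ennreal K"
    "\<And>\<tau>. 0 \<le> \<tau> \<Longrightarrow> \<tau> \<le> t \<Longrightarrow> (\<integral>\<^sup>+x. indicator {0<..} x * ennreal (neg up (v \<tau> x)) \<partial>lborel) \<le> ennreal K"
    by (rule tail_bounds[OF t]) (rule that; assumption)
  note K = K0(1) K0(2,3)[OF t order_refl]
  note bl = pos_neg_bdd(1)[OF um_le t] and br = pos_neg_bdd(2)[OF up_le t]
  note i = bdd_borel_integrable_on(1)
  define d where "d = min (c - um) (up - c)"
  have d: "0 < d" using c unfolding d_def by simp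
  define R0 where "R0 = max 1 ((K + \<bar>B\<bar>) / d)"
  have "B \<le> primitive t c x" if x: "R0 \<le> \<bar>x\<bar>" for x
  proof -
    have "(K + \<bar>B\<bar>) / d \<le> \<bar>x\<bar>" "1 \<le> \<bar>x\<bar>" using x unfolding R0_def by auto
    then have dx: "K + \<bar>B\<bar> \<le> d * \<bar>x\<bar>" using d by (simp add: divide_le_eq mult.commute)
    show ?thesis
    proof (cases "0 < x")
      case True
      have "integral {0..x} (\<lambda>z. (up - c) - neg up (v t z)) \<le> integral {0..x} (\<lambda>z. v t z - c)"
        by (rule integral_le[OF i[OF bdd_borel_diff[OF bdd_borel_const br]] i[OF v_minus_bdd[OF t]]])
           (auto simp: neg_def)
      moreover have "integral {0..x} (\<lambda>z. (up - c) - neg up (v t z)) = (up - c) * x - integral {0..x} (\<lambda>z. neg up (v t z))"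
        using Henstock_Kurzweil_Integration.integral_diff[OF i[OF bdd_borel_const] i[OF br], of 0 x "up - c"] True by simp
      moreover have "integral {0..x} (\<lambda>z. neg up (v t z)) \<le> K"
        by (rule integral_le_half_line(1)[OF br level_facts(4) K(1,3)]) simp
      moreover have "d * \<bar>x\<bar> \<le> (up - c) * x" using True unfolding d_def by (simp add: mult_right_mono)
      moreover have "primitive t c x = integral {0..x} (\<lambda>z. v t z - c)" using True by (simp add: primitive_def)
      ultimately show ?thesis using dx by linarith
    next
      case False
      then have x0: "x < 0" using \<open>1 \<le> \<bar>x\<bar>\<close> by linarith
      have "integral {x..0} (\<lambda>z. v t z - c) \<le> integral {x..0} (\<lambda>z. (um - c) + pos um (v t z))"
        by (rule integral_le[OF i[OF v_minus_bdd[OF t]] i[OF bdd_borel_add[OF bdd_borel_const bl]]])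
           (auto simp: pos_def)
      moreover have "integral {x..0} (\<lambda>z. (um - c) + pos um (v t z)) = (um - c) * (- x) + integral {x..0} (\<lambda>z. pos um (v t z))"
        using Henstock_Kurzweil_Integration.integral_add[OF i[OF bdd_borel_const] i[OF bl], of x 0 "um - c"] x0 by simp
      moreover have "integral {x..0} (\<lambda>z. pos um (v t z)) \<le> K"
        by (rule integral_le_half_line(2)[OF bl level_facts(3) K(1,2)]) simp
      moreover have "d * \<bar>x\<bar> \<le> (c - um) * (- x)" using x0 unfolding d_def by (simp add: mult_right_mono)
      moreover have "primitive t c x = - integral {x..0} (\<lambda>z. v t z - c)" using x0 by (simp add: primitive_def)
      moreover have "(um - c) * (- x) = - ((c - um) * (- x))" by (simp add: algebra_simps)
      ultimately show ?thesis using dx by linarith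
    qed
  qed
  then show ?thesis by (intro exI[of _ R0]) (auto simp: R0_def)
qed

lemma primitive_continuous: assumes t: "0 \<le> t" shows "continuous_on S (primitive t c)"
proof -
  obtain H where H: "H \<ge> 0" "\<And>z. \<bar>v t z - c\<bar> \<le> H" using bdd_borelE[OF v_minus_bdd[OF t, of c]] by blast
  have lip: "\<bar>primitive t c b - primitive t c a\<bar> \<le> H * \<bar>b - a\<bar>" for a b
  proof -
    have *: "\<bar>primitive t c b - primitive t c a\<bar> \<le> H * (b - a)" if "a \<le> b" for a b
      unfolding primitive_diff[OF t that] by (rule integral_Icc_bound[OF v_minus_bdd[OF t] that H(2)])
    show ?thesis using *[of a b] *[of b a] by (cases "a \<le> b") auto
  qed
  show ?thesis
    using lip by (intro lipschitz_on_continuous_on[of H] lipschitz_onI) (auto simp: dist_real_def H)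
qed

lemma primitive_argmin:
  assumes c: "um < c" "c < up" and t: "0 \<le> t"
  shows "\<exists>y. \<forall>x. primitive t c y \<le> primitive t c x"
proof -
  obtain R0 where R0: "R0 > 0" "\<And>x. R0 \<le> \<bar>x\<bar> \<Longrightarrow> 0 \<le> primitive t c x" using primitive_far[OF c t] by blast
  obtain y where y: "y \<in> {-R0..R0}" "\<And>x. x \<in> {-R0..R0} \<Longrightarrow> primitive t c y \<le> primitive t c x"
    using continuous_attains_inf[of "{-R0..R0}" "primitive t c"] primitive_continuous[OF t] R0(1) by auto
  have "primitive t c y \<le> primitive t c x" for x
  proof (cases "\<bar>x\<bar> \<le> R0")
    case True then show ?thesis by (intro y(2)) auto
  next
    case False
    have "primitive t c y \<le> 0" using y(2)[of 0] R0(1) by (simp add: primitive_0)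
    then show ?thesis using R0(2)[of x] False by simp
  qed
  then show ?thesis by blast
qed

lemma level_energy_nn:
  assumes c: "\<bar>c\<bar> \<le> C" and \<tau>: "0 \<le> \<tau>" and R: "0 < R" and y: "\<bar>y\<bar> \<le> R"
  shows "ennreal (level_energy c R \<tau> y) = (\<integral>\<^sup>+x. ennreal (indicator {-2*R..y} x * (pos c (v \<tau> x) * cutoff_ext R x)) \<partial>lborel)
     + (\<integral>\<^sup>+x. ennreal (indicator {y..2*R} x * (neg c (v \<tau> x) * cutoff_ext R x)) \<partial>lborel)"
proof -
  note bp = bdd_borel_mult[OF pos_neg_bdd(1)[OF c \<tau>] ext_bdd_borel(3)[OF R]]
    and bn = bdd_borel_mult[OF pos_neg_bdd(2)[OF c \<tau>] ext_bdd_borel(3)[OF R]]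
  have cut0: "0 \<le> cutoff_ext R x" for x using cutoff_props(4)[OF R, of x] by (simp add: cutoff_ext_def)
  have p0: "0 \<le> pos c (v \<tau> x) * cutoff_ext R x" "0 \<le> neg c (v \<tau> x) * cutoff_ext R x" for x by (intro mult_nonneg_nonneg level_facts cut0)+
  have 1: "integral {-2*R..y} (\<lambda>x. pos c (v \<tau> x) * cutoff R x) = integral {-2*R..y} (\<lambda>x. pos c (v \<tau> x) * cutoff_ext R x)"
    using y by (intro integral_cong) (auto simp: cutoff_ext_def)
  have 2: "integral {y..2*R} (\<lambda>x. neg c (v \<tau> x) * cutoff R x) = integral {y..2*R} (\<lambda>x. neg c (v \<tau> x) * cutoff_ext R x)"
    using y by (intro integral_cong) (auto simp: cutoff_ext_def)
  show ?thesis unfolding level_energy_def 1 2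
    by (simp only: ennreal_plus[OF integral_nonneg[OF bdd_borel_integrable_on(1)[OF bp] p0(1)] integral_nonneg[OF bdd_borel_integrable_on(1)[OF bn] p0(2)]]
      bdd_borel_nn_integral[OF bp p0(1)] bdd_borel_nn_integral[OF bn p0(2)])
qed

text \<open>\<open>level_limit\<close> with \<open>R\<close> to infinity. At time \<open>s\<close>
  the cutoff energy is below the sharp one because the cutoff is at most 1; at time \<open>t\<close>
  Fatou recovers the sharp energy; the flanks contribute \<open>\<kappa> / R\<close>.\<close>

lemma sharp_energy_mono:
  assumes c: "um < c" "c < up" and st: "0 \<le> s" "s \<le> t"
    and ystar: "\<And>x. primitive t c ystar \<le> primitive t c x"
  shows "sharp_energy t c ystar \<le> sharp_energy s c y"
proof (rule ennreal_le_epsilon)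
  fix e :: real assume e: "0 < e"
  have cC: "\<bar>c\<bar> \<le> C" using c um_le up_le by auto
  have t0: "0 \<le> t" using st by simp
  note l = lipschitz_levels[OF cC]
  note [measurable] = bdd_borelD[OF pos_neg_bdd(1)[OF cC t0]] bdd_borelD[OF pos_neg_bdd(2)[OF cC t0]]
     bdd_borelD[OF pos_neg_bdd(1)[OF cC st(1)]] bdd_borelD[OF pos_neg_bdd(2)[OF cC st(1)]]
  obtain B3 where B3: "\<And>\<epsilon> k \<tau> x. kernel \<epsilon> k \<Longrightarrow> 0 < \<epsilon> \<Longrightarrow> \<bar>moll k (fpos c) \<tau> x\<bar> \<le> B3" using moll_bounded[OF l(3)] by metis
  obtain B4 where B4: "\<And>\<epsilon> k \<tau> x. kernel \<epsilon> k \<Longrightarrow> 0 < \<epsilon> \<Longrightarrow> \<bar>moll k (fneg c) \<tau> x\<bar> \<le> B4" using moll_bounded[OF l(4)] by metis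
  have FB: "\<bar>moll k (fpos c) \<tau> x - moll k (fneg c) \<tau> x\<bar> \<le> B3 + B4" if "kernel \<epsilon> k" "0 < \<epsilon>" for \<epsilon> k \<tau> x
    using B3[OF that, of \<tau> x] B4[OF that, of \<tau> x] by linarith
  obtain R0 where R0: "R0 > 0" "\<And>x. R0 \<le> \<bar>x\<bar> \<Longrightarrow> 1 + (B3 + B4) * (t - s) \<le> primitive t c x"
    using primitive_far[OF c t0] by blast
  obtain K where K: "0 \<le> K"
    "\<And>\<tau>. 0 \<le> \<tau> \<Longrightarrow> \<tau> \<le> t \<Longrightarrow> (\<integral>\<^sup>+x. indicator {..<0} x * ennreal (pos um (v \<tau> x)) \<partial>lborel) \<le> ennreal K"
    "\<And>\<tau>. 0 \<le> \<tau> \<Longrightarrow> \<tau> \<le> t \<Longrightarrow> (\<integral>\<^sup>+x. indicator {0<..} x * ennreal (neg up (v \<tau> x)) \<partial>lborel) \<le> ennreal K"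
    by (rule tail_bounds[OF t0]) (rule that; assumption)
  \<comment> \<open>Slopes at most \<open>2 / R\<close>, speed \<open>L\<close>, a tail bound
    \<open>K\<close> for each side, and the duration.\<close>
  define \<kappa> where "\<kappa> = 2 * L * (K + K) * (t - s)"
  have \<kappa>: "0 \<le> \<kappa>" unfolding \<kappa>_def using L_nonneg K st by simp
  have bound: "ennreal (level_energy c R t ystar) \<le> sharp_energy s c y + ennreal e"
    if R: "R0 \<le> R" "\<bar>y\<bar> \<le> R" "\<bar>ystar\<bar> \<le> R" "\<kappa> / e \<le> R" for R
  proof -
    have Rpos: "0 < R" using R R0 by simp
    have W: "integral {-2*R..x} (\<lambda>z. v t z - c) = primitive t c x - primitive t c (-2*R)" if "\<bar>x\<bar> \<le> 2*R" for x
      using primitive_diff[OF t0, of "-2*R" x c] that by (simp add: abs_le_iff)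
    have "level_energy c R t ystar \<le> level_energy c R s y + (2 * L / R * (K + K)) * (t - s)"
    proof (rule level_limit[OF cC st R0(1) R(1-3) _ FB])
      show "integral {-2*R..ystar} (\<lambda>z. v t z - c) \<le> integral {-2*R..x} (\<lambda>z. v t z - c)" if "\<bar>x\<bar> \<le> R" for x
      proof -
        have "\<bar>x\<bar> \<le> 2*R" "\<bar>ystar\<bar> \<le> 2*R" using that R Rpos by auto
        then show ?thesis using W[of x] W[of ystar] ystar[of x] by linarith
      qed
      show "integral {-2*R..0} (\<lambda>z. v t z - c) + 1 + (B3 + B4) * (t - s) \<le> integral {-2*R..x} (\<lambda>z. v t z - c)"
        if "\<bar>x\<bar> \<le> 2*R" "R0 \<le> \<bar>x\<bar>" for x
      proof -
        have "\<bar>0::real\<bar> \<le> 2*R" using Rpos by simp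
        from W[OF this] show ?thesis using R0(2)[OF that(2)] W[OF that(1)] primitive_0[of t c] by linarith
      qed
      fix \<tau> assume \<tau>: "\<tau> \<in> {s..t}"
      then have \<tau>0: "0 \<le> \<tau>" "\<tau> \<le> t" using st by auto
      let ?hl = "\<lambda>x. indicator {..<0} x * pos um (v \<tau> x)" and ?hr = "\<lambda>x. indicator {0<..} x * neg up (v \<tau> x)"
      have bi: "bdd_borel (indicator S :: real \<Rightarrow> real)" if "S \<in> sets borel" for S
        using that by (intro bdd_borelI[of _ 1]) auto
      have bl: "bdd_borel ?hl" by (rule bdd_borel_mult[OF bi pos_neg_bdd(1)[OF um_le \<tau>0(1)]]) simp
      have br: "bdd_borel ?hr" by (rule bdd_borel_mult[OF bi pos_neg_bdd(2)[OF up_le \<tau>0(1)]]) simp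
      have half: "integral {-2*R..2*R} (\<lambda>x. indicator S x * h x) \<le> K"
        if b: "bdd_borel (\<lambda>x. indicator S x * h x)" and h: "\<And>x. 0 \<le> h x" and k: "(\<integral>\<^sup>+x. indicator S x * ennreal (h x) \<partial>lborel) \<le> ennreal K" for S h
      proof -
        have "ennreal (integral {-2*R..2*R} (\<lambda>x. indicator S x * h x)) = (\<integral>\<^sup>+x. ennreal (indicator {-2*R..2*R} x * (indicator S x * h x)) \<partial>lborel)"
          by (rule bdd_borel_nn_integral[OF b, symmetric]) (simp add: h)
        also have "\<dots> \<le> (\<integral>\<^sup>+x. indicator S x * ennreal (h x) \<partial>lborel)"
          by (intro nn_integral_mono) (simp add: indicator_def)
        finally show ?thesis using k K(1) by (meson ennreal_le_iff order_trans)
      qed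
      have "integral {-2*R..2*R} (\<lambda>x. \<bar>fpos c (v \<tau> x)\<bar> * slope_left R x + \<bar>fneg c (v \<tau> x)\<bar> * slope_right R x)
         \<le> integral {-2*R..2*R} (\<lambda>x. 2 * L / R * (?hl x + ?hr x))"
      proof (rule integral_le)
        show "(\<lambda>x. 2 * L / R * (?hl x + ?hr x)) integrable_on {-2*R..2*R}"
          by (rule bdd_borel_integrable_on(1)[OF bdd_borel_mult[OF bdd_borel_const bdd_borel_add[OF bl br]]])
        show "(\<lambda>x. \<bar>fpos c (v \<tau> x)\<bar> * slope_left R x + \<bar>fneg c (v \<tau> x)\<bar> * slope_right R x) integrable_on {-2*R..2*R}"
        proof (rule integrable_eq)
          show "(\<lambda>x. \<bar>fpos c (v \<tau> x)\<bar> * slope_left_ext R x + \<bar>fneg c (v \<tau> x)\<bar> * slope_right_ext R x) integrable_on {-2*R..2*R}"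
            by (rule bdd_borel_integrable_on(1)[OF bdd_borel_add[OF bdd_borel_mult[OF bdd_borel_abs[OF pos_neg_bdd(3)[OF cC \<tau>0(1)]] ext_bdd_borel(1)[OF Rpos]]
              bdd_borel_mult[OF bdd_borel_abs[OF pos_neg_bdd(4)[OF cC \<tau>0(1)]] ext_bdd_borel(2)[OF Rpos]]]])
        qed (auto simp: slope_left_ext_def slope_right_ext_def)
        fix x assume x: "x \<in> {-2*R..2*R}"
        have sl: "0 \<le> slope_left R x" "slope_left R x \<le> 2 / R" "0 \<le> slope_right R x" "slope_right R x \<le> 2 / R"
          using cutoff_props[OF Rpos] x by auto
        \<comment> \<open>Since \<open>um < c < up\<close>, the one-sided quantities at level
          \<open>c\<close> are dominated by those at the end states, whose tails are bounded
          uniformly in \<open>\<tau>\<close>.\<close>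
        have fl: "\<bar>fpos c (v \<tau> x)\<bar> \<le> L * pos um (v \<tau> x)" "\<bar>fneg c (v \<tau> x)\<bar> \<le> L * neg up (v \<tau> x)"
        proof -
          have "pos c (v \<tau> x) \<le> pos um (v \<tau> x)" "neg c (v \<tau> x) \<le> neg up (v \<tau> x)"
            using c by (auto simp: pos_def neg_def)
          then show "\<bar>fpos c (v \<tau> x)\<bar> \<le> L * pos um (v \<tau> x)" "\<bar>fneg c (v \<tau> x)\<bar> \<le> L * neg up (v \<tau> x)"
            using order_trans[OF flux_le(1)[OF cC v_le] mult_left_mono[OF _ L_nonneg]]
              order_trans[OF flux_le(2)[OF cC v_le] mult_left_mono[OF _ L_nonneg]] by blast+
        qed
        have "\<bar>fpos c (v \<tau> x)\<bar> * slope_left R x \<le> 2 * L / R * ?hl x"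
        proof (cases "x < 0")
          case True
          have "\<bar>fpos c (v \<tau> x)\<bar> * slope_left R x \<le> (L * pos um (v \<tau> x)) * (2 / R)"
            by (rule mult_mono[OF fl(1) sl(2)]) (use sl L_nonneg level_facts in auto)
          then show ?thesis using True by (simp add: mult_ac)
        next
          case False
          then show ?thesis using cutoff_props(8)[OF Rpos, of x] Rpos by simp
        qed
        moreover have "\<bar>fneg c (v \<tau> x)\<bar> * slope_right R x \<le> 2 * L / R * ?hr x"
        proof (cases "0 < x")
          case True
          have "\<bar>fneg c (v \<tau> x)\<bar> * slope_right R x \<le> (L * neg up (v \<tau> x)) * (2 / R)"
            by (rule mult_mono[OF fl(2) sl(4)]) (use sl L_nonneg level_facts in auto)
          then show ?thesis using True by (simp add: mult_ac)
        next
          case False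
          then show ?thesis using cutoff_props(9)[OF Rpos, of x] Rpos by simp
        qed
        ultimately show "\<bar>fpos c (v \<tau> x)\<bar> * slope_left R x + \<bar>fneg c (v \<tau> x)\<bar> * slope_right R x \<le> 2 * L / R * (?hl x + ?hr x)"
          unfolding distrib_left by (rule add_mono)
      qed
      also have "\<dots> = 2 * L / R * (integral {-2*R..2*R} ?hl + integral {-2*R..2*R} ?hr)"
        by (simp only: Henstock_Kurzweil_Integration.integral_mult_right Henstock_Kurzweil_Integration.integral_add[OF bdd_borel_integrable_on(1)[OF bl] bdd_borel_integrable_on(1)[OF br]])
      also have "\<dots> \<le> 2 * L / R * (K + K)"
        using L_nonneg Rpos by (intro mult_left_mono add_mono half bl br level_facts K(2,3) \<tau>0) auto
      finally show "integral {-2*R..2*R} (\<lambda>x. \<bar>fpos c (v \<tau> x)\<bar> * slope_left R x + \<bar>fneg c (v \<tau> x)\<bar> * slope_right R x) \<le> 2 * L / R * (K + K)" .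
    qed
    also have "(2 * L / R * (K + K)) * (t - s) = \<kappa> / R" unfolding \<kappa>_def by simp
    also have "\<kappa> / R \<le> e" using R(4) e Rpos by (simp add: divide_le_eq mult.commute)
    finally have "ennreal (level_energy c R t ystar) \<le> ennreal (level_energy c R s y + e)" by (intro ennreal_leI) simp
    also have "\<dots> \<le> ennreal (level_energy c R s y) + ennreal e"
    proof -
      have "ennreal (a + e) \<le> ennreal a + ennreal e" for a
      proof -
        have "ennreal (a + e) \<le> ennreal (max 0 a + e)" by (intro ennreal_leI) simp
        also have "\<dots> = ennreal (max 0 a) + ennreal e" using e by (intro ennreal_plus) auto
        also have "ennreal (max 0 a) = ennreal a" by (simp add: max_def ennreal_neg)
        finally show ?thesis .
      qed
      then show ?thesis .
    qed
    also have "ennreal (level_energy c R s y) \<le> sharp_energy s c y"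
    proof -
      \<comment> \<open>The energies use closed and open intervals at \<open>y\<close> respectively;
        a single point makes the difference.\<close>
      have ne: "AE x in lborel. x \<noteq> y" by (rule AE_lborel_singleton)
      have cut01: "0 \<le> cutoff_ext R x" "cutoff_ext R x \<le> 1" for x using cutoff_props(4,5)[OF Rpos, of x] by (auto simp: cutoff_ext_def)
      have m: "h * cutoff_ext R x \<le> h" "0 \<le> h * cutoff_ext R x" if "0 \<le> h" for h x using cut01[of x] that by (auto simp: mult_left_le)
      show ?thesis unfolding level_energy_nn[OF cC st(1) Rpos R(2)] sharp_energy_def
        by (intro add_mono nn_integral_mono_AE; rule AE_mp[OF ne]; rule AE_I2)
           (auto simp: indicator_def level_facts intro!: ennreal_leI m)
    qed
    finally show ?thesis by (simp add: add_right_mono)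
  qed
  \<comment> \<open>Evaluated at \<open>Suc n\<close> only: at radius 0 the formula of
    \<open>cutoff\<close> would divide by 0.\<close>
  define F where "F n x = ennreal (indicator {-2*real n..ystar} x * (pos c (v t x) * cutoff_ext n x)) + ennreal (indicator {ystar..2*real n} x * (neg c (v t x) * cutoff_ext n x))" for n x
  have [measurable]: "cutoff_ext (real (Suc n)) \<in> borel_measurable borel" for n
    by (rule bdd_borelD[OF ext_bdd_borel(3)]) simp
  have Fm[measurable]: "F (Suc n) \<in> borel_measurable borel" for n unfolding F_def[abs_def] by measurable
  define G where "G x = indicator {..<ystar} x * ennreal (pos c (v t x)) + indicator {ystar<..} x * ennreal (neg c (v t x))" for x
  have "sharp_energy t c ystar = (\<integral>\<^sup>+x. G x \<partial>lborel)"
    unfolding sharp_energy_def G_def by (rule nn_integral_add[symmetric]) measurable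
  also have "\<dots> \<le> (\<integral>\<^sup>+x. liminf (\<lambda>n. F (Suc n) x) \<partial>lborel)"
  proof (rule nn_integral_mono)
    fix x
    obtain N :: nat where N: "\<bar>x\<bar> \<le> real N" using real_arch_simple by blast
    show "G x \<le> liminf (\<lambda>n. F (Suc n) x)"
    proof (rule Liminf_bounded)
      show "\<forall>\<^sub>F n in sequentially. G x \<le> F (Suc n) x"
        using eventually_ge_at_top[of N]
      proof eventually_elim
        case (elim n)
        then have n: "\<bar>x\<bar> \<le> real (Suc n)" using N by simp
        then have "cutoff_ext (real (Suc n)) x = 1" using cutoff_props(1)[of "real (Suc n)" x] by (simp add: cutoff_ext_def)
        moreover have "- 2 * real (Suc n) \<le> x" "x \<le> 2 * real (Suc n)" using n by auto
        ultimately show ?case unfolding G_def F_def by (auto simp: indicator_def)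
      qed
    qed
  qed
  also have "\<dots> \<le> liminf (\<lambda>n. \<integral>\<^sup>+x. F (Suc n) x \<partial>lborel)" by (rule nn_integral_liminf) simp
  also have "\<dots> \<le> liminf (\<lambda>n::nat. sharp_energy s c y + ennreal e)"
  proof (rule Liminf_mono)
    obtain N :: nat where N: "max (max R0 (\<kappa> / e)) (max \<bar>y\<bar> \<bar>ystar\<bar>) \<le> real N" using real_arch_simple by blast
    show "\<forall>\<^sub>F n in sequentially. (\<integral>\<^sup>+x. F (Suc n) x \<partial>lborel) \<le> sharp_energy s c y + ennreal e"
      using eventually_ge_at_top[of N]
    proof eventually_elim
      case (elim n)
      have n: "real N \<le> real (Suc n)" using elim by simp
      have ys: "\<bar>ystar\<bar> \<le> real (Suc n)" using N n by linarith
      have "(\<integral>\<^sup>+x. F (Suc n) x \<partial>lborel) = ennreal (level_energy c (real (Suc n)) t ystar)"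
      proof -
        have [measurable]: "cutoff_ext (real (Suc n)) \<in> borel_measurable borel" using bdd_borelD[OF ext_bdd_borel(3)[of "real (Suc n)"]] by simp
        have "0 < real (Suc n)" by simp
        show ?thesis unfolding F_def level_energy_nn[OF cC t0 \<open>0 < real (Suc n)\<close> ys] by (rule nn_integral_add) measurable
      qed
      then show ?case using bound[of "real (Suc n)"] N n by auto
    qed
  qed
  also have "\<dots> = sharp_energy s c y + ennreal e" by (simp add: Liminf_const)
  finally show "sharp_energy t c ystar \<le> sharp_energy s c y + ennreal e" .
qed

end

section \<open>Layer cake\<close>

text \<open>Passes from the completed, restricted measure to extended integrals over
  \<open>lborel\<close>, where Tonelli and the layer cake formula are available.\<close>

lemma L2_on_iff_finite:
  fixes g :: "real \<Rightarrow> real"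
  assumes [measurable]: "g \<in> borel_measurable borel" "S \<in> sets borel"
  shows "L2_on S g \<longleftrightarrow> (\<integral>\<^sup>+x. indicator S x * ennreal ((g x)\<^sup>2) \<partial>lborel) < \<infinity>"
proof -
  have "g \<in> borel_measurable (lebesgue_on S)"
    by (intro measurable_restrict_space1 measurable_completion) simp
  moreover have "integrable (lebesgue_on S) (\<lambda>x. (g x)\<^sup>2) \<longleftrightarrow> integrable lebesgue (\<lambda>x. indicator S x *\<^sub>R (g x)\<^sup>2)"
    by (rule integrable_restrict_space) simp
  moreover have "\<dots> \<longleftrightarrow> integrable lborel (\<lambda>x. indicator S x *\<^sub>R (g x)\<^sup>2)"
    by (rule integrable_completion) measurable
  moreover have "\<dots> \<longleftrightarrow> (\<integral>\<^sup>+x. indicator S x * ennreal ((g x)\<^sup>2) \<partial>lborel) < \<infinity>"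
  proof -
    have "(\<integral>\<^sup>+x. ennreal (norm (indicator S x *\<^sub>R (g x)\<^sup>2)) \<partial>lborel) = (\<integral>\<^sup>+x. indicator S x * ennreal ((g x)\<^sup>2) \<partial>lborel)"
      by (intro nn_integral_cong) (simp add: indicator_def)
    then show ?thesis by (simp add: integrable_iff_bounded)
  qed
  ultimately show ?thesis unfolding L2_on_def by simp
qed

lemma L2_norm_eq:
  assumes [measurable]: "g \<in> borel_measurable borel"
  shows "L2_norm g = (if (\<integral>\<^sup>+x. ennreal ((g x)\<^sup>2) \<partial>lborel) < \<infinity>
     then ennreal (sqrt (enn2real (\<integral>\<^sup>+x. ennreal ((g x)\<^sup>2) \<partial>lborel))) else \<infinity>)"
proof -
  have "(LINT x|lebesgue. (g x)\<^sup>2) = (LINT x|lborel. (g x)\<^sup>2)"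
    by (rule integral_completion) measurable
  also have "\<dots> = enn2real (\<integral>\<^sup>+x. ennreal ((g x)\<^sup>2) \<partial>lborel)"
    by (rule integral_eq_nn_integral) auto
  finally show ?thesis unfolding L2_norm_def by (simp add: L2_on_iff_finite)
qed

lemma L2_norm_mono:
  assumes "g \<in> borel_measurable borel" "h \<in> borel_measurable borel"
    and "(\<integral>\<^sup>+x. ennreal ((g x)\<^sup>2) \<partial>lborel) \<le> (\<integral>\<^sup>+x. ennreal ((h x)\<^sup>2) \<partial>lborel)"
  shows "L2_norm g \<le> L2_norm h"
  unfolding L2_norm_eq[OF assms(1)] L2_norm_eq[OF assms(2)]
  using assms(3) by (auto intro!: ennreal_leI real_sqrt_le_mono enn2real_mono simp: less_top[symmetric] top_unique)

text \<open>The contribution of level \<open>c\<close> to \<open>(y - b)\<^sup>2 / 2\<close>: only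
  levels between \<open>b\<close> and \<open>y\<close> count, each with its distance to
  \<open>y\<close>. What matters is that for fixed \<open>c\<close> the value \<open>b\<close>
  enters only through the truth of \<open>c < b\<close>.\<close>

definition penalty :: "real \<Rightarrow> real \<Rightarrow> real \<Rightarrow> real" where
  "penalty c b y = (if c < b then max 0 (c - y) else max 0 (y - c))"

lemma layer_cake_square:
  "(\<integral>\<^sup>+c. ennreal (penalty c b y) \<partial>lborel) = ennreal ((y - b)\<^sup>2 / 2)"
proof (cases "b \<le> y")
  case True
  have "(\<integral>\<^sup>+c. ennreal (penalty c b y) \<partial>lborel) = (\<integral>\<^sup>+c. ennreal (y - c) * indicator {b..y} c \<partial>lborel)"
    using True by (intro nn_integral_cong) (auto simp: penalty_def indicator_def)
  also have "\<dots> = ennreal (- ((y - y)\<^sup>2 / 2) - (- ((y - b)\<^sup>2 / 2)))"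
    by (rule nn_integral_FTC_Icc[where F = "\<lambda>c. - ((y - c)\<^sup>2 / 2)"]) (use True in \<open>auto intro!: derivative_eq_intros simp: field_simps\<close>)
  finally show ?thesis by simp
next
  case False
  have "(\<integral>\<^sup>+c. ennreal (penalty c b y) \<partial>lborel) = (\<integral>\<^sup>+c. ennreal (c - y) * indicator {y..b} c \<partial>lborel)"
    by (rule nn_integral_cong_AE, rule AE_mp[OF AE_lborel_singleton[of b]], rule AE_I2)
       (use False in \<open>auto simp: penalty_def indicator_def\<close>)
  also have "\<dots> = ennreal ((b - y)\<^sup>2 / 2 - (y - y)\<^sup>2 / 2)"
    by (rule nn_integral_FTC_Icc[where F = "\<lambda>c. (c - y)\<^sup>2 / 2"]) (use False in \<open>auto intro!: derivative_eq_intros simp: field_simps\<close>)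
  finally show ?thesis by (simp add: power2_commute)
qed

lemma layer_cake_L2:
  assumes [measurable]: "h \<in> borel_measurable borel" "b \<in> borel_measurable borel"
  shows "(\<integral>\<^sup>+x. ennreal ((h x - b x)\<^sup>2) \<partial>lborel) = 2 * (\<integral>\<^sup>+c. (\<integral>\<^sup>+x. ennreal (penalty c (b x) (h x)) \<partial>lborel) \<partial>lborel)"
proof -
  have "(\<integral>\<^sup>+x. ennreal ((h x - b x)\<^sup>2) \<partial>lborel) = (\<integral>\<^sup>+x. 2 * ennreal ((h x - b x)\<^sup>2 / 2) \<partial>lborel)"
    by (intro nn_integral_cong) (simp add: ennreal_mult'[symmetric] flip: ennreal_numeral)
  also have "\<dots> = 2 * (\<integral>\<^sup>+x. ennreal ((h x - b x)\<^sup>2 / 2) \<partial>lborel)"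
    by (rule nn_integral_cmult) measurable
  also have "(\<integral>\<^sup>+x. ennreal ((h x - b x)\<^sup>2 / 2) \<partial>lborel) = (\<integral>\<^sup>+x. (\<integral>\<^sup>+c. ennreal (penalty c (b x) (h x)) \<partial>lborel) \<partial>lborel)"
    by (simp add: layer_cake_square)
  also have "\<dots> = (\<integral>\<^sup>+c. (\<integral>\<^sup>+x. ennreal (penalty c (b x) (h x)) \<partial>lborel) \<partial>lborel)"
    unfolding penalty_def by (rule lborel_pair.Fubini'[symmetric]) measurable
  finally show ?thesis .
qed

context entropy_cauchy
begin

lemma primitive_level:
  assumes t: "0 \<le> t" shows "primitive t c' y = primitive t c y - (c' - c) * y"
proof -
  have *: "integral {a..b} (\<lambda>z. v t z - c') = integral {a..b} (\<lambda>z. v t z - c) - (c' - c) * (if a \<le> b then b - a else 0)" for a b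
  proof -
    have "integral {a..b} (\<lambda>z. (v t z - c) - (c' - c)) = integral {a..b} (\<lambda>z. v t z - c) - integral {a..b} (\<lambda>z. c' - c)"
      by (rule Henstock_Kurzweil_Integration.integral_diff[OF bdd_borel_integrable_on(1)[OF v_minus_bdd[OF t]] bdd_borel_integrable_on(1)[OF bdd_borel_const]])
    then show ?thesis by (simp add: mult.commute)
  qed
  show ?thesis using *[of 0 y] *[of y 0] unfolding primitive_def
    by (cases "0 \<le> y"; cases "y = 0") (auto simp: algebra_simps)
qed

text \<open>Raising the level from \<open>c\<close> to \<open>c'\<close> tilts the primitive by
  \<open>- (c' - c) * y\<close>. Adding the two minimality conditions leaves
  \<open>(c' - c) * (y - y') \<le> 0\<close>, whichever minimisers were chosen.\<close>

lemma argmin_mono: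
  assumes t: "0 \<le> t" and cc: "c < c'"
    and y: "\<And>x. primitive t c y \<le> primitive t c x" and y': "\<And>x. primitive t c' y' \<le> primitive t c' x"
  shows "y \<le> y'"
proof -
  have "(c' - c) * (y - y') \<le> 0"
    using y[of y'] y'[of y] primitive_level[OF t, of c' y c] primitive_level[OF t, of c' y' c] by (simp add: algebra_simps)
  then show ?thesis using cc by (simp add: mult_le_0_iff)
qed

lemma penalty_split:
  assumes "0 \<le> t" and "AE x in lborel. c < b x \<longleftrightarrow> y < x" 
    and [measurable]: "b \<in> borel_measurable borel" and c: "\<bar>c\<bar> \<le> C"
  shows "(\<integral>\<^sup>+x. ennreal (penalty c (b x) (v t x)) \<partial>lborel) = sharp_energy t c y"
proof -
  note [measurable] = bdd_borelD[OF pos_neg_bdd(1)[OF c assms(1)]] bdd_borelD[OF pos_neg_bdd(2)[OF c assms(1)]]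
  have ne: "AE x in lborel. x \<noteq> y" by (rule AE_lborel_singleton)
  have "(\<integral>\<^sup>+x. ennreal (penalty c (b x) (v t x)) \<partial>lborel) =
     (\<integral>\<^sup>+x. indicator {..<y} x * ennreal (pos c (v t x)) + indicator {y<..} x * ennreal (neg c (v t x)) \<partial>lborel)"
  proof (rule nn_integral_cong_AE)
    show "AE x in lborel. ennreal (penalty c (b x) (v t x)) =
       indicator {..<y} x * ennreal (pos c (v t x)) + indicator {y<..} x * ennreal (neg c (v t x))"
      using assms(2) ne by eventually_elim (auto simp: penalty_def pos_def neg_def indicator_def)
  qed
  also have "\<dots> = sharp_energy t c y" unfolding sharp_energy_def by (rule nn_integral_add) measurable
  finally show ?thesis .
qed

text \<open>Levels outside \<open>[um, up]\<close> have their minimum at \<open>y = \<plusminus>\<infinity>\<close>, where the energy is one-sided.\<close>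

lemma outer_levels:
  assumes st: "0 \<le> s" "s \<le> t"
  shows "up < c \<Longrightarrow> (\<integral>\<^sup>+x. ennreal (pos c (v t x)) \<partial>lborel) \<le> (\<integral>\<^sup>+x. ennreal (pos c (v s x)) \<partial>lborel)"
    and "c < um \<Longrightarrow> (\<integral>\<^sup>+x. ennreal (neg c (v t x)) \<partial>lborel) \<le> (\<integral>\<^sup>+x. ennreal (neg c (v s x)) \<partial>lborel)"
proof -
  show "(\<integral>\<^sup>+x. ennreal (pos c (v t x)) \<partial>lborel) \<le> (\<integral>\<^sup>+x. ennreal (pos c (v s x)) \<partial>lborel)" if "up < c"
  proof (cases "c \<le> C")
    case True
    then have c: "\<bar>c\<bar> \<le> C" using that up_le by auto
    show ?thesis
      by (rule contraction_whole_line[OF lipschitz_levels(1,3)[OF c] ent_levels(1)[OF c] flux_le(1)[OF c] level_facts(3) st])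
  next
    case False
    have "v t x \<le> c" for x using v_le[of t x] False by linarith
    then show ?thesis by (simp add: pos_def)
  qed
  show "(\<integral>\<^sup>+x. ennreal (neg c (v t x)) \<partial>lborel) \<le> (\<integral>\<^sup>+x. ennreal (neg c (v s x)) \<partial>lborel)" if "c < um"
  proof (cases "- C \<le> c")
    case True
    then have c: "\<bar>c\<bar> \<le> C" using that um_le by auto
    show ?thesis
      by (rule contraction_whole_line[OF lipschitz_levels(2,4)[OF c] ent_levels(2)[OF c] flux_le(2)[OF c] level_facts(4) st])
  next
    case False
    have "c \<le> v t x" for x using v_le[of t x] False by linarith
    then show ?thesis by (simp add: neg_def)
  qed
qed

text \<open>The new profile is made from the minimisers at time \<open>t\<close> and depends neither
  on \<open>s\<close> nor on \<open>b\<close>. The hypotheses \<open>lim\<close> make the superlevel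
  sets of \<open>b\<close> at inner levels half-lines with a finite end point, so that each has a
  sharp energy to compare with.\<close>

lemma L2_nearest_profile:
  assumes st: "0 \<le> s" "s \<le> t" and b: "mono b" "\<And>x. um \<le> b x" "\<And>x. b x \<le> up"
    and lim: "\<And>c. um < c \<Longrightarrow> c < up \<Longrightarrow> \<exists>x. b x \<le> c" "\<And>c. um < c \<Longrightarrow> c < up \<Longrightarrow> \<exists>x. c < b x"
  shows "\<exists>b'. mono b' \<and> (\<forall>x. um \<le> b' x \<and> b' x \<le> up) \<and>
    (\<integral>\<^sup>+x. ennreal ((v t x - b' x)\<^sup>2) \<partial>lborel) \<le> (\<integral>\<^sup>+x. ennreal ((v s x - b x)\<^sup>2) \<partial>lborel)"
proof -
  have t0: "0 \<le> t" using st by simp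
  note [measurable] = v_borel[OF t0] v_borel[OF st(1)] borel_measurable_mono[OF b(1)]
  define Y where "Y c = (SOME y. \<forall>x. primitive t c y \<le> primitive t c x)" for c
  have Y: "primitive t c (Y c) \<le> primitive t c x" if "um < c" "c < up" for c x
    using someI_ex[OF primitive_argmin[OF that t0]] unfolding Y_def by blast
  have Ymono: "Y c \<le> Y c'" if "um < c" "c \<le> c'" "c' < up" for c c'
  proof (cases "c = c'")
    case False
    then show ?thesis using that by (intro argmin_mono[OF t0 _ Y Y]) auto
  qed simp
  \<comment> \<open>The profile whose superlevel set \<open>{b' > c}\<close> is \<open>{Y c <..}\<close> for almost every \<open>c\<close>.\<close>
  define A where "A x = insert um {c. um < c \<and> c < up \<and> Y c < x}" for x
  \<comment> \<open>The inserted \<open>um\<close> keeps the set non-empty and is the value of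
    \<open>b'\<close> where no inner level is exceeded.\<close>
  define b' where "b' x = Sup (A x)" for x
  have A_le: "c \<le> up" if "c \<in> A x" for c x using that um_up unfolding A_def by auto
  have bdd: "bdd_above (A x)" for x using A_le by (meson bdd_above.I)
  have A_b': "c \<le> b' x" if "c \<in> A x" for c x unfolding b'_def by (rule cSup_upper[OF that bdd])
  have b'_bounds: "um \<le> b' x" "b' x \<le> up" for x
    using A_b'[of um x] cSup_least[of "A x" up] A_le by (auto simp: A_def b'_def)
  have b'_mono: "mono b'"
    unfolding b'_def by (intro monoI cSup_subset_mono bdd) (auto simp: A_def)
  note [measurable] = borel_measurable_mono[OF b'_mono]
  \<comment> \<open>Trivial for fixed \<open>x\<close>; exchanging the quantifiers by Tonelli shows
    that almost every level set of \<open>b'\<close> is null, so \<open>b' x > c\<close> and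
    \<open>b' x \<ge> c\<close> need not be told apart.\<close>
  have "AE x in lborel. AE c in lborel. b' x \<noteq> c"
  proof (rule AE_I2)
    fix x show "AE c in lborel. b' x \<noteq> c"
      using AE_lborel_singleton[of "b' x"] by eventually_elim auto
  qed
  then have ae_c: "AE c in lborel. AE x in lborel. b' x \<noteq> c"
    by (subst (asm) lborel_pair.AE_commute) measurable
  have level: "AE c in lborel. (\<integral>\<^sup>+x. ennreal (penalty c (b' x) (v t x)) \<partial>lborel) \<le> (\<integral>\<^sup>+x. ennreal (penalty c (b x) (v s x)) \<partial>lborel)"
    using ae_c AE_lborel_singleton[of um] AE_lborel_singleton[of up]
  proof eventually_elim
    case (elim c)
    consider "c < um" | "up < c" | "um < c" "c < up" using elim by linarith
    then show ?case
    proof cases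
      case 1
      then have "c < b x" "c < b' x" for x using b(2)[of x] b'_bounds(1)[of x] by auto
      then show ?thesis using outer_levels(2)[OF st 1] by (simp add: penalty_def neg_def)
    next
      case 2
      then have "\<not> c < b x" "\<not> c < b' x" for x using b(3)[of x] b'_bounds(2)[of x] by auto
      then show ?thesis using outer_levels(1)[OF st 2] by (simp add: penalty_def pos_def)
    next
      case 3
      have c: "\<bar>c\<bar> \<le> C" using 3 um_le up_le by auto
      define S where "S = {x. c < b x}"
      obtain x1 where x1: "b x1 \<le> c" using lim(1)[OF 3] by blast
      have "x1 \<le> x" if "x \<in> S" for x using that x1 monoD[OF b(1), of x x1] unfolding S_def by fastforce
      then have bb: "bdd_below S" by (meson bdd_below.I)
      have ne: "S \<noteq> {}" using lim(2)[OF 3] unfolding S_def by blast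
      have "AE x in lborel. c < b x \<longleftrightarrow> Inf S < x"
      proof (rule AE_mp[OF AE_lborel_singleton[of "Inf S"]], rule AE_I2, rule impI)
        fix x assume x: "x \<noteq> Inf S"
        show "c < b x \<longleftrightarrow> Inf S < x"
        proof
          assume "c < b x"
          then have "Inf S \<le> x" using bb by (intro cInf_lower) (auto simp: S_def)
          then show "Inf S < x" using x by simp
        next
          assume "Inf S < x"
          then obtain z where "z \<in> S" "z < x" using cInf_lessD[OF ne] by blast
          then show "c < b x" using monoD[OF b(1), of z x] unfolding S_def by auto
        qed
      qed
      then have 1: "(\<integral>\<^sup>+x. ennreal (penalty c (b x) (v s x)) \<partial>lborel) = sharp_energy s c (Inf S)"
        by (rule penalty_split[OF st(1) _ _ c]) measurable
      have "AE x in lborel. c < b' x \<longleftrightarrow> Y c < x"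
        using elim(1)
      proof eventually_elim
        case (elim x)
        show ?case
        proof
          assume "c < b' x"
          then obtain d where d: "d \<in> A x" "c < d" unfolding b'_def using less_cSupD[of "A x" c] by (auto simp: A_def)
          then have "um < d" "d < up" "Y d < x" using 3 by (auto simp: A_def)
          then show "Y c < x" using Ymono[of c d] d 3 by auto
        next
          assume "Y c < x"
          then have "c \<le> b' x" using 3 by (intro A_b') (simp add: A_def)
          then show "c < b' x" using elim by simp
        qed
      qed
      then have 2: "(\<integral>\<^sup>+x. ennreal (penalty c (b' x) (v t x)) \<partial>lborel) = sharp_energy t c (Y c)"
        by (rule penalty_split[OF t0 _ _ c]) measurable
      show ?thesis unfolding 1 2 by (rule sharp_energy_mono[OF 3 st Y[OF 3]])
    qed
  qed
  have "(\<integral>\<^sup>+x. ennreal ((v t x - b' x)\<^sup>2) \<partial>lborel) \<le> (\<integral>\<^sup>+x. ennreal ((v s x - b x)\<^sup>2) \<partial>lborel)"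
  proof -
    have "(\<integral>\<^sup>+x. ennreal ((v t x - b' x)\<^sup>2) \<partial>lborel) = 2 * (\<integral>\<^sup>+c. (\<integral>\<^sup>+x. ennreal (penalty c (b' x) (v t x)) \<partial>lborel) \<partial>lborel)"
      by (rule layer_cake_L2) measurable
    also have "\<dots> \<le> 2 * (\<integral>\<^sup>+c. (\<integral>\<^sup>+x. ennreal (penalty c (b x) (v s x)) \<partial>lborel) \<partial>lborel)"
      by (intro mult_left_mono nn_integral_mono_AE level) simp
    also have "\<dots> = (\<integral>\<^sup>+x. ennreal ((v s x - b x)\<^sup>2) \<partial>lborel)"
      by (rule layer_cake_L2[symmetric]) measurable
    finally show ?thesis .
  qed
  then show ?thesis using b'_mono b'_bounds by blast
qed

text \<open>A bounded integrable deviation is square integrable: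
  \<open>(v - d)\<^sup>2 \<le> 2 * C * \<bar>v - d\<bar>\<close>. This places every profile at
  finite distance from \<open>v t\<close> on the correct end states.\<close>

lemma v_square_tails:
  assumes t: "0 \<le> t"
  shows "(\<integral>\<^sup>+x. indicator {..<0} x * ennreal ((v t x - um)\<^sup>2) \<partial>lborel) < \<infinity>"
    and "(\<integral>\<^sup>+x. indicator {0<..} x * ennreal ((v t x - up)\<^sup>2) \<partial>lborel) < \<infinity>"
proof -
  obtain K where K0: "0 \<le> K"
    "\<And>\<tau>. 0 \<le> \<tau> \<Longrightarrow> \<tau> \<le> t \<Longrightarrow> (\<integral>\<^sup>+x. indicator {..<0} x * ennreal (pos um (v \<tau> x)) \<partial>lborel) \<le> ennreal K"
    "\<And>\<tau>. 0 \<le> \<tau> \<Longrightarrow> \<tau> \<le> t \<Longrightarrow> (\<integral>\<^sup>+x. indicator {..<0} x * ennreal (neg um (v \<tau> x)) \<partial>lborel) \<le> ennreal K"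
    "\<And>\<tau>. 0 \<le> \<tau> \<Longrightarrow> \<tau> \<le> t \<Longrightarrow> (\<integral>\<^sup>+x. indicator {0<..} x * ennreal (pos up (v \<tau> x)) \<partial>lborel) \<le> ennreal K"
    "\<And>\<tau>. 0 \<le> \<tau> \<Longrightarrow> \<tau> \<le> t \<Longrightarrow> (\<integral>\<^sup>+x. indicator {0<..} x * ennreal (neg up (v \<tau> x)) \<partial>lborel) \<le> ennreal K"
    by (rule tail_bounds[OF t]) (rule that; assumption)
  note K = K0(2-5)[OF t order_refl]
  have gen: "(\<integral>\<^sup>+x. indicator S x * ennreal ((v t x - d)\<^sup>2) \<partial>lborel) < \<infinity>"
    if d: "\<bar>d\<bar> \<le> C" and [measurable]: "S \<in> sets borel"
      and p: "(\<integral>\<^sup>+x. indicator S x * ennreal (pos d (v t x)) \<partial>lborel) \<le> ennreal K"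
      and n: "(\<integral>\<^sup>+x. indicator S x * ennreal (neg d (v t x)) \<partial>lborel) \<le> ennreal K" for d S
  proof -
    note [measurable] = bdd_borelD[OF pos_neg_bdd(1)[OF d t]] bdd_borelD[OF pos_neg_bdd(2)[OF d t]]
    have pw: "ennreal ((v t x - d)\<^sup>2) \<le> ennreal (2 * C) * (ennreal (pos d (v t x)) + ennreal (neg d (v t x)))" for x
    proof -
      have "\<bar>v t x - d\<bar> \<le> 2 * C" using v_le[of t x] d by linarith
      then have "\<bar>v t x - d\<bar> * \<bar>v t x - d\<bar> \<le> 2 * C * \<bar>v t x - d\<bar>" by (intro mult_right_mono) auto
      then have "(v t x - d)\<^sup>2 \<le> 2 * C * \<bar>v t x - d\<bar>" by (simp add: power2_eq_square)
      moreover have e: "\<bar>v t x - d\<bar> = pos d (v t x) + neg d (v t x)" by (auto simp: pos_def neg_def)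
      ultimately have "(v t x - d)\<^sup>2 \<le> 2 * C * (pos d (v t x) + neg d (v t x))" by (simp only:)
      then have "ennreal ((v t x - d)\<^sup>2) \<le> ennreal (2 * C * (pos d (v t x) + neg d (v t x)))" by (rule ennreal_leI)
      also have "\<dots> = ennreal (2 * C) * (ennreal (pos d (v t x)) + ennreal (neg d (v t x)))"
        using C_nonneg by (simp add: ennreal_mult level_facts del: ennreal_numeral)
      finally show ?thesis .
    qed
    have "(\<integral>\<^sup>+x. indicator S x * ennreal ((v t x - d)\<^sup>2) \<partial>lborel) \<le>
      (\<integral>\<^sup>+x. ennreal (2 * C) * (indicator S x * ennreal (pos d (v t x)) + indicator S x * ennreal (neg d (v t x))) \<partial>lborel)"
      using pw by (intro nn_integral_mono) (auto simp: indicator_def)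
    also have "\<dots> = ennreal (2 * C) * ((\<integral>\<^sup>+x. indicator S x * ennreal (pos d (v t x)) \<partial>lborel) + (\<integral>\<^sup>+x. indicator S x * ennreal (neg d (v t x)) \<partial>lborel))"
      by (subst nn_integral_cmult, measurable, subst nn_integral_add, measurable)
    also have "\<dots> \<le> ennreal (2 * C) * (ennreal K + ennreal K)" by (intro mult_left_mono add_mono p n) simp
    also have "\<dots> < \<infinity>" by (simp add: ennreal_mult_less_top)
    finally show ?thesis .
  qed
  show "(\<integral>\<^sup>+x. indicator {..<0} x * ennreal ((v t x - um)\<^sup>2) \<partial>lborel) < \<infinity>"
    by (rule gen[OF um_le _ K(1,2)]) simp
  show "(\<integral>\<^sup>+x. indicator {0<..} x * ennreal ((v t x - up)\<^sup>2) \<partial>lborel) < \<infinity>"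
    by (rule gen[OF up_le _ K(3,4)]) simp
qed

end

section \<open>The distance to the monotone profiles\<close>

lemma L2_norm_cong_AE:
  assumes gh: "AE x in lebesgue. g x = h x" and [measurable]: "g \<in> borel_measurable lebesgue" "h \<in> borel_measurable lebesgue"
  shows "L2_norm g = L2_norm h"
proof -
  have ae: "AE x in lebesgue. (g x)\<^sup>2 = (h x)\<^sup>2" using gh by eventually_elim simp
  have U: "lebesgue_on UNIV = (lebesgue :: real measure)" by (rule lebesgue_on_UNIV_eq)
  have "integrable lebesgue (\<lambda>x. (g x)\<^sup>2) \<longleftrightarrow> integrable lebesgue (\<lambda>x. (h x)\<^sup>2)"
    by (rule integrable_cong_AE[OF _ _ ae]) measurable
  moreover have "(LINT x|lebesgue. (g x)\<^sup>2) = (LINT x|lebesgue. (h x)\<^sup>2)"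
    by (rule integral_cong_AE[OF _ _ ae]) measurable
  ultimately show ?thesis unfolding L2_norm_def L2_on_def U by simp
qed

lemma L2_norm_minus: "L2_norm (\<lambda>x. - g x) = L2_norm g"
  unfolding L2_norm_def L2_on_def by simp

lemma L2_on_minus: "L2_on S (\<lambda>x. - g x) = L2_on S g"
  unfolding L2_on_def by simp

lemma monotone_profiles_minus: "(\<lambda>x. - b x) \<in> monotone_profiles (- um) (- up) \<longleftrightarrow> b \<in> monotone_profiles um up"
proof -
  have "(\<lambda>x. - b x - - um) = (\<lambda>x. - (b x - um))" "(\<lambda>x. - b x - - up) = (\<lambda>x. - (b x - up))" by auto
  moreover have "mono (\<lambda>x. - b x) \<longleftrightarrow> antimono b" "antimono (\<lambda>x. - b x) \<longleftrightarrow> mono b"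
    by (auto simp: mono_def antimono_def)
  ultimately show ?thesis unfolding monotone_profiles_def by (auto simp only: mem_Collect_eq L2_on_minus)
qed

lemma d2_minus: "d2 (\<lambda>x. - g x) (monotone_profiles (- um) (- up)) = d2 g (monotone_profiles um up)"
proof -
  have "monotone_profiles (- um) (- up) = (\<lambda>b x. - b x) ` monotone_profiles um up"
  proof (intro set_eqI iffI)
    fix b assume "b \<in> monotone_profiles (- um) (- up)"
    then have "(\<lambda>x. - b x) \<in> monotone_profiles um up" using monotone_profiles_minus[of "\<lambda>x. - b x" um up] by simp
    then show "b \<in> (\<lambda>b x. - b x) ` monotone_profiles um up" by (rule rev_image_eqI) simp
  qed (auto simp: monotone_profiles_minus)
  moreover have "L2_norm (\<lambda>x. - g x - - b x) = L2_norm (\<lambda>x. g x - b x)" for b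
    using L2_norm_minus[of "\<lambda>x. g x - b x"] by simp
  ultimately show ?thesis unfolding d2_def by (simp add: image_image)
qed

text \<open>A square integrable function cannot stay above \<open>\<delta>\<close> on a set of
  infinite measure. For monotone functions this replaces the limits at infinity.\<close>

lemma L2_on_half_line_small:
  fixes g :: "real \<Rightarrow> real"
  assumes [measurable]: "g \<in> borel_measurable borel" and \<delta>: "\<delta> > 0"
  shows "L2_on {..<0} g \<Longrightarrow> \<exists>x<x0. \<bar>g x\<bar> < \<delta>" "L2_on {0<..} g \<Longrightarrow> \<exists>x>x0. \<bar>g x\<bar> < \<delta>"
proof -
  have inf: "(\<integral>\<^sup>+x. indicator S x * ennreal ((g x)\<^sup>2) \<partial>lborel) = \<infinity>"
    if "T \<in> sets borel" "T \<subseteq> S" "emeasure lborel T = \<infinity>" "\<And>x. x \<in> T \<Longrightarrow> \<delta> \<le> \<bar>g x\<bar>" for S T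
  proof -
    have "\<infinity> = ennreal (\<delta>\<^sup>2) * emeasure lborel T" using \<delta> that(3) by (simp add: ennreal_mult_top)
    also have "\<dots> = (\<integral>\<^sup>+x. ennreal (\<delta>\<^sup>2) * indicator T x \<partial>lborel)"
      using that(1) by (subst nn_integral_cmult_indicator) auto
    also have "\<dots> \<le> (\<integral>\<^sup>+x. indicator S x * ennreal ((g x)\<^sup>2) \<partial>lborel)"
    proof (rule nn_integral_mono)
      fix x show "ennreal (\<delta>\<^sup>2) * indicator T x \<le> indicator S x * ennreal ((g x)\<^sup>2)"
      proof (cases "x \<in> T")
        case True
        then have "\<delta>\<^sup>2 \<le> (g x)\<^sup>2" using power_mono[OF that(4)[OF True], of 2] \<delta> by simp
        then show ?thesis using True that(2) by (auto simp: indicator_def intro: ennreal_leI)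
      qed simp
    qed
    finally show ?thesis by (simp add: top_unique)
  qed
  have i1: "emeasure lborel {..<a} = \<infinity>" "emeasure lborel {a<..} = \<infinity>" for a :: real
  proof -
    have top: "emeasure lborel T = \<infinity>" if T: "\<And>n::nat. \<exists>b. {b<..<b + real n} \<subseteq> T" "T \<in> sets borel" for T
    proof -
      have "of_nat n \<le> emeasure lborel T" for n
      proof -
        obtain b where "{b<..<b + real n} \<subseteq> T" using T(1) by blast
        from emeasure_mono[OF this, of lborel] T(2) show ?thesis by (simp add: ennreal_of_nat_eq_real_of_nat)
      qed
      then have "(SUP n. of_nat n) \<le> emeasure lborel T" by (intro SUP_least)
      then show ?thesis by (simp add: ennreal_SUP_of_nat_eq_top top_unique)
    qed
    show "emeasure lborel {..<a} = \<infinity>" by (rule top, rule_tac x = "a - real n" in exI) auto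
    show "emeasure lborel {a<..} = \<infinity>" by (rule top, rule_tac x = a in exI) auto
  qed
  show "\<exists>x<x0. \<bar>g x\<bar> < \<delta>" if "L2_on {..<0} g"
  proof (rule ccontr)
    assume "\<not> ?thesis"
    then have "\<delta> \<le> \<bar>g x\<bar>" if "x < x0" for x using that by force
    then have "(\<integral>\<^sup>+x. indicator {..<0} x * ennreal ((g x)\<^sup>2) \<partial>lborel) = \<infinity>"
      by (intro inf[of "{..<min x0 0}"] i1) auto
    then show False using that by (simp add: L2_on_iff_finite)
  qed
  show "\<exists>x>x0. \<bar>g x\<bar> < \<delta>" if "L2_on {0<..} g"
  proof (rule ccontr)
    assume "\<not> ?thesis"
    then have "\<delta> \<le> \<bar>g x\<bar>" if "x0 < x" for x using that by force
    then have "(\<integral>\<^sup>+x. indicator {0<..} x * ennreal ((g x)\<^sup>2) \<partial>lborel) = \<infinity>"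
      by (intro inf[of "{max x0 0<..}"] i1) auto
    then show False using that by (simp add: L2_on_iff_finite)
  qed
qed

text \<open>Values arbitrarily far out come close to \<open>um\<close> and \<open>up\<close>, and
  monotonicity spreads this over the line. A decreasing profile would satisfy
  \<open>up \<le> b x \<le> um \<le> up\<close>, so it is constant and thereby increasing as
  well.\<close>

lemma monotone_profiles_props:
  assumes b: "b \<in> monotone_profiles um up" and le: "um \<le> up"
  shows "mono b" "um \<le> b x" "b x \<le> up" 
    "um < c \<Longrightarrow> c < up \<Longrightarrow> \<exists>x. b x \<le> c" "um < c \<Longrightarrow> c < up \<Longrightarrow> \<exists>x. c < b x"
proof -
  have cases: "mono b \<or> antimono b" and L: "L2_on {..<0} (\<lambda>x. b x - um)" "L2_on {0<..} (\<lambda>x. b x - up)"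
    using b unfolding monotone_profiles_def by auto
  have [measurable]: "b \<in> borel_measurable borel"
  proof -
    have "b \<in> borel_measurable borel" if "antimono b"
    proof -
      have "mono (\<lambda>x. - b x)" using that by (auto simp: mono_def antimono_def)
      from borel_measurable_mono[OF this] have "(\<lambda>x. - (- b x)) \<in> borel_measurable borel" by measurable
      then show ?thesis by simp
    qed
    then show ?thesis using cases borel_measurable_mono by blast
  qed
  have left: "\<exists>x<x0. \<bar>b x - um\<bar> < \<delta>" and right: "\<exists>x>x0. \<bar>b x - up\<bar> < \<delta>" if "\<delta> > 0" for x0 \<delta>
    using L2_on_half_line_small(1)[OF _ that L(1), of x0] L2_on_half_line_small(2)[OF _ that L(2), of x0] by auto
  have m: "mono b"
  proof (rule ccontr)
    assume nm: "\<not> mono b"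
    then have am: "antimono b" using cases by simp
    have "b x \<le> um" for x
    proof (rule ccontr)
      assume "\<not> b x \<le> um"
      then obtain z where "z < x" "\<bar>b z - um\<bar> < b x - um" using left[of "b x - um" x] by auto
      then show False using antimonoD[OF am, of z x] by auto
    qed
    moreover have "up \<le> b x" for x
    proof (rule ccontr)
      assume "\<not> up \<le> b x"
      then obtain z where "x < z" "\<bar>b z - up\<bar> < up - b x" using right[of "up - b x" x] by auto
      then show False using antimonoD[OF am, of x z] by auto
    qed
    ultimately have "b x = um" for x using le by (meson order_antisym order_trans)
    then show False using nm by (auto simp: mono_def)
  qed
  show "mono b" by (rule m)
  show "um \<le> b x" for x
  proof (rule ccontr)
    assume "\<not> um \<le> b x"
    then obtain z where "z < x" "\<bar>b z - um\<bar> < um - b x" using left[of "um - b x" x] by auto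
    then show False using monoD[OF m, of z x] by auto
  qed
  show "b x \<le> up" for x
  proof (rule ccontr)
    assume "\<not> b x \<le> up"
    then obtain z where "x < z" "\<bar>b z - up\<bar> < b x - up" using right[of "b x - up" x] by auto
    then show False using monoD[OF m, of x z] by auto
  qed
  show "\<exists>x. b x \<le> c" if uc: "um < c"
  proof -
    obtain z where "\<bar>b z - um\<bar> < c - um" using left[of "c - um" 0] uc by auto
    then show ?thesis by (intro exI[of _ z]) auto
  qed
  show "\<exists>x. c < b x" if uc: "c < up"
  proof -
    obtain z where "\<bar>b z - up\<bar> < up - c" using right[of "up - c" 0] uc by auto
    then show ?thesis by (intro exI[of _ z]) auto
  qed
qed

lemma (in entropy_cauchy) d2_decreasing:
  assumes u: "\<And>t. 0 \<le> t \<Longrightarrow> AE x in lebesgue. u t x = v t x" 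
    and um_meas: "\<And>t. 0 \<le> t \<Longrightarrow> u t \<in> borel_measurable lebesgue" and st: "0 \<le> s" "s \<le> t"
  shows "d2 (u t) (monotone_profiles um up) \<le> d2 (u s) (monotone_profiles um up)"
  unfolding d2_def[of "u s"]
proof (rule INF_greatest)
  fix b assume b: "b \<in> monotone_profiles um up"
  have t0: "0 \<le> t" using st by simp
  note bp = monotone_profiles_props[OF b um_up]
  note [measurable] = borel_measurable_mono[OF bp(1)] v_borel[OF st(1)] v_borel[OF t0] um_meas[OF st(1)] um_meas[OF t0]
  have uv: "L2_norm (\<lambda>x. u \<tau> x - h x) = L2_norm (\<lambda>x. v \<tau> x - h x)" if \<tau>: "0 \<le> \<tau>" and h: "h \<in> borel_measurable borel" for \<tau> h
  proof (rule L2_norm_cong_AE)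
    show "AE x in lebesgue. u \<tau> x - h x = v \<tau> x - h x" using u[OF \<tau>] by eventually_elim simp
    have hl: "h \<in> borel_measurable lebesgue" "v \<tau> \<in> borel_measurable lebesgue" using h v_borel[OF \<tau>] by (auto intro: measurable_completion)
    show "(\<lambda>x. u \<tau> x - h x) \<in> borel_measurable lebesgue" "(\<lambda>x. v \<tau> x - h x) \<in> borel_measurable lebesgue"
      using hl um_meas[OF \<tau>] by (auto intro: borel_measurable_diff)
  qed
  show "d2 (u t) (monotone_profiles um up) \<le> L2_norm (\<lambda>x. u s x - b x)"
  proof (cases "(\<integral>\<^sup>+x. ennreal ((v s x - b x)\<^sup>2) \<partial>lborel) < \<infinity>")
    case False
    then have "L2_norm (\<lambda>x. u s x - b x) = \<infinity>"
      unfolding uv[OF st(1) borel_measurable_mono[OF bp(1)]] by (subst L2_norm_eq) auto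
    then show ?thesis by simp
  next
    case fin: True
    obtain b' where b': "mono b'" and
      less: "(\<integral>\<^sup>+x. ennreal ((v t x - b' x)\<^sup>2) \<partial>lborel) \<le> (\<integral>\<^sup>+x. ennreal ((v s x - b x)\<^sup>2) \<partial>lborel)"
      using L2_nearest_profile[OF st bp] by blast
    note [measurable] = borel_measurable_mono[OF b']
    \<comment> \<open>For the membership of \<open>b'\<close>: it is at finite distance from
      \<open>v t\<close>, and \<open>v t\<close> is at finite distance from the end states.\<close>
    have half: "(\<integral>\<^sup>+x. indicator S x * ennreal ((b' x - d)\<^sup>2) \<partial>lborel) < \<infinity>"
      if [measurable]: "S \<in> sets borel" and f: "(\<integral>\<^sup>+x. indicator S x * ennreal ((v t x - d)\<^sup>2) \<partial>lborel) < \<infinity>" for S d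
    proof -
      have pw: "ennreal ((b' x - d)\<^sup>2) \<le> ennreal 2 * ennreal ((v t x - b' x)\<^sup>2) + ennreal 2 * ennreal ((v t x - d)\<^sup>2)" for x
      proof -
        have "(b' x - d)\<^sup>2 \<le> 2 * (v t x - b' x)\<^sup>2 + 2 * (v t x - d)\<^sup>2"
          using zero_le_power2[of "(v t x - b' x) + (v t x - d)"] by (simp add: power2_eq_square algebra_simps)
        then have "ennreal ((b' x - d)\<^sup>2) \<le> ennreal (2 * (v t x - b' x)\<^sup>2 + 2 * (v t x - d)\<^sup>2)" by (rule ennreal_leI)
        then show ?thesis by (simp add: ennreal_mult del: ennreal_numeral)
      qed
      have "(\<integral>\<^sup>+x. indicator S x * ennreal ((b' x - d)\<^sup>2) \<partial>lborel) \<le>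
         (\<integral>\<^sup>+x. ennreal 2 * ennreal ((v t x - b' x)\<^sup>2) + ennreal 2 * (indicator S x * ennreal ((v t x - d)\<^sup>2)) \<partial>lborel)"
        using pw by (intro nn_integral_mono) (auto simp: indicator_def)
      also have "\<dots> = ennreal 2 * (\<integral>\<^sup>+x. ennreal ((v t x - b' x)\<^sup>2) \<partial>lborel) + ennreal 2 * (\<integral>\<^sup>+x. indicator S x * ennreal ((v t x - d)\<^sup>2) \<partial>lborel)"
        by (subst nn_integral_add, measurable, subst nn_integral_cmult, measurable, subst nn_integral_cmult, measurable)
      also have "\<dots> < \<infinity>" using le_less_trans[OF less fin] f by (simp add: ennreal_mult_less_top)
      finally show ?thesis .
    qed
    have "b' \<in> monotone_profiles um up"
      unfolding monotone_profiles_def using b' half[OF _ v_square_tails(1)[OF t0]] half[OF _ v_square_tails(2)[OF t0]]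
      by (simp add: L2_on_iff_finite)
    then have "d2 (u t) (monotone_profiles um up) \<le> L2_norm (\<lambda>x. u t x - b' x)"
      unfolding d2_def by (rule INF_lower)
    also have "\<dots> = L2_norm (\<lambda>x. v t x - b' x)" by (rule uv[OF t0 borel_measurable_mono[OF b']])
    also have "\<dots> \<le> L2_norm (\<lambda>x. v s x - b x)"
      by (rule L2_norm_mono[OF _ _ less]) measurable
    also have "\<dots> = L2_norm (\<lambda>x. u s x - b x)" by (rule uv[OF st(1) borel_measurable_mono[OF bp(1)], symmetric])
    finally show ?thesis .
  qed
qed

text \<open>Under \<open>u \<mapsto> - u\<close> the flux becomes \<open>- f (- y)\<close>, with the
  same \<open>C\<close> and \<open>L\<close>. The two one-sided entropies trade places at the level
  \<open>- c\<close>, and so do the two signs of the conservation law.\<close>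

lemma entropy_solution_minus:
  assumes "entropy_solution f w v C L"
  shows "entropy_solution (\<lambda>y. - f (- y)) (\<lambda>r z. - w r z) (\<lambda>t z. - v t z) C L"
proof -
  interpret entropy_solution f w v C L by fact
  have wb: "bdd_borel (\<lambda>(r, z). - w r z)"
  proof (rule bdd_borelI)
    show "(\<lambda>(r, z). - w r z) \<in> borel_measurable borel"
      using borel_measurable_uminus[OF bdd_borelD[OF w_bdd]] by (simp add: split_beta)
    show "\<bar>case p of (r, z) \<Rightarrow> - w r z\<bar> \<le> C" for p using w_le[of "fst p" "snd p"] by (simp add: split_beta)
  qed
  have ae: "AE r in lborel. 0 < r \<longrightarrow> (AE z in lborel. - w r z = - v r z)" using w_eq_v by simp
  interpret m: entropy_evolution "\<lambda>y. - f (- y)" "\<lambda>r z. - w r z" "\<lambda>t z. - v t z" C L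
  proof
    show "((\<lambda>s. integral {-R..R} (\<lambda>z. \<bar>- v s z - - v t z\<bar>)) \<longlongrightarrow> 0) (at t within {0..})" if "0 \<le> t" for t R
      using v_cont[OF that, of R] by (simp add: abs_minus_commute)
    show "continuous_on UNIV (\<lambda>y. - f (- y))"
      by (intro continuous_intros continuous_on_compose2[OF f_cont]) auto
    show "\<bar>- f (- a) - - f (- b)\<bar> \<le> L * \<bar>a - b\<bar>" if "\<bar>a\<bar> \<le> C" "\<bar>b\<bar> \<le> C" for a b
      using f_lip[of "- a" "- b"] that by (simp add: abs_minus_commute)
  qed (use wb ae w_le v_le v_borel L_nonneg in auto)
  show ?thesis
  proof
    fix c assume c: "\<bar>c\<bar> \<le> C"
    then have c': "\<bar>- c\<bar> \<le> C" by simp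
    have e: "max 0 (- y - c) = max 0 (- c - y)" "max 0 (c - - y) = max 0 (y - - c)"
      "- f (- max c (- y)) - - f (- c) = f (- c) - f (min (- c) y)"
      "- f (- c) - - f (- min c (- y)) = f (max (- c) y) - f (- c)"
      "- y - c = - c - y" "c - - y = y - - c" "- f (- (- y)) - - f (- c) = f (- c) - f y" "- f (- c) - - f (- (- y)) = f y - f (- c)" for y
      by (simp_all add: minus_max_eq_min minus_min_eq_max max.commute min.commute)
    show "m.entropy_ineq (\<lambda>y. max 0 (y - c)) (\<lambda>y. - f (- max c y) - - f (- c))"
      using ent_neg[OF c'] unfolding entropy_ineq_def m.entropy_ineq_def e .
    show "m.entropy_ineq (\<lambda>y. max 0 (c - y)) (\<lambda>y. - f (- c) - - f (- min c y))"
      using ent_pos[OF c'] unfolding entropy_ineq_def m.entropy_ineq_def e .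
    show "m.entropy_ineq (\<lambda>y. y - c) (\<lambda>y. - f (- y) - - f (- c))"
      using conservation(2)[OF c'] unfolding entropy_ineq_def m.entropy_ineq_def e .
    show "m.entropy_ineq (\<lambda>y. c - y) (\<lambda>y. - f (- c) - - f (- y))"
      using conservation(1)[OF c'] unfolding entropy_ineq_def m.entropy_ineq_def e .
  qed
qed

section \<open>From Kruzhkov solutions to mollified inequalities\<close>

abbreviation half_plane :: "(real \<times> real) set" where "half_plane \<equiv> {0<..} \<times> UNIV"

lemma half_plane_sets: "half_plane \<in> sets borel" 
  by (intro borel_open open_Times) auto

text \<open>At \<open>y = c\<close> the entropies have a kink, so that \<open>entropy_flux_pair\<close> demands nothing there.\<close>

lemma entropy_flux_pair_levels:
  assumes "smooth f"
  shows "entropy_flux_pair f (\<lambda>y. max 0 (y - c)) (\<lambda>y. f (max c y) - f c)" (is ?pos)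
    and "entropy_flux_pair f (\<lambda>y. max 0 (c - y)) (\<lambda>y. f c - f (min c y))" (is ?neg)
    and "entropy_flux_pair f (\<lambda>y. y - c) (\<lambda>y. f y - f c)" (is ?lin)
    and "entropy_flux_pair f (\<lambda>y. c - y) (\<lambda>y. f c - f y)" (is ?lin')
proof -
  have f': "(f has_real_derivative deriv f y) (at y)" for y by (rule smooth_has_deriv[OF assms])
  have fc: "continuous_on UNIV f" by (rule smooth_continuous[OF assms])
  have conv: "convex_on UNIV (\<lambda>y. max 0 (y - c))" "convex_on UNIV (\<lambda>y. max 0 (c - y))"
    "convex_on UNIV (\<lambda>y. y - c)" "convex_on UNIV (\<lambda>y. c - y)" for c :: real
  proof -
    have *: "u * c + w * c = c" if "u + w = 1" for u w :: real using that by (simp flip: distrib_right)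
    have lin: "convex_on UNIV (\<lambda>y. y - c)" "convex_on UNIV (\<lambda>y. c - y)"
      by (auto simp: convex_on_def algebra_simps *)
    then show "convex_on UNIV (\<lambda>y. y - c)" "convex_on UNIV (\<lambda>y. c - y)" by auto
    have mx: "convex_on UNIV (\<lambda>y. max 0 (h y))" if h: "convex_on UNIV h" for h :: "real \<Rightarrow> real"
      unfolding convex_on_def
    proof (intro conjI ballI allI impI)
      fix x y u w :: real assume u: "0 \<le> u" "0 \<le> w" "u + w = 1"
      have "h (u *\<^sub>R x + w *\<^sub>R y) \<le> u * h x + w * h y" using h u unfolding convex_on_def by blast
      also have "\<dots> \<le> u * max 0 (h x) + w * max 0 (h y)" using u by (intro add_mono mult_left_mono) auto
      finally show "max 0 (h (u *\<^sub>R x + w *\<^sub>R y)) \<le> u * max 0 (h x) + w * max 0 (h y)" using u by simp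
    qed simp
    show "convex_on UNIV (\<lambda>y. max 0 (y - c))" "convex_on UNIV (\<lambda>y. max 0 (c - y))" by (intro mx lin)+
  qed
  \<comment> \<open>Both \<open>max 0 (y - c)\<close> and \<open>max 0 (y - c) - (y - c)\<close> are
    minimal at \<open>c\<close>, so a derivative there would be 0 and 1 at once.\<close>
  have no_diff: False if d: "((\<lambda>y. max 0 (y - c)) has_real_derivative D) (at c)" for D
  proof -
    have "D = 0" by (rule DERIV_local_min[OF d, of 1]) auto
    moreover have "((\<lambda>y. max 0 (y - c) - (y - c)) has_real_derivative D - 1) (at c)"
      by (rule DERIV_diff[OF d]) (auto intro!: derivative_eq_intros)
    then have "D - 1 = 0" by (rule DERIV_local_min[where d = 1]) auto
    ultimately show False by simp
  qed
  have no_diff': False if d: "((\<lambda>y. max 0 (c - y)) has_real_derivative D) (at c)" for D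
  proof -
    have "((\<lambda>y. max 0 (c - y) + (y - c)) has_real_derivative D + 1) (at c)"
      by (rule DERIV_add[OF d]) (auto intro!: derivative_eq_intros)
    moreover have "(\<lambda>y. max 0 (c - y) + (y - c)) = (\<lambda>y. max 0 (y - c))" by (auto simp: max_def)
    ultimately show False using no_diff by metis
  qed
  show ?pos
    unfolding entropy_flux_pair_def
  proof (intro conjI allI impI conv)
    show "continuous_on UNIV (\<lambda>y. f (max c y) - f c)"
      by (intro continuous_intros continuous_on_compose2[OF fc]) auto
    fix y assume "(\<lambda>y. max 0 (y - c)) field_differentiable at y"
    then obtain D where D: "((\<lambda>y. max 0 (y - c)) has_real_derivative D) (at y)"
      unfolding field_differentiable_def by blast
    consider "y < c" | "y = c" | "c < y" by linarith
    then show "((\<lambda>y. f (max c y) - f c) has_real_derivative deriv (\<lambda>y. max 0 (y - c)) y * deriv f y) (at y)"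
    proof cases
      case 1
      have "((\<lambda>y. max 0 (y - c)) has_real_derivative 0) (at y)"
        by (rule has_field_derivative_transform_within_open[of "\<lambda>_. 0" _ _ "{..<c}"]) (use 1 in auto)
      moreover have "((\<lambda>y. f (max c y) - f c) has_real_derivative 0) (at y)"
        by (rule has_field_derivative_transform_within_open[of "\<lambda>_. 0" _ _ "{..<c}"]) (use 1 in \<open>auto simp: max_def\<close>)
      ultimately show ?thesis by (simp add: DERIV_imp_deriv)
    next
      case 2 then show ?thesis using no_diff D by blast
    next
      case 3
      have "((\<lambda>y. y - c) has_real_derivative 1) (at y)" by (auto intro!: derivative_eq_intros)
      then have "((\<lambda>y. max 0 (y - c)) has_real_derivative 1) (at y)"
        by (rule has_field_derivative_transform_within_open[where S = "{c<..}"]) (use 3 in auto)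
      moreover have "((\<lambda>y. f y - f c) has_real_derivative deriv f y) (at y)"
        using DERIV_diff[OF f' DERIV_const] by simp
      then have "((\<lambda>y. f (max c y) - f c) has_real_derivative deriv f y) (at y)"
        by (rule has_field_derivative_transform_within_open[where S = "{c<..}"]) (use 3 in \<open>auto simp: max_def\<close>)
      ultimately show ?thesis by (simp add: DERIV_imp_deriv)
    qed
  qed
  show ?neg
    unfolding entropy_flux_pair_def
  proof (intro conjI allI impI conv)
    show "continuous_on UNIV (\<lambda>y. f c - f (min c y))"
      by (intro continuous_intros continuous_on_compose2[OF fc]) auto
    fix y assume "(\<lambda>y. max 0 (c - y)) field_differentiable at y"
    then obtain D where D: "((\<lambda>y. max 0 (c - y)) has_real_derivative D) (at y)"
      unfolding field_differentiable_def by blast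
    consider "c < y" | "y = c" | "y < c" by linarith
    then show "((\<lambda>y. f c - f (min c y)) has_real_derivative deriv (\<lambda>y. max 0 (c - y)) y * deriv f y) (at y)"
    proof cases
      case 1
      have "((\<lambda>y. max 0 (c - y)) has_real_derivative 0) (at y)"
        by (rule has_field_derivative_transform_within_open[of "\<lambda>_. 0" _ _ "{c<..}"]) (use 1 in auto)
      moreover have "((\<lambda>y. f c - f (min c y)) has_real_derivative 0) (at y)"
        by (rule has_field_derivative_transform_within_open[of "\<lambda>_. 0" _ _ "{c<..}"]) (use 1 in \<open>auto simp: min_def\<close>)
      ultimately show ?thesis by (simp add: DERIV_imp_deriv)
    next
      case 2 then show ?thesis using no_diff' D by blast
    next
      case 3
      have "((\<lambda>y. c - y) has_real_derivative - 1) (at y)" by (auto intro!: derivative_eq_intros)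
      then have "((\<lambda>y. max 0 (c - y)) has_real_derivative - 1) (at y)"
        by (rule has_field_derivative_transform_within_open[where S = "{..<c}"]) (use 3 in auto)
      moreover have "((\<lambda>y. f c - f y) has_real_derivative - deriv f y) (at y)"
        using DERIV_diff[OF DERIV_const f'] by simp
      then have "((\<lambda>y. f c - f (min c y)) has_real_derivative - deriv f y) (at y)"
        by (rule has_field_derivative_transform_within_open[where S = "{..<c}"]) (use 3 in \<open>auto simp: min_def\<close>)
      ultimately show ?thesis by (simp add: DERIV_imp_deriv)
    qed
  qed
  show ?lin
    unfolding entropy_flux_pair_def
  proof (intro conjI allI impI conv)
    show "continuous_on UNIV (\<lambda>y. f y - f c)" by (intro continuous_intros fc)
    fix y
    have "((\<lambda>y. y - c) has_real_derivative 1) (at y)" by (auto intro!: derivative_eq_intros)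
    then have "deriv (\<lambda>y. y - c) y = 1" by (rule DERIV_imp_deriv)
    then show "((\<lambda>y. f y - f c) has_real_derivative deriv (\<lambda>y. y - c) y * deriv f y) (at y)"
      using DERIV_diff[OF f' DERIV_const] by simp
  qed
  show ?lin'
    unfolding entropy_flux_pair_def
  proof (intro conjI allI impI conv)
    show "continuous_on UNIV (\<lambda>y. f c - f y)" by (intro continuous_intros fc)
    fix y
    have "((\<lambda>y. c - y) has_real_derivative - 1) (at y)" by (auto intro!: derivative_eq_intros)
    then have "deriv (\<lambda>y. c - y) y = - 1" by (rule DERIV_imp_deriv)
    then show "((\<lambda>y. f c - f y) has_real_derivative deriv (\<lambda>y. c - y) y * deriv f y) (at y)"
      using DERIV_diff[OF DERIV_const f'] by simp
  qed
qed

text \<open>The test function is the product of two kernels, translated by \<open>\<tau>\<close> and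
  \<open>x\<close>. Its support starts at time \<open>\<tau> + \<epsilon>\<close>, so it is
  admissible for every \<open>\<tau> \<ge> 0\<close>, and its partial derivatives are exactly the
  kernels that occur in \<open>conv\<close>.\<close>

lemma (in entropy_evolution) entropy_ineq_if_div_nonpos:
  assumes ent: "div_nonpos (\<lambda>t x. g (u t x)) (\<lambda>t x. q (u t x))"
    and g: "lipschitz_fun g" and q: "lipschitz_fun q"
    and u: "(\<lambda>(t, x). u t x) \<in> borel_measurable (lebesgue_on half_plane)"
    and uw: "AE p in lebesgue_on half_plane. case_prod u p = case_prod w p"
  shows "entropy_ineq g q"
  unfolding entropy_ineq_def
proof (intro allI impI)
  fix \<epsilon> k and \<tau> x :: real assume \<epsilon>: "0 < \<epsilon>" and k: "kernel \<epsilon> k" and \<tau>: "0 \<le> \<tau>"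
  note b = kernel_bump_on[OF k \<epsilon>] and d = bump_on_deriv[OF kernel_bump_on[OF k \<epsilon>]]
  have sm: "smooth k" using k by (simp add: kernel_def)
  have k0: "k r = 0" if "r \<notin> {\<epsilon>..2*\<epsilon>}" for r using k that unfolding kernel_def by blast
  have d0: "deriv k r = 0" if "r < \<epsilon>" for r
  proof -
    have "((\<lambda>x. 0) has_real_derivative 0) (at r)" by simp
    then have "(k has_real_derivative 0) (at r)"
      by (rule has_field_derivative_transform_within_open[where S = "{..<\<epsilon>}"]) (use that k0 in auto)
    then show ?thesis by (rule DERIV_imp_deriv)
  qed
  define \<phi> where "\<phi> = (\<lambda>(r, z). k (r - \<tau>) * k (z - x))"
  have "test_function half_plane \<phi>"
    unfolding test_function_def
  proof (intro conjI exI[of _ "{\<tau> + \<epsilon>..\<tau> + 2*\<epsilon>} \<times> {x + \<epsilon>..x + 2*\<epsilon>}"] allI impI)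
    show "smooth2 \<phi>" unfolding \<phi>_def by (rule smooth2_product[OF sm sm])
    show "compact ({\<tau> + \<epsilon>..\<tau> + 2*\<epsilon>} \<times> {x + \<epsilon>..x + 2*\<epsilon>})" by (intro compact_Times) auto
    show "{\<tau> + \<epsilon>..\<tau> + 2*\<epsilon>} \<times> {x + \<epsilon>..x + 2*\<epsilon>} \<subseteq> half_plane" using \<tau> \<epsilon> by auto
    fix p assume "p \<notin> {\<tau> + \<epsilon>..\<tau> + 2*\<epsilon>} \<times> {x + \<epsilon>..x + 2*\<epsilon>}"
    then have "fst p - \<tau> \<notin> {\<epsilon>..2*\<epsilon>} \<or> snd p - x \<notin> {\<epsilon>..2*\<epsilon>}" by (cases p) auto
    then show "\<phi> p = 0" using k0 unfolding \<phi>_def by (auto simp: split_beta)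
  qed
  moreover have "\<forall>p. 0 \<le> \<phi> p" unfolding \<phi>_def using kernel_nonneg[OF k] by (auto simp: split_beta)
  ultimately have ineq: "0 \<le> (LINT (t, x') | lebesgue_on half_plane.
      g (u t x') * deriv (\<lambda>s. \<phi> (s, x')) t + q (u t x') * deriv (\<lambda>y. \<phi> (t, y)) x')"
    using ent unfolding div_nonpos_def by (simp add: minus_le_iff)
  have d1: "deriv (\<lambda>s. \<phi> (s, x')) t = deriv k (t - \<tau>) * k (x' - x)" for t x'
  proof (rule DERIV_imp_deriv)
    have "((\<lambda>s. k (s - \<tau>)) has_real_derivative deriv k (t - \<tau>) * 1) (at t)"
      by (rule DERIV_chain2[OF smooth_has_deriv[OF sm]]) (auto intro!: derivative_eq_intros)
    from DERIV_cmult_right[OF this, of "k (x' - x)"]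
    show "((\<lambda>s. \<phi> (s, x')) has_real_derivative deriv k (t - \<tau>) * k (x' - x)) (at t)" unfolding \<phi>_def by simp
  qed
  have d2: "deriv (\<lambda>y. \<phi> (t, y)) x' = k (t - \<tau>) * deriv k (x' - x)" for t x'
  proof (rule DERIV_imp_deriv)
    have "((\<lambda>y. k (y - x)) has_real_derivative deriv k (x' - x) * 1) (at x')"
      by (rule DERIV_chain2[OF smooth_has_deriv[OF sm]]) (auto intro!: derivative_eq_intros)
    from DERIV_cmult[OF this, of "k (t - \<tau>)"]
    show "((\<lambda>y. \<phi> (t, y)) has_real_derivative k (t - \<tau>) * deriv k (x' - x)) (at x')" unfolding \<phi>_def by simp
  qed
  define F where "F y p = g y * (deriv k (fst p - \<tau>) * k (snd p - x)) + q y * (k (fst p - \<tau>) * deriv k (snd p - x))" for y p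
  note [measurable] = bump_on_borel[OF b] bump_on_borel[OF d] lipschitz_fun_borel[OF g] lipschitz_fun_borel[OF q]
  have wm[measurable]: "case_prod w \<in> borel_measurable borel" by (rule bdd_borelD[OF w_bdd])
  have Fw: "(\<lambda>p. F (case_prod w p) p) \<in> borel_measurable borel"
    unfolding F_def[abs_def] borel_prod[symmetric] using wm[folded borel_prod] by measurable
  have Fwl: "(\<lambda>p. F (case_prod w p) p) \<in> borel_measurable (lebesgue_on half_plane)"
    using Fw by (intro measurable_restrict_space1 measurable_completion) simp
  have Fu: "(\<lambda>p. F (case_prod u p) p) \<in> borel_measurable (lebesgue_on half_plane)"
  proof -
    have K: "(\<lambda>p. deriv k (fst p - \<tau>) * k (snd p - x)) \<in> borel_measurable (lebesgue_on half_plane)"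
      "(\<lambda>p. k (fst p - \<tau>) * deriv k (snd p - x)) \<in> borel_measurable (lebesgue_on half_plane)"
    proof -
      have "(\<lambda>p. deriv k (fst p - \<tau>) * k (snd p - x)) \<in> borel_measurable (borel :: (real \<times> real) measure)"
        "(\<lambda>p. k (fst p - \<tau>) * deriv k (snd p - x)) \<in> borel_measurable (borel :: (real \<times> real) measure)"
        unfolding borel_prod[symmetric] by measurable
      then show "(\<lambda>p. deriv k (fst p - \<tau>) * k (snd p - x)) \<in> borel_measurable (lebesgue_on half_plane)"
      "(\<lambda>p. k (fst p - \<tau>) * deriv k (snd p - x)) \<in> borel_measurable (lebesgue_on half_plane)"
        by (auto intro!: measurable_restrict_space1 measurable_completion)
    qed
    have "(\<lambda>p. g (case_prod u p)) \<in> borel_measurable (lebesgue_on half_plane)"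
      "(\<lambda>p. q (case_prod u p)) \<in> borel_measurable (lebesgue_on half_plane)"
      using measurable_compose[OF u lipschitz_fun_borel[OF g]] measurable_compose[OF u lipschitz_fun_borel[OF q]] by simp_all
    then show ?thesis unfolding F_def by (intro borel_measurable_add borel_measurable_times K)
  qed
  have "(LINT (t, x') | lebesgue_on half_plane.
      g (u t x') * deriv (\<lambda>s. \<phi> (s, x')) t + q (u t x') * deriv (\<lambda>y. \<phi> (t, y)) x') =
     (LINT p | lebesgue_on half_plane. F (case_prod u p) p)"
    unfolding d1 d2 F_def split_beta ..
  also have "\<dots> = (LINT p | lebesgue_on half_plane. F (case_prod w p) p)"
  proof (rule integral_cong_AE[OF Fu Fwl])
    show "AE p in lebesgue_on half_plane. F (case_prod u p) p = F (case_prod w p) p"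
      using uw by eventually_elim simp
  qed
  also have "\<dots> = (LINT p | lebesgue. indicator half_plane p *\<^sub>R F (case_prod w p) p)"
    using half_plane_sets by (intro integral_restrict_space) simp
  \<comment> \<open>The kernel and its derivative vanish for \<open>r - \<tau> < \<epsilon>\<close>,
    in particular at all \<open>r \<le> 0\<close>, so the integrand is already 0 off the
    half-plane.\<close>
  also have "(\<lambda>p. indicator half_plane p *\<^sub>R F (case_prod w p) p) = (\<lambda>p. F (case_prod w p) p)"
  proof
    fix p :: "real \<times> real"
    show "indicator half_plane p *\<^sub>R F (case_prod w p) p = F (case_prod w p) p"
    proof (cases "p \<in> half_plane")
      case False
      then have "fst p - \<tau> < \<epsilon>" using \<tau> \<epsilon> by (cases p) auto
      then show ?thesis using False k0[of "fst p - \<tau>"] d0[of "fst p - \<tau>"] unfolding F_def by auto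
    qed simp
  qed
  also have "(LINT p | lebesgue. F (case_prod w p) p) = (LINT p | lborel. F (case_prod w p) p)"
    using Fw by (intro integral_completion) simp
  also have "\<dots> = (LINT p | (lborel \<Otimes>\<^sub>M lborel). F (case_prod w p) p)" by (simp add: lborel_prod)
  also have "\<dots> = (LINT p | (lborel \<Otimes>\<^sub>M lborel). (case p of (r, z) \<Rightarrow> deriv k (r - \<tau>) * k (z - x) * g (w r z)) + (case p of (r, z) \<Rightarrow> k (r - \<tau>) * deriv k (z - x) * q (w r z)))"
    unfolding F_def split_beta by (simp only: mult.commute)
  also have "\<dots> = (LINT p | (lborel \<Otimes>\<^sub>M lborel). (case p of (r, z) \<Rightarrow> deriv k (r - \<tau>) * k (z - x) * g (w r z))) + (LINT p | (lborel \<Otimes>\<^sub>M lborel). (case p of (r, z) \<Rightarrow> k (r - \<tau>) * deriv k (z - x) * q (w r z)))"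
    by (rule Bochner_Integration.integral_add[OF avg_swap(2)[OF d b g_w_bdd[OF g]] avg_swap(2)[OF b d g_w_bdd[OF q]]])
  also have "\<dots> = conv (deriv k) k (\<lambda>r z. g (w r z)) \<tau> x + conv k (deriv k) (\<lambda>r z. q (w r z)) \<tau> x"
  proof -
    have "(LINT p | (lborel \<Otimes>\<^sub>M lborel). (case p of (r, z) \<Rightarrow> \<alpha> (r - \<tau>) * \<beta> (z - x) * h (w r z))) = conv \<alpha> \<beta> (\<lambda>r z. h (w r z)) \<tau> x"
      if "bump_on N \<alpha>" "bump_on N' \<beta>" "lipschitz_fun h" for N N' \<alpha> \<beta> h
      unfolding conv_def avg_def
      by (subst lborel_pair.integral_fst'[OF avg_swap(2)[OF that(1,2) g_w_bdd[OF that(3)]], symmetric]) (simp add: mult.assoc)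
    from this[OF d b g] this[OF b d q] show ?thesis by simp
  qed
  finally show "0 \<le> conv (deriv k) k (\<lambda>r z. g (w r z)) \<tau> x + conv k (deriv k) (\<lambda>r z. q (w r z)) \<tau> x"
    using ineq by simp
qed

section \<open>Bounded Borel representatives of a Kruzhkov solution\<close>

definition clamp_real :: "real \<Rightarrow> real \<Rightarrow> real" where "clamp_real C y = max (- C) (min C y)"

lemma clamp_real: "0 \<le> C \<Longrightarrow> \<bar>clamp_real C y\<bar> \<le> C" "\<bar>y\<bar> \<le> C \<Longrightarrow> clamp_real C y = y"
  by (auto simp: clamp_real_def)

lemma clamp_real_borel[measurable]: "clamp_real C \<in> borel_measurable borel"
  unfolding clamp_real_def[abs_def] by measurable

lemma lebesgue_measurable_if_segments:
  assumes "\<And>R. h \<in> borel_measurable (lebesgue_on {-R..R::real})"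
  shows "(h :: real \<Rightarrow> real) \<in> borel_measurable lebesgue"
proof (rule borel_measurable_LIMSEQ_real)
  show "(\<lambda>x. if x \<in> {- real n..real n} then h x else 0) \<in> borel_measurable lebesgue" for n
    using assms[of "real n"] by (intro borel_measurable_if_I) auto
  show "(\<lambda>n. if x \<in> {- real n..real n} then h x else 0) \<longlonglongrightarrow> h x" for x
  proof (rule Lim_transform_eventually[OF tendsto_const])
    obtain N :: nat where N: "\<bar>x\<bar> \<le> real N" using real_arch_simple by blast
    show "\<forall>\<^sub>F n in sequentially. h x = (if x \<in> {- real n..real n} then h x else 0)"
      using eventually_ge_at_top[of N] by eventually_elim (use N in auto)
  qed
qed

lemma smooth_lipschitz_on_segment:
  assumes "smooth f"
  obtains L where "0 \<le> L" "\<And>a b. \<bar>a\<bar> \<le> C \<Longrightarrow> \<bar>b\<bar> \<le> C \<Longrightarrow> \<bar>f a - f b\<bar> \<le> L * \<bar>a - b\<bar>"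
proof -
  have "bounded (deriv f ` {-C..C})"
    by (intro compact_imp_bounded compact_continuous_image smooth_continuous smooth_deriv assms) simp
  then obtain L where L: "L > 0" "\<And>x. x \<in> {-C..C} \<Longrightarrow> \<bar>deriv f x\<bar> \<le> L"
    unfolding bounded_pos by auto
  have "\<bar>f a - f b\<bar> \<le> L * \<bar>a - b\<bar>" if "\<bar>a\<bar> \<le> C" "\<bar>b\<bar> \<le> C" for a b
  proof -
    have "norm (f a - f b) \<le> L * norm (a - b)"
    proof (rule field_differentiable_bound[of "{-C..C}" f "deriv f"])
      show "(f has_real_derivative deriv f z) (at z within {-C..C})" for z
        by (rule has_field_derivative_at_within[OF smooth_has_deriv[OF assms]])
    qed (use that L(2) in auto)
    then show ?thesis by simp
  qed
  with L(1) show thesis using that[of L] by simp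
qed

lemma kruzhkov_slices:
  assumes K: "kruzhkov_solution f a u"
  shows "0 \<le> t \<Longrightarrow> u t \<in> borel_measurable lebesgue"
    and "0 \<le> t \<Longrightarrow> integrable (lebesgue_on {-R..R}) (u t)"
    and "0 \<le> t0 \<Longrightarrow> ((\<lambda>t. LINT x | lebesgue_on {-R..R}. \<bar>u t x - u t0 x\<bar>) \<longlongrightarrow> 0) (at t0 within {0..})"
proof -
  have c: "continuous_L1loc u" using K unfolding kruzhkov_solution_def by blast
  show i: "integrable (lebesgue_on {-R..R}) (u t)" if "0 \<le> t" for R t
    using c that unfolding continuous_L1loc_def L1_on_def by blast
  show "u t \<in> borel_measurable lebesgue" if "0 \<le> t"
    by (rule lebesgue_measurable_if_segments[OF borel_measurable_integrable[OF i[OF that]]])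
  show "((\<lambda>t. LINT x | lebesgue_on {-R..R}. \<bar>u t x - u t0 x\<bar>) \<longlongrightarrow> 0) (at t0 within {0..})" if "0 \<le> t0"
    using c that unfolding continuous_L1loc_def by blast
qed

text \<open>A Borel version of the completed-measurable solution, clamped to be bounded everywhere.
  The parameter \<open>M\<close> allows \<open>C\<close> to be enlarged, because the end states have
  to be admissible levels.\<close>

lemma kruzhkov_plane_representative:
  assumes K: "kruzhkov_solution f a u"
  obtains w C where "bdd_borel (case_prod w)" "M \<le> C" "0 \<le> C" "\<And>r z. \<bar>w r z\<bar> \<le> C"
    "AE p in lebesgue_on half_plane. case_prod u p = case_prod w p"
    "AE r in lborel. 0 < r \<longrightarrow> (AE z in lborel. u r z = w r z)"
proof -
  have u: "(\<lambda>(t, x). u t x) \<in> borel_measurable (lebesgue_on half_plane)"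
    and "\<exists>C. AE p in lebesgue_on half_plane. \<bar>case p of (t, x) \<Rightarrow> u t x\<bar> \<le> C"
    using K unfolding kruzhkov_solution_def Linf_on_def by auto
  then obtain C0 where C0: "AE p in lebesgue_on half_plane. \<bar>case_prod u p\<bar> \<le> C0" by auto
  define C where "C = max (max C0 M) 0"
  have C: "C0 \<le> C" "M \<le> C" "0 \<le> C" unfolding C_def by auto
  have hs: "half_plane \<in> sets lebesgue" using half_plane_sets by simp
  have "(\<lambda>p. if p \<in> half_plane then case_prod u p else 0) \<in> borel_measurable lebesgue"
    using u hs by (intro borel_measurable_if_I) auto
  from completion_ex_borel_measurable_real[OF this]
  obtain g where g: "g \<in> borel_measurable lborel"
    "AE p in lborel. (if p \<in> half_plane then case_prod u p else 0) = g p" by blast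
  define w where "w r z = clamp_real C (g (r, z))" for r z
  have ae: "AE p in lborel. p \<in> half_plane \<longrightarrow> case_prod u p = case_prod w p"
  proof -
    have "AE p in lebesgue. p \<in> half_plane \<longrightarrow> \<bar>case_prod u p\<bar> \<le> C0"
      using C0 hs by (subst (asm) AE_restrict_space_iff) auto
    then have "AE p in lborel. p \<in> half_plane \<longrightarrow> \<bar>case_prod u p\<bar> \<le> C0" by (simp only: AE_completion_iff)
    with g(2) show ?thesis
    proof eventually_elim
      case (elim p)
      show ?case
      proof
        assume p: "p \<in> half_plane"
        then have "case_prod u p = g p" "\<bar>g p\<bar> \<le> C" using elim C(1) by auto
        then show "case_prod u p = case_prod w p" using clamp_real(2)[of "g p" C] by (simp add: w_def split_beta)
      qed
    qed
  qed
  show thesis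
  proof (rule that)
    have "(\<lambda>p. clamp_real C (g p)) \<in> borel_measurable borel" using g(1) by measurable
    moreover have "case_prod w = (\<lambda>p. clamp_real C (g p))" by (auto simp: w_def)
    ultimately show "bdd_borel (case_prod w)" using clamp_real(1)[OF C(3)] by (intro bdd_borelI[of _ C]) auto
    show "\<bar>w r z\<bar> \<le> C" for r z unfolding w_def by (rule clamp_real(1)[OF C(3)])
    have "AE p in lebesgue. p \<in> half_plane \<longrightarrow> case_prod u p = case_prod w p" using ae by (simp only: AE_completion_iff)
    then show "AE p in lebesgue_on half_plane. case_prod u p = case_prod w p"
      using hs by (subst AE_restrict_space_iff) auto
    have "AE p in lborel \<Otimes>\<^sub>M lborel. p \<in> half_plane \<longrightarrow> case_prod u p = case_prod w p" using ae by (simp only: lborel_prod)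
    from lborel_pair.AE_pair[OF this]
    have "AE r in lborel. AE z in lborel. (r, z) \<in> half_plane \<longrightarrow> u r z = w r z" by simp
    then show "AE r in lborel. 0 < r \<longrightarrow> (AE z in lborel. u r z = w r z)"
      by (rule AE_mp) (auto intro!: AE_I2)
  qed (use C in auto)
qed

text \<open>The bound on the half-plane reaches almost every time only. Continuity in
  \<open>L\<^sup>1\<close> transports it to every time, including 0: if the slice at
  \<open>r\<close> is bounded by \<open>C\<close>, then \<open>max 0 (\<bar>u t z\<bar> - C) \<le>
  \<bar>u r z - u t z\<bar>\<close>.\<close>

lemma kruzhkov_slices_bounded:
  assumes K: "kruzhkov_solution f a u" and C: "\<And>r z. \<bar>w r z\<bar> \<le> C"
    and uw: "AE r in lborel. 0 < r \<longrightarrow> (AE z in lborel. u r z = w r z)" and t: "0 \<le> t"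
  shows "AE z in lebesgue. \<bar>u t z\<bar> \<le> C"
proof -
  note ki = kruzhkov_slices(2)[OF K] and kl = kruzhkov_slices(3)[OF K t]
  have seg: "AE z in lebesgue_on {-R..R}. \<bar>u t z\<bar> \<le> C" for R
  proof -
    let ?M = "lebesgue_on {-R..R}"
    let ?h = "\<lambda>z. max 0 (\<bar>u t z\<bar> - C)"
    have ih: "integrable ?M ?h"
    proof (rule Bochner_Integration.integrable_bound[OF integrable_abs[OF ki[OF t]]])
      show "?h \<in> borel_measurable ?M" using borel_measurable_integrable[OF ki[OF t, of R]] by measurable
      have "0 \<le> C" using C[of 0 0] by linarith
      then show "AE z in ?M. norm (?h z) \<le> norm \<bar>u t z\<bar>" by (intro AE_I2) auto
    qed
    have "(LINT z|?M. ?h z) \<le> e" if e: "0 < e" for e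
    proof -
      have "\<forall>\<^sub>F r in at t within {0..}. (LINT x | ?M. \<bar>u r x - u t x\<bar>) < e"
        by (rule order_tendstoD(2)[OF kl e])
      then obtain d where d: "d > 0" "\<And>r. 0 \<le> r \<Longrightarrow> r \<noteq> t \<Longrightarrow> \<bar>r - t\<bar> < d \<Longrightarrow> (LINT x | ?M. \<bar>u r x - u t x\<bar>) < e"
        unfolding eventually_at dist_real_def by auto
      \<comment> \<open>Good times have full measure and therefore meet every interval to the right
        of \<open>t\<close>.\<close>
      have "\<exists>r. r \<in> {t<..<t + d} \<and> (AE z in lborel. u r z = w r z)"
      proof (rule ccontr)
        assume no: "\<not> ?thesis"
        have "AE r in lborel. r \<notin> {t<..<t + d}"
          using uw by eventually_elim (use no t in force)
        then have "emeasure lborel {t<..<t + d} = 0"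
          by (subst (asm) AE_iff_measurable[where N = "{t<..<t + d}"]) auto
        then show False using d(1) by simp
      qed
      then obtain r where r: "t < r" "r < t + d" "AE z in lborel. u r z = w r z" by auto
      have "AE z in lebesgue. u r z = w r z" using r(3) by (simp only: AE_completion_iff)
      then have "AE z in lebesgue. z \<in> {-R..R} \<longrightarrow> u r z = w r z" by eventually_elim simp
      then have ae: "AE z in ?M. u r z = w r z" by (subst AE_restrict_space_iff) auto
      have "(LINT z|?M. ?h z) \<le> (LINT x | ?M. \<bar>u r x - u t x\<bar>)"
      proof (rule integral_mono_AE[OF ih])
        show "integrable ?M (\<lambda>x. \<bar>u r x - u t x\<bar>)"
          using ki[of r R] ki[OF t, of R] r t by auto
        show "AE z in ?M. ?h z \<le> \<bar>u r z - u t z\<bar>"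
          using ae
        proof eventually_elim
          case (elim z)
          then have "\<bar>u r z\<bar> \<le> C" using C[of r z] by simp
          then show ?case by linarith
        qed
      qed
      also have "\<dots> < e" using d(2)[of r] r t by auto
      finally show ?thesis by simp
    qed
    then have "(LINT z|?M. ?h z) \<le> 0" by (meson dense_ge)
    moreover have "0 \<le> (LINT z|?M. ?h z)" by (intro Bochner_Integration.integral_nonneg) simp
    ultimately have "(LINT z|?M. ?h z) = 0" by simp
    then have "AE z in ?M. ?h z = 0"
      using integral_nonneg_eq_0_iff_AE[OF ih] by simp
    then show ?thesis by eventually_elim simp
  qed
  have "AE z in lebesgue. \<forall>n::nat. z \<in> {- real n..real n} \<longrightarrow> \<bar>u t z\<bar> \<le> C"
    unfolding AE_all_countable
  proof
    fix n :: nat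
    show "AE z in lebesgue. z \<in> {- real n..real n} \<longrightarrow> \<bar>u t z\<bar> \<le> C"
      using seg[of "real n"] by (subst (asm) AE_restrict_space_iff) auto
  qed
  then show ?thesis
  proof eventually_elim
    case (elim z)
    obtain N :: nat where N: "\<bar>z\<bar> \<le> real N" using real_arch_simple by blast
    then have "z \<in> {- real N..real N}" by auto
    then show ?case using elim by blast
  qed
qed

text \<open>The Borel slices \<open>v t\<close> are chosen separately for each \<open>t\<close>, so
  nothing is known about joint measurability of \<open>v\<close>; this is what \<open>w\<close>
  provides.\<close>

lemma kruzhkov_reduction:
  assumes f: "smooth f" and K: "kruzhkov_solution f a u"
  obtains w v C L where "entropy_solution f w v C L" "M \<le> C" 
    "\<And>t. 0 \<le> t \<Longrightarrow> AE x in lebesgue. u t x = v t x"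
proof -
  obtain w C where w: "bdd_borel (case_prod w)" "M \<le> C" "0 \<le> C" "\<And>r z. \<bar>w r z\<bar> \<le> C"
    "AE p in lebesgue_on half_plane. case_prod u p = case_prod w p"
    "AE r in lborel. 0 < r \<longrightarrow> (AE z in lborel. u r z = w r z)"
    by (rule kruzhkov_plane_representative[OF K, of M]) (rule that; assumption)
  obtain L where L: "0 \<le> L" "\<And>a b. \<bar>a\<bar> \<le> C \<Longrightarrow> \<bar>b\<bar> \<le> C \<Longrightarrow> \<bar>f a - f b\<bar> \<le> L * \<bar>a - b\<bar>"
    by (rule smooth_lipschitz_on_segment[OF f, of C]) (rule that; assumption)
  have "\<exists>g. g \<in> borel_measurable lborel \<and> (AE x in lborel. u t x = g x)" if "0 \<le> t" for t
    using completion_ex_borel_measurable_real[OF kruzhkov_slices(1)[OF K that]] by blast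
  then obtain g where g: "\<And>t. 0 \<le> t \<Longrightarrow> g t \<in> borel_measurable lborel" "\<And>t. 0 \<le> t \<Longrightarrow> AE x in lborel. u t x = g t x"
    by metis
  define v where "v t x = clamp_real C (g t x)" for t x
  have v_borel: "v t \<in> borel_measurable borel" if "0 \<le> t" for t
    using g(1)[OF that] unfolding v_def[abs_def] by measurable
  have v_le: "\<bar>v t x\<bar> \<le> C" for t x unfolding v_def by (rule clamp_real(1)[OF w(3)])
  have uv: "AE x in lebesgue. u t x = v t x" if t: "0 \<le> t" for t
  proof -
    have "AE x in lebesgue. u t x = g t x" using g(2)[OF t] by (simp only: AE_completion_iff)
    with kruzhkov_slices_bounded[OF K w(4,6) t] show ?thesis
      by eventually_elim (simp add: v_def clamp_real(2))
  qed
  have uv_b: "AE x in lborel. u t x = v t x" if t: "0 \<le> t" for t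
    using uv[OF t] by (simp only: AE_completion_iff)
  have vb: "bdd_borel (v t)" if "0 \<le> t" for t by (rule bdd_borelI[OF v_borel[OF that] v_le])
  have wv: "AE r in lborel. 0 < r \<longrightarrow> (AE z in lborel. w r z = v r z)"
    using w(6)
  proof eventually_elim
    case (elim r)
    show ?case
    proof
      assume r: "0 < r"
      then have "AE z in lborel. u r z = w r z" using elim by simp
      moreover have "AE z in lborel. u r z = v r z" using uv_b[of r] r by simp
      ultimately show "AE z in lborel. w r z = v r z" by eventually_elim simp
    qed
  qed
  have cont: "((\<lambda>s. integral {-R..R} (\<lambda>z. \<bar>v s z - v t z\<bar>)) \<longlongrightarrow> 0) (at t within {0..})" if t: "0 \<le> t" for t R
  proof (rule Lim_transform_eventually[OF kruzhkov_slices(3)[OF K t, of R]])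
    show "\<forall>\<^sub>F s in at t within {0..}. (LINT x | lebesgue_on {-R..R}. \<bar>u s x - u t x\<bar>) = integral {-R..R} (\<lambda>z. \<bar>v s z - v t z\<bar>)"
      unfolding eventually_at
    proof (intro exI[of _ 1] conjI ballI impI)
      fix s :: real assume "s \<in> {0..}"
      then have s: "0 \<le> s" by simp
      have bd: "bdd_borel (\<lambda>z. \<bar>v s z - v t z\<bar>)" by (intro bdd_borel_abs bdd_borel_diff vb s t)
      have vm: "(\<lambda>z. \<bar>v s z - v t z\<bar>) \<in> borel_measurable (lebesgue_on {-R..R})"
        using bdd_borelD[OF bd] by (intro measurable_restrict_space1 measurable_completion) simp
      have "(LINT x | lebesgue_on {-R..R}. \<bar>u s x - u t x\<bar>) = (LINT x | lebesgue_on {-R..R}. \<bar>v s x - v t x\<bar>)"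
      proof (rule integral_cong_AE[OF _ vm])
        show "(\<lambda>x. \<bar>u s x - u t x\<bar>) \<in> borel_measurable (lebesgue_on {-R..R})"
          using borel_measurable_integrable[OF kruzhkov_slices(2)[OF K s, of R]] borel_measurable_integrable[OF kruzhkov_slices(2)[OF K t, of R]]
          by measurable
        have "AE x in lebesgue. x \<in> {-R..R} \<longrightarrow> \<bar>u s x - u t x\<bar> = \<bar>v s x - v t x\<bar>"
          using uv[OF s] uv[OF t] by eventually_elim simp
        then show "AE x in lebesgue_on {-R..R}. \<bar>u s x - u t x\<bar> = \<bar>v s x - v t x\<bar>"
          by (subst AE_restrict_space_iff) auto
      qed
      also have "\<dots> = (LINT x | lebesgue. indicator {-R..R} x *\<^sub>R \<bar>v s x - v t x\<bar>)"
        by (rule integral_restrict_space) simp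
      also have "\<dots> = (LINT x | lborel. indicator {-R..R} x *\<^sub>R \<bar>v s x - v t x\<bar>)"
        using bdd_borelD[OF bd] by (intro integral_completion borel_measurable_scaleR) simp_all
      also have "\<dots> = integral {-R..R} (\<lambda>z. \<bar>v s z - v t z\<bar>)"
        using bdd_borel_integrable_on(2)[OF bd] by simp
      finally show "(LINT x | lebesgue_on {-R..R}. \<bar>u s x - u t x\<bar>) = integral {-R..R} (\<lambda>z. \<bar>v s z - v t z\<bar>)" .
    qed simp
  qed
  interpret e: entropy_evolution f w v C L
    by standard (use w(1,4) v_borel v_le wv cont smooth_continuous[OF f] L in auto)
  have um: "(\<lambda>(t, x). u t x) \<in> borel_measurable (lebesgue_on half_plane)"
    and ent: "\<And>\<eta> q. entropy_flux_pair f \<eta> q \<Longrightarrow> div_nonpos (\<lambda>t x. \<eta> (u t x)) (\<lambda>t x. q (u t x))"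
    using K unfolding kruzhkov_solution_def Linf_on_def by auto
  note toI = e.entropy_ineq_if_div_nonpos[OF ent _ _ um w(5)]
  note fp = entropy_flux_pair_levels[OF f]
  have "entropy_solution f w v C L"
  proof
    fix c assume c: "\<bar>c\<bar> \<le> C"
    have lip1: "e.lipschitz_fun (\<lambda>y. max 0 (y - c))" "e.lipschitz_fun (\<lambda>y. max 0 (c - y))" "e.lipschitz_fun (\<lambda>y. y - c)" "e.lipschitz_fun (\<lambda>y. c - y)"
      unfolding e.lipschitz_fun_def by (intro conjI exI[of _ 1] continuous_intros; auto)+
    have cf: "continuous_on UNIV (\<lambda>y. f (h y))" if "continuous_on UNIV h" for h :: "real \<Rightarrow> real"
      by (rule continuous_on_compose2[OF smooth_continuous[OF f] that subset_UNIV])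
    have lipf: "e.lipschitz_fun (\<lambda>y. f (h y) - f c)" "e.lipschitz_fun (\<lambda>y. f c - f (h y))"
      if h: "continuous_on UNIV h" "\<And>a. \<bar>a\<bar> \<le> C \<Longrightarrow> \<bar>h a\<bar> \<le> C" "\<And>a b. \<bar>h a - h b\<bar> \<le> \<bar>a - b\<bar>" for h
    proof -
      have "\<bar>f (h a) - f (h b)\<bar> \<le> L * \<bar>a - b\<bar>" if "\<bar>a\<bar> \<le> C" "\<bar>b\<bar> \<le> C" for a b
        using order_trans[OF L(2)[OF h(2)[OF that(1)] h(2)[OF that(2)]] mult_left_mono[OF h(3) L(1)]] .
      then show "e.lipschitz_fun (\<lambda>y. f (h y) - f c)" "e.lipschitz_fun (\<lambda>y. f c - f (h y))"
        unfolding e.lipschitz_fun_def using L(1) by (auto intro!: continuous_intros cf h(1) exI[of _ L] simp: abs_minus_commute)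
    qed
    have mx: "e.lipschitz_fun (\<lambda>y. f (max c y) - f c)" by (rule lipf(1)) (use c in \<open>auto intro!: continuous_intros\<close>)
    have mn: "e.lipschitz_fun (\<lambda>y. f c - f (min c y))" by (rule lipf(2)) (use c in \<open>auto intro!: continuous_intros\<close>)
    have id: "e.lipschitz_fun (\<lambda>y. f y - f c)" "e.lipschitz_fun (\<lambda>y. f c - f y)" by (rule lipf; auto)+
    show "e.entropy_ineq (\<lambda>y. max 0 (y - c)) (\<lambda>y. f (max c y) - f c)" by (rule toI[OF fp(1) lip1(1) mx])
    show "e.entropy_ineq (\<lambda>y. max 0 (c - y)) (\<lambda>y. f c - f (min c y))" by (rule toI[OF fp(2) lip1(2) mn])
    show "e.entropy_ineq (\<lambda>y. y - c) (\<lambda>y. f y - f c)" by (rule toI[OF fp(3) lip1(3) id(1)])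
    show "e.entropy_ineq (\<lambda>y. c - y) (\<lambda>y. f c - f y)" by (rule toI[OF fp(4) lip1(4) id(2)])
  qed
  then show thesis using that w(2) uv by blast
qed

lemma L1_on_finite:
  fixes h :: "real \<Rightarrow> real"
  assumes L1: "L1_on S (\<lambda>x. a x - d)" and S: "S \<in> sets borel" and h: "h \<in> borel_measurable borel"
    and ah: "AE x in lebesgue. a x = h x"
  shows "(\<integral>\<^sup>+x. indicator S x * ennreal \<bar>h x - d\<bar> \<partial>lborel) < \<infinity>"
proof -
  note [measurable] = S h
  have "(\<integral>\<^sup>+x. indicator S x * ennreal \<bar>h x - d\<bar> \<partial>lborel) = (\<integral>\<^sup>+x. indicator S x * ennreal \<bar>h x - d\<bar> \<partial>lebesgue)"
    by (rule nn_integral_completion[symmetric]) 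
  also have "\<dots> = (\<integral>\<^sup>+x. ennreal (norm (indicator S x *\<^sub>R (a x - d))) \<partial>lebesgue)"
  proof (rule nn_integral_cong_AE)
    show "AE x in lebesgue. indicator S x * ennreal \<bar>h x - d\<bar> = ennreal (norm (indicator S x *\<^sub>R (a x - d)))"
      using ah by eventually_elim (simp add: indicator_def)
  qed
  also have "\<dots> < \<infinity>"
  proof -
    have "integrable lebesgue (\<lambda>x. indicator S x *\<^sub>R (a x - d))"
      using L1 S unfolding L1_on_def by (subst (asm) integrable_restrict_space) auto
    then show ?thesis by (simp only: integrable_iff_bounded)
  qed
  finally show ?thesis .
qed

theorem theorem1p1:
  fixes f a :: "real \<Rightarrow> real" and um up :: real and u :: "real \<Rightarrow> real \<Rightarrow> real"
  assumes "smooth f"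
    and "a \<in> borel_measurable lebesgue"
    and "L1_on {..<0} (\<lambda>x. a x - um)" and "Linf_on {..<0} (\<lambda>x. a x - um)"
    and "L1_on {0<..} (\<lambda>x. a x - up)" and "Linf_on {0<..} (\<lambda>x. a x - up)"
    and "kruzhkov_solution f a u"
  shows "antimono_on {0..} (\<lambda>t. d2 (u t) (monotone_profiles um up))"
proof (rule monotone_onI)
  fix s t :: real assume "s \<in> {0..}" "t \<in> {0..}" "s \<le> t"
  then have st: "0 \<le> s" "s \<le> t" by auto
  obtain w v C L where sol: "entropy_solution f w v C L" and C: "max \<bar>um\<bar> \<bar>up\<bar> \<le> C"
    and uv: "\<And>t. 0 \<le> t \<Longrightarrow> AE x in lebesgue. u t x = v t x"
    by (rule kruzhkov_reduction[OF assms(1,7), of "max \<bar>um\<bar> \<bar>up\<bar>"]) (rule that; assumption)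
  interpret e: entropy_solution f w v C L by (rule sol)
  note u_meas = kruzhkov_slices(1)[OF assms(7)]
  have "AE x in lebesgue. u 0 x = a x" using assms(7) unfolding kruzhkov_solution_def by blast
  then have av: "AE x in lebesgue. a x = v 0 x" using uv[OF order_refl] by eventually_elim simp
  have il: "(\<integral>\<^sup>+x. indicator {..<0} x * ennreal \<bar>v 0 x - um\<bar> \<partial>lborel) < \<infinity>"
    by (rule L1_on_finite[OF assms(3) _ e.v_borel[OF order_refl] av]) simp
  have ir: "(\<integral>\<^sup>+x. indicator {0<..} x * ennreal \<bar>v 0 x - up\<bar> \<partial>lborel) < \<infinity>"
    by (rule L1_on_finite[OF assms(5) _ e.v_borel[OF order_refl] av]) simp
  show "d2 (u t) (monotone_profiles um up) \<le> d2 (u s) (monotone_profiles um up)"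
  proof (cases "um \<le> up")
    case True
    interpret c: entropy_cauchy f w v C L um up
      by standard (use True C il ir in auto)
    show ?thesis by (rule c.d2_decreasing[OF uv u_meas st])
  next
    case False
    interpret m: entropy_solution "\<lambda>y. - f (- y)" "\<lambda>r z. - w r z" "\<lambda>t z. - v t z" C L
      by (rule entropy_solution_minus[OF sol])
    interpret c: entropy_cauchy "\<lambda>y. - f (- y)" "\<lambda>r z. - w r z" "\<lambda>t z. - v t z" C L "- um" "- up"
    proof
      have "\<bar>- v 0 x - - um\<bar> = \<bar>v 0 x - um\<bar>" "\<bar>- v 0 x - - up\<bar> = \<bar>v 0 x - up\<bar>" for x by linarith+
      then show "(\<integral>\<^sup>+x. indicator {..<0} x * ennreal \<bar>- v 0 x - - um\<bar> \<partial>lborel) < \<infinity>"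
        "(\<integral>\<^sup>+x. indicator {0<..} x * ennreal \<bar>- v 0 x - - up\<bar> \<partial>lborel) < \<infinity>"
        using il ir by simp_all
    qed (use False C in auto)
    have "d2 (\<lambda>x. - u t x) (monotone_profiles (- um) (- up)) \<le> d2 (\<lambda>x. - u s x) (monotone_profiles (- um) (- up))"
    proof (rule c.d2_decreasing[OF _ _ st])
      fix t :: real assume t: "0 \<le> t"
      show "AE x in lebesgue. - u t x = - v t x" using uv[OF t] by eventually_elim simp
      show "(\<lambda>x. - u t x) \<in> borel_measurable lebesgue" using u_meas[OF t] by (rule borel_measurable_uminus)
    qed
    then show ?thesis by (simp only: d2_minus)
  qed
qed

end
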